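(* Let $L,\hat L,\eta,\varepsilon,p_a,p_b>0$ be fixed, let $s:=\sqrt{\tilde k_{\min}^2+\eta-i\varepsilon}$, where $\tilde k_{\min}=\pi/\hat L$ and the complex square root is taken with positive real part, and let $K$ be the real constant $$K:=\Re\,\frac{s\left((p_b+s)(p_a+s)-(s-p_b)(s-p_a)e^{-4sL}\right)}{\left((s-p_a)e^{-2sL}+s+p_a\right)\left((s-p_b)e^{-2sL}+s+p_b\right)}.$$ Consider the optimized Schwarz method with two subdomains and Ventcell transmission conditions described in the context. (1) For one-sided Ventcell transmission conditions, $p_1^+=p_2^-=:p$, $q_1^+=q_2^-=:q$, the asymptotically optimized parameters $p$ and $q$ for small overlap $\delta$ and the associated convergence factor are $$p\sim2^{-3/5}K^{4/5}\delta^{-1/5},\qquad q\sim2^{-1/5}K^{-2/5}\delta^{3/5},\qquad \rho=1-2^{8/5}K^{1/5}\delta^{1/5}+\mathcal O(\delta^{2/5}).$$ (2) For two-sided Ventcell transmission conditions, $p_1^+\ne p_2^-$, $q_1^+\ne q_2^-$, the asymptotically optimized parameters for small overlap $\delta$ are $$p_1^+\sim2^{-8/9}K^{8/9}\delta^{-1/9},\quad q_1^+\sim2^{2/9}K^{-2/9}\delta^{7/9},\quad p_2^-\sim2^{-2/3}K^{2/3}\delta^{-1/3},\quad q_2^-\sim2^{4/9}K^{-4/9}\delta^{5/9},$$ and the associated convergence factor is $\rho=1-2^{8/9}K^{1/9}\delta^{1/9}+\mathcal O(\delta^{2/9})$.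
   Context: Method. For the complex diffusion equation $\Delta u-(\eta-i\varepsilon)u=f$ with $\eta,\varepsilon>0$, the domain is the union of two overlapping rectangles $\Omega_j=(a_j,b_j)\times(0,\hat L)$, $j=1,2$, with $a_j=(j-1)L-\frac{\delta}{2}$, $b_j=jL+\frac{\delta}{2}$ and overlap $\delta>0$, and homogeneous Dirichlet conditions at the top and bottom. Taking $f=0$ and expanding in a sine series in $y$ with frequencies $\tilde k=m\pi/\hat L$, the Fourier coefficients $v_j^n(x,\tilde k)$ of the optimized Schwarz iterates satisfy $$\partial_{xx}v_j^n-(\tilde k^2+\eta-i\varepsilon)v_j^n=0\ \text{ in }(a_j,b_j),\qquad j=1,2,$$ $$\partial_xv_1^n+P_1^+v_1^n=\partial_xv_2^{n-1}+P_1^+v_2^{n-1}\ \text{ at }x=b_1,\qquad -\partial_xv_2^n+P_2^-v_2^n=-\partial_xv_1^{n-1}+P_2^-v_1^{n-1}\ \text{ at }x=a_2,$$ with $P_1^+:=p_1^++\tilde k^2q_1^+$, $P_2^-:=p_2^-+\tilde k^2q_2^-$ and positive real parameters $p_1^+,p_2^-,q_1^+,q_2^-$. At the outer boundaries homogeneous Robin conditions are imposed with fixed parameters: $-\partial_xv_1^n+p_av_1^n=0$ at $x=a_1$ and $\partial_xv_2^n+p_bv_2^n=0$ at $x=b_2$. Iteration matrix. Let $\lambda=\lambda(\tilde k)=\sqrt{\tilde k^2+\eta-i\varepsilon}$ (square root with positive real part). The interface traces, i.e. the right-hand sides of the two transmission conditions, satisfy $R_+^n(b_1)=\beta_1^+R_-^{n-1}(a_2)$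 and $R_-^n(a_2)=\beta_2^-R_+^{n-1}(b_1)$ with $$\beta_2^-=\frac{(\lambda+P_2^-)(\lambda-p_a)e^{-\lambda L}-(\lambda-P_2^-)(\lambda+p_a)e^{\lambda L}}{(\lambda+P_1^+)(\lambda+p_a)e^{\lambda(L+\delta)}-(\lambda-P_1^+)(\lambda-p_a)e^{-\lambda(L+\delta)}},$$ $$\beta_1^+=\frac{(\lambda+P_1^+)(\lambda-p_b)e^{-\lambda L}-(\lambda-P_1^+)(\lambda+p_b)e^{\lambda L}}{(\lambda+p_b)(\lambda+P_2^-)e^{\lambda(L+\delta)}-(\lambda-p_b)(\lambda-P_2^-)e^{-\lambda(L+\delta)}}.$$ The iteration matrix is $T_2=\begin{pmatrix}0&\beta_1^+\\ \beta_2^-&0\end{pmatrix}$, with spectral radius $\rho(T_2)=|\beta_1^+\beta_2^-|^{1/2}$. Optimization. The optimized parameters are the solution of the min-max problem of minimizing, over the parameters, $\max_{\tilde k\in[\tilde k_{\min},\tilde k_{\max}]}\rho(T_2(\tilde k))$, where $\tilde k_{\min}=\pi/\hat L$, $\tilde k_{\max}=M\pi/\hat L$, $M\sim1/h$, and $h$ is the mesh size. The overlap is proportional to the mesh size ($\delta=ch$ with $c>0$ fixed), and the asymptotics are for $\delta\to0$. The associated convergence factor $\rho$ is the resulting min-max value. Here $p\sim C\delta^{\gamma}$ means $p/(C\delta^{\gamma})\to1$ as $\delta\to0$.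
   Formalization: In (2) the parameter asymptotics are for minimizers with p_1^+<p_2^- and q_1^+<q_2^-, since the two-sided optimum is not unique (for p_a=p_b swapping the two conditions leaves rho unchanged); the expansion of rho is proved also for the full two-sided problem. *)

theory Defs
  imports
    "HOL-Analysis.Analysis"
    "HOL-Library.Landau_Symbols"
    "Jordan_Normal_Form.Spectral_Radius"
begin

text \<open>
  Two-subdomain optimized Schwarz method with Ventcell transmission conditions for the complex
  diffusion equation. The subdomains in \<open>x\<close> are \<open>(-\<delta>/2, L + \<delta>/2)\<close> and \<open>(L - \<delta>/2, 2 * L + \<delta>/2)\<close>;
  the transmission conditions sit at \<open>b\<^sub>1 = L + \<delta>/2\<close> and \<open>a\<^sub>2 = L - \<delta>/2\<close>, and \<open>pa\<close>, \<open>pb\<close> are the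
  fixed Robin parameters at the outer boundaries.
\<close>

text \<open>For \<open>\<eta> > 0\<close> the principal root is the one with positive real part.\<close>

definition freq_root :: "real \<Rightarrow> real \<Rightarrow> real \<Rightarrow> complex" where
  "freq_root \<eta> \<epsilon> k = csqrt (of_real (k\<^sup>2 + \<eta>) - \<i> * of_real \<epsilon>)"

definition ventcell_symbol :: "real \<Rightarrow> real \<Rightarrow> real \<Rightarrow> real" where
  "ventcell_symbol p q k = p + k\<^sup>2 * q"

definition beta_2_minus ::
    "real \<Rightarrow> real \<Rightarrow> real \<Rightarrow> real \<Rightarrow> real \<Rightarrow> complex \<Rightarrow> complex" where
  "beta_2_minus L \<delta> pa P1 P2 l =
     ((l + P2) * (l - pa) * exp (- l * L) - (l - P2) * (l + pa) * exp (l * L)) /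
     ((l + P1) * (l + pa) * exp (l * (L + \<delta>)) - (l - P1) * (l - pa) * exp (- l * (L + \<delta>)))"

definition beta_1_plus ::
    "real \<Rightarrow> real \<Rightarrow> real \<Rightarrow> real \<Rightarrow> real \<Rightarrow> complex \<Rightarrow> complex" where
  "beta_1_plus L \<delta> pb P1 P2 l =
     ((l + P1) * (l - pb) * exp (- l * L) - (l - P1) * (l + pb) * exp (l * L)) /
     ((l + pb) * (l + P2) * exp (l * (L + \<delta>)) - (l - pb) * (l - P2) * exp (- l * (L + \<delta>)))"

text \<open>
  A parameter choice is a quadruple \<open>(p\<^sub>1\<^sup>+, q\<^sub>1\<^sup>+, p\<^sub>2\<^sup>-, q\<^sub>2\<^sup>-)\<close>.
\<close>

type_synonym params = "real \<times> real \<times> real \<times> real"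

definition iteration_matrix ::
    "real \<Rightarrow> real \<Rightarrow> real \<Rightarrow> real \<Rightarrow> real \<Rightarrow> real \<Rightarrow> params \<Rightarrow> real \<Rightarrow> complex mat" where
  "iteration_matrix L \<eta> \<epsilon> pa pb \<delta> = (\<lambda>(p1, q1, p2, q2) k.
     let l = freq_root \<eta> \<epsilon> k; P1 = ventcell_symbol p1 q1 k; P2 = ventcell_symbol p2 q2 k
     in mat_of_rows_list 2
          [[0, beta_1_plus L \<delta> pb P1 P2 l],
           [beta_2_minus L \<delta> pa P1 P2 l, 0]])"

text \<open>
  Frequencies range over \<open>[\<pi>/Lhat, M \<pi>/Lhat]\<close>. The spectral radius is continuous in the frequency,
  so for \<open>M \<ge> 1\<close> the supremum is the maximum.
\<close>

definition worst_factor ::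
    "real \<Rightarrow> real \<Rightarrow> real \<Rightarrow> real \<Rightarrow> real \<Rightarrow> real \<Rightarrow> nat \<Rightarrow> real \<Rightarrow> params \<Rightarrow> real" where
  "worst_factor L Lhat \<eta> \<epsilon> pa pb M \<delta> x =
     (SUP k \<in> {pi / Lhat .. M * pi / Lhat}.
        spectral_radius (iteration_matrix L \<eta> \<epsilon> pa pb \<delta> x k))"

definition one_sided :: "params set" where
  "one_sided = {(p, q, p, q) | p q. p > 0 \<and> q > 0}"

definition two_sided :: "params set" where
  "two_sided = {(p1, q1, p2, q2). p1 > 0 \<and> q1 > 0 \<and> p2 > 0 \<and> q2 > 0 \<and> p1 \<noteq> p2 \<and> q1 \<noteq> q2}"

text \<open>
  The two-sided problem has several families of optima that agree to leading order, one for each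
  way of distributing the four roots of \<open>k = p\<^sub>1 + q\<^sub>1 k\<^sup>2\<close> and \<open>k = p\<^sub>2 + q\<^sub>2 k\<^sup>2\<close> over the two
  conditions; for \<open>pa = pb\<close> exchanging the subdomains even leaves the spectral radius unchanged.
  The following ordering, which resolves both inequalities in the definition above, singles
  out one of them.
\<close>

definition two_sided_ordered :: "params set" where
  "two_sided_ordered = {(p1, q1, p2, q2) \<in> two_sided. p1 < p2 \<and> q1 < q2}"

definition minmax_value :: "(params \<Rightarrow> real) \<Rightarrow> params set \<Rightarrow> real" where
  "minmax_value J A = (INF x \<in> A. J x)"

definition minmax_solution :: "(params \<Rightarrow> real) \<Rightarrow> params set \<Rightarrow> params \<Rightarrow> bool" where
  "minmax_solution J A = is_arg_min J (\<lambda>x. x \<in> A)"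

definition K_const :: "real \<Rightarrow> real \<Rightarrow> real \<Rightarrow> real \<Rightarrow> real \<Rightarrow> real \<Rightarrow> real" where
  "K_const L Lhat \<eta> \<epsilon> pa pb =
     (let s = freq_root \<eta> \<epsilon> (pi / Lhat) in
      Re (s * ((pb + s) * (pa + s) - (s - pb) * (s - pa) * exp (- 4 * s * L)) /
          (((s - pa) * exp (- 2 * s * L) + s + pa) * ((s - pb) * exp (- 2 * s * L) + s + pb))))"

text \<open>
  Consistency checks: the two entries of the matrix are the factors relating the interface traces
  of the Schwarz iterates, and its spectral radius has the expected closed form.
\<close>

lemma robin_solution_traces:
  fixes v v' :: "real \<Rightarrow> complex" and l :: complex and a b A :: real
  assumes "a \<le> b" "x \<in> {a..b}"
    and v: "\<And>x. x \<in> {a..b} \<Longrightarrow> (v has_vector_derivative v' x) (at x within {a..b})"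
    and v': "\<And>x. x \<in> {a..b} \<Longrightarrow> (v' has_vector_derivative l\<^sup>2 * v x) (at x within {a..b})"
    and bc: "- v' a + pa * v a = 0"
  shows "v' x + l * v x = (l + pa) * v a * exp (l * (x - a))"
proof -
  have "((\<lambda>x. (v' x + l * v x) * exp (- l * (x - a))) has_vector_derivative 0) (at x within {a..b})"
    if x: "x \<in> {a..b}" for x
  proof -
    have e: "((\<lambda>x::real. exp (- l * (x - a))) has_vector_derivative (- l * exp (- l * (x - a)))) (at x within {a..b})"
    proof -
      have "((\<lambda>z. exp (- l * (z - a))) has_field_derivative (- l * exp (- l * (of_real x - a)))) (at (of_real x))"
        by (auto intro!: derivative_eq_intros)
      from has_vector_derivative_real_field[OF this, of "{a..b}"] show ?thesis by simp
    qed
    have s: "((\<lambda>x. v' x + l * v x) has_vector_derivative l\<^sup>2 * v x + l * v' x) (at x within {a..b})"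
      by (intro has_vector_derivative_add v'[OF x] has_vector_derivative_mult_right v[OF x])
    show ?thesis
      using has_vector_derivative_mult[OF s e] by (simp add: algebra_simps power2_eq_square)
  qed
  then obtain c where c: "\<And>y. y \<in> {a..b} \<Longrightarrow> (v' y + l * v y) * exp (- l * (y - a)) = c"
    using has_vector_derivative_zero_constant[OF convex_real_interval(5), of a b "\<lambda>x. (v' x + l * v x) * exp (- l * (x - a))"]
    by blast
  have "(v' x + l * v x) * exp (- l * (x - a)) = v' a + l * v a"
    using c[OF assms(2)] c[of a] assms(1) by simp
  also have "\<dots> = (l + pa) * v a" using bc by (simp add: algebra_simps)
  finally have "(v' x + l * v x) * (exp (- l * (x - a)) * exp (l * (x - a))) =
     (l + pa) * v a * exp (l * (x - a))" by (metis mult.assoc)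
  moreover have "exp (- l * (x - a)) * exp (l * (x - a)) = 1" by (simp flip: exp_add)
  ultimately show ?thesis by (simp only: mult_1_right)
qed

lemma left_subdomain_traces:
  fixes v v' :: "real \<Rightarrow> complex" and l :: complex
  assumes "L > 0" "\<delta> > 0" and a: "a1 = - \<delta> / 2" and b: "b1 = L + \<delta> / 2" and a2: "a2 = L - \<delta> / 2"
    and v: "\<And>x. x \<in> {a1..b1} \<Longrightarrow> (v has_vector_derivative v' x) (at x within {a1..b1})"
    and v': "\<And>x. x \<in> {a1..b1} \<Longrightarrow> (v' has_vector_derivative l\<^sup>2 * v x) (at x within {a1..b1})"
    and bc: "- v' a1 + pa * v a1 = 0"
    and nz: "(l + P1) * (l + pa) * exp (l * (L + \<delta>)) - (l - P1) * (l - pa) * exp (- l * (L + \<delta>)) \<noteq> 0"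
    and l: "l \<noteq> 0"
  shows "- v' a2 + P2 * v a2 = beta_2_minus L \<delta> pa P1 P2 l * (v' b1 + P1 * v b1)"
proof -
  have v'm: "\<And>x. x \<in> {a1..b1} \<Longrightarrow> (v' has_vector_derivative (- l)\<^sup>2 * v x) (at x within {a1..b1})"
    using v' by simp
  have ab: "a1 \<le> b1" "b1 \<in> {a1..b1}" "a2 \<in> {a1..b1}" using assms(1,2) a b a2 by auto
  have d: "b1 - a1 = L + \<delta>" "a2 - a1 = L" using a b a2 by auto
  note p = robin_solution_traces[OF ab(1) _ v v' bc, unfolded of_real_diff[symmetric]]
  note m = robin_solution_traces[OF ab(1) _ v v'm bc, unfolded of_real_diff[symmetric]]
  have 1: "v' b1 + l * v b1 = (l + pa) * v a1 * exp (l * (L + \<delta>))" using p[OF ab(2)] d by simp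
  have 2: "v' b1 - l * v b1 = (pa - l) * v a1 * exp (- l * (L + \<delta>))" using m[OF ab(2)] d by simp
  have 3: "v' a2 + l * v a2 = (l + pa) * v a1 * exp (l * L)" using p[OF ab(3)] d by simp
  have 4: "v' a2 - l * v a2 = (pa - l) * v a1 * exp (- l * L)" using m[OF ab(3)] d by simp
  define N where "N = (l + P2) * (l - pa) * exp (- l * L) - (l - P2) * (l + pa) * exp (l * L)"
  define D where "D = (l + P1) * (l + pa) * exp (l * (L + \<delta>)) - (l - P1) * (l - pa) * exp (- l * (L + \<delta>))"
  have "2 * l * (v' b1 + P1 * v b1) = (l + P1) * (v' b1 + l * v b1) + (l - P1) * (v' b1 - l * v b1)"
    by (simp add: algebra_simps)
  also have "\<dots> = v a1 * D" unfolding 1 2 D_def by (simp add: algebra_simps)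
  finally have A: "2 * l * (v' b1 + P1 * v b1) = v a1 * D" .
  have "2 * l * (- v' a2 + P2 * v a2) = - (l - P2) * (v' a2 + l * v a2) - (l + P2) * (v' a2 - l * v a2)"
    by (simp add: algebra_simps)
  also have "\<dots> = v a1 * N" unfolding 3 4 N_def by (simp add: algebra_simps)
  finally have B: "2 * l * (- v' a2 + P2 * v a2) = v a1 * N" .
  have "D \<noteq> 0" using nz by (simp add: D_def)
  have "2 * l * (- v' a2 + P2 * v a2) = (N / D) * (2 * l * (v' b1 + P1 * v b1))"
    unfolding A B using \<open>D \<noteq> 0\<close> by (simp only: times_divide_eq_left mult.commute[of N] mult.assoc nonzero_mult_div_cancel_left times_divide_eq_right) simp
  then have "2 * l * (- v' a2 + P2 * v a2) = 2 * l * ((N / D) * (v' b1 + P1 * v b1))"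
    by (simp only: mult_ac)
  then have "- v' a2 + P2 * v a2 = (N / D) * (v' b1 + P1 * v b1)"
    using l by (metis mult_cancel_left mult_eq_0_iff zero_neq_numeral)
  then show ?thesis unfolding beta_2_minus_def N_def D_def .
qed

text \<open>The right subdomain is the mirror image of the left one.\<close>

lemma beta_1_plus_mirror: "beta_1_plus L \<delta> pb P1 P2 l = beta_2_minus L \<delta> pb P2 P1 l"
  unfolding beta_1_plus_def beta_2_minus_def by (simp add: mult.commute)

lemma spectral_radius_iteration_matrix:
  "spectral_radius (iteration_matrix L \<eta> \<epsilon> pa pb \<delta> (p1, q1, p2, q2) k) =
    sqrt (cmod (beta_1_plus L \<delta> pb (ventcell_symbol p1 q1 k) (ventcell_symbol p2 q2 k) (freq_root \<eta> \<epsilon> k) *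
                beta_2_minus L \<delta> pa (ventcell_symbol p1 q1 k) (ventcell_symbol p2 q2 k) (freq_root \<eta> \<epsilon> k)))"
proof -
  define b1 where "b1 = beta_1_plus L \<delta> pb (ventcell_symbol p1 q1 k) (ventcell_symbol p2 q2 k) (freq_root \<eta> \<epsilon> k)"
  define b2 where "b2 = beta_2_minus L \<delta> pa (ventcell_symbol p1 q1 k) (ventcell_symbol p2 q2 k) (freq_root \<eta> \<epsilon> k)"
  define T where "T = mat_of_rows_list 2 [[0, b1], [b2, 0]]"
  have T: "T \<in> carrier_mat 2 2"
    unfolding T_def mat_of_rows_list_def carrier_mat_def by simp
  have cp: "char_poly T = [:- b1 * b2, 0, 1:]"
  proof -
    have c: "char_poly_matrix T \<in> carrier_mat 2 2" using T by simp
    then have d: "mat_delete (char_poly_matrix T) 0 j \<in> carrier_mat 1 1" for j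
      by (intro carrier_matI) (auto simp: mat_delete_def)
    show ?thesis
      unfolding char_poly_def laplace_expansion_row[OF c, of 0, simplified] cofactor_def
        det_single[OF d]
      using T
      by (simp add: mat_delete_def char_poly_matrix_def T_def mat_of_rows_list_def
          numeral_2_eq_2 lessThan_Suc)
  qed
  have sp: "spectrum T = {z. z\<^sup>2 = b1 * b2}"
    unfolding spectrum_root_char_poly[OF T] cp by (auto simp: power2_eq_square algebra_simps)
  have "norm ` spectrum T = {sqrt (cmod (b1 * b2))}"
  proof -
    have "cmod z = sqrt (cmod (b1 * b2))" if "z\<^sup>2 = b1 * b2" for z
      using that by (metis norm_power norm_ge_zero real_sqrt_unique)
    moreover have "(csqrt (b1 * b2))\<^sup>2 = b1 * b2" by simp
    ultimately show ?thesis unfolding sp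
      by (intro equalityI subsetI) (blast, metis (mono_tags, lifting) image_eqI mem_Collect_eq singletonD)
  qed
  then show ?thesis
    unfolding iteration_matrix_def Let_def prod.case b1_def[symmetric] b2_def[symmetric] T_def[symmetric]
    by (simp add: spectral_radius_def)
qed

end

theory Submission
  imports Defs
begin

text \<open>
  Let \<open>A\<close>, \<open>B\<close> be the Dirichlet-to-Neumann symbols of the two subdomains. Up to terms in the overlap,
  \<open>\<rho>\<^sup>2\<close> is \<open>exp (- 2 \<delta> Re \<lambda>)\<close> times \<open>\<bar>P\<^sub>2 - A\<bar> \<bar>P\<^sub>1 - B\<bar> / (\<bar>P\<^sub>2 + B\<bar> \<bar>P\<^sub>1 + A\<bar>)\<close>. At low frequencies it
  behaves like \<open>1 - Re (A + B) (1/P\<^sub>1 + 1/P\<^sub>2)\<close>, and \<open>Re (A + B) \<ge> 2 K\<close> with equality at the lowest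
  frequency, because \<open>Re A\<close> and \<open>Re B\<close> increase with the frequency: the Wronskian expressing this
  is a sum of products of power series with nonnegative coefficients. At high frequencies \<open>A\<close>, \<open>B\<close>
  are close to \<open>k\<close>, and \<open>1 - \<rho>\<close> is governed by \<open>k \<delta>\<close> and by the proximity \<open>min (k/r) (r/k)\<close> of \<open>k\<close>
  to the roots \<open>r \<approx> p\<close> and \<open>r \<approx> 1/q\<close> of \<open>k = p + q k\<^sup>2\<close>.

  Measure frequencies in units of \<open>K/2\<close> and write \<open>\<delta>\<close> as a multiple of \<open>B\<close> to the power \<open>-(2 N + 1)\<close>,
  where \<open>N\<close> is the number of distinct roots. Sampling \<open>\<rho>\<close> at the lowest frequency and at \<open>B\<^sup>2\<close>, \<open>B\<^sup>4\<close>,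
  up to \<open>B\<^sup>2\<^sup>N\<close> forces, root by root, the sorted roots of a near-optimal choice to be
  \<open>B\<close>, \<open>B\<^sup>3\<close>, up to \<open>B\<^sup>2\<^sup>N\<^sup>-\<^sup>1\<close> to leading order, and bounds the min-max value from below.
  Conversely the arithmetic-geometric mean inequality shows that the parameters with exactly these
  roots reach that bound up to \<open>O(1/B\<^sup>2)\<close> at every frequency.
\<close>

section \<open>Monotonicity of the Dirichlet-to-Neumann symbol\<close>

text \<open>The scale \<open>B\<close> comes from an equal-ripple picture. Roots and test
  frequencies alternate in a geometric chain of ratio B, and the overlap term k \<delta> enters 1 -
  \<rho> like the left flank k / r of one more root at B^(2 N + 1); this fixes the relation between
  \<delta> and B. At an inner test frequency two neighbouring flanks of size 1/B with fixed product
  meet. At the lowest frequency there is only one term, K/p, and the unit K/2 is what makes it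
  balance the sum of two flanks. In the one-sided method both conditions share their roots, so every
  contribution, including the overlap, carries a factor 2. Monotonicity matters because a dip of Re
  (A + B) just above the lowest frequency would replace K by a smaller constant. The sign of the
  derivative is not visible in the complex formula, hence the passage to real power series. The
  other obstacle is that competing parameters are neither bounded nor ordered a priori: roots may
  coincide, leave the range or fail to exist, so an expansion around the expected optimum would not
  suffice.\<close>

lemma abs_cos_odd_multiple: "\<bar>cos (real (2*j+1) * x)\<bar> \<le> real (2*j+1) * \<bar>cos x\<bar>"
proof (induction j)
  case (Suc j)
  have "cos (real (2 * Suc j + 1) * x) = cos (real (2*j+1) * x + 2 * x)" by (simp add: algebra_simps)
  also have "\<dots> = cos (real (2*j+1) * x) * cos (2*x) - sin (real (2*j+1) * x) * (2 * sin x * cos x)"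
    by (simp only: cos_add sin_double)
  finally have "\<bar>cos (real (2 * Suc j + 1) * x)\<bar> \<le> \<bar>cos (real (2*j+1) * x)\<bar> * \<bar>cos (2*x)\<bar>
      + \<bar>sin (real (2*j+1) * x)\<bar> * (2 * \<bar>sin x\<bar> * \<bar>cos x\<bar>)"
    by (metis abs_mult abs_numeral abs_triangle_ineq4)
  also have "\<dots> \<le> \<bar>cos (real (2*j+1) * x)\<bar> * 1 + 1 * (2 * 1 * \<bar>cos x\<bar>)"
    by (intro add_mono mult_mono) auto
  finally show ?case using Suc by (simp add: algebra_simps)
qed simp

text \<open>Each step adds 2 x, and \<open>sin (2 * x)\<close> contains the factor
  \<open>cos x\<close>. A bound by 1 would be too weak near the zeros of \<open>cos x\<close>, where
  some of the binomial coefficients below vanish as well.\<close>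

lemma abs_sin_even_multiple: "\<bar>sin (real (2*j) * x)\<bar> \<le> real (2*j) * \<bar>cos x\<bar>"
proof (induction j)
  case (Suc j)
  have "sin (real (2 * Suc j) * x) = sin (real (2*j) * x + 2 * x)" by (simp add: algebra_simps)
  also have "\<dots> = sin (real (2*j) * x) * cos (2*x) + cos (real (2*j) * x) * (2 * sin x * cos x)"
    by (simp only: sin_add sin_double)
  finally have "\<bar>sin (real (2 * Suc j) * x)\<bar> \<le> \<bar>sin (real (2*j) * x)\<bar> * \<bar>cos (2*x)\<bar>
      + \<bar>cos (real (2*j) * x)\<bar> * (2 * \<bar>sin x\<bar> * \<bar>cos x\<bar>)"
    by (metis abs_mult abs_numeral abs_triangle_ineq)
  also have "\<dots> \<le> \<bar>sin (real (2*j) * x)\<bar> * 1 + 1 * (2 * 1 * \<bar>cos x\<bar>)"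
    by (intro add_mono mult_mono) auto
  finally show ?case using Suc by (simp add: algebra_simps)
qed simp

text \<open>Twice the even-degree part of the binomial expansion of \<open>(1 + q) ^ m\<close>;
  \<open>odd_bin\<close> is twice the odd-degree part.\<close>

definition even_bin :: "real \<Rightarrow> nat \<Rightarrow> real" where
  "even_bin q m = (1 + q) ^ m + (1 - q) ^ m"

definition odd_bin :: "real \<Rightarrow> nat \<Rightarrow> real" where
  "odd_bin q m = (1 + q) ^ m - (1 - q) ^ m"

lemma even_bin_ge:
  assumes "0 \<le> q" "q \<le> 1" shows "even_bin q m \<ge> 2"
proof -
  have "(1 + q) ^ m \<ge> 1 + m * q" "(1 + - q) ^ m \<ge> 1 + m * - q"
    using assms by (intro Bernoulli_inequality; simp)+
  then show ?thesis by (simp add: even_bin_def)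
qed

lemma odd_bin_ge:
  assumes "0 \<le> q" "q \<le> 1" shows "odd_bin q m \<ge> 2 * m * q"
proof (induction m)
  case (Suc m)
  have "odd_bin q (Suc m) = odd_bin q m + q * even_bin q m"
    by (simp add: odd_bin_def even_bin_def algebra_simps)
  moreover have "q * even_bin q m \<ge> q * 2"
    using even_bin_ge[OF assms] assms by (intro mult_left_mono) auto
  ultimately show ?case using Suc by (simp add: algebra_simps)
qed (simp add: odd_bin_def)

lemma sums_nonneg:
  fixes f :: "nat \<Rightarrow> real"
  shows "f sums a \<Longrightarrow> (\<And>n. 0 \<le> f n) \<Longrightarrow> 0 \<le> a"
  using sums_le[OF _ sums_zero] by blast

section \<open>Power series of products of hyperbolic and trigonometric functions\<close>

lemma cosh_sums_even: "(\<lambda>n. z ^ (2*n) /\<^sub>R fact (2*n)) sums cosh (z :: 'a :: {real_normed_field,banach})"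
proof -
  have "(\<lambda>n. if even (2*n) then z ^ (2*n) /\<^sub>R fact (2*n) else 0) sums cosh z"
    by (subst sums_mono_reindex[of "\<lambda>n. 2*n" "\<lambda>n. if even n then z ^ n /\<^sub>R fact n else 0"])
       (use cosh_converges[of z] in \<open>auto simp: strict_mono_def elim!: evenE\<close>)
  then show ?thesis by simp
qed

lemma sinh_sums_odd: "(\<lambda>n. z ^ (2*n+1) /\<^sub>R fact (2*n+1)) sums sinh (z :: 'a :: {real_normed_field,banach})"
proof -
  have "(\<lambda>n. if even (2*n+1) then 0 else z ^ (2*n+1) /\<^sub>R fact (2*n+1)) sums sinh z"
    by (subst sums_mono_reindex[of "\<lambda>n. 2*n+1" "\<lambda>n. if even n then 0 else z ^ n /\<^sub>R fact n"])
       (use sinh_converges[of z] in \<open>auto simp: strict_mono_def elim!: oddE simp del: fact_Suc\<close>)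
  then show ?thesis by (simp del: fact_Suc power_Suc)
qed

lemma scaleR_inverse_real: "(a::real) /\<^sub>R f = a / f"
  by (simp add: divide_inverse)

lemma Re_of_real_scaleR_inverse: "Re (complex_of_real a /\<^sub>R f) = a / f"
  by (simp add: divide_inverse)

lemma Re_of_real_mult_cis: "Re (complex_of_real a * cis t) = a * cos t"
  and Im_of_real_mult_cis: "Im (complex_of_real a * cis t) = a * sin t"
  by simp_all

lemma cosh_Complex: "cosh (Complex x y) = Complex (cosh x * cos y) (sinh x * sin y)"
proof -
  have "exp (- Complex x y) = exp (Complex (-x) (-y))" by (simp add: complex_eq_iff Re_exp Im_exp)
  then show ?thesis
    unfolding cosh_def sinh_def by (simp add: complex_eq_iff Re_exp Im_exp field_simps)
qed

lemma sinh_Complex: "sinh (Complex x y) = Complex (sinh x * cos y) (cosh x * sin y)"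
proof -
  have "exp (- Complex x y) = exp (Complex (-x) (-y))" by (simp add: complex_eq_iff Re_exp Im_exp)
  then show ?thesis
    unfolding cosh_def sinh_def by (simp add: complex_eq_iff Re_exp Im_exp field_simps)
qed

lemma mult_sinh_double_sums:
  fixes w :: "'a :: {real_normed_field,banach}"
  shows "(\<lambda>n. (2 * 4 ^ n * (w\<^sup>2) ^ (n+1)) /\<^sub>R fact (2*n+1)) sums (w * sinh (2 * w))"
proof -
  have "(\<lambda>n. w * ((2 * w) ^ (2*n+1) /\<^sub>R fact (2*n+1))) sums (w * sinh (2 * w))"
    by (intro sums_mult sinh_sums_odd)
  moreover have "w * (2 * w) ^ (2*n+1) = 2 * 4 ^ n * (w\<^sup>2) ^ (n+1)" for n
    by (simp add: power_mult power_mult_distrib power2_eq_square)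
  ultimately show ?thesis
    by (simp only: mult_scaleR_right)
qed

lemma mult_cosh_double_sums:
  fixes w :: "'a :: {real_normed_field,banach}"
  shows "(\<lambda>n. (4 ^ n * (w\<^sup>2) ^ (n+1)) /\<^sub>R fact (2*n)) sums (w\<^sup>2 * cosh (2 * w))"
proof -
  have "(\<lambda>n. w\<^sup>2 * ((2 * w) ^ (2*n) /\<^sub>R fact (2*n))) sums (w\<^sup>2 * cosh (2 * w))"
    by (intro sums_mult cosh_sums_even)
  moreover have "w\<^sup>2 * (2 * w) ^ (2*n) = 4 ^ n * (w\<^sup>2) ^ (n+1)" for n
    by (simp add: power_mult power_mult_distrib power2_eq_square)
  ultimately show ?thesis
    by (simp only: mult_scaleR_right)
qed

text \<open>The series of \<open>w * sinh (2 * w)\<close> at the imaginary point w = \<i> y, where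
  the function equals \<open>- (y * sin (2 * y))\<close>.\<close>

lemma mult_sin_double_sums:
  fixes y :: real
  shows "(\<lambda>n. (2 * 4 ^ n * (-1) ^ n * (y\<^sup>2) ^ (n+1)) / fact (2*n+1)) sums (y * sin (2 * y))"
proof -
  let ?w = "Complex 0 y"
  have w2: "?w\<^sup>2 = complex_of_real (- (y\<^sup>2))" by (simp add: complex_eq_iff power2_eq_square)
  have "2 * ?w = Complex 0 (2 * y)" by (simp add: complex_eq_iff)
  then have "Re (?w * sinh (2 * ?w)) = - (y * sin (2 * y))"
    by (simp add: sinh_Complex)
  moreover have "2 * 4 ^ n * (?w\<^sup>2) ^ (n+1) = complex_of_real (- (2 * 4 ^ n * (-1) ^ n * (y\<^sup>2) ^ (n+1)))" for n
    unfolding w2 by (simp add: power_minus[of "(complex_of_real y)\<^sup>2"])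
  ultimately have "(\<lambda>n. - ((2 * 4 ^ n * (-1) ^ n * (y\<^sup>2) ^ (n+1)) / fact (2*n+1))) sums (- (y * sin (2 * y)))"
    using sums_Re[OF mult_sinh_double_sums[of ?w]]
    by (simp only: Re_of_real_scaleR_inverse minus_divide_left[symmetric])
  from sums_minus[OF this] show ?thesis by (simp only: minus_minus)
qed

lemma mult_cos_double_sums:
  fixes y :: real
  shows "(\<lambda>n. (4 ^ n * (-1) ^ n * (y\<^sup>2) ^ (n+1)) / fact (2*n)) sums (y\<^sup>2 * cos (2 * y))"
proof -
  let ?w = "Complex 0 y"
  have w2: "?w\<^sup>2 = complex_of_real (- (y\<^sup>2))" by (simp add: complex_eq_iff power2_eq_square)
  have "2 * ?w = Complex 0 (2 * y)" by (simp add: complex_eq_iff)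
  then have "Re (?w\<^sup>2 * cosh (2 * ?w)) = - (y\<^sup>2 * cos (2 * y))"
    unfolding w2 by (simp add: cosh_Complex)
  moreover have "4 ^ n * (?w\<^sup>2) ^ (n+1) = complex_of_real (- (4 ^ n * (-1) ^ n * (y\<^sup>2) ^ (n+1)))" for n
    unfolding w2 by (simp add: power_minus[of "(complex_of_real y)\<^sup>2"])
  ultimately have "(\<lambda>n. - ((4 ^ n * (-1) ^ n * (y\<^sup>2) ^ (n+1)) / fact (2*n))) sums (- (y\<^sup>2 * cos (2 * y)))"
    using sums_Re[OF mult_cosh_double_sums[of ?w]]
    by (simp only: Re_of_real_scaleR_inverse minus_divide_left[symmetric])
  from sums_minus[OF this] show ?thesis by (simp only: minus_minus)
qed

text \<open>Z = X + \<i> Y satisfies Z^2 = s cis \<phi>, so \<open>X\<^sup>2\<close> and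
  \<open>Y\<^sup>2\<close> are s times affine functions of q, and every expression needed below
  becomes a power series in s whose coefficients depend on the angle alone. The condition
  \<open>0 \<le> q\<close> encodes |Y| \<le> |X|.\<close>

locale polar_pair =
  fixes r \<theta> X Y s \<phi> q :: real
  assumes X: "X = r * cos \<theta>" and Y: "Y = r * sin \<theta>" and s: "s = r\<^sup>2" and phi: "\<phi> = 2 * \<theta>"
    and q: "q = cos \<phi>" and q0: "0 \<le> q"
begin

lemma q1: "q \<le> 1" using q by simp

lemma s0: "0 \<le> s" using s by simp

lemma X2: "X\<^sup>2 = s * (1 + q) / 2"
  unfolding X s q phi cos_double_cos by (simp add: power_mult_distrib)

lemma Y2: "Y\<^sup>2 = s * (1 - q) / 2"
  unfolding Y s q phi cos_double_sin by (simp add: power_mult_distrib)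

text \<open>The weights of the sinh and cosh series. All series are written against \<open>w\<close>
  or \<open>v\<close> so that inequalities can be checked coefficient by coefficient.\<close>

definition w :: "nat \<Rightarrow> real" where "w n = s ^ (n+1) / fact (2*n+1)"
definition v :: "nat \<Rightarrow> real" where "v n = s ^ (n+1) / fact (2*n)"
definition Z :: complex where "Z = Complex X Y"

lemma w0: "w n \<ge> 0" and v0: "v n \<ge> 0"
  using s0 by (simp_all add: w_def v_def del: fact_Suc power_Suc)

lemma wv: "v n = (2 * real n + 1) * w n"
proof -
  have f: "fact (2*n+1) = (2 * real n + 1) * fact (2*n)" by simp
  have c: "2 * real n + 1 \<noteq> 0" by linarith
  show ?thesis unfolding w_def v_def f times_divide_eq_right of_nat_add of_nat_mult
    of_nat_numeral of_nat_1 by (rule mult_divide_mult_cancel_left[OF c, symmetric])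
qed

lemma four_halves: "4 ^ n * (a / 2) ^ (n+1) = 2 ^ n * a ^ (n+1) / (2::real)"
proof -
  have "(4::real) ^ n = 2 ^ n * 2 ^ n" by (simp flip: power_mult_distrib)
  then show ?thesis by (simp add: power_divide)
qed

lemma X_sinh_sums: "(\<lambda>n. 2 ^ n * (1 + q) ^ (n+1) * w n) sums (X * sinh (2 * X))"
proof -
  have "2 * 4 ^ n * (X\<^sup>2) ^ (n+1) = 2 ^ n * (1 + q) ^ (n+1) * s ^ (n+1)" for n
    unfolding X2 mult.assoc four_halves power_mult_distrib by simp
  then show ?thesis using mult_sinh_double_sums[of X]
    by (simp only: w_def scaleR_inverse_real times_divide_eq_right)
qed

lemma Y_sin_sums: "(\<lambda>n. 2 ^ n * (-1) ^ n * (1 - q) ^ (n+1) * w n) sums (Y * sin (2 * Y))"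
proof -
  have "2 * 4 ^ n * (-1) ^ n * (Y\<^sup>2) ^ (n+1) = 2 * (-1) ^ n * (4 ^ n * (s * (1 - q) / 2) ^ (n+1))" for n
    unfolding Y2 by simp
  then have "2 * 4 ^ n * (-1) ^ n * (Y\<^sup>2) ^ (n+1) = 2 ^ n * (-1) ^ n * (1 - q) ^ (n+1) * s ^ (n+1)" for n
    unfolding four_halves power_mult_distrib by simp
  then show ?thesis using mult_sin_double_sums[of Y] by (simp only: w_def times_divide_eq_right)
qed

lemma X_cosh_sums: "(\<lambda>n. 2 ^ n / 2 * (1 + q) ^ (n+1) * v n) sums (X\<^sup>2 * cosh (2 * X))"
proof -
  have "4 ^ n * (X\<^sup>2) ^ (n+1) = 2 ^ n / 2 * (1 + q) ^ (n+1) * s ^ (n+1)" for n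
    unfolding X2 mult.assoc four_halves power_mult_distrib by simp
  then show ?thesis using mult_cosh_double_sums[of X]
    by (simp only: v_def scaleR_inverse_real times_divide_eq_right)
qed

lemma Y_cos_sums: "(\<lambda>n. 2 ^ n / 2 * (-1) ^ n * (1 - q) ^ (n+1) * v n) sums (Y\<^sup>2 * cos (2 * Y))"
proof -
  have "4 ^ n * (-1) ^ n * (Y\<^sup>2) ^ (n+1) = (-1) ^ n * (4 ^ n * (s * (1 - q) / 2) ^ (n+1))" for n
    unfolding Y2 by simp
  then have "4 ^ n * (-1) ^ n * (Y\<^sup>2) ^ (n+1) = 2 ^ n / 2 * (-1) ^ n * (1 - q) ^ (n+1) * s ^ (n+1)" for n
    unfolding four_halves power_mult_distrib by simp
  then show ?thesis using mult_cos_double_sums[of Y] by (simp only: v_def times_divide_eq_right)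
qed

lemma Z_even: "Z ^ (2 * n) = complex_of_real (s ^ n) * cis (real n * \<phi>)"
proof -
  have "Z = complex_of_real r * cis \<theta>" unfolding Z_def by (simp add: X Y complex_eq_iff)
  then have "Z ^ (2 * n) = complex_of_real (r ^ (2*n)) * cis (real (2*n) * \<theta>)"
    by (simp only: power_mult_distrib Complex.DeMoivre of_real_power)
  moreover have "r ^ (2*n) = s ^ n" by (simp add: s power_mult)
  moreover have "real (2*n) * \<theta> = real n * \<phi>" by (simp add: phi)
  ultimately show ?thesis by (simp only:)
qed

lemma cnj_Z: "cnj Z * Z ^ (2*n+1) = complex_of_real (s ^ (n+1)) * cis (real n * \<phi>)"
proof -
  have sums: "X\<^sup>2 + Y\<^sup>2 = s" unfolding X2 Y2 by (simp add: field_simps)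
  have "cnj Z * Z = complex_of_real s"
    using complex_mult_cnj[of Z] sums by (simp add: Z_def mult.commute flip: of_real_power of_real_add)
  moreover have "cnj Z * Z ^ (2*n+1) = (cnj Z * Z) * Z ^ (2*n)" by (simp only: power_add power_one_right mult_ac)
  ultimately have "cnj Z * Z ^ (2*n+1) = complex_of_real s * (complex_of_real (s ^ n) * cis (real n * \<phi>))"
    by (simp only: Z_even)
  then show ?thesis by (simp only: power_add power_one_right of_real_mult mult_ac)
qed

text \<open>Real and imaginary part of \<open>cosh Z\<close> are the mixed products
  \<open>cosh X * cos Y\<close> and \<open>sinh X * sin Y\<close>.\<close>

lemma cosh_Z_sums: "(\<lambda>n. complex_of_real (s ^ n / fact (2*n)) * cis (real n * \<phi>)) sums cosh Z"
  using cosh_sums_even[of Z] unfolding Z_even by (simp add: scaleR_conv_of_real field_simps)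

lemma cosh_cos_sums: "(\<lambda>n. (2 * real n + 1) * cos (n * \<phi>) * w n) sums (s * (cosh X * cos Y))"
proof -
  have "(\<lambda>n. s * (s ^ n / fact (2*n) * cos (n * \<phi>))) sums (s * (cosh X * cos Y))"
    using sums_mult[OF sums_Re[OF cosh_Z_sums], of s]
    by (simp only: Re_of_real_mult_cis) (simp only: Z_def cosh_Complex complex.sel)
  moreover have "s * (s ^ n / fact (2*n) * cos (n * \<phi>)) = (2 * real n + 1) * cos (n * \<phi>) * w n" for n
  proof -
    have "s * (s ^ n / fact (2*n) * cos (n * \<phi>)) = cos (n * \<phi>) * v n"
      by (simp add: v_def)
    then show ?thesis unfolding wv by (simp only: mult_ac)
  qed
  ultimately show ?thesis by (simp only:)
qed

lemma cosh_cos_sums': "(\<lambda>n. cos (n * \<phi>) * v n) sums (s * (cosh X * cos Y))"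
  using cosh_cos_sums unfolding wv by (simp only: mult_ac)

lemma sinh_sin_sums: "(\<lambda>n. (2 * real n + 1) * sin (n * \<phi>) * w n) sums (s * (sinh X * sin Y))"
proof -
  have "(\<lambda>n. s * (s ^ n / fact (2*n) * sin (n * \<phi>))) sums (s * (sinh X * sin Y))"
    using sums_mult[OF sums_Im[OF cosh_Z_sums], of s]
    by (simp only: Im_of_real_mult_cis) (simp only: Z_def cosh_Complex complex.sel)
  moreover have "s * (s ^ n / fact (2*n) * sin (n * \<phi>)) = (2 * real n + 1) * sin (n * \<phi>) * w n" for n
  proof -
    have "s * (s ^ n / fact (2*n) * sin (n * \<phi>)) = sin (n * \<phi>) * v n"
      by (simp add: v_def)
    then show ?thesis unfolding wv by (simp only: mult_ac)
  qed
  ultimately show ?thesis by (simp only:)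
qed

lemma sinh_sin_sums': "(\<lambda>n. sin (n * \<phi>) * v n) sums (s * (sinh X * sin Y))"
  using sinh_sin_sums unfolding wv by (simp only: mult_ac)

text \<open>The factor \<open>cnj Z\<close> keeps the angle at n \<phi>, whereas
  \<open>Z * sinh Z\<close> has the angle (n + 1) \<phi>. Their real parts are the sum and the
  difference of X sinh X cos Y and Y cosh X sin Y.\<close>

lemma cnj_sinh_sums: "(\<lambda>n. complex_of_real (w n) * cis (n * \<phi>)) sums (cnj Z * sinh Z)"
proof -
  have "(\<lambda>n. cnj Z * (Z ^ (2*n+1) /\<^sub>R fact (2*n+1))) sums (cnj Z * sinh Z)"
    by (intro sums_mult sinh_sums_odd)
  then have "(\<lambda>n. (complex_of_real (s ^ (n+1)) * cis (real n * \<phi>)) /\<^sub>R fact (2*n+1)) sums (cnj Z * sinh Z)"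
    by (simp only: mult_scaleR_right cnj_Z)
  then show ?thesis by (simp add: w_def scaleR_conv_of_real field_simps del: fact_Suc power_Suc)
qed

lemma A_sums: "(\<lambda>n. cos (n * \<phi>) * w n) sums (X * (sinh X * cos Y) + Y * (cosh X * sin Y))"
  using sums_Re[OF cnj_sinh_sums] by (simp add: Z_def sinh_Complex mult_ac)

lemma B_sums: "(\<lambda>n. sin (n * \<phi>) * w n) sums (X * (cosh X * sin Y) - Y * (sinh X * cos Y))"
  using sums_Im[OF cnj_sinh_sums] by (simp add: Z_def sinh_Complex mult_ac)

lemma C_sums: "(\<lambda>n. cos (real (n+1) * \<phi>) * w n) sums (X * (sinh X * cos Y) - Y * (cosh X * sin Y))"
proof -
  have "(\<lambda>n. Z * (Z ^ (2*n+1) /\<^sub>R fact (2*n+1))) sums (Z * sinh Z)"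
    by (intro sums_mult sinh_sums_odd)
  moreover have "Z * Z ^ (2*n+1) = complex_of_real (s ^ (n+1)) * cis (real (n+1) * \<phi>)" for n
    using Z_even[of "n+1"] by simp
  ultimately have "(\<lambda>n. (complex_of_real (s ^ (n+1)) * cis (real (n+1) * \<phi>)) /\<^sub>R fact (2*n+1)) sums (Z * sinh Z)"
    by (simp only: mult_scaleR_right)
  then have "(\<lambda>n. complex_of_real (w n) * cis (real (n+1) * \<phi>)) sums (Z * sinh Z)"
    by (simp add: w_def scaleR_conv_of_real field_simps del: fact_Suc power_Suc of_nat_Suc)
  from sums_Re[OF this] show ?thesis by (simp add: Z_def sinh_Complex mult_ac add.commute)
qed

lemma v_Suc: "2 * real (Suc n) * v (Suc n) = s * w n"
proof -
  have f: "fact (2 * Suc n) = (2 * real (Suc n)) * fact (2*n+1)" by simp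
  have c: "2 * real (Suc n) \<noteq> 0" by simp
  have "2 * real (Suc n) * v (Suc n) = s ^ (Suc n + 1) / fact (2*n+1)"
    unfolding v_def f times_divide_eq_right by (rule mult_divide_mult_cancel_left[OF c])
  also have "\<dots> = s * w n" by (simp add: w_def)
  finally show ?thesis .
qed

text \<open>Multiplication by s shifts the index by one and turns the weights \<open>w\<close> into
  \<open>v\<close>; the new summand at index 0 vanishes because of the factor n.\<close>

lemma sA_sums: "(\<lambda>n. 2 * real n * cos (n * \<phi> - \<phi>) * v n) sums (s * (X * (sinh X * cos Y) + Y * (cosh X * sin Y)))"
proof -
  have "(\<lambda>n. s * (cos (n * \<phi>) * w n)) sums (s * (X * (sinh X * cos Y) + Y * (cosh X * sin Y)))"
    by (intro sums_mult A_sums)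
  moreover have "s * (cos (n * \<phi>) * w n) = 2 * real (Suc n) * cos (real (Suc n) * \<phi> - \<phi>) * v (Suc n)" for n
  proof -
    have "real (Suc n) * \<phi> - \<phi> = n * \<phi>" by (simp add: algebra_simps)
    then show ?thesis using v_Suc[of n, symmetric] by (simp only: mult.left_commute[of s]) (simp only: mult_ac)
  qed
  ultimately have "(\<lambda>n. (\<lambda>n. 2 * real n * cos (n * \<phi> - \<phi>) * v n) (Suc n)) sums (s * (X * (sinh X * cos Y) + Y * (cosh X * sin Y)))"
    by (simp only:)
  from sums_Suc[OF this] show ?thesis by simp
qed

lemma sC_sums: "(\<lambda>n. 2 * real n * cos (n * \<phi>) * v n) sums (s * (X * (sinh X * cos Y) - Y * (cosh X * sin Y)))"
proof -
  have "(\<lambda>n. s * (cos (real (n+1) * \<phi>) * w n)) sums (s * (X * (sinh X * cos Y) - Y * (cosh X * sin Y)))"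
    by (intro sums_mult C_sums)
  moreover have "s * (cos (real (n+1) * \<phi>) * w n) = 2 * real (Suc n) * cos (real (Suc n) * \<phi>) * v (Suc n)" for n
    using v_Suc[of n, symmetric] by (simp only: mult.left_commute[of s] Suc_eq_plus1) (simp only: mult_ac)
  ultimately have "(\<lambda>n. (\<lambda>n. 2 * real n * cos (n * \<phi>) * v n) (Suc n)) sums (s * (X * (sinh X * cos Y) - Y * (cosh X * sin Y)))"
    by (simp only:)
  from sums_Suc[OF this] show ?thesis by simp
qed

lemma const_sums: "(\<lambda>n. (if n = 0 then a else 0) * w n) sums (a * s)"
  and const_sums': "(\<lambda>n. (if n = 0 then a else 0) * v n) sums (a * s)"
proof -
  have "(\<lambda>n. (if n = 0 then a else 0) * w n) = (\<lambda>n. if n = 0 then a * s else 0)"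
    "(\<lambda>n. (if n = 0 then a else 0) * v n) = (\<lambda>n. if n = 0 then a * s else 0)"
    by (auto simp: w_def v_def)
  then show "(\<lambda>n. (if n = 0 then a else 0) * w n) sums (a * s)" "(\<lambda>n. (if n = 0 then a else 0) * v n) sums (a * s)"
    using sums_single[of 0 "\<lambda>_. a * s"] by simp_all
qed

section \<open>Signs of the coefficients\<close>

definition P :: "nat \<Rightarrow> real" where "P n = (1 + q) ^ (n+1) + (-1) ^ n * (1 - q) ^ (n+1)"
definition M :: "nat \<Rightarrow> real" where "M n = (1 + q) ^ (n+1) - (-1) ^ n * (1 - q) ^ (n+1)"

text \<open>By the parity of n, one of \<open>P n\<close> and \<open>M n\<close> is
  \<open>even_bin\<close> and the other \<open>odd_bin\<close> at n + 1. The first kind stays above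
  2, the second may vanish with q.\<close>

lemma P_even: "even n \<Longrightarrow> P n \<ge> 2" and M_odd: "odd n \<Longrightarrow> M n \<ge> 2"
  using even_bin_ge[OF q0 q1, of "n+1"] by (simp_all add: P_def M_def even_bin_def)

lemma P_odd: "odd n \<Longrightarrow> P n \<ge> 2 * (real n + 1) * q" and M_even: "even n \<Longrightarrow> M n \<ge> 2 * (real n + 1) * q"
  using odd_bin_ge[OF q0 q1, of "n+1"] by (simp_all add: P_def M_def odd_bin_def add.commute)

text \<open>The factor q is essential: for odd n the competing coefficient \<open>P n\<close> is
  itself bounded below only by a multiple of q.\<close>

lemma cos_odd_le: "odd n \<Longrightarrow> \<bar>cos (real n * \<phi>)\<bar> \<le> real n * q"
  using abs_cos_odd_multiple[of _ \<phi>] q0 by (auto elim!: oddE simp flip: q)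

lemma sin_even_le: "even n \<Longrightarrow> \<bar>sin (real n * \<phi>)\<bar> \<le> real n * q"
  using abs_sin_even_multiple[of _ \<phi>] q0 by (auto elim!: evenE simp flip: q)

lemma two_power_ge: "n \<ge> 3 \<Longrightarrow> (2::real) ^ n \<ge> 2 * real n + 2"
proof (induction n rule: dec_induct)
  case (step n)
  then show ?case by simp
qed simp

lemma two_power_ge': "n \<ge> 1 \<Longrightarrow> (2::real) ^ n \<ge> 2 * real n"
proof (induction n rule: dec_induct)
  case (step n)
  then show ?case by simp
qed simp

text \<open>For even n the bound 2 on \<open>P n\<close> suffices, for odd n both sides carry a
  factor q. Index 2 fails at q = 0 (6 against 4) and index 0 fails too (2 against 1); there the sign
  of the cosine has to be used.\<close>

lemma P_dominates:
  assumes "n \<noteq> 0" "n \<noteq> 2"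
  shows "(2 * real n + 2) * \<bar>cos (real n * \<phi>)\<bar> \<le> 2 ^ n / 2 * P n"
proof (cases "even n")
  case True
  have "n \<ge> 3" using True assms by presburger
  then have "(2 * real n + 2) * \<bar>cos (real n * \<phi>)\<bar> \<le> (2 ^ n :: real) * 1"
    using two_power_ge[of n] by (intro mult_mono) auto
  also have "\<dots> \<le> 2 ^ n / 2 * P n" using P_even[OF True] by simp
  finally show ?thesis .
next
  case False
  then have "n \<ge> 1" by presburger
  have "(2 * real n + 2) * \<bar>cos (real n * \<phi>)\<bar> \<le> (2 * real n + 2) * (real n * q)"
    using cos_odd_le[OF False] by (intro mult_left_mono) auto
  also have "\<dots> = 2 * real n * ((real n + 1) * q)" by (simp add: algebra_simps)
  also have "\<dots> \<le> 2 ^ n * ((real n + 1) * q)"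
    using two_power_ge'[OF \<open>n \<ge> 1\<close>] q0 by (intro mult_right_mono) auto
  also have "\<dots> = 2 ^ n / 2 * (2 * (real n + 1) * q)" by simp
  also have "\<dots> \<le> 2 ^ n / 2 * P n"
    using P_odd[OF False] by (intro mult_left_mono) auto
  finally show ?thesis .
qed

lemma P_2: "P 2 = 2 + 6 * q\<^sup>2"
  by (simp add: P_def power2_eq_square power3_eq_cube algebra_simps numeral_3_eq_3)

lemma cos_2: "cos (2 * \<phi>) = 2 * q\<^sup>2 - 1"
  by (simp add: q cos_double_cos)

lemma sin_2: "sin \<phi> * sin \<phi> = 1 - q\<^sup>2"
  using sin_cos_squared_add[of \<phi>] by (simp add: q power2_eq_square)

text \<open>The extra 1 at index 0 stems from the isolated summand s in the next two lemmas and
  makes that coefficient exactly 0. At index 2 the dependence on q cancels and 10 remains.\<close>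

lemma P_minus_cos_nonneg: "0 \<le> (if n = 0 then 1 else 0) + 2 ^ n / 2 * P n - (2 * real n + 2) * cos (real n * \<phi>)"
proof -
  consider "n = 0" | "n = 2" | "n \<noteq> 0" "n \<noteq> 2" by blast
  then show ?thesis
  proof cases
    case 3
    have "(2 * real n + 2) * cos (real n * \<phi>) \<le> (2 * real n + 2) * \<bar>cos (real n * \<phi>)\<bar>"
      by (intro mult_left_mono) auto
    then have "0 \<le> 2 ^ n / 2 * P n - (2 * real n + 2) * cos (real n * \<phi>)"
      using P_dominates[OF 3] by linarith
    then show ?thesis using 3 by (simp only: if_False add_0_left)
  qed (simp_all add: P_2 cos_2, simp add: P_def)
qed

text \<open>The coefficient of \<open>P ^ 4\<close> in the Wronskian of the Robin quotient, i.e. the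
  limit of a Dirichlet condition at the outer boundary.\<close>

lemma dirichlet_dirichlet_nonneg:
  "0 \<le> s + (X * sinh (2*X) + Y * sin (2*Y)) / 2 - s * (cosh X * cos Y)
      - (X * (sinh X * cos Y) + Y * (cosh X * sin Y))"
proof -
  have "(\<lambda>n. (if n = 0 then 1 else 0) * w n + (2 ^ n * (1 + q) ^ (n+1) * w n + 2 ^ n * (-1) ^ n * (1 - q) ^ (n+1) * w n) / 2
      - (2 * real n + 1) * cos (n * \<phi>) * w n - cos (n * \<phi>) * w n)
    sums (1 * s + (X * sinh (2*X) + Y * sin (2*Y)) / 2 - s * (cosh X * cos Y)
      - (X * (sinh X * cos Y) + Y * (cosh X * sin Y)))"
    by (intro sums_add sums_diff sums_divide const_sums X_sinh_sums Y_sin_sums cosh_cos_sums A_sums)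
  moreover have "0 \<le> (if n = 0 then 1 else 0) * w n + (2 ^ n * (1 + q) ^ (n+1) * w n + 2 ^ n * (-1) ^ n * (1 - q) ^ (n+1) * w n) / 2
      - (2 * real n + 1) * cos (n * \<phi>) * w n - cos (n * \<phi>) * w n" for n
  proof -
    have "0 \<le> ((if n = 0 then 1 else 0) + 2 ^ n / 2 * P n - (2 * real n + 2) * cos (real n * \<phi>)) * w n"
      by (intro mult_nonneg_nonneg P_minus_cos_nonneg w0)
    then show ?thesis unfolding P_def by (simp add: algebra_simps add_divide_distrib diff_divide_distrib split del: if_split)
  qed
  ultimately show ?thesis by (simp only: mult_1_left) (rule sums_nonneg)
qed

text \<open>Half of the coefficient of \<open>P ^ 3\<close> in the Wronskian. The coefficients are
  those of the Dirichlet case, now against the weights \<open>v\<close>.\<close>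

lemma dirichlet_cubic_nonneg:
  "0 \<le> s + (X\<^sup>2 * cosh (2*X) + Y\<^sup>2 * cos (2*Y)) - 2 * (s * (cosh X * cos Y))
      - s * (X * (sinh X * cos Y) - Y * (cosh X * sin Y))"
proof -
  have "(\<lambda>n. (if n = 0 then 1 else 0) * v n + (2 ^ n / 2 * (1 + q) ^ (n+1) * v n + 2 ^ n / 2 * (-1) ^ n * (1 - q) ^ (n+1) * v n)
      - 2 * (cos (n * \<phi>) * v n) - 2 * real n * cos (n * \<phi>) * v n)
    sums (1 * s + (X\<^sup>2 * cosh (2*X) + Y\<^sup>2 * cos (2*Y)) - 2 * (s * (cosh X * cos Y))
      - s * (X * (sinh X * cos Y) - Y * (cosh X * sin Y)))"
    by (intro sums_add sums_diff sums_mult const_sums' X_cosh_sums Y_cos_sums cosh_cos_sums' sC_sums)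
  moreover have "0 \<le> (if n = 0 then 1 else 0) * v n + (2 ^ n / 2 * (1 + q) ^ (n+1) * v n + 2 ^ n / 2 * (-1) ^ n * (1 - q) ^ (n+1) * v n)
      - 2 * (cos (n * \<phi>) * v n) - 2 * real n * cos (n * \<phi>) * v n" for n
  proof -
    have "0 \<le> ((if n = 0 then 1 else 0) + 2 ^ n / 2 * P n - (2 * real n + 2) * cos (real n * \<phi>)) * v n"
      by (intro mult_nonneg_nonneg P_minus_cos_nonneg v0)
    then show ?thesis unfolding P_def by (simp add: algebra_simps add_divide_distrib diff_divide_distrib split del: if_split)
  qed
  ultimately show ?thesis by (simp only: mult_1_left) (rule sums_nonneg)
qed

text \<open>For odd n \<ge> 3 the binomial term is at least \<open>2 ^ n\<close> and beats the
  trivial bounds. For even n \<ge> 2 every term carries a factor q, because n \<phi> - \<phi> is an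
  odd multiple of \<phi>.\<close>

lemma M_linear_nonneg:
  "0 \<le> 2 ^ n / 2 * M n - (if n = 0 then q else 0) + 2 * sin \<phi> * sin (real n * \<phi>) + 2 * real n * cos (real n * \<phi> - \<phi>)"
proof -
  have "n = 0 \<or> n = 1 \<or> n \<ge> 3 \<and> odd n \<or> n \<ge> 2 \<and> even n" by presburger
  then consider "n = 0" | "n = 1" | "n \<ge> 3" "odd n" | "n \<ge> 2" "even n" by blast
  then show ?thesis
  proof cases
    case 1 then show ?thesis by (simp add: M_def)
  next
    case 2
    have "q\<^sup>2 \<le> 1" using q0 q1 by (simp add: power_le_one)
    then show ?thesis using 2 M_odd[of 1] sin_2 by simp
  next
    case 3
    have "\<bar>sin \<phi> * sin (real n * \<phi>)\<bar> \<le> 1 * 1" unfolding abs_mult by (intro mult_mono) auto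
    moreover have "\<bar>real n * cos (real n * \<phi> - \<phi>)\<bar> \<le> real n * 1" unfolding abs_mult by (intro mult_mono) auto
    moreover have "(2::real) ^ n \<le> 2 ^ n / 2 * M n" using mult_left_mono[OF M_odd[OF 3(2)], of "2 ^ n / 2"] by simp
    moreover have "(n = 0) = False" using 3 by simp
    ultimately show ?thesis using two_power_ge[OF 3(1)] by (simp only: if_False mult.assoc; linarith)
  next
    case 4
    then obtain m where m: "n = Suc m" "odd m" by (cases n) auto
    have "\<bar>sin \<phi> * sin (real n * \<phi>)\<bar> \<le> 1 * (real n * q)" unfolding abs_mult
      using sin_even_le[OF 4(2)] by (intro mult_mono) auto
    moreover have "real n * \<phi> - \<phi> = real m * \<phi>" by (simp add: m algebra_simps)
    then have "\<bar>real n * cos (real n * \<phi> - \<phi>)\<bar> \<le> real n * ((real n - 1) * q)" unfolding abs_mult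
      using cos_odd_le[OF m(2)] m by (intro mult_mono) auto
    moreover have "2 ^ n / 2 * (2 * (real n + 1) * q) \<le> 2 ^ n / 2 * M n" using M_even[OF 4(2)] by (intro mult_left_mono) auto
    moreover have "2 * real n * ((real n + 1) * q) \<le> 2 ^ n * ((real n + 1) * q)"
      using two_power_ge'[of n] 4 q0 by (intro mult_right_mono) auto
    moreover have "2 * real n * ((real n + 1) * q) = 2 * (real n * q) + 2 * (real n * ((real n - 1) * q)) + 2 * real n * q"
      by (simp add: algebra_simps)
    moreover have "0 \<le> 2 * real n * q" using q0 by simp
    moreover have "(n = 0) = False" using 4 by simp
    ultimately show ?thesis by (simp only: if_False mult.assoc; linarith)
  qed
qed

text \<open>The coefficient of the first power of P in the Wronskian, up to the factor
  \<open>2 * (X\<^sup>2 + Y\<^sup>2)\<close>.\<close>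

lemma neumann_cubic_nonneg:
  "0 \<le> (X\<^sup>2 * cosh (2*X) - Y\<^sup>2 * cos (2*Y)) - s * q + 2 * sin \<phi> * (s * (sinh X * sin Y))
      + s * (X * (sinh X * cos Y) + Y * (cosh X * sin Y))"
proof -
  have "(\<lambda>n. (2 ^ n / 2 * (1 + q) ^ (n+1) * v n - 2 ^ n / 2 * (-1) ^ n * (1 - q) ^ (n+1) * v n)
      - (if n = 0 then q else 0) * v n + 2 * sin \<phi> * (sin (n * \<phi>) * v n) + 2 * real n * cos (n * \<phi> - \<phi>) * v n)
    sums ((X\<^sup>2 * cosh (2*X) - Y\<^sup>2 * cos (2*Y)) - q * s + 2 * sin \<phi> * (s * (sinh X * sin Y))
      + s * (X * (sinh X * cos Y) + Y * (cosh X * sin Y)))"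
    by (intro sums_add sums_diff sums_mult const_sums' X_cosh_sums Y_cos_sums sinh_sin_sums' sA_sums)
  moreover have "0 \<le> (2 ^ n / 2 * (1 + q) ^ (n+1) * v n - 2 ^ n / 2 * (-1) ^ n * (1 - q) ^ (n+1) * v n)
      - (if n = 0 then q else 0) * v n + 2 * sin \<phi> * (sin (n * \<phi>) * v n) + 2 * real n * cos (n * \<phi> - \<phi>) * v n" for n
  proof -
    have "0 \<le> (2 ^ n / 2 * M n - (if n = 0 then q else 0) + 2 * sin \<phi> * sin (real n * \<phi>) + 2 * real n * cos (real n * \<phi> - \<phi>)) * v n"
      by (intro mult_nonneg_nonneg M_linear_nonneg v0)
    then show ?thesis unfolding M_def by (simp add: algebra_simps add_divide_distrib diff_divide_distrib split del: if_split)
  qed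
  ultimately show ?thesis unfolding mult.commute[of q s] by (rule sums_nonneg)
qed

text \<open>The same parity split as before. The second binomial term comes from the factors
  \<open>X\<^sup>2\<close> and \<open>Y\<^sup>2\<close>, which raise the exponent by one. At n = 0
  everything cancels exactly.\<close>

lemma mixed_nonneg_coeff:
  "0 \<le> 2 ^ n * (M n + P (n+1)) - (if n = 0 then 2 * q else 0) + (4 * real n + 4) * (sin \<phi> * sin (real n * \<phi>))
      - 4 * cos (real (n+1) * \<phi>)"
proof -
  have "n = 0 \<or> n = 1 \<or> n \<ge> 3 \<and> odd n \<or> n \<ge> 2 \<and> even n" by presburger
  then consider "n = 0" | "n = 1" | "n \<ge> 3" "odd n" | "n \<ge> 2" "even n" by blast
  then show ?thesis
  proof cases
    case 1 show ?thesis unfolding 1 M_def P_def by (simp add: power2_eq_square algebra_simps flip: q)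
  next
    case 2
    have "q\<^sup>2 \<le> 1" using q0 q1 by (simp add: power_le_one)
    then show ?thesis using 2 M_odd[of 1] sin_2 P_2 cos_2 by (simp add: numeral_2_eq_2)
  next
    case 3
    have "\<bar>(4 * real n + 4) * (sin \<phi> * sin (real n * \<phi>))\<bar> \<le> (4 * real n + 4) * (1 * 1)"
      unfolding abs_mult by (intro mult_mono) auto
    moreover have "\<bar>cos (real (n+1) * \<phi>)\<bar> \<le> 1" by simp
    moreover have "2 ^ n * 4 \<le> 2 ^ n * (M n + P (n+1))"
      using M_odd[OF 3(2)] P_even[of "n+1"] 3 by (intro mult_left_mono) auto
    moreover have "(n = 0) = False" using 3 by simp
    ultimately show ?thesis using two_power_ge[OF 3(1)] by (simp only: if_False mult_1_right; linarith)
  next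
    case 4
    have "\<bar>(4 * real n + 4) * (sin \<phi> * sin (real n * \<phi>))\<bar> \<le> (4 * real n + 4) * (1 * (real n * q))"
      unfolding abs_mult using sin_even_le[OF 4(2)] by (intro mult_mono) auto
    moreover have "\<bar>cos (real (n+1) * \<phi>)\<bar> \<le> (real n + 1) * q" using cos_odd_le[of "n+1"] 4 by (simp add: add.commute)
    moreover have "2 ^ n * ((4 * real n + 6) * q) \<le> 2 ^ n * (M n + P (n+1))"
      using M_even[OF 4(2)] P_odd[of "n+1"] 4 by (intro mult_left_mono) (auto simp: algebra_simps)
    moreover have "2 * real n * ((4 * real n + 6) * q) \<le> 2 ^ n * ((4 * real n + 6) * q)"
      using two_power_ge'[of n] 4 q0 by (intro mult_right_mono) auto
    moreover have "2 * real n * ((4 * real n + 6) * q) - ((4 * real n + 4) * (1 * (real n * q)) + 4 * ((real n + 1) * q)) = 4 * q * (real n * real n + n - 1)"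
      by (simp add: algebra_simps)
    moreover have "real n * real n \<ge> 2 * 2" using 4 by (intro mult_mono) auto
    then have "0 \<le> 4 * q * (real n * real n + n - 1)" using q0 by (intro mult_nonneg_nonneg) auto
    moreover have "(n = 0) = False" using 4 by simp
    ultimately show ?thesis by (simp only: if_False; linarith)
  qed
qed

text \<open>The coefficient of \<open>P\<^sup>2\<close> in the Wronskian. Every summand contains a
  factor s once \<open>X\<^sup>2\<close> and \<open>Y\<^sup>2\<close> are expressed by s and q;
  \<open>S\<close> is the quotient by this factor.\<close>

lemma mixed_nonneg:
  "0 \<le> s * (X * sinh (2*X) - Y * sin (2*Y)) - 2 * q * s\<^sup>2 + 2 * (X\<^sup>2 * (X * sinh (2*X)) - Y\<^sup>2 * (Y * sin (2*Y)))
      + 2 * sin \<phi> * s * (s * (sinh X * sin Y))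
      - 4 * s * (X * (sinh X * cos Y) - Y * (cosh X * sin Y))
      + 2 * sin \<phi> * s * (X * (cosh X * sin Y) - Y * (sinh X * cos Y))"
proof -
  define S where "S = (X * sinh (2*X) - Y * sin (2*Y)) - 2 * q * s + ((1 + q) * (X * sinh (2*X)) - (1 - q) * (Y * sin (2*Y)))
      + 2 * sin \<phi> * (s * (sinh X * sin Y))
      - 4 * (X * (sinh X * cos Y) - Y * (cosh X * sin Y))
      + 2 * sin \<phi> * (X * (cosh X * sin Y) - Y * (sinh X * cos Y))"
  have "(\<lambda>n. (2 ^ n * (1 + q) ^ (n+1) * w n - 2 ^ n * (-1) ^ n * (1 - q) ^ (n+1) * w n)
      - (if n = 0 then 2 * q else 0) * w n
      + ((1 + q) * (2 ^ n * (1 + q) ^ (n+1) * w n) - (1 - q) * (2 ^ n * (-1) ^ n * (1 - q) ^ (n+1) * w n))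
      + 2 * sin \<phi> * ((2 * real n + 1) * sin (n * \<phi>) * w n) - 4 * (cos (real (n+1) * \<phi>) * w n)
      + 2 * sin \<phi> * (sin (n * \<phi>) * w n))
    sums S"
    unfolding S_def
    by (intro sums_add sums_diff sums_mult const_sums X_sinh_sums Y_sin_sums sinh_sin_sums B_sums C_sums)
  moreover have "0 \<le> (2 ^ n * (1 + q) ^ (n+1) * w n - 2 ^ n * (-1) ^ n * (1 - q) ^ (n+1) * w n)
      - (if n = 0 then 2 * q else 0) * w n
      + ((1 + q) * (2 ^ n * (1 + q) ^ (n+1) * w n) - (1 - q) * (2 ^ n * (-1) ^ n * (1 - q) ^ (n+1) * w n))
      + 2 * sin \<phi> * ((2 * real n + 1) * sin (n * \<phi>) * w n) - 4 * (cos (real (n+1) * \<phi>) * w n)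
      + 2 * sin \<phi> * (sin (n * \<phi>) * w n)" for n
  proof -
    have "0 \<le> (2 ^ n * (M n + P (n+1)) - (if n = 0 then 2 * q else 0) + (4 * real n + 4) * (sin \<phi> * sin (real n * \<phi>))
      - 4 * cos (real (n+1) * \<phi>)) * w n"
      by (intro mult_nonneg_nonneg mixed_nonneg_coeff w0)
    then show ?thesis unfolding P_def M_def by (simp add: algebra_simps add_divide_distrib diff_divide_distrib split del: if_split)
  qed
  ultimately have "0 \<le> S" by (rule sums_nonneg)
  then have "0 \<le> s * S" using s0 by simp
  also have "s * S = s * (X * sinh (2*X) - Y * sin (2*Y)) - 2 * q * s\<^sup>2 + 2 * (X\<^sup>2 * (X * sinh (2*X)) - Y\<^sup>2 * (Y * sin (2*Y)))
      + 2 * sin \<phi> * s * (s * (sinh X * sin Y))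
      - 4 * s * (X * (sinh X * cos Y) - Y * (cosh X * sin Y))
      + 2 * sin \<phi> * s * (X * (cosh X * sin Y) - Y * (sinh X * cos Y))"
    unfolding S_def X2 Y2 by (simp add: field_simps power2_eq_square)
  finally show ?thesis .
qed

text \<open>The constant coefficient in P, i.e. the Neumann case. Termwise positivity fails here:
  the coefficient of \<open>w 2\<close> is -2 at q = 0. The terms of index 0 and 4 compensate it,
  whatever the size of s.\<close>

lemma neumann_neumann_nonneg:
  "0 \<le> s + (X * sinh (2*X) + Y * sin (2*Y)) / 2 + s * (cosh X * cos Y)
      + (X * (sinh X * cos Y) + Y * (cosh X * sin Y))"
proof -
  define c where "c n = (if n = 0 then 1 else 0) + 2 ^ n / 2 * P n + (2 * real n + 2) * cos (real n * \<phi>)" for n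
  have "(\<lambda>n. (if n = 0 then 1 else 0) * w n + (2 ^ n * (1 + q) ^ (n+1) * w n + 2 ^ n * (-1) ^ n * (1 - q) ^ (n+1) * w n) / 2
      + (2 * real n + 1) * cos (n * \<phi>) * w n + cos (n * \<phi>) * w n)
    sums (1 * s + (X * sinh (2*X) + Y * sin (2*Y)) / 2 + s * (cosh X * cos Y)
      + (X * (sinh X * cos Y) + Y * (cosh X * sin Y)))"
    by (intro sums_add sums_diff sums_divide const_sums X_sinh_sums Y_sin_sums cosh_cos_sums A_sums)
  also have "(\<lambda>n. (if n = 0 then 1 else 0) * w n + (2 ^ n * (1 + q) ^ (n+1) * w n + 2 ^ n * (-1) ^ n * (1 - q) ^ (n+1) * w n) / 2
      + (2 * real n + 1) * cos (n * \<phi>) * w n + cos (n * \<phi>) * w n) = (\<lambda>n. c n * w n)"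
  proof -
    have "e * w + (t * a * w + t * u * b * w) / 2 + (2 * x + 1) * d * w + d * w
        = (e + t / 2 * (a + u * b) + (2 * x + 2) * d) * w" for e w t a u b x d :: real
      by (simp add: field_simps)
    then show ?thesis unfolding c_def P_def by (simp only:)
  qed
  finally have sums: "(\<lambda>n. c n * w n) sums (1 * s + (X * sinh (2*X) + Y * sin (2*Y)) / 2 + s * (cosh X * cos Y)
      + (X * (sinh X * cos Y) + Y * (cosh X * sin Y)))" .
  have "0 \<le> c n * w n" if "n \<notin> {0,2,4}" for n
  proof -
    have "(2 * real n + 2) * (- \<bar>cos (real n * \<phi>)\<bar>) \<le> (2 * real n + 2) * cos (real n * \<phi>)"
      by (intro mult_left_mono) auto
    moreover have "c n = 2 ^ n / 2 * P n + (2 * real n + 2) * cos (real n * \<phi>)"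
      using that by (simp add: c_def)
    moreover have "(2 * real n + 2) * \<bar>cos (real n * \<phi>)\<bar> \<le> 2 ^ n / 2 * P n"
      using that by (intro P_dominates) auto
    ultimately have "0 \<le> c n" by linarith
    then show ?thesis using w0 by simp
  qed
  then have "(\<Sum>n\<in>{0,2,4}. c n * w n) \<le> suminf (\<lambda>n. c n * w n)"
    using sums by (intro sum_le_suminf) (auto simp: sums_iff)
  moreover have "0 \<le> (\<Sum>n\<in>{0,2,4}. c n * w n)"
  proof -
    have "c 0 = 4" by (simp add: c_def P_def)
    have "c 2 \<ge> -2" by (simp add: c_def P_2 cos_2)
    have "cos (4 * \<phi>) = 2 * (2 * q\<^sup>2 - 1)\<^sup>2 - 1"
      using cos_double_cos[of "2 * \<phi>"] by (simp add: cos_2)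
    moreover have "P 4 = 2 + 20 * q\<^sup>2 + 10 * q\<^sup>2 * q\<^sup>2"
      by (simp add: P_def power2_eq_square algebra_simps eval_nat_numeral)
    ultimately have "c 4 = 26 + 80 * q\<^sup>2 + 160 * (q\<^sup>2 * q\<^sup>2)"
      by (simp add: c_def power2_eq_square algebra_simps)
    then have "c 4 \<ge> 26" by simp
    have w: "w 0 = s" "w 2 = s * s\<^sup>2 / 120" "w 4 = s * (s\<^sup>2)\<^sup>2 / 362880"
      by (simp_all add: w_def fact_numeral power2_eq_square eval_nat_numeral)
    have "c 0 * w 0 + -2 * w 2 + 26 * w 4 \<le> c 0 * w 0 + c 2 * w 2 + c 4 * w 4"
      using \<open>c 2 \<ge> -2\<close> \<open>c 4 \<ge> 26\<close> w0 by (intro add_mono mult_right_mono) auto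
    moreover have "0 \<le> s * (4 - s\<^sup>2 / 60 + 26 * (s\<^sup>2)\<^sup>2 / 362880)"
    proof (intro mult_nonneg_nonneg s0)
      \<comment> \<open>This square trades s^2 / 60 for s^4 / 57600 + 4, and 1 / 57600 is less than
        26 / 362880.\<close>
      have "0 \<le> (s\<^sup>2 / 240 - 2)\<^sup>2" by simp
      then have "s\<^sup>2 / 60 \<le> (s\<^sup>2)\<^sup>2 / 57600 + 4"
        unfolding power2_diff by (simp add: power_divide)
      moreover have "(s\<^sup>2)\<^sup>2 / 57600 \<le> 26 * (s\<^sup>2)\<^sup>2 / 362880"
        using zero_le_power2[of "s\<^sup>2"] by linarith
      ultimately show "0 \<le> 4 - s\<^sup>2 / 60 + 26 * (s\<^sup>2)\<^sup>2 / 362880" by linarith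
    qed
    moreover have "c 0 * w 0 + -2 * w 2 + 26 * w 4 = s * (4 - s\<^sup>2 / 60 + 26 * (s\<^sup>2)\<^sup>2 / 362880)"
      unfolding \<open>c 0 = 4\<close> w by (simp add: field_simps)
    ultimately have "0 \<le> c 0 * w 0 + c 2 * w 2 + c 4 * w 4" by linarith
    then show ?thesis by simp
  qed
  ultimately show ?thesis using sums by (simp add: sums_iff)
qed

end

section \<open>The Wronskian of the Robin quotient\<close>

lemma polar_pair_exists:
  assumes "0 \<le> Y" "Y \<le> X" "0 < X"
  obtains r \<theta> s \<phi> q where "polar_pair r \<theta> X Y s \<phi> q" "s = X\<^sup>2 + Y\<^sup>2" "s * q = X\<^sup>2 - Y\<^sup>2" "s * sin \<phi> = 2 * (X * Y)"
proof -
  obtain r \<theta> where XY: "X = r * cos \<theta>" "Y = r * sin \<theta>" using polar_Ex[of X Y] by blast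
  have r: "r\<^sup>2 = X\<^sup>2 + Y\<^sup>2"
    unfolding XY by (simp add: power_mult_distrib flip: distrib_left)
  then have "r\<^sup>2 > 0" using assms by (simp add: add_pos_nonneg)
  have q: "r\<^sup>2 * cos (2 * \<theta>) = X\<^sup>2 - Y\<^sup>2"
    unfolding XY cos_double by (simp add: power_mult_distrib algebra_simps)
  have "Y\<^sup>2 \<le> X\<^sup>2" using assms by (intro power_mono) auto
  then have "0 \<le> cos (2 * \<theta>)" using q \<open>r\<^sup>2 > 0\<close> by (metis diff_ge_0_iff_ge zero_le_mult_iff not_less)
  moreover have "r\<^sup>2 * sin (2 * \<theta>) = 2 * (X * Y)"
    unfolding XY sin_double by (simp add: power2_eq_square)
  ultimately show ?thesis using that[of r \<theta> "r\<^sup>2" "2 * \<theta>" "cos (2 * \<theta>)"] XY r q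
    by (auto simp: polar_pair_def)
qed

text \<open>
  With \<open>X - \<i> Y = 2 L \<lambda>\<close> and \<open>P = 2 L p\<close>, the quotient \<open>robin_num / robin_den\<close> below is \<open>2 L\<close> times
  the real part of the Dirichlet-to-Neumann symbol of a subdomain of length \<open>L\<close> with Robin
  parameter \<open>p\<close> at the far end. The curves \<open>X Y = const\<close> correspond to varying the frequency, and
  \<open>robin_dnum\<close>, \<open>robin_dden\<close> are the derivatives along \<open>X \<partial>\<^sub>X - Y \<partial>\<^sub>Y\<close>.
\<close>

definition robin_num :: "real \<Rightarrow> real \<Rightarrow> real \<Rightarrow> real" where
  "robin_num P X Y = (X\<^sup>2 + Y\<^sup>2) * (X * sinh X - Y * sin Y) + 2 * P * (X\<^sup>2 * cosh X + Y\<^sup>2 * cos Y)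
     + P\<^sup>2 * (X * sinh X + Y * sin Y)"

definition robin_den :: "real \<Rightarrow> real \<Rightarrow> real \<Rightarrow> real" where
  "robin_den P X Y = (X\<^sup>2 + Y\<^sup>2) * (cosh X + cos Y) + 2 * P * (X * sinh X + Y * sin Y)
     + P\<^sup>2 * (cosh X - cos Y)"

definition robin_dnum :: "real \<Rightarrow> real \<Rightarrow> real \<Rightarrow> real" where
  "robin_dnum P X Y =
     (2 * (X\<^sup>2 - Y\<^sup>2) * (X * sinh X - Y * sin Y) + (X\<^sup>2 + Y\<^sup>2) * (X * sinh X + Y * sin Y + X\<^sup>2 * cosh X + Y\<^sup>2 * cos Y))
     + P * (2 * (2 * X\<^sup>2 * cosh X + X ^ 3 * sinh X - 2 * Y\<^sup>2 * cos Y + Y ^ 3 * sin Y))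
     + P\<^sup>2 * (X * sinh X - Y * sin Y + X\<^sup>2 * cosh X - Y\<^sup>2 * cos Y)"

definition robin_dden :: "real \<Rightarrow> real \<Rightarrow> real \<Rightarrow> real" where
  "robin_dden P X Y =
     (2 * (X\<^sup>2 - Y\<^sup>2) * (cosh X + cos Y) + (X\<^sup>2 + Y\<^sup>2) * (X * sinh X + Y * sin Y))
     + P * (2 * (X * sinh X - Y * sin Y + X\<^sup>2 * cosh X - Y\<^sup>2 * cos Y))
     + P\<^sup>2 * (X * sinh X - Y * sin Y)"

text \<open>As a polynomial in P the Wronskian has degree 4, and each of its five coefficients is a
  nonnegative multiple of one of the expressions treated above.\<close>

lemma robin_wronskian_nonneg:
  assumes "0 \<le> Y" "Y \<le> X" "0 < X" "0 \<le> P"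
  shows "0 \<le> robin_dnum P X Y * robin_den P X Y - robin_num P X Y * robin_dden P X Y"
proof -
  obtain r \<theta> s \<phi> q where pp: "polar_pair r \<theta> X Y s \<phi> q" and sXY: "s = X\<^sup>2 + Y\<^sup>2"
    and sq: "s * q = X\<^sup>2 - Y\<^sup>2" and sp: "s * sin \<phi> = 2 * (X * Y)"
    using polar_pair_exists[OF assms(1-3)] by metis
  interpret polar_pair r \<theta> X Y s \<phi> q by (fact pp)
  define sh ch si co where d: "sh = sinh X" "ch = cosh X" "si = sin Y" "co = cos Y"
  \<comment> \<open>With these two relations and the double-angle formulas \<open>dbl\<close>, the
    coefficient identities below become polynomial identities.\<close>
  have h: "ch * ch = sh * sh + 1" "co * co = 1 - si * si"
    using cosh_square_eq[of X] sin_cos_squared_add[of Y] by (auto simp: d power2_eq_square algebra_simps)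
  have dbl: "sinh (2 * X) = 2 * sh * ch" "cosh (2 * X) = 2 * (sh * sh) + 1" "sin (2 * Y) = 2 * si * co" "cos (2 * Y) = 1 - 2 * (si * si)"
    using h by (simp_all add: d sinh_double cosh_double sin_double cos_double_sin power2_eq_square)
  define N0 N1 N2 D0 D1 D2 A0 A1 A2 B0 B1 B2 where defs:
    "N0 = (X\<^sup>2 + Y\<^sup>2) * (X * sh - Y * si)" "N1 = 2 * (X\<^sup>2 * ch + Y\<^sup>2 * co)" "N2 = X * sh + Y * si"
    "D0 = (X\<^sup>2 + Y\<^sup>2) * (ch + co)" "D1 = 2 * (X * sh + Y * si)" "D2 = ch - co"
    "A0 = 2 * (X\<^sup>2 - Y\<^sup>2) * (X * sh - Y * si) + (X\<^sup>2 + Y\<^sup>2) * (X * sh + Y * si + X\<^sup>2 * ch + Y\<^sup>2 * co)"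
    "A1 = 2 * (2 * X\<^sup>2 * ch + X ^ 3 * sh - 2 * Y\<^sup>2 * co + Y ^ 3 * si)"
    "A2 = X * sh - Y * si + X\<^sup>2 * ch - Y\<^sup>2 * co"
    "B0 = 2 * (X\<^sup>2 - Y\<^sup>2) * (ch + co) + (X\<^sup>2 + Y\<^sup>2) * (X * sh + Y * si)"
    "B1 = 2 * (X * sh - Y * si + X\<^sup>2 * ch - Y\<^sup>2 * co)" "B2 = X * sh - Y * si"
  have eq: "robin_dnum P X Y * robin_den P X Y - robin_num P X Y * robin_dden P X Y
    = (A0 * D0 - N0 * B0) + P * (A0 * D1 + A1 * D0 - N0 * B1 - N1 * B0)
      + P\<^sup>2 * (A0 * D2 + A1 * D1 + A2 * D0 - N0 * B2 - N1 * B1 - N2 * B0)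
      + P ^ 3 * (A1 * D2 + A2 * D1 - N1 * B2 - N2 * B1) + P ^ 4 * (A2 * D2 - N2 * B2)"
  proof -
    have "robin_dnum P X Y = A0 + P * A1 + P\<^sup>2 * A2" "robin_den P X Y = D0 + P * D1 + P\<^sup>2 * D2"
      "robin_num P X Y = N0 + P * N1 + P\<^sup>2 * N2" "robin_dden P X Y = B0 + P * B1 + P\<^sup>2 * B2"
      by (simp_all add: robin_dnum_def robin_den_def robin_num_def robin_dden_def defs d)
    then show ?thesis
      by (simp only:) (simp add: algebra_simps power2_eq_square power3_eq_cube power4_eq_xxxx)
  qed
  have "A0 * D0 - N0 * B0 = (X\<^sup>2 + Y\<^sup>2)\<^sup>2 * (s + (X * sinh (2*X) + Y * sin (2*Y)) / 2 + s * (cosh X * cos Y)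
      + (X * (sinh X * cos Y) + Y * (cosh X * sin Y)))"
    unfolding sXY dbl d[symmetric] defs using h by Groebner_Basis.algebra
  then have "0 \<le> A0 * D0 - N0 * B0" using neumann_neumann_nonneg by simp
  moreover have "0 \<le> A0 * D1 + A1 * D0 - N0 * B1 - N1 * B0"
  proof -
    have "A0 * D1 + A1 * D0 - N0 * B1 - N1 * B0 = 2 * (X\<^sup>2 + Y\<^sup>2) *
      ((X\<^sup>2 * cosh (2*X) - Y\<^sup>2 * cos (2*Y)) - s * q + 2 * sin \<phi> * (s * (sinh X * sin Y))
      + s * (X * (sinh X * cos Y) + Y * (cosh X * sin Y)))"
      using sq[unfolded sXY] sp[unfolded sXY] h unfolding sXY dbl d[symmetric] defs by Groebner_Basis.algebra
    then show ?thesis using neumann_cubic_nonneg by simp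
  qed
  moreover have "0 \<le> A0 * D2 + A1 * D1 + A2 * D0 - N0 * B2 - N1 * B1 - N2 * B0"
  proof -
    have "A0 * D2 + A1 * D1 + A2 * D0 - N0 * B2 - N1 * B1 - N2 * B0 =
      s * (X * sinh (2*X) - Y * sin (2*Y)) - 2 * q * s\<^sup>2 + 2 * (X\<^sup>2 * (X * sinh (2*X)) - Y\<^sup>2 * (Y * sin (2*Y)))
      + 2 * sin \<phi> * s * (s * (sinh X * sin Y))
      - 4 * s * (X * (sinh X * cos Y) - Y * (cosh X * sin Y))
      + 2 * sin \<phi> * s * (X * (cosh X * sin Y) - Y * (sinh X * cos Y))"
      using sq[unfolded sXY] sp[unfolded sXY] h unfolding sXY dbl d[symmetric] defs by Groebner_Basis.algebra
    then show ?thesis using mixed_nonneg by simp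
  qed
  moreover have "0 \<le> A1 * D2 + A2 * D1 - N1 * B2 - N2 * B1"
  proof -
    have "A1 * D2 + A2 * D1 - N1 * B2 - N2 * B1 = 2 * (s + (X\<^sup>2 * cosh (2*X) + Y\<^sup>2 * cos (2*Y)) - 2 * (s * (cosh X * cos Y))
      - s * (X * (sinh X * cos Y) - Y * (cosh X * sin Y)))"
      unfolding sXY dbl d[symmetric] defs using h by Groebner_Basis.algebra
    then show ?thesis using dirichlet_cubic_nonneg by simp
  qed
  moreover have "0 \<le> A2 * D2 - N2 * B2"
  proof -
    have "A2 * D2 - N2 * B2 = s + (X * sinh (2*X) + Y * sin (2*Y)) / 2 - s * (cosh X * cos Y)
      - (X * (sinh X * cos Y) + Y * (cosh X * sin Y))"
      unfolding sXY dbl d[symmetric] defs using h by Groebner_Basis.algebra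
    then show ?thesis using dirichlet_dirichlet_nonneg by simp
  qed
  ultimately show ?thesis unfolding eq using assms(4)
    by (intro add_nonneg_nonneg mult_nonneg_nonneg zero_le_power) auto
qed

lemma cosh_real_gt_1:
  assumes "0 < (x::real)" shows "1 < cosh x"
proof -
  have "0 < sinh x" using assms by simp
  then have "1\<^sup>2 < (cosh x)\<^sup>2" by (simp add: cosh_square_eq)
  then show ?thesis by (rule power2_less_imp_less) simp
qed

text \<open>The terms of unknown sign are controlled by Y |sin Y| \<le> Y^2 \<le> X^2 \<le> X sinh
  X.\<close>

lemma robin_den_pos:
  assumes "0 < X" "0 \<le> Y" "Y \<le> X" "0 \<le> P"
  shows "0 < robin_den P X Y"
proof -
  have c: "cosh X > 1" using assms by (simp add: cosh_real_gt_1)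
  have "Y * - sin Y \<le> Y * Y" 
    using assms abs_sin_x_le_abs_x[of Y] by (intro mult_left_mono) auto
  moreover have "Y * Y \<le> X * X" using assms by (intro mult_mono) auto
  moreover have "X * X \<le> X * sinh X" using assms real_le_x_sinh[of X] by (intro mult_left_mono) (auto simp: sinh_def exp_minus)
  ultimately have "0 \<le> X * sinh X + Y * sin Y" by linarith
  moreover have "0 < cosh X + cos Y" using c cos_ge_minus_one[of Y] by linarith
  then have "0 < (X\<^sup>2 + Y\<^sup>2) * (cosh X + cos Y)"
    using assms by (intro mult_pos_pos) (auto intro: add_pos_nonneg)
  moreover have "0 \<le> cosh X - cos Y" using c cos_le_one[of Y] by linarith
  ultimately show ?thesis unfolding robin_den_def using assms(4)
    by (intro add_pos_nonneg mult_nonneg_nonneg) auto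
qed

lemma robin_num_pos:
  assumes "0 < X" "0 \<le> Y" "Y < X" "0 < P"
  shows "0 < robin_num P X Y"
proof -
  have c: "cosh X > 1" using assms by (simp add: cosh_real_gt_1)
  have Y: "Y * \<bar>sin Y\<bar> \<le> Y * Y"
    using assms abs_sin_x_le_abs_x[of Y] by (intro mult_left_mono) auto
  moreover have YX: "Y * Y < X * X" using assms by (intro mult_strict_mono) auto
  moreover have "X * X \<le> X * sinh X" using assms real_le_x_sinh[of X] by (intro mult_left_mono) (auto simp: sinh_def exp_minus)
  moreover have "\<bar>Y * sin Y\<bar> = Y * \<bar>sin Y\<bar>" using assms by (simp add: abs_mult)
  ultimately have s: "0 < X * sinh X - Y * sin Y" "0 < X * sinh X + Y * sin Y" by linarith+
  have "X\<^sup>2 * 1 \<le> X\<^sup>2 * cosh X" using c by (intro mult_left_mono) auto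
  moreover have "Y\<^sup>2 * -1 \<le> Y\<^sup>2 * cos Y" by (intro mult_left_mono) auto
  ultimately have "0 \<le> X\<^sup>2 * cosh X + Y\<^sup>2 * cos Y" using YX by (simp add: power2_eq_square)
  then have "0 \<le> 2 * P * (X\<^sup>2 * cosh X + Y\<^sup>2 * cos Y)" using assms by simp
  moreover have "0 < P\<^sup>2 * (X * sinh X + Y * sin Y)" using s assms by simp
  moreover have "0 \<le> (X\<^sup>2 + Y\<^sup>2) * (X * sinh X - Y * sin Y)"
    using s by (intro mult_nonneg_nonneg) auto
  ultimately show ?thesis unfolding robin_num_def by linarith
qed

lemma DERIV_robin:
  assumes f: "(f has_real_derivative f t / t) (at t)" and h: "(h has_real_derivative - h t / t) (at t)"
    and t: "t > 0"
  shows "((\<lambda>t. robin_num P (f t) (h t)) has_real_derivative robin_dnum P (f t) (h t) / t) (at t)"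
    and "((\<lambda>t. robin_den P (f t) (h t)) has_real_derivative robin_dden P (f t) (h t) / t) (at t)"
  unfolding robin_num_def robin_dnum_def robin_den_def robin_dden_def
  using t by (auto intro!: derivative_eq_intros f h simp: field_simps power2_eq_square power3_eq_cube)

text \<open>The derivative is the Wronskian divided by t and by the square of the denominator. The
  hypothesis \<open>g \<le> c * t1\<^sup>2\<close> is Y \<le> X at the start of the curve, and it
  persists because X grows and Y decreases.\<close>

lemma robin_quotient_mono:
  fixes c g P t1 t2 :: real
  assumes "0 < c" "0 \<le> g" "0 \<le> P" "0 < t1" "t1 \<le> t2" "g \<le> c * t1\<^sup>2"
  shows "robin_num P (c * t1) (g / t1) / robin_den P (c * t1) (g / t1)
       \<le> robin_num P (c * t2) (g / t2) / robin_den P (c * t2) (g / t2)"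
proof (rule DERIV_nonneg_imp_nondecreasing[OF assms(5)])
  fix t assume t: "t1 \<le> t" "t \<le> t2"
  let ?X = "c * t" and ?Y = "g / t"
  have t0: "t > 0" using t assms by simp
  have "g \<le> c * t\<^sup>2" using assms t by (meson mult_left_mono order_trans power_mono less_imp_le)
  then have XY: "0 \<le> ?Y" "?Y \<le> ?X" "0 < ?X" using t0 assms by (auto simp: field_simps power2_eq_square)
  have "((\<lambda>t. c * t) has_real_derivative c * t / t) (at t)"
    and "((\<lambda>t. g / t) has_real_derivative - (g / t) / t) (at t)"
    using t0 by (auto intro!: derivative_eq_intros simp: power2_eq_square)
  note n = DERIV_robin(1)[OF this t0, of P] and dn = DERIV_robin(2)[OF this t0, of P]
  have pos: "0 < robin_den P ?X ?Y" using robin_den_pos XY assms by auto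
  have "((\<lambda>t. robin_num P (c * t) (g / t) / robin_den P (c * t) (g / t)) has_real_derivative
      (robin_dnum P ?X ?Y / t * robin_den P ?X ?Y - robin_num P ?X ?Y * (robin_dden P ?X ?Y / t)) / (robin_den P ?X ?Y * robin_den P ?X ?Y)) (at t)"
    using pos by (intro DERIV_divide n dn) auto
  moreover have "0 \<le> (robin_dnum P ?X ?Y / t * robin_den P ?X ?Y - robin_num P ?X ?Y * (robin_dden P ?X ?Y / t)) / (robin_den P ?X ?Y * robin_den P ?X ?Y)"
  proof -
    have "robin_dnum P ?X ?Y / t * robin_den P ?X ?Y - robin_num P ?X ?Y * (robin_dden P ?X ?Y / t)
      = (robin_dnum P ?X ?Y * robin_den P ?X ?Y - robin_num P ?X ?Y * robin_dden P ?X ?Y) / t"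
      by (simp add: diff_divide_distrib)
    moreover have "0 \<le> robin_dnum P ?X ?Y * robin_den P ?X ?Y - robin_num P ?X ?Y * robin_dden P ?X ?Y"
      using robin_wronskian_nonneg XY assms by blast
    ultimately show ?thesis using t0 pos by simp
  qed
  ultimately show "\<exists>y. ((\<lambda>t. robin_num P (c * t) (g / t) / robin_den P (c * t) (g / t)) has_real_derivative y) (at t) \<and> 0 \<le> y"
    by blast
qed

lemma Re_div_eq: "Re (z / w) = Re (z * cnj w) / (cmod w)\<^sup>2"
  by (simp add: complex_div_cnj[of z w])

text \<open>After multiplication by the conjugate denominator, the products of functions of x L and
  y L recombine into functions of the doubled arguments; hence the variables 2 L x and 2 L
  y.\<close>

lemma robin_symbol_eq:
  fixes x y p L :: real and l :: complex
  defines "l \<equiv> Complex x (- y)"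
  shows "2 * L * Re (l * (l * sinh (l * L) + p * cosh (l * L)) / (l * cosh (l * L) + p * sinh (l * L)))
    = robin_num (2 * L * p) (2 * L * x) (2 * L * y) / robin_den (2 * L * p) (2 * L * x) (2 * L * y)"
proof (cases "L = 0")
  case False
  define ca sa cb sb where d: "ca = cosh (x * L)" "sa = sinh (x * L)" "cb = cos (y * L)" "sb = sin (y * L)"
  have lL: "l * L = Complex (x * L) (- (y * L))" by (simp add: l_def complex_eq_iff)
  have C: "cosh (l * L) = Complex (ca * cb) (- (sa * sb))" and S: "sinh (l * L) = Complex (sa * cb) (- (ca * sb))"
    unfolding lL cosh_Complex sinh_Complex by (simp_all add: d)
  define N where "N = l * (l * sinh (l * L) + p * cosh (l * L))"
  define D where "D = l * cosh (l * L) + p * sinh (l * L)"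
  have h: "ca * ca = sa * sa + 1" "cb * cb = 1 - sb * sb"
    using cosh_square_eq[of "x * L"] sin_cos_squared_add[of "y * L"] by (auto simp: d power2_eq_square algebra_simps)
  have dbl: "sinh (2 * L * x) = 2 * sa * ca" "cosh (2 * L * x) = 2 * (sa * sa) + 1"
      "sin (2 * L * y) = 2 * sb * cb" "cos (2 * L * y) = 1 - 2 * (sb * sb)"
    using h sinh_double[of "x * L"] cosh_double[of "x * L"] sin_double[of "y * L"] cos_double_sin[of "y * L"]
    by (simp_all add: d power2_eq_square mult_ac)
  have ReD: "Re D = x * (ca * cb) - y * (sa * sb) + p * (sa * cb)" and ImD: "Im D = - (x * (sa * sb)) - y * (ca * cb) - p * (ca * sb)"
    unfolding D_def C S by (simp_all add: l_def algebra_simps)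
  have c: "ca * cb * (sa * cb) + sa * sb * (ca * sb) = sa * ca" "ca * cb * (ca * sb) - sa * sb * (sa * cb) = sb * cb"
      "(ca * cb)\<^sup>2 + (sa * sb)\<^sup>2 = 1 + sa * sa - sb * sb" "(sa * cb)\<^sup>2 + (ca * sb)\<^sup>2 = sa * sa + sb * sb"
  proof -
    have "ca * cb * (sa * cb) + sa * sb * (ca * sb) = sa * ca * (cb * cb + sb * sb)"
      "ca * cb * (ca * sb) - sa * sb * (sa * cb) = sb * cb * (ca * ca - sa * sa)"
      "(ca * cb)\<^sup>2 + (sa * sb)\<^sup>2 = (ca * ca) * (cb * cb) + (sa * sa) * (sb * sb)"
      "(sa * cb)\<^sup>2 + (ca * sb)\<^sup>2 = (sa * sa) * (cb * cb) + (ca * ca) * (sb * sb)"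
      by (simp_all add: power2_eq_square algebra_simps)
    then show "ca * cb * (sa * cb) + sa * sb * (ca * sb) = sa * ca" "ca * cb * (ca * sb) - sa * sb * (sa * cb) = sb * cb"
      "(ca * cb)\<^sup>2 + (sa * sb)\<^sup>2 = 1 + sa * sa - sb * sb" "(sa * cb)\<^sup>2 + (ca * sb)\<^sup>2 = sa * sa + sb * sb"
      unfolding h by (simp_all add: algebra_simps)
  qed
  define u v where uv: "u = x * (sa * cb) - y * (ca * sb) + p * (ca * cb)" "v = - (x * (ca * sb)) - y * (sa * cb) - p * (sa * sb)"
  have ReN: "Re N = x * u + y * v" and ImN: "Im N = x * v - y * u"
    unfolding N_def C S by (simp_all add: l_def uv algebra_simps)
  have den: "robin_den (2 * L * p) (2 * L * x) (2 * L * y) = 8 * L\<^sup>2 * (cmod D)\<^sup>2"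
  proof - have "(cmod D)\<^sup>2 = (x\<^sup>2 + y\<^sup>2) * ((ca * cb)\<^sup>2 + (sa * sb)\<^sup>2) + p\<^sup>2 * ((sa * cb)\<^sup>2 + (ca * sb)\<^sup>2)
      + 2 * p * (x * (ca * cb * (sa * cb) + sa * sb * (ca * sb)) + y * (ca * cb * (ca * sb) - sa * sb * (sa * cb)))"
      unfolding cmod_power2 ReD ImD by (simp add: power2_eq_square algebra_simps)
    note D2 = this[unfolded c]
    show ?thesis unfolding robin_den_def dbl D2 by (simp add: power2_eq_square algebra_simps)
  qed
  have num: "robin_num (2 * L * p) (2 * L * x) (2 * L * y) = 16 * L ^ 3 * Re (N * cnj D)"
  proof -
    have "Re (N * cnj D) = (x * u + y * v) * Re D + (x * v - y * u) * Im D" by (simp add: ReN ImN)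
    also have "\<dots> = (x\<^sup>2 + y\<^sup>2) * (x * (sa * ca) - y * (sb * cb))
       + p * ((x\<^sup>2 - y\<^sup>2) * (sa * sa + sb * sb) + (x\<^sup>2 + y\<^sup>2) * (1 + sa * sa - sb * sb)) + p\<^sup>2 * (x * (sa * ca) + y * (sb * cb))"
      unfolding uv ReD ImD c[symmetric] by (simp add: power2_eq_square algebra_simps)
    finally have RN: "Re (N * cnj D) = \<dots>" .
    show ?thesis unfolding robin_num_def dbl RN by (simp add: power2_eq_square power3_eq_cube algebra_simps)
  qed
  have "2 * L * Re (N / D) = (8 * L\<^sup>2 * (2 * L * Re (N * cnj D))) / (8 * L\<^sup>2 * (cmod D)\<^sup>2)"
    unfolding Re_div_eq using False by simp
  also have "8 * L\<^sup>2 * (2 * L * Re (N * cnj D)) = 16 * L ^ 3 * Re (N * cnj D)"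
    by (simp add: power2_eq_square power3_eq_cube)
  finally show ?thesis unfolding den num N_def D_def .
qed (simp add: robin_num_def)

section \<open>Symbols of the Schwarz iteration\<close>

text \<open>Mean value inequality on the left half plane, which is convex and on which the
  derivative of \<open>exp\<close> has norm at most 1.\<close>

lemma norm_exp_minus_one_le:
  fixes z :: complex assumes "Re z \<le> 0" shows "cmod (exp z - 1) \<le> cmod z"
proof -
  have "convex {z. Re z \<le> 0}" using convex_halfspace_Re_le[of 0] by simp
  then have "cmod (exp z - exp 0) \<le> 1 * cmod (z - 0)"
  proof (rule field_differentiable_bound)
    show "(exp has_field_derivative exp w) (at w within {z. Re z \<le> 0})" for w :: complex
      by (rule DERIV_subset[OF DERIV_exp]) simp
  qed (use assms in auto)
  then show ?thesis by simp
qed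

text \<open>The factors may exceed 1 and so may a and b; if one of the latter does, the left side is
  negative.\<close>

lemma mult_ge_one_minus:
  fixes x y a b :: real
  assumes "0 \<le> x" "0 \<le> y" "1 - a \<le> x" "1 - b \<le> y" "0 \<le> a" "0 \<le> b"
  shows "1 - (a + b) \<le> x * y"
proof (cases "a \<le> 1 \<and> b \<le> 1")
  case True
  then have "(1 - a) * (1 - b) \<le> x * y" using assms by (intro mult_mono) auto
  moreover have "0 \<le> a * b" using assms by simp
  ultimately show ?thesis by (simp add: algebra_simps)
next
  case False
  then have "1 - (a + b) \<le> 0" using assms by linarith
  also have "0 \<le> x * y" using assms by simp
  finally show ?thesis .
qed

locale schwarz =
  fixes L Lhat \<eta> \<epsilon> pa pb :: real
  assumes L: "L > 0" and Lhat: "Lhat > 0" and eta: "\<eta> > 0" and eps: "\<epsilon> > 0" and pa: "pa > 0" and pb: "pb > 0"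
begin

definition kmin :: real where "kmin = pi / Lhat"
definition lam :: "real \<Rightarrow> complex" where "lam k = freq_root \<eta> \<epsilon> k"
definition re :: "real \<Rightarrow> real" where "re k = Re (lam k)"
text \<open>\<open>refl\<close> is the reflection coefficient of the outer Robin boundary seen from the interface, and
  \<open>dtn\<close> the resulting Dirichlet-to-Neumann symbol.\<close>

definition refl :: "real \<Rightarrow> real \<Rightarrow> complex" where
  "refl p k = (lam k - p) / (lam k + p) * exp (- 2 * lam k * L)"
definition refl' :: "real \<Rightarrow> real \<Rightarrow> real \<Rightarrow> complex" where
  "refl' \<delta> p k = refl p k * exp (- 2 * lam k * \<delta>)"
definition dtn :: "real \<Rightarrow> real \<Rightarrow> complex" where
  "dtn p k = lam k * (1 - refl p k) / (1 + refl p k)"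
definition decay :: "real \<Rightarrow> real" where "decay k = exp (- 2 * re k * L)"

lemma kmin: "kmin > 0" using Lhat by (simp add: kmin_def)

lemma lam_square: "(lam k)\<^sup>2 = of_real (k\<^sup>2 + \<eta>) - \<i> * of_real \<epsilon>"
  by (simp add: lam_def freq_root_def)

lemma lam_parts: "(re k)\<^sup>2 - (Im (lam k))\<^sup>2 = k\<^sup>2 + \<eta>" "2 * re k * Im (lam k) = - \<epsilon>"
  using arg_cong[OF lam_square[of k], of Re] arg_cong[OF lam_square[of k], of Im]
  by (simp_all add: re_def power2_eq_square mult_ac)

lemma re_pos: "re k > 0"
proof -
  have "re k \<ge> 0" unfolding re_def lam_def freq_root_def by (rule Re_csqrt)
  moreover have "re k \<noteq> 0" using lam_parts(2)[of k] eps by auto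
  ultimately show ?thesis by simp
qed

lemma Im_lam: "Im (lam k) = - (\<epsilon> / (2 * re k))"
  using lam_parts(2)[of k] re_pos[of k] by (simp add: field_simps)

text \<open>Because \<eta> > 0, \<open>lam k\<close> lies strictly within 45 degrees of the positive
  axis. This provides the condition Y < X of the monotonicity argument.\<close>

lemma Im_less_re: "\<bar>Im (lam k)\<bar> < re k"
proof -
  have "(Im (lam k))\<^sup>2 < (re k)\<^sup>2" using lam_parts(1)[of k] eta zero_le_power2[of k] by linarith
  then show ?thesis using re_pos[of k] by (metis abs_of_pos abs_square_less_1 power2_less_imp_less power2_abs less_imp_le)
qed

lemma Im_lam_square_le: "(Im (lam k))\<^sup>2 \<le> \<epsilon> / 2"
proof -
  have "\<bar>Im (lam k)\<bar> * \<bar>Im (lam k)\<bar> \<le> re k * \<bar>Im (lam k)\<bar>"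
    using Im_less_re[of k] by (intro mult_right_mono) auto
  also have "\<dots> = \<epsilon> / 2" using re_pos[of k] eps by (simp add: Im_lam)
  finally show ?thesis by (simp add: power2_eq_square)
qed

lemma re_square_bounds: "k\<^sup>2 \<le> (re k)\<^sup>2" "(re k)\<^sup>2 \<le> k\<^sup>2 + (\<eta> + \<epsilon> / 2)"
  using lam_parts(1)[of k] Im_lam_square_le[of k] eta zero_le_power2[of "Im (lam k)"] by linarith+

lemma re_ge: "k \<le> re k"
  using re_square_bounds(1)[of k] re_pos[of k] by (metis abs_le_square_iff abs_of_pos abs_ge_self order_trans)

lemma re_le: assumes "k > 0" shows "re k \<le> k * (1 + (\<eta> + \<epsilon> / 2) / k\<^sup>2)"
proof -
  have "(re k)\<^sup>2 \<le> (k * (1 + (\<eta> + \<epsilon> / 2) / k\<^sup>2))\<^sup>2"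
  proof -
    have "k\<^sup>2 + (\<eta> + \<epsilon> / 2) \<le> k\<^sup>2 + 2 * (\<eta> + \<epsilon> / 2) + ((\<eta> + \<epsilon> / 2) / k)\<^sup>2" using eta eps by simp
    also have "\<dots> = (k * (1 + (\<eta> + \<epsilon> / 2) / k\<^sup>2))\<^sup>2"
    proof -
      have "k * (1 + w / k\<^sup>2) = k + w / k" for w using assms by (simp add: field_simps power2_eq_square)
      then show ?thesis using assms by (simp add: power2_sum)
    qed
    finally show ?thesis using re_square_bounds(2)[of k] by linarith
  qed
  then show ?thesis by (rule power2_le_imp_le) (use assms eta eps in simp)
qed

text \<open>x = \<open>re k\<close> solves x^2 - (\<epsilon> / (2 x))^2 = k^2 + \<eta>, and the left
  side increases with x > 0.\<close>

lemma re_mono: assumes "0 \<le> k1" "k1 \<le> k2" shows "re k1 \<le> re k2"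
proof (rule ccontr)
  assume "\<not> re k1 \<le> re k2"
  then have lt: "re k2 < re k1" by simp
  then have "(re k2)\<^sup>2 < (re k1)\<^sup>2" using re_pos[of k2] by (intro power_strict_mono) auto
  moreover have "\<epsilon> / (2 * re k1) \<le> \<epsilon> / (2 * re k2)" using lt re_pos eps by (intro divide_left_mono) auto
  then have "(\<epsilon> / (2 * re k1))\<^sup>2 \<le> (\<epsilon> / (2 * re k2))\<^sup>2" using eps re_pos[of k1] by (intro power_mono) auto
  moreover have "k1\<^sup>2 \<le> k2\<^sup>2" using assms by (intro power_mono) auto
  ultimately show False using lam_parts(1)[of k1] lam_parts(1)[of k2] by (simp add: Im_lam)
qed

lemma norm_lam_le: "cmod (lam k) \<le> 2 * re k"
  using cmod_le[of "lam k"] Im_less_re[of k] re_pos[of k] by (simp add: re_def)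

lemma norm_lam_ge: "re k \<le> cmod (lam k)"
  unfolding re_def by (rule complex_Re_le_cmod)

lemma lam_add_nonzero: "p \<ge> 0 \<Longrightarrow> lam k + of_real p \<noteq> 0"
proof
  assume "p \<ge> 0" "lam k + of_real p = 0"
  then have "re k + p = 0" by (metis Re_complex_of_real plus_complex.sel(1) re_def zero_complex.sel(1))
  then show False using re_pos[of k] \<open>p \<ge> 0\<close> by linarith
qed

lemma norm_diff_less: "p > 0 \<Longrightarrow> cmod (of_real p - lam k) < cmod (of_real p + lam k)"
proof -
  assume "p > 0"
  then have "(p - re k)\<^sup>2 + (Im (lam k))\<^sup>2 < (p + re k)\<^sup>2 + (Im (lam k))\<^sup>2"
    using re_pos[of k] by (simp add: power2_eq_square algebra_simps)
  then show ?thesis by (simp add: cmod_def re_def)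
qed

lemma decay_bounds: "0 < decay k" "decay k < 1"
  using re_pos[of k] L by (simp_all add: decay_def)

lemma decay_antimono: "0 \<le> k1 \<Longrightarrow> k1 \<le> k2 \<Longrightarrow> decay k2 \<le> decay k1"
  using re_mono[of k1 k2] L by (simp add: decay_def)

lemma norm_refl_le: assumes "p > 0" shows "cmod (refl p k) \<le> decay k"
proof -
  have "cmod (lam k - p) \<le> cmod (lam k + p)"
    using norm_diff_less[OF assms, of k] by (simp add: norm_minus_commute add.commute)
  then have "cmod ((lam k - p) / (lam k + p)) \<le> 1"
    using lam_add_nonzero[of p k] assms by (simp add: norm_divide divide_le_eq_1)
  moreover have "cmod (exp (- 2 * lam k * L)) = decay k"
    by (simp add: decay_def re_def)
  ultimately show ?thesis unfolding refl_def norm_mult using decay_bounds(1)[of k]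
    by (simp add: mult_left_le_one_le)
qed

lemma norm_exp_overlap: "(\<delta>::real) \<ge> 0 \<Longrightarrow> cmod (exp (- 2 * lam k * of_real \<delta>)) \<le> 1"
  using re_pos[of k] by (simp add: re_def)

lemma norm_refl'_le: assumes "p > 0" "\<delta> \<ge> 0" shows "cmod (refl' \<delta> p k) \<le> decay k"
proof -
  have "cmod (refl' \<delta> p k) \<le> decay k * 1" unfolding refl'_def norm_mult
    by (intro mult_mono norm_refl_le norm_exp_overlap) (use assms decay_bounds(1)[of k] in auto)
  then show ?thesis by simp
qed

text \<open>Numerator and denominator are expanded by a growing exponential, which turns the
  reflection form into the hyperbolic form of \<open>robin_symbol_eq\<close>.\<close>

lemma dtn_eq:
  assumes "p > 0"
  shows "dtn p k = lam k * (lam k * sinh (lam k * L) + p * cosh (lam k * L)) / (lam k * cosh (lam k * L) + p * sinh (lam k * L))"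
proof -
  define E where "E = exp (lam k * L)"
  have "- 2 * lam k * L = - (lam k * L + lam k * L)" by (simp add: algebra_simps)
  then have E: "E \<noteq> 0" "exp (- (lam k * L)) = 1 / E" "exp (- 2 * lam k * L) = 1 / (E * E)"
    by (simp_all only: E_def exp_minus exp_add divide_inverse mult_1_left exp_not_eq_zero not_False_eq_True)
  have nz: "lam k + p \<noteq> 0" using lam_add_nonzero assms by simp
  define Q where "Q = lam k + p"
  have l: "lam k = Q - p" and Q: "Q \<noteq> 0" using nz by (simp_all add: Q_def)
  have S: "lam k * sinh (lam k * L) + p * cosh (lam k * L) = (lam k + p) * E / 2 * (1 - refl p k)"
    unfolding refl_def sinh_def cosh_def E_def[symmetric] E(2,3) scaleR_conv_of_real unfolding l
    using E(1) Q by (simp add: field_simps)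
  have C: "lam k * cosh (lam k * L) + p * sinh (lam k * L) = (lam k + p) * E / 2 * (1 + refl p k)"
    unfolding refl_def sinh_def cosh_def E_def[symmetric] E(2,3) scaleR_conv_of_real unfolding l
    using E(1) Q by (simp add: field_simps)
  show ?thesis unfolding S C dtn_def using E(1) nz by simp
qed

lemma Re_dtn_eq:
  assumes "p > 0"
  shows "2 * L * Re (dtn p k) = robin_num (2 * L * p) (2 * L * re k) (L * \<epsilon> / re k) /
    robin_den (2 * L * p) (2 * L * re k) (L * \<epsilon> / re k)"
proof -
  have "lam k = Complex (re k) (- (\<epsilon> / (2 * re k)))" by (simp add: complex_eq_iff re_def[symmetric] Im_lam)
  moreover have "2 * L * (\<epsilon> / (2 * re k)) = L * \<epsilon> / re k" by simp
  ultimately show ?thesis unfolding dtn_eq[OF assms] using robin_symbol_eq[of L "re k" "\<epsilon> / (2 * re k)" p] by simp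
qed

lemma eps_le: "\<epsilon> < 2 * (re k)\<^sup>2"
proof -
  have "\<epsilon> / (2 * re k) < re k" using Im_less_re[of k] eps re_pos[of k] by (simp add: Im_lam)
  then show ?thesis using re_pos[of k] by (simp add: field_simps power2_eq_square)
qed

text \<open>The product of real and imaginary part of \<open>lam k\<close> does not depend on k, so
  the points move along one of the curves of \<open>robin_quotient_mono\<close>, parametrized by t =
  \<open>re k\<close>.\<close>

lemma Re_dtn_mono:
  assumes "p > 0" "0 \<le> k1" "k1 \<le> k2" shows "Re (dtn p k1) \<le> Re (dtn p k2)"
proof -
  have "2 * L * Re (dtn p k1) \<le> 2 * L * Re (dtn p k2)"
    unfolding Re_dtn_eq[OF assms(1)]
    using L assms re_pos[of k1] re_mono eps eps_le[of k1] by (intro robin_quotient_mono) auto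
  then show ?thesis using L by simp
qed

lemma Re_dtn_pos: assumes "p > 0" shows "Re (dtn p k) > 0"
proof -
  have Y: "L * \<epsilon> / re k < 2 * L * re k"
  proof -
    have "L * \<epsilon> < L * (2 * (re k)\<^sup>2)" using L eps_le[of k] by (intro mult_strict_left_mono) auto
    then show ?thesis using re_pos[of k] by (simp add: field_simps power2_eq_square)
  qed
  have "0 < robin_num (2 * L * p) (2 * L * re k) (L * \<epsilon> / re k) / robin_den (2 * L * p) (2 * L * re k) (L * \<epsilon> / re k)"
    using L assms re_pos[of k] eps Y by (intro divide_pos_pos robin_num_pos robin_den_pos) auto
  then show ?thesis unfolding Re_dtn_eq[OF assms, symmetric] using L by (simp add: zero_less_mult_iff)
qed

section \<open>The constant K and the size of the Dirichlet-to-Neumann symbols\<close>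

definition S :: "real \<Rightarrow> real" where "S k = Re (dtn pa k) + Re (dtn pb k)"
definition K :: real where "K = K_const L Lhat \<eta> \<epsilon> pa pb"

lemma one_plus_refl_nonzero: assumes "p > 0" shows "1 + refl p k \<noteq> 0"
proof
  assume "1 + refl p k = 0"
  then have "refl p k = -1" by (simp add: add_eq_0_iff)
  then show False using norm_refl_le[OF assms, of k] decay_bounds(2)[of k] by simp
qed

text \<open>With the reflection coefficients u and v of the two outer boundaries, the quotient in
  \<open>K_const\<close> becomes s (1 - u v) / ((1 + u) (1 + v)). This is half of the sum of s (1 -
  u) / (1 + u) and s (1 - v) / (1 + v), the two symbols.\<close>

lemma K_eq: "2 * K = S kmin"
proof -
  define s where "s = lam kmin"
  define u where "u = refl pa kmin" define v where "v = refl pb kmin"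
  define E where "E = exp (- 2 * s * L)"
  have nz: "s + pa \<noteq> 0" "s + pb \<noteq> 0" using lam_add_nonzero pa pb by (simp_all add: s_def)
  have uv: "u = (s - pa) / (s + pa) * E" "v = (s - pb) / (s + pb) * E"
    by (simp_all add: u_def v_def s_def refl_def E_def)
  have nz': "1 + u \<noteq> 0" "1 + v \<noteq> 0" using one_plus_refl_nonzero pa pb by (simp_all add: u_def v_def)
  have E2: "exp (- 4 * s * L) = E * E" unfolding E_def by (simp add: mult.assoc flip: exp_add)
  have a: "(s - pa) * E + s + pa = (s + pa) * (1 + u)" "(s - pb) * E + s + pb = (s + pb) * (1 + v)"
    unfolding uv using nz by (simp_all add: field_simps)
  have b: "(pb + s) * (pa + s) - (s - pb) * (s - pa) * (E * E) = (s + pa) * (s + pb) * (1 - u * v)"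
  proof -
    define \<alpha> \<beta> where ab: "\<alpha> = (s - pa) / (s + pa)" "\<beta> = (s - pb) / (s + pb)"
    have "s - pa = \<alpha> * (s + pa)" "s - pb = \<beta> * (s + pb)" using nz by (simp_all add: ab)
    then show ?thesis unfolding uv ab[symmetric] by (simp only:) (simp add: algebra_simps)
  qed
  have "s * ((pb + s) * (pa + s) - (s - pb) * (s - pa) * exp (- 4 * s * L)) /
          (((s - pa) * exp (- 2 * s * L) + s + pa) * ((s - pb) * exp (- 2 * s * L) + s + pb))
     = s * (1 - u * v) / ((1 + u) * (1 + v))"
  proof -
    have "s * ((s + pa) * (s + pb) * (1 - u * v)) = ((s + pa) * (s + pb)) * (s * (1 - u * v))"
      "(s + pa) * (1 + u) * ((s + pb) * (1 + v)) = ((s + pa) * (s + pb)) * ((1 + u) * (1 + v))"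
      by (simp_all only: mult_ac)
    moreover have "(s + pa) * (s + pb) \<noteq> 0" using nz by simp
    ultimately show ?thesis
      unfolding E2 E_def[symmetric] a b by (simp only:) (rule mult_divide_mult_cancel_left)
  qed
  also have "2 * \<dots> = dtn pa kmin + dtn pb kmin"
    unfolding dtn_def s_def[symmetric] u_def[symmetric] v_def[symmetric] using nz' by (simp add: field_simps)
  finally have T: "2 * (s * ((pb + s) * (pa + s) - (s - pb) * (s - pa) * exp (- 4 * s * L)) /
          (((s - pa) * exp (- 2 * s * L) + s + pa) * ((s - pb) * exp (- 2 * s * L) + s + pb)))
      = dtn pa kmin + dtn pb kmin" .
  have R: "Re (2 * z) = 2 * Re z" for z by simp
  have "2 * K = Re (dtn pa kmin + dtn pb kmin)"
    unfolding K_def K_const_def Let_def kmin_def[symmetric] lam_def[symmetric] s_def[symmetric] R[symmetric] T ..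
  then show ?thesis by (simp add: S_def)
qed

lemma K_pos: "K > 0"
  using K_eq Re_dtn_pos[OF pa, of kmin] Re_dtn_pos[OF pb, of kmin] by (simp add: S_def)

lemma S_ge_K: "kmin \<le> k \<Longrightarrow> 2 * K \<le> S k"
  unfolding K_eq S_def using kmin by (intro add_mono Re_dtn_mono pa pb) auto

lemma norm_one_plus_refl: assumes "p > 0" "kmin \<le> k" shows "1 - decay kmin \<le> cmod (1 + refl p k)"
proof -
  have "1 - cmod (refl p k) \<le> cmod (1 + refl p k)" using norm_diff_ineq[of 1 "refl p k"] by simp
  moreover have "cmod (refl p k) \<le> decay kmin"
    using norm_refl_le[OF assms(1), of k] decay_antimono[of kmin k] assms kmin by simp
  ultimately show ?thesis by linarith
qed

lemma norm_dtn_le: assumes "p > 0" "kmin \<le> k" shows "cmod (dtn p k) \<le> 2 / (1 - decay kmin) * cmod (lam k)"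
proof -
  have c: "0 < 1 - decay kmin" using decay_bounds by simp
  have "cmod (1 - refl p k) \<le> 2"
    using norm_triangle_ineq4[of 1 "refl p k"] norm_refl_le[OF assms(1), of k] decay_bounds(2)[of k] by simp
  then have "cmod (lam k) * cmod (1 - refl p k) / cmod (1 + refl p k) \<le> cmod (lam k) * 2 / (1 - decay kmin)"
    using norm_one_plus_refl[OF assms] c by (intro frac_le mult_left_mono) auto
  then show ?thesis by (simp add: dtn_def norm_divide norm_mult mult_ac)
qed

text \<open>Since x exp (- x) is bounded, reflections stay harmless even after multiplication by
  \<lambda>.\<close>

lemma lam_decay_le: "cmod (lam k) * decay k \<le> 1 / L"
proof -
  have "2 * re k * L \<le> exp (2 * re k * L)" using exp_ge_add_one_self[of "2 * re k * L"] by linarith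
  then have "2 * re k * decay k \<le> 1 / L"
    using L by (simp add: decay_def exp_minus field_simps)
  moreover have "cmod (lam k) * decay k \<le> 2 * re k * decay k"
    using norm_lam_le[of k] decay_bounds(1)[of k] by (intro mult_right_mono) auto
  ultimately show ?thesis by linarith
qed

text \<open>The symbol differs from \<lambda> by 2 \<lambda> refl / (1 + refl), which is bounded
  uniformly for k \<ge> kmin by \<open>lam_decay_le\<close>.\<close>

lemma Re_dtn_growth:
  assumes "p > 0" "kmin \<le> k"
  shows "Re (dtn p k) \<ge> k - 2 / (L * (1 - decay kmin))"
proof -
  have c: "0 < 1 - decay kmin" using decay_bounds by simp
  have "lam k - dtn p k = 2 * lam k * refl p k / (1 + refl p k)"
    unfolding dtn_def using one_plus_refl_nonzero[OF assms(1), of k] by (simp add: field_simps)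
  then have "cmod (lam k - dtn p k) = 2 * (cmod (lam k) * cmod (refl p k)) / cmod (1 + refl p k)"
    by (simp add: norm_mult norm_divide)
  also have "\<dots> \<le> 2 * (1 / L) / (1 - decay kmin)"
  proof (intro frac_le mult_left_mono)
    have "cmod (lam k) * cmod (refl p k) \<le> cmod (lam k) * decay k"
      using norm_refl_le[OF assms(1), of k] by (intro mult_left_mono) auto
    then show "cmod (lam k) * cmod (refl p k) \<le> 1 / L" using lam_decay_le[of k] by linarith
  qed (use c norm_one_plus_refl[OF assms] L in auto)
  finally have "\<bar>Re (lam k - dtn p k)\<bar> \<le> 2 / (L * (1 - decay kmin))"
    using abs_Re_le_cmod[of "lam k - dtn p k"] by simp
  then show ?thesis using re_ge[of k] by (simp add: re_def)
qed

section \<open>The convergence factor as a product of two quotients\<close>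

definition rho :: "real \<Rightarrow> params \<Rightarrow> real \<Rightarrow> real" where
  "rho \<delta> x k = spectral_radius (iteration_matrix L \<eta> \<epsilon> pa pb \<delta> x k)"

text \<open>A subdomain is traversed over the length L up to the receiving interface and over L +
  \<delta> up to the emitting one. Hence \<open>num\<close> carries \<open>refl\<close>, while
  \<open>den\<close> carries the further damped \<open>refl'\<close>.\<close>

definition num :: "real \<Rightarrow> real \<Rightarrow> real \<Rightarrow> complex" where
  "num p P k = P * (1 + refl p k) - lam k * (1 - refl p k)"

definition den :: "real \<Rightarrow> real \<Rightarrow> real \<Rightarrow> real \<Rightarrow> complex" where
  "den \<delta> p P k = P * (1 + refl' \<delta> p k) + lam k * (1 - refl' \<delta> p k)"

lemma beta_2_minus_eq:
  assumes "p > 0"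
  shows "beta_2_minus L \<delta> p P1 P2 (lam k) = num p P2 k / (exp (lam k * \<delta>) * den \<delta> p P1 k)"
proof -
  define l where "l = lam k"
  define E D where "E = exp (l * L)" and "D = exp (l * \<delta>)"
  define \<alpha> where "\<alpha> = (l - p) / (l + p)"
  have nz: "l + p \<noteq> 0" using lam_add_nonzero assms by (simp add: l_def)
  have E: "E \<noteq> 0" and D: "D \<noteq> 0" by (simp_all add: E_def D_def)
  have "- 2 * l * L = - (l * L + l * L)" "- 2 * l * \<delta> = - (l * \<delta> + l * \<delta>)" by (simp_all add: algebra_simps)
  then have e: "exp (- 2 * l * L) = inverse E * inverse E" "exp (- 2 * l * \<delta>) = inverse D * inverse D"
    by (simp_all only: E_def D_def exp_minus exp_add inverse_mult_distrib)
  have lp: "l - p = \<alpha> * (l + p)" using nz by (simp add: \<alpha>_def)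
  have r: "refl p k = \<alpha> * (inverse E * inverse E)" "refl' \<delta> p k = \<alpha> * (inverse E * inverse E) * (inverse D * inverse D)"
    unfolding refl'_def refl_def l_def[symmetric] \<alpha>_def[symmetric] e by simp_all
  have "l * (L + \<delta>) = l * L + l * \<delta>" "- l * (L + \<delta>) = - (l * L + l * \<delta>)" "- l * L = - (l * L)"
    by (simp_all add: algebra_simps)
  then have ed: "exp (- l * L) = inverse E" "exp (l * (L + \<delta>)) = E * D" "exp (- l * (L + \<delta>)) = inverse E * inverse D"
    by (simp_all only: E_def D_def exp_minus exp_add inverse_mult_distrib)
  have "(l + P2) * (l - p) * exp (- l * L) - (l - P2) * (l + p) * exp (l * L) = ((l + p) * E) * num p P2 k"
    unfolding ed lp num_def l_def[symmetric] r E_def[symmetric] using E by (simp add: field_simps)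
  moreover have "(l + P1) * (l + p) * exp (l * (L + \<delta>)) - (l - P1) * (l - p) * exp (- l * (L + \<delta>)) = ((l + p) * E) * (D * den \<delta> p P1 k)"
    unfolding ed lp den_def l_def[symmetric] r using E D by (simp add: field_simps)
  ultimately show ?thesis unfolding beta_2_minus_def l_def[symmetric] D_def[symmetric] using nz E by simp
qed

lemma rho_square:
  fixes p1 q1 p2 q2 k :: real
  defines "P1 \<equiv> ventcell_symbol p1 q1 k" and "P2 \<equiv> ventcell_symbol p2 q2 k"
  shows "(rho \<delta> (p1, q1, p2, q2) k)\<^sup>2 = exp (- 2 * re k * \<delta>) *
    ((cmod (num pa P2 k) / cmod (den \<delta> pb P2 k)) * (cmod (num pb P1 k) / cmod (den \<delta> pa P1 k)))"
proof -
  have e: "cmod (exp (lam k * \<delta>)) = exp (re k * \<delta>)" by (simp add: re_def)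
  have "exp (- 2 * re k * \<delta>) = 1 / (exp (re k * \<delta>) * exp (re k * \<delta>))"
    by (simp add: exp_minus inverse_eq_divide mult.assoc flip: exp_add)
  moreover have "(rho \<delta> (p1, q1, p2, q2) k)\<^sup>2 = cmod (beta_2_minus L \<delta> pb P2 P1 (lam k) * beta_2_minus L \<delta> pa P1 P2 (lam k))"
    unfolding rho_def spectral_radius_iteration_matrix P1_def[symmetric] P2_def[symmetric] lam_def[symmetric]
      beta_1_plus_mirror by simp
  ultimately show ?thesis
    unfolding beta_2_minus_eq[OF pa] beta_2_minus_eq[OF pb] norm_mult norm_divide e by (simp add: mult_ac)
qed

lemma rho_nonneg: "0 \<le> rho \<delta> x k"
  by (cases x) (simp add: rho_def spectral_radius_iteration_matrix)

lemma num_eq: "num p P k = (of_real P - lam k) + refl p k * (of_real P + lam k)"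
  by (simp add: num_def algebra_simps)

lemma den_eq: "den \<delta> p P k = (of_real P + lam k) + refl' \<delta> p k * (of_real P - lam k)"
  by (simp add: den_def algebra_simps)

lemma norm_add_pos: "P > 0 \<Longrightarrow> 0 < cmod (of_real P + lam k)"
  using norm_diff_less[of P k] norm_ge_zero[of "of_real P - lam k"] by linarith

lemma den_nonzero:
  assumes "p > 0" "\<delta> \<ge> 0" "P > 0" shows "den \<delta> p P k \<noteq> 0"
proof
  assume "den \<delta> p P k = 0"
  then have "of_real P + lam k = - (refl' \<delta> p k * (of_real P - lam k))" by (simp add: den_eq add_eq_0_iff)
  then have "cmod (of_real P + lam k) = cmod (refl' \<delta> p k) * cmod (of_real P - lam k)"
    by (simp add: norm_mult)
  also have "\<dots> \<le> 1 * cmod (of_real P - lam k)"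
    using norm_refl'_le[OF assms(1,2), of k] decay_bounds(2)[of k] by (intro mult_right_mono) auto
  finally show False using norm_diff_less[OF assms(3), of k] by simp
qed

text \<open>The deficit 1 - |P - \<lambda>|^2 / |P + \<lambda>|^2. It is largest when P matches
  |\<lambda>| and small when the two differ by orders of magnitude.\<close>

definition contrast :: "real \<Rightarrow> real \<Rightarrow> real" where
  "contrast P k = 4 * P * re k / ((P + re k)\<^sup>2 + (Im (lam k))\<^sup>2)"

text \<open>The factor of a subdomain extending to infinity, where the reflection coefficient vanishes.\<close>

definition halfline :: "real \<Rightarrow> real \<Rightarrow> real" where
  "halfline P k = cmod (of_real P - lam k) / cmod (of_real P + lam k)"

lemma halfline_square: assumes "P > 0" shows "(halfline P k)\<^sup>2 = 1 - contrast P k"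
proof -
  have pos: "(P + re k)\<^sup>2 + (Im (lam k))\<^sup>2 > 0" using assms re_pos[of k] by (simp add: add_pos_nonneg)
  have "(halfline P k)\<^sup>2 = ((P - re k)\<^sup>2 + (Im (lam k))\<^sup>2) / ((P + re k)\<^sup>2 + (Im (lam k))\<^sup>2)"
    by (simp add: halfline_def power_divide cmod_power2 re_def)
  also have "(P - re k)\<^sup>2 + (Im (lam k))\<^sup>2 = ((P + re k)\<^sup>2 + (Im (lam k))\<^sup>2) - 4 * P * re k"
    by (simp add: power2_eq_square algebra_simps)
  also have "(m - c) / m = 1 - c / m" if "m > 0" for m c :: real
    using that by (simp add: diff_divide_distrib)
  note this[OF pos]
  finally show ?thesis unfolding contrast_def .
qed

lemma halfline_bounds: assumes "P > 0" shows "0 \<le> halfline P k" "halfline P k \<le> 1"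
  using norm_diff_less[OF assms, of k] norm_add_pos[OF assms, of k] by (auto simp: halfline_def divide_le_eq_1)

lemma contrast_nonneg: "P > 0 \<Longrightarrow> 0 \<le> contrast P k"
  using re_pos[of k] by (simp add: contrast_def)

text \<open>Both reflection coefficients are at most \<open>decay k\<close>, so a subdomain acts
  like a half line up to that error. The case split makes the lower bound of the numerator
  nonnegative before dividing.\<close>

lemma ratio_lower:
  assumes "p > 0" "p' > 0" "P > 0" "\<delta> \<ge> 0"
  shows "halfline P k - 2 * decay k \<le> cmod (num p P k) / cmod (den \<delta> p' P k)"
proof (cases "halfline P k \<le> decay k")
  case True
  then have "halfline P k - 2 * decay k \<le> 0" using decay_bounds(1)[of k] by linarith
  then show ?thesis by (rule order_trans) simp
next
  case False
  define a b where "a = cmod (of_real P - lam k)" and "b = cmod (of_real P + lam k)"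
  have ab: "0 \<le> a" "a \<le> b" "0 < b" using norm_diff_less[OF assms(3), of k] norm_add_pos[OF assms(3), of k] by (auto simp: a_def b_def)
  have v: "halfline P k = a / b" by (simp add: halfline_def a_def b_def)
  have "cmod (refl p k * (of_real P + lam k)) \<le> decay k * b"
    unfolding norm_mult b_def using norm_refl_le[OF assms(1)] by (intro mult_right_mono) auto
  then have n: "a - decay k * b \<le> cmod (num p P k)"
    unfolding num_eq a_def using norm_diff_ineq[of "of_real P - lam k" "refl p k * (of_real P + lam k)"] by linarith
  have "cmod (refl' \<delta> p' k * (of_real P - lam k)) \<le> decay k * b"
    unfolding norm_mult a_def[symmetric] using norm_refl'_le[OF assms(2,4), of k] ab decay_bounds(1)[of k] by (intro mult_mono) auto
  then have d: "cmod (den \<delta> p' P k) \<le> b + decay k * b"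
    unfolding den_eq b_def using norm_triangle_ineq[of "of_real P + lam k" "refl' \<delta> p' k * (of_real P - lam k)"] by linarith
  have pos: "0 < cmod (den \<delta> p' P k)" using den_nonzero[OF assms(2,4,3)] by simp
  have "(halfline P k - decay k) * (1 - decay k) \<le> (halfline P k - decay k) / (1 + decay k)"
  proof -
    have "(1 - decay k) * (1 + decay k) \<le> 1" by (simp add: algebra_simps)
    then have "1 - decay k \<le> 1 / (1 + decay k)" using decay_bounds(1)[of k] by (simp add: field_simps)
    then have "(halfline P k - decay k) * (1 - decay k) \<le> (halfline P k - decay k) * (1 / (1 + decay k))"
      using False by (intro mult_left_mono) auto
    then show ?thesis by simp
  qed
  also have "\<dots> = (a - decay k * b) / (b + decay k * b)"
    unfolding v using ab decay_bounds(1)[of k] by (simp add: field_simps)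
  also have "\<dots> \<le> cmod (num p P k) / cmod (den \<delta> p' P k)"
    using n d pos False ab by (intro frac_le) (auto simp: v field_simps)
  finally have "(halfline P k - decay k) * (1 - decay k) \<le> cmod (num p P k) / cmod (den \<delta> p' P k)" .
  moreover have "(halfline P k - decay k) * (1 - decay k) = halfline P k - decay k - decay k * halfline P k + (decay k)\<^sup>2"
    by (simp add: algebra_simps power2_eq_square)
  moreover have "decay k * halfline P k \<le> decay k" 
    using halfline_bounds[OF assms(3), of k] decay_bounds(1)[of k] by simp
  ultimately show ?thesis using zero_le_power2[of "decay k"] by linarith
qed

text \<open>The fourth power contains the squares of the two half-line factors, which equal 1 -
  contrast without any square root; the resulting bound is linear in the contrasts and in
  \<delta>.\<close>

lemma rho_power4_lower:
  fixes p1 q1 p2 q2 k :: real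
  defines "P1 \<equiv> ventcell_symbol p1 q1 k" and "P2 \<equiv> ventcell_symbol p2 q2 k"
  assumes "P1 > 0" "P2 > 0" "\<delta> \<ge> 0"
  shows "1 - 4 * re k * \<delta> - contrast P1 k - contrast P2 k - 8 * decay k \<le> (rho \<delta> (p1, q1, p2, q2) k) ^ 4"
proof -
  define v1 v2 e x where d: "v1 = halfline P1 k" "v2 = halfline P2 k" "e = decay k" "x = exp (- 2 * re k * \<delta>)"
  define b where "b = x * (v2 * v1)"
  have v: "0 \<le> v1" "v1 \<le> 1" "0 \<le> v2" "v2 \<le> 1" using halfline_bounds assms(3,4) by (auto simp: d)
  have e: "0 < e" using decay_bounds(1)[of k] by (simp add: d)
  have x: "0 < x" "x \<le> 1" using re_pos[of k] assms(5) by (auto simp: d)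
  define r1 r2 where r: "r1 = cmod (num pb P1 k) / cmod (den \<delta> pa P1 k)" "r2 = cmod (num pa P2 k) / cmod (den \<delta> pb P2 k)"
  have r1: "v1 - 2 * e \<le> r1" "0 \<le> r1" and r2: "v2 - 2 * e \<le> r2" "0 \<le> r2"
    unfolding d r using ratio_lower pa pb assms(3-5) by auto
  have sq: "(rho \<delta> (p1, q1, p2, q2) k)\<^sup>2 = x * (r2 * r1)"
    unfolding rho_square P1_def[symmetric] P2_def[symmetric] d r by simp
  have "v2 * v1 - 4 * e \<le> r2 * r1"
  proof (cases "2 * e \<le> v1 \<and> 2 * e \<le> v2")
    case True
    then have "(v2 - 2 * e) * (v1 - 2 * e) \<le> r2 * r1" using r1 r2 by (intro mult_mono) auto
    moreover have "(v2 - 2 * e) * (v1 - 2 * e) = v2 * v1 - 2 * e * v1 - 2 * e * v2 + 4 * e * e" by (simp add: algebra_simps)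
    moreover have "2 * e * v1 \<le> 2 * e * 1" "2 * e * v2 \<le> 2 * e * 1" using v e by (intro mult_left_mono; simp)+
    ultimately show ?thesis using e mult_pos_pos[OF e e] by linarith
  next
    case False
    have "v2 * v1 \<le> v1" "v2 * v1 \<le> v2" using v by (simp_all add: mult_left_le mult_left_le_one_le)
    then have "v2 * v1 - 4 * e \<le> 0" using False e by linarith
    then show ?thesis using r1 r2 by (meson mult_nonneg_nonneg order_trans)
  qed
  then have "x * (v2 * v1 - 4 * e) \<le> x * (r2 * r1)" using x by (intro mult_left_mono) auto
  moreover have "x * e \<le> e" using x e by simp
  ultimately have a: "b - 4 * e \<le> x * (r2 * r1)" by (simp add: b_def algebra_simps)
  have "v2 * v1 \<le> 1 * 1" using v by (intro mult_mono) auto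
  then have "b \<le> 1 * 1" unfolding b_def using x v by (intro mult_mono) auto
  have b0: "0 \<le> b" using x v by (simp add: b_def)
  have a0: "0 \<le> x * (r2 * r1)" using x r1 r2 by simp
  have "b\<^sup>2 - 8 * e \<le> (x * (r2 * r1))\<^sup>2"
  proof (cases "4 * e \<le> b")
    case True
    then have "(b - 4 * e)\<^sup>2 \<le> (x * (r2 * r1))\<^sup>2" using a by (intro power_mono) auto
    moreover have "(b - 4 * e)\<^sup>2 = b\<^sup>2 - 8 * e * b + 16 * (e * e)" by (simp add: power2_eq_square algebra_simps)
    moreover have "8 * e * b \<le> 8 * e * 1" using e \<open>b \<le> 1 * 1\<close> by (intro mult_left_mono) auto
    ultimately show ?thesis using mult_pos_pos[OF e e] by linarith
  next
    case False
    have "b * b \<le> b * 1" using b0 \<open>b \<le> 1 * 1\<close> by (intro mult_left_mono) auto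
    then have "b\<^sup>2 - 8 * e \<le> 0" using False e by (simp add: power2_eq_square)
    then show ?thesis by (rule order_trans) simp
  qed
  moreover have "(rho \<delta> (p1, q1, p2, q2) k) ^ 4 = (x * (r2 * r1))\<^sup>2"
    unfolding sq[symmetric] by simp
  moreover have "1 - 4 * re k * \<delta> - contrast P1 k - contrast P2 k \<le> b\<^sup>2"
  proof -
    have "x\<^sup>2 = exp (- 4 * re k * \<delta>)" unfolding d power2_eq_square by (simp flip: exp_add)
    then have x2: "1 - 4 * re k * \<delta> \<le> x\<^sup>2" using exp_ge_add_one_self[of "- 4 * re k * \<delta>"] by simp
    have b2: "b\<^sup>2 = x\<^sup>2 * ((1 - contrast P2 k) * (1 - contrast P1 k))"
      using halfline_square assms(3,4) by (simp add: b_def d power_mult_distrib)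
    have c: "0 \<le> 1 - contrast P1 k" "0 \<le> 1 - contrast P2 k"
      using halfline_square[OF assms(3), of k] halfline_square[OF assms(4), of k] by (metis zero_le_power2)+
    have "1 - (contrast P2 k + contrast P1 k) \<le> (1 - contrast P2 k) * (1 - contrast P1 k)"
      using c contrast_nonneg assms(3,4) by (intro mult_ge_one_minus) auto
    then have "1 - (4 * re k * \<delta> + (contrast P2 k + contrast P1 k)) \<le> b\<^sup>2"
      unfolding b2 using c contrast_nonneg assms(3-5) x2 re_pos[of k]
      by (intro mult_ge_one_minus) (auto intro: mult_nonneg_nonneg add_nonneg_nonneg less_imp_le)
    then show ?thesis by linarith
  qed
  ultimately show ?thesis unfolding d(3) by linarith
qed

end

section \<open>Bounds for the convergence factor\<close>

text \<open>An expansion in 1/P whose first-order term involves only the sum of the real parts,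
  although A and B belong to different subdomains. In exponential form the bounds of the two
  quotients can simply be multiplied.\<close>

lemma quotient_upper:
  fixes A B :: complex and P :: real
  assumes P: "P > 0" and A: "cmod A \<le> N" and B: "cmod B \<le> N" "0 \<le> Re B"
  shows "cmod (of_real P - A) / cmod (of_real P + B) \<le> exp (- (Re A + Re B) / P + 2 * N\<^sup>2 / P\<^sup>2)"
proof -
  define a b n where d: "a = Re A / P" "b = Re B / P" "n = N\<^sup>2 / P\<^sup>2"
  have "(cmod (of_real P - A) / P)\<^sup>2 = 1 - 2 * a + (cmod A)\<^sup>2 / P\<^sup>2"
    unfolding power_divide cmod_power2 d using P by (simp add: field_simps power2_eq_square)
  also have "\<dots> \<le> 1 + (- 2 * a + n)"
    using A P by (simp add: d divide_right_mono power_mono)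
  also have "\<dots> \<le> exp (- 2 * a + n)" by (rule exp_ge_add_one_self)
  also have "\<dots> = (exp (- a + n / 2))\<^sup>2" by (simp add: power2_eq_square flip: exp_add)
  finally have num: "cmod (of_real P - A) / P \<le> exp (- a + n / 2)"
    by (rule power2_le_imp_le) simp
  have b: "0 \<le> b" using B P by (simp add: d)
  \<comment> \<open>This combines exp (b^2 - b) \<ge> 1 - b + b^2 with (1 + b) (1 - b + b^2) = 1 +
    b^3 \<ge> 1.\<close>
  have "exp (b - b\<^sup>2) \<le> 1 + b"
  proof -
    have "exp (b - b\<^sup>2) * (1 - (b - b\<^sup>2)) \<le> 1"
    proof -
      have "1 - (b - b\<^sup>2) \<le> exp (- (b - b\<^sup>2))" using exp_ge_add_one_self[of "- (b - b\<^sup>2)"] by (simp add: algebra_simps)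
      then have "exp (b - b\<^sup>2) * (1 - (b - b\<^sup>2)) \<le> exp (b - b\<^sup>2) * exp (- (b - b\<^sup>2))" by (intro mult_left_mono) auto
      then show ?thesis by (simp flip: exp_add)
    qed
    moreover have "1 \<le> (1 + b) * (1 - (b - b\<^sup>2))"
    proof -
      have "(1 + b) * (1 - (b - b\<^sup>2)) = 1 + b ^ 3" by (simp add: algebra_simps power2_eq_square power3_eq_cube)
      then show ?thesis using b by simp
    qed
    moreover have "0 < 1 - (b - b\<^sup>2)"
    proof -
      have "1 - (b - b\<^sup>2) = (b - 1/2)\<^sup>2 + 3/4" by (simp add: power2_eq_square algebra_simps)
      then show ?thesis by (simp add: add_nonneg_pos)
    qed
    ultimately show ?thesis by (meson dual_order.trans mult_right_le_imp_le)
  qed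
  also have "1 + b \<le> cmod (of_real P + B) / P"
    using complex_Re_le_cmod[of "of_real P + B"] P by (simp add: d pos_le_divide_eq distrib_right)
  finally have den: "exp (b - b\<^sup>2) \<le> cmod (of_real P + B) / P" .
  have "Re B \<le> N" using complex_Re_le_cmod[of B] B by linarith
  then have bn: "b\<^sup>2 \<le> n" unfolding d power_divide using B by (intro divide_right_mono power_mono) auto
  have "cmod (of_real P - A) / cmod (of_real P + B) = (cmod (of_real P - A) / P) / (cmod (of_real P + B) / P)"
    using P by simp
  also have "\<dots> \<le> exp (- a + n / 2) / exp (b - b\<^sup>2)"
    using num den P by (intro frac_le) auto
  also have "\<dots> = exp (- a - b + n / 2 + b\<^sup>2)" by (simp flip: exp_diff)
  also have "\<dots> \<le> exp (- (Re A + Re B) / P + 2 * N\<^sup>2 / P\<^sup>2)"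
  proof -
    have "- (Re A + Re B) / P = - a - b" unfolding d by (simp add: add_divide_distrib diff_divide_distrib)
    moreover have "2 * N\<^sup>2 / P\<^sup>2 = 2 * n" by (simp add: d(3))
    then have "n / 2 + b\<^sup>2 \<le> 2 * N\<^sup>2 / P\<^sup>2" using bn zero_le_power2[of b] by linarith
    ultimately show ?thesis by simp
  qed
  finally show ?thesis .
qed

text \<open>The imaginary part can only enlarge the numerator; in the denominator it costs the
  second-order term \<open>N\<^sup>2 / P\<^sup>2\<close>.\<close>

lemma quotient_lower:
  fixes A B :: complex and P :: real
  assumes P: "P > 0" and A: "0 \<le> Re A" and B: "cmod B \<le> N" "0 \<le> Re B"
  shows "1 - ((Re A + Re B) / P + N\<^sup>2 / P\<^sup>2) \<le> cmod (of_real P - A) / cmod (of_real P + B)"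
proof -
  define a b n where d: "a = Re A / P" "b = Re B / P" "n = (cmod B)\<^sup>2 / P\<^sup>2"
  have nn: "n \<le> N\<^sup>2 / P\<^sup>2" unfolding d using B by (intro divide_right_mono power_mono) auto
  have pos: "0 \<le> a" "0 \<le> b" "0 \<le> n" using A B P by (simp_all add: d)
  have num: "1 - a \<le> cmod (of_real P - A) / P"
    using complex_Re_le_cmod[of "of_real P - A"] P by (simp add: d pos_le_divide_eq left_diff_distrib)
  have "(cmod (of_real P + B) / P)\<^sup>2 = 1 + 2 * b + n"
    unfolding power_divide cmod_power2 d using P by (simp add: field_simps power2_eq_square)
  also have "\<dots> \<le> (1 + b + n)\<^sup>2"
  proof -
    have "(1 + b + n)\<^sup>2 = 1 + 2 * b + n + (n + b * b + n * n + 2 * (b * n))"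
      by (simp add: power2_eq_square algebra_simps)
    moreover have "0 \<le> b * b" "0 \<le> n * n" "0 \<le> b * n" using pos by simp_all
    then have "0 \<le> n + b * b + n * n + 2 * (b * n)" using pos by linarith
    ultimately show ?thesis by linarith
  qed
  finally have den: "cmod (of_real P + B) / P \<le> 1 + b + n"
    by (rule power2_le_imp_le) (use pos in simp)
  have dpos: "0 < cmod (of_real P + B)"
  proof -
    have "P + Re B \<le> cmod (of_real P + B)" using complex_Re_le_cmod[of "of_real P + B"] by simp
    then show ?thesis using P B(2) by linarith
  qed
  have "1 - (a + (b + n)) \<le> cmod (of_real P - A) / P * (1 / (cmod (of_real P + B) / P))"
  proof (rule mult_ge_one_minus)
    have "(1 - (b + n)) * (1 + b + n) = 1 - (b + n)\<^sup>2" by (simp add: algebra_simps power2_eq_square)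
    then have "(1 - (b + n)) * (1 + b + n) \<le> 1" by simp
    then have "1 - (b + n) \<le> 1 / (1 + b + n)" using pos by (simp add: field_simps)
    also have "\<dots> \<le> 1 / (cmod (of_real P + B) / P)" using den dpos P pos
      by (intro divide_left_mono mult_pos_pos divide_pos_pos) auto
    finally show "1 - (b + n) \<le> 1 / (cmod (of_real P + B) / P)" .
  qed (use pos num P in auto)
  also have "\<dots> = cmod (of_real P - A) / cmod (of_real P + B)" using P by simp
  finally show ?thesis using nn unfolding d(1,2) add_divide_distrib by linarith
qed

section \<open>Estimates at high and at low frequencies\<close>

context schwarz
begin

lemma ratio_upper:
  assumes "p > 0" "p' > 0" "P > 0" "\<delta> \<ge> 0" "decay k \<le> 1 / 2"
  shows "cmod (num p P k) / cmod (den \<delta> p' P k) \<le> halfline P k + 4 * decay k"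
proof -
  define a b e where d: "a = cmod (of_real P - lam k)" "b = cmod (of_real P + lam k)" "e = decay k"
  have ab: "0 \<le> a" "a \<le> b" "0 < b" using norm_diff_less[OF assms(3), of k] norm_add_pos[OF assms(3), of k] by (auto simp: d)
  have e: "0 < e" "e \<le> 1/2" using decay_bounds(1)[of k] assms(5) by (auto simp: d)
  have v: "halfline P k = a / b" by (simp add: halfline_def d)
  have "cmod (refl p k * (of_real P + lam k)) \<le> e * b"
    unfolding norm_mult d using norm_refl_le[OF assms(1)] by (intro mult_right_mono) auto
  then have n: "cmod (num p P k) \<le> a + e * b"
    unfolding num_eq d(1) using norm_triangle_ineq[of "of_real P - lam k" "refl p k * (of_real P + lam k)"] by linarith
  have "cmod (refl' \<delta> p' k * (of_real P - lam k)) \<le> e * b"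
    unfolding norm_mult d(1)[symmetric] using norm_refl'_le[OF assms(2,4), of k] ab e by (intro mult_mono) (auto simp: d(3))
  then have dn: "b - e * b \<le> cmod (den \<delta> p' P k)"
    unfolding den_eq d(2) using norm_diff_ineq[of "of_real P + lam k" "refl' \<delta> p' k * (of_real P - lam k)"] by linarith
  have "e * b \<le> 1/2 * b" using e ab by (intro mult_right_mono) auto
  then have pos: "0 < b - e * b" using ab by linarith
  have "cmod (num p P k) / cmod (den \<delta> p' P k) \<le> (a + e * b) / (b - e * b)"
    using n dn pos ab e by (intro frac_le) auto
  also have "\<dots> \<le> a / b + 4 * e"
  proof -
    define w where "w = a / b"
    have "w * e \<le> 1 * e" using ab e by (intro mult_right_mono) (auto simp: w_def)
    moreover have "e * e \<le> 1/2 * e" using e by (intro mult_right_mono) auto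
    ultimately have "w + e \<le> (w + 4 * e) * (1 - e)" by (simp add: algebra_simps)
    then have "a / b + e \<le> (a / b + 4 * e) * (1 - e)" by (simp only: w_def)
    then have "(a / b + e) * b \<le> (a / b + 4 * e) * (1 - e) * b" using ab by (intro mult_right_mono) auto
    moreover have "(a / b + e) * b = a + e * b" using ab by (simp add: distrib_right)
    moreover have "(a / b + 4 * e) * (1 - e) * b = (a / b + 4 * e) * (b - e * b)"
      by (simp only: mult.assoc left_diff_distrib mult_1_left)
    ultimately show ?thesis using pos by (simp add: pos_divide_le_eq)
  qed
  finally show ?thesis by (simp add: v d(3))
qed

lemma halfline_le_exp: assumes "P > 0" shows "halfline P k \<le> exp (- contrast P k / 2)"
proof (rule power2_le_imp_le)
  have "(halfline P k)\<^sup>2 \<le> exp (- contrast P k)"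
    unfolding halfline_square[OF assms] using exp_ge_add_one_self[of "- contrast P k"] by simp
  also have "\<dots> = (exp (- contrast P k / 2))\<^sup>2" by (simp add: power2_eq_square flip: exp_add)
  finally show "(halfline P k)\<^sup>2 \<le> (exp (- contrast P k / 2))\<^sup>2" .
qed simp

lemma rho_square_upper_high:
  fixes p1 q1 p2 q2 k \<delta> :: real
  defines "P1 \<equiv> ventcell_symbol p1 q1 k" and "P2 \<equiv> ventcell_symbol p2 q2 k"
  assumes "P1 > 0" "P2 > 0" "\<delta> \<ge> 0" "decay k \<le> 1 / 2"
  shows "(rho \<delta> (p1, q1, p2, q2) k)\<^sup>2 \<le> exp (- (2 * re k * \<delta> + (contrast P1 k + contrast P2 k) / 2)) + 16 * decay k"
proof -
  define v1 v2 e x where d: "v1 = halfline P1 k" "v2 = halfline P2 k" "e = decay k" "x = exp (- 2 * re k * \<delta>)"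
  have v: "0 \<le> v1" "v1 \<le> 1" "0 \<le> v2" "v2 \<le> 1" using halfline_bounds assms(3,4) by (auto simp: d)
  have e: "0 < e" "e \<le> 1/2" using decay_bounds(1)[of k] assms(6) by (auto simp: d)
  have x: "0 < x" "x \<le> 1" using re_pos[of k] assms(5) by (auto simp: d)
  have "(rho \<delta> (p1, q1, p2, q2) k)\<^sup>2 \<le> x * ((v2 + 4 * e) * (v1 + 4 * e))"
    unfolding rho_square P1_def[symmetric] P2_def[symmetric] d
    using ratio_upper assms(3-6) pa pb halfline_bounds decay_bounds(1)[of k]
    by (intro mult_left_mono mult_mono) auto
  also have "\<dots> = x * (v2 * v1) + x * (4 * e * v1 + 4 * e * v2 + 16 * (e * e))" by (simp add: algebra_simps)
  also have "\<dots> \<le> x * (v2 * v1) + 1 * (16 * e)"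
  proof -
    have "4 * e * v1 \<le> 4 * e * 1" "4 * e * v2 \<le> 4 * e * 1" using v e by (intro mult_left_mono; simp)+
    moreover have "e * e \<le> 1/2 * e" using e by (intro mult_right_mono) auto
    ultimately have "4 * e * v1 + 4 * e * v2 + 16 * (e * e) \<le> 16 * e" by linarith
    then show ?thesis using x e v by (intro add_left_mono mult_mono) (auto intro!: add_nonneg_nonneg)
  qed
  also have "x * (v2 * v1) \<le> x * (exp (- contrast P2 k / 2) * exp (- contrast P1 k / 2))"
    using halfline_le_exp assms(3,4) v x by (intro mult_left_mono mult_mono) (auto simp: d)
  also have "\<dots> = exp (- (2 * re k * \<delta> + (contrast P1 k + contrast P2 k) / 2))"
    unfolding d by (simp add: field_simps flip: exp_add)
  finally show ?thesis by (simp add: d(3))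
qed

definition gap :: real where "gap = 1 - decay kmin"

lemma gap: "0 < gap" using decay_bounds by (simp add: gap_def)

lemma num_eq_dtn: assumes "p > 0" shows "num p P k = (1 + refl p k) * (of_real P - dtn p k)"
  using one_plus_refl_nonzero[OF assms, of k] by (simp add: num_def dtn_def field_simps)

lemma norm_P_add_dtn_ge: assumes "p > 0" "P > 0" shows "P \<le> cmod (of_real P + dtn p k)"
  using complex_Re_le_cmod[of "of_real P + dtn p k"] Re_dtn_pos[OF assms(1), of k] by simp

text \<open>\<open>num\<close> is an exact multiple of P - dtn, but \<open>den\<close> contains the
  reflection from the distance L + \<delta>. The discrepancy refl (exp (- 2 \<lambda> \<delta>) - 1)
  (P - \<lambda>) has a factor of size |\<lambda>| \<delta>, which the decay of \<open>refl\<close>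
  tames; a relative error of order \<delta> remains, uniformly in k.\<close>

lemma den_perturb:
  assumes "p > 0" "P > 0" "\<delta> \<ge> 0" "kmin \<le> k" "cmod (lam k) \<le> P"
  shows "\<bar>cmod (den \<delta> p P k) - cmod (1 + refl p k) * cmod (of_real P + dtn p k)\<bar>
      \<le> 4 / (L * gap) * \<delta> * (cmod (1 + refl p k) * cmod (of_real P + dtn p k))"
proof -
  have d: "(1 + refl p k) * (of_real P + dtn p k) = P * (1 + refl p k) + lam k * (1 - refl p k)"
    using one_plus_refl_nonzero[OF assms(1), of k] by (simp add: dtn_def field_simps)
  have "den \<delta> p P k - (1 + refl p k) * (of_real P + dtn p k) = refl p k * (exp (- 2 * lam k * \<delta>) - 1) * (of_real P - lam k)"
    unfolding d den_def refl'_def by (simp add: algebra_simps)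
  then have "\<bar>cmod (den \<delta> p P k) - cmod ((1 + refl p k) * (of_real P + dtn p k))\<bar>
      \<le> cmod (refl p k) * cmod (exp (- 2 * lam k * \<delta>) - 1) * cmod (of_real P - lam k)"
    by (metis norm_mult norm_triangle_ineq3)
  also have "\<dots> \<le> decay k * (2 * cmod (lam k) * \<delta>) * (2 * P)"
  proof (intro mult_mono)
    have "cmod (exp (- 2 * lam k * \<delta>) - 1) \<le> cmod (- 2 * lam k * \<delta>)"
      using re_pos[of k] assms(3) by (intro norm_exp_minus_one_le) (simp add: re_def)
    then show "cmod (exp (- 2 * lam k * \<delta>) - 1) \<le> 2 * cmod (lam k) * \<delta>" using assms(3) by (simp add: norm_mult)
    show "cmod (of_real P - lam k) \<le> 2 * P"
      using norm_triangle_ineq4[of "of_real P" "lam k"] assms(2,5) by simp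
  qed (use norm_refl_le[OF assms(1), of k] decay_bounds(1)[of k] assms(2,3) in auto)
  also have "\<dots> = (cmod (lam k) * decay k) * (4 * \<delta> * P)" by simp
  also have "\<dots> \<le> (1 / L) * (4 * \<delta> * P)" using lam_decay_le[of k] assms(2,3) by (intro mult_right_mono) auto
  also have "\<dots> = 4 / (L * gap) * \<delta> * (gap * P)" using gap by simp
  also have "\<dots> \<le> 4 / (L * gap) * \<delta> * (cmod (1 + refl p k) * cmod (of_real P + dtn p k))"
    using gap L assms norm_one_plus_refl[OF assms(1,4)] norm_P_add_dtn_ge[OF assms(1,2), of k]
    by (intro mult_left_mono mult_mono) (auto simp: gap_def)
  finally show ?thesis by (simp add: norm_mult)
qed

lemma rho_square_low_factor:
  fixes p1 q1 p2 q2 k \<delta> :: real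
  defines "P1 \<equiv> ventcell_symbol p1 q1 k" and "P2 \<equiv> ventcell_symbol p2 q2 k"
  defines "Y \<equiv> (cmod (of_real P2 - dtn pa k) / cmod (of_real P2 + dtn pb k)) * (cmod (of_real P1 - dtn pb k) / cmod (of_real P1 + dtn pa k))"
    and "t \<equiv> 4 / (L * gap) * \<delta>"
  assumes "P1 > 0" "P2 > 0" "\<delta> \<ge> 0" "kmin \<le> k" "cmod (lam k) \<le> P1" "cmod (lam k) \<le> P2" "t \<le> 1 / 4"
  shows "(rho \<delta> (p1, q1, p2, q2) k)\<^sup>2 \<le> (1 + 4 * t) * Y"
    and "exp (- 2 * re k * \<delta>) * (1 - 2 * t) * Y \<le> (rho \<delta> (p1, q1, p2, q2) k)\<^sup>2"
proof -
  define ra rb where r: "ra = cmod (1 + refl pa k)" "rb = cmod (1 + refl pb k)"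
  define n1 n2 d1 d2 where d: "n1 = cmod (of_real P1 - dtn pb k)" "n2 = cmod (of_real P2 - dtn pa k)"
    "d1 = cmod (of_real P1 + dtn pa k)" "d2 = cmod (of_real P2 + dtn pb k)"
  define e1 e2 where e: "e1 = cmod (den \<delta> pa P1 k)" "e2 = cmod (den \<delta> pb P2 k)"
  define x where "x = exp (- 2 * re k * \<delta>)"
  have x: "0 < x" "x \<le> 1" using re_pos[of k] assms(7) by (auto simp: x_def)
  have t0: "0 \<le> t" using L gap assms(7) by (simp add: t_def)
  have rp: "0 < ra" "0 < rb" using one_plus_refl_nonzero pa pb by (auto simp: r)
  have dp: "0 < d1" "0 < d2" using norm_P_add_dtn_ge[OF pa assms(5), of k] norm_P_add_dtn_ge[OF pb assms(6), of k] assms(5,6)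
    by (auto simp: d simp del: zero_less_norm_iff)
  have np: "0 \<le> n1" "0 \<le> n2" by (simp_all add: d)
  have E: "\<bar>e1 - ra * d1\<bar> \<le> t * (ra * d1)" "\<bar>e2 - rb * d2\<bar> \<le> t * (rb * d2)"
    unfolding e r d t_def using den_perturb[OF pa assms(5,7,8,9)] den_perturb[OF pb assms(6,7,8,10)] .
  have El: "(1 - t) * (ra * d1) \<le> e1" "(1 - t) * (rb * d2) \<le> e2" and Eu: "e1 \<le> (1 + t) * (ra * d1)" "e2 \<le> (1 + t) * (rb * d2)"
    using E by (simp_all add: abs_le_iff algebra_simps)
  have rd: "0 < ra * d1" "0 < rb * d2" using rp dp by simp_all
  have ep: "0 < e1" "0 < e2" using den_nonzero[OF pa assms(7,5), of k] den_nonzero[OF pb assms(7,6), of k] by (simp_all add: e)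
  have sq: "(rho \<delta> (p1, q1, p2, q2) k)\<^sup>2 = x * ((ra * n2 / e2) * (rb * n1 / e1))"
    unfolding rho_square P1_def[symmetric] P2_def[symmetric] num_eq_dtn[OF pa] num_eq_dtn[OF pb] norm_mult x_def r d e by simp
  have Y: "Y = (n2 / d2) * (n1 / d1)" by (simp add: Y_def d)
  \<comment> \<open>The two quotients are crossed: each prefactor |1 + refl| occurs once above and
    once below in the product, and cancels.\<close>
  have Yr: "(ra * n2 / (rb * d2)) * (rb * n1 / (ra * d1)) = Y" unfolding Y using rp by simp
  have Y0: "0 \<le> Y" using np dp by (simp add: Y)
  have "(rho \<delta> (p1, q1, p2, q2) k)\<^sup>2 \<le> 1 * ((ra * n2 / ((1 - t) * (rb * d2))) * (rb * n1 / ((1 - t) * (ra * d1))))"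
    unfolding sq using El ep rd np rp x assms(11) by (intro mult_mono frac_le) auto
  also have "\<dots> = 1 / ((1 - t) * (1 - t)) * Y" unfolding Yr[symmetric] using assms(11) by simp
  also have "\<dots> \<le> (1 + 4 * t) * Y"
  proof (intro mult_right_mono Y0)
    have "1 \<le> (1 + 4 * t) * ((1 - t) * (1 - t))"
    proof -
      have "(1 + 4 * t) * ((1 - t) * (1 - t)) = 1 + t * ((1/4 - t) * (6 - 4 * t) + 1/2)" by (simp add: algebra_simps)
      moreover have "0 \<le> t * ((1/4 - t) * (6 - 4 * t) + 1/2)"
        using t0 assms(11) by (intro mult_nonneg_nonneg add_nonneg_nonneg) auto
      ultimately show ?thesis by linarith
    qed
    then show "1 / ((1 - t) * (1 - t)) \<le> 1 + 4 * t" using assms(11) by (simp add: divide_le_eq)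
  qed
  finally show "(rho \<delta> (p1, q1, p2, q2) k)\<^sup>2 \<le> (1 + 4 * t) * Y" .
  have "x * (1 - 2 * t) * Y \<le> x * (1 / ((1 + t) * (1 + t))) * Y"
  proof (intro mult_right_mono mult_left_mono Y0)
    have "(1 - 2 * t) * ((1 + t) * (1 + t)) = 1 - t * t * (3 + 2 * t)" by (simp add: algebra_simps)
    also have "\<dots> \<le> 1" using t0 by simp
    finally show "1 - 2 * t \<le> 1 / ((1 + t) * (1 + t))" using t0 by (simp add: le_divide_eq)
  qed (use x in auto)
  also have "\<dots> = x * ((ra * n2 / ((1 + t) * (rb * d2))) * (rb * n1 / ((1 + t) * (ra * d1))))"
    unfolding Yr[symmetric] by simp
  also have "\<dots> \<le> (rho \<delta> (p1, q1, p2, q2) k)\<^sup>2"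
    unfolding sq using Eu ep rd np rp x t0 by (intro mult_left_mono mult_mono frac_le) auto
  finally show "exp (- 2 * re k * \<delta>) * (1 - 2 * t) * Y \<le> (rho \<delta> (p1, q1, p2, q2) k)\<^sup>2" by (simp add: x_def)
qed

lemma rho_square_upper_low:
  fixes p1 q1 p2 q2 k \<delta> :: real
  defines "P1 \<equiv> ventcell_symbol p1 q1 k" and "P2 \<equiv> ventcell_symbol p2 q2 k"
  defines "N \<equiv> 2 / gap * cmod (lam k)"
  assumes "P1 > 0" "P2 > 0" "\<delta> \<ge> 0" "kmin \<le> k" "cmod (lam k) \<le> P1" "cmod (lam k) \<le> P2" "4 / (L * gap) * \<delta> \<le> 1 / 4"
  shows "(rho \<delta> (p1, q1, p2, q2) k)\<^sup>2 \<le> (1 + 16 / (L * gap) * \<delta>) *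
    exp ((- S k / P1 + 2 * N\<^sup>2 / P1\<^sup>2) + (- S k / P2 + 2 * N\<^sup>2 / P2\<^sup>2))"
proof -
  have N: "cmod (dtn pa k) \<le> N" "cmod (dtn pb k) \<le> N"
    using norm_dtn_le pa pb assms(7) by (auto simp: N_def gap_def)
  have R: "0 \<le> Re (dtn pa k)" "0 \<le> Re (dtn pb k)" using Re_dtn_pos pa pb by (simp_all add: less_imp_le)
  have t0: "0 \<le> 16 / (L * gap) * \<delta>" using L gap assms by simp
  have "(rho \<delta> (p1, q1, p2, q2) k)\<^sup>2 \<le> (1 + 4 * (4 / (L * gap) * \<delta>)) *
      ((cmod (of_real P2 - dtn pa k) / cmod (of_real P2 + dtn pb k)) * (cmod (of_real P1 - dtn pb k) / cmod (of_real P1 + dtn pa k)))"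
    unfolding P1_def P2_def by (rule rho_square_low_factor(1)) (use assms in auto)
  also have "\<dots> \<le> (1 + 4 * (4 / (L * gap) * \<delta>)) * (exp (- (Re (dtn pa k) + Re (dtn pb k)) / P2 + 2 * N\<^sup>2 / P2\<^sup>2)
      * exp (- (Re (dtn pb k) + Re (dtn pa k)) / P1 + 2 * N\<^sup>2 / P1\<^sup>2))"
    using t0 by (intro mult_left_mono mult_mono quotient_upper N R assms(4,5)) auto
  finally show ?thesis by (simp add: S_def add.commute flip: exp_add)
qed

lemma rho_square_lower_low:
  fixes p1 q1 p2 q2 k \<delta> :: real
  defines "P1 \<equiv> ventcell_symbol p1 q1 k" and "P2 \<equiv> ventcell_symbol p2 q2 k"
  defines "N \<equiv> 2 / gap * cmod (lam k)"
  assumes "P1 > 0" "P2 > 0" "\<delta> \<ge> 0" "kmin \<le> k" "cmod (lam k) \<le> P1" "cmod (lam k) \<le> P2" "4 / (L * gap) * \<delta> \<le> 1 / 4"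
  shows "1 - ((2 * re k * \<delta> + 8 / (L * gap) * \<delta>) + ((S k / P2 + N\<^sup>2 / P2\<^sup>2) + (S k / P1 + N\<^sup>2 / P1\<^sup>2)))
    \<le> (rho \<delta> (p1, q1, p2, q2) k)\<^sup>2"
proof -
  have N: "cmod (dtn pa k) \<le> N" "cmod (dtn pb k) \<le> N"
    using norm_dtn_le pa pb assms(7) by (auto simp: N_def gap_def)
  have R: "0 \<le> Re (dtn pa k)" "0 \<le> Re (dtn pb k)" using Re_dtn_pos pa pb by (simp_all add: less_imp_le)
  have S0: "0 \<le> S k" using R by (simp add: S_def)
  have t0: "0 \<le> 4 / (L * gap) * \<delta>" using L gap assms by simp
  have rd: "0 \<le> re k * \<delta>" "0 \<le> \<delta> * re k" using re_pos[of k] assms(6) by simp_all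
  have y2: "1 - (S k / P2 + N\<^sup>2 / P2\<^sup>2) \<le> cmod (of_real P2 - dtn pa k) / cmod (of_real P2 + dtn pb k)"
    using quotient_lower[OF assms(5) R(1) N(2) R(2)] by (simp add: S_def)
  have y1: "1 - (S k / P1 + N\<^sup>2 / P1\<^sup>2) \<le> cmod (of_real P1 - dtn pb k) / cmod (of_real P1 + dtn pa k)"
    using quotient_lower[OF assms(4) R(2) N(1) R(1)] by (simp add: S_def add.commute)
  have Y: "1 - ((S k / P2 + N\<^sup>2 / P2\<^sup>2) + (S k / P1 + N\<^sup>2 / P1\<^sup>2)) \<le> (cmod (of_real P2 - dtn pa k) / cmod (of_real P2 + dtn pb k)) * (cmod (of_real P1 - dtn pb k) / cmod (of_real P1 + dtn pa k))"
    using S0 assms(4,5) by (intro mult_ge_one_minus y1 y2) auto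
  have x1: "1 - (2 * re k * \<delta> + 2 * (4 / (L * gap) * \<delta>)) \<le> exp (- 2 * re k * \<delta>) * (1 - 2 * (4 / (L * gap) * \<delta>))"
    using exp_ge_add_one_self[of "- 2 * re k * \<delta>"] t0 assms(10) rd by (intro mult_ge_one_minus) auto
  have "1 - ((2 * re k * \<delta> + 2 * (4 / (L * gap) * \<delta>)) + ((S k / P2 + N\<^sup>2 / P2\<^sup>2) + (S k / P1 + N\<^sup>2 / P1\<^sup>2))) \<le>
    (exp (- 2 * re k * \<delta>) * (1 - 2 * (4 / (L * gap) * \<delta>))) * ((cmod (of_real P2 - dtn pa k) / cmod (of_real P2 + dtn pb k)) * (cmod (of_real P1 - dtn pb k) / cmod (of_real P1 + dtn pa k)))"
    by (rule mult_ge_one_minus) (use Y x1 t0 assms(4,5,10) S0 rd in auto)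
  also have "\<dots> \<le> (rho \<delta> (p1, q1, p2, q2) k)\<^sup>2"
    unfolding P1_def P2_def mult.assoc[symmetric]
    by (rule rho_square_low_factor(2)[unfolded mult.assoc[symmetric]]) (use assms in auto)
  finally show ?thesis by simp
qed

end

section \<open>Chains of roots\<close>

definition proximity :: "real \<Rightarrow> real \<Rightarrow> real" where
  "proximity r k = min (k / r) (r / k)"

lemma proximity_le: "proximity r k \<le> k / r" "proximity r k \<le> r / k"
  by (simp_all add: proximity_def)

text \<open>At an inner test frequency only the two neighbouring roots contribute at order 1/B; all
  others form the error N e.\<close>

lemma sum_split_pair:
  fixes f :: "nat \<Rightarrow> real"
  assumes "i \<in> {1..N}" "Suc i \<in> {1..N}" and small: "\<And>j. j \<in> {1..N} \<Longrightarrow> j \<noteq> i \<Longrightarrow> j \<noteq> Suc i \<Longrightarrow> f j \<le> e" and "0 \<le> e"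
  shows "(\<Sum>j=1..N. f j) \<le> f i + f (Suc i) + N * e"
proof -
  have "(\<Sum>j=1..N. f j) = f i + (\<Sum>j\<in>{1..N} - {i}. f j)"
    by (rule sum.remove) (use assms in auto)
  moreover have "(\<Sum>j\<in>{1..N} - {i}. f j) = f (Suc i) + (\<Sum>j\<in>{1..N} - {i} - {Suc i}. f j)"
    by (rule sum.remove) (use assms in auto)
  moreover have "(\<Sum>j\<in>{1..N} - {i} - {Suc i}. f j) \<le> (\<Sum>j\<in>{1..N} - {i} - {Suc i}. e)"
    using small by (intro sum_mono) auto
  moreover have "\<dots> \<le> (\<Sum>j\<in>{1..N}. e)" using assms(4) by (intro sum_mono2) auto
  ultimately show ?thesis by simp
qed

lemma sum_split_one:
  fixes f :: "nat \<Rightarrow> real"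
  assumes "i \<in> {1..N}" and small: "\<And>j. j \<in> {1..N} \<Longrightarrow> j \<noteq> i \<Longrightarrow> f j \<le> e" and "0 \<le> e"
  shows "(\<Sum>j=1..N. f j) \<le> f i + N * e"
proof -
  have "(\<Sum>j=1..N. f j) = f i + (\<Sum>j\<in>{1..N} - {i}. f j)"
    by (rule sum.remove) (use assms in auto)
  moreover have "(\<Sum>j\<in>{1..N} - {i}. f j) \<le> (\<Sum>j\<in>{1..N} - {i}. e)"
    using small by (intro sum_mono) auto
  moreover have "\<dots> \<le> (\<Sum>j\<in>{1..N}. e)" using assms(3) by (intro sum_mono2) auto
  ultimately show ?thesis by simp
qed

lemma inverse_one_minus_le: "0 \<le> x \<Longrightarrow> x \<le> 1 / 2 \<Longrightarrow> 1 / (1 - x) \<le> 1 + 2 * (x::real)"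
proof -
  assume x: "0 \<le> x" "x \<le> 1 / 2"
  have "1 + 2 * x * (1/2 - x) * 2 = (1 + 2 * x) * (1 - x) + x - 2 * x * x" by (simp add: algebra_simps)
  moreover have "0 \<le> x * (1 - 2 * x)" using x by simp
  ultimately have "1 \<le> (1 + 2 * x) * (1 - x)" by (simp add: algebra_simps)
  then show ?thesis using x by (simp add: divide_le_eq)
qed

text \<open>
  The test frequencies are \<open>B\<^sup>2\<^sup>i\<close> and the optimal sorted roots \<open>B\<^sup>2\<^sup>i\<^sup>-\<^sup>1\<close> lie geometrically halfway
  between them. The forward invariant is that either the \<open>i\<close>-th root is at most slightly too large,
  or the \<open>(i+1)\<close>-st root already lies left of the \<open>i\<close>-th test frequency; the roots that are left over
  never suffice to reach the last test frequency in the second case.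
\<close>

locale root_chain =
  fixes N :: nat and C B s :: real and r :: "nat \<Rightarrow> real"
  assumes C: "0 \<le> C" and N: "1 \<le> N" and B: "(2 * C + N) * 4 ^ (N + 2) \<le> B"
    and pos: "\<And>i. i \<in> {1..N} \<Longrightarrow> 0 < r i"
    and mono: "\<And>i j. i \<in> {1..N} \<Longrightarrow> j \<in> {1..N} \<Longrightarrow> i \<le> j \<Longrightarrow> r i \<le> r j"
    and first: "(1 - C / B) / B \<le> (\<Sum>j=1..N. 1 / r j)"
    and inner: "\<And>i. i \<in> {1..<N} \<Longrightarrow> 2 * (1 - C / B) / B \<le> (\<Sum>j=1..N. proximity (r j) (B ^ (2 * i)))"
    and last: "(1 + s) / B \<le> (\<Sum>j=1..N. proximity (r j) (B ^ (2 * N)))" "- C / B \<le> s"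
begin

text \<open>The error of one induction step: twice the defect C of a test condition plus one unit
  for each neglected root. It grows by at most a factor 4 per step, hence the powers of 4.\<close>

definition Z :: real where "Z = 2 * C + N"

lemma Z: "1 \<le> Z" "N \<le> Z" "C \<le> Z" "2 * C + N = Z" using C N by (auto simp: Z_def)

lemma B4: "4 \<le> B"
proof -
  have "(4::real) ^ 1 \<le> 4 ^ (N + 2)" by (intro power_increasing) auto
  then have "1 * 4 \<le> Z * 4 ^ (N + 2)" using Z by (intro mult_mono) auto
  moreover have "Z * 4 ^ (N + 2) \<le> B" using B by (simp only: Z_def)
  ultimately show ?thesis by linarith
qed

lemma Z_le: assumes "m \<le> N + 1" shows "Z * 4 ^ m / B \<le> 1 / 4" and "1 \<le> Z * 4 ^ m"
proof -
  have "(4::real) ^ m * 4 \<le> 4 ^ (N + 2)" using power_increasing[of "Suc m" "N + 2" "4::real"] assms by simp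
  then have "Z * (4 ^ m * 4) \<le> Z * 4 ^ (N + 2)" using Z by (intro mult_left_mono) auto
  also have "\<dots> \<le> B" using B by (simp add: Z_def)
  finally have "Z * 4 ^ m * 4 \<le> B" by simp
  moreover have "1 * 1 \<le> Z * 4 ^ m" using Z by (intro mult_mono) auto
  ultimately show "Z * 4 ^ m / B \<le> 1 / 4" "1 \<le> Z * 4 ^ m" using B4 by (auto simp: divide_le_eq)
qed

lemma power_ge: "i \<le> j \<Longrightarrow> B ^ (2 * i) \<le> B ^ (2 * j)"
  using B4 by (intro power_increasing) auto

lemma Bpow: "0 < B ^ m" using B4 by simp

lemma Bpow_Suc: "B ^ (2 * Suc i) = B ^ (2 * i) * B * B"
  by simp

lemma ratio_small: 
  assumes "r j \<le> B ^ (2 * j)" "j < i" shows "proximity (r j) (B ^ (2 * i)) \<le> 1 / (B * B)"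
proof -
  have "r j / B ^ (2 * i) \<le> B ^ (2 * j) / B ^ (2 * Suc j)"
    by (intro frac_le less_imp_le[OF Bpow] Bpow power_ge) (use assms in auto)
  also have "\<dots> = 1 / (B * B)" unfolding Bpow_Suc using B4 by simp
  finally show ?thesis using proximity_le(2)[of "r j" "B ^ (2 * i)"] by linarith
qed

lemma ratio_small': 
  assumes "B ^ (2 * Suc i) \<le> r j" shows "proximity (r j) (B ^ (2 * i)) \<le> 1 / (B * B)"
proof -
  have "B ^ (2 * i) / r j \<le> B ^ (2 * i) / B ^ (2 * Suc i)"
    using assms Bpow[of "2 * Suc i"] Bpow[of "2 * i"] by (intro divide_left_mono mult_pos_pos) auto
  also have "\<dots> = 1 / (B * B)" unfolding Bpow_Suc using B4 by simp
  finally show ?thesis using proximity_le(1)[of "r j" "B ^ (2 * i)"] by linarith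
qed

lemma forward:
  assumes "i \<in> {1..N}"
  shows "(\<forall>j\<in>{1..i}. r j \<le> B ^ (2 * j)) \<and>
    (r i \<le> B ^ (2 * i) / B * (1 + Z * 4 ^ i / B) \<or> Suc i \<le> N \<and> r (Suc i) \<le> B ^ (2 * i))"
proof -
  have "1 \<le> i \<longrightarrow> i \<le> N \<longrightarrow> ?thesis"
  proof (induction i rule: nat_induct)
    case (Suc i)
    show ?case
    proof (intro impI)
      assume iN: "1 \<le> Suc i" "Suc i \<le> N"
      have Bp: "B > 0" using B4 by simp
      \<comment> \<open>By \<open>gap\<close> the roots after the next one lie beyond the next test
        frequency and are negligible at the current one, or at the lowest frequency if i = 0. The
        i-th root contributes hardly more than 1/B there, so the (i+1)-th has to supply the rest and
        cannot be too large.\<close>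
      have key: "r (Suc i) \<le> B ^ (2 * Suc i) / B * (1 + Z * 4 ^ Suc i / B)"
        if low: "\<forall>j\<in>{1..i}. r j \<le> B ^ (2 * j)" and ri: "i \<ge> 1 \<Longrightarrow> r i \<le> B ^ (2 * i) / B * (1 + Z * 4 ^ i / B)"
          and gap: "Suc (Suc i) \<le> N \<Longrightarrow> B ^ (2 * Suc i) < r (Suc (Suc i))"
      proof -
        have rp: "0 < r (Suc i)" using pos iN by simp
        have ex: "(1 - 2 * Z * 4 ^ i / B) / B \<le> B ^ (2 * i) / r (Suc i)"
        proof (cases "i = 0")
          case True
          have "(\<Sum>j=1..N. 1 / r j) \<le> 1 / r 1 + N * (1 / (B * B))"
          proof (rule sum_split_one)
            fix j assume j: "j \<in> {1..N}" "j \<noteq> 1"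
            then have "Suc (Suc 0) \<le> N" "Suc (Suc 0) \<le> j" by auto
            then have "B * B < r j" using gap mono[of "Suc (Suc 0)" j] j True by (simp add: power2_eq_square)
            then show "1 / r j \<le> 1 / (B * B)" using Bp j pos by (intro divide_left_mono mult_pos_pos) auto
          qed (use N in auto)
          then have "(1 - C / B) / B - N / (B * B) \<le> 1 / r 1" using first by simp
          moreover have "(1 - (C + N) / B) / B = (1 - C / B) / B - N / (B * B)"
            by (simp add: add_divide_distrib diff_divide_distrib)
          moreover have "C + N \<le> 2 * Z" using C by (simp add: Z_def)
          then have "(1 - 2 * Z / B) / B \<le> (1 - (C + N) / B) / B"
            using Bp by (intro divide_right_mono diff_left_mono) auto
          ultimately show ?thesis using True by simp
        next
          case False
          have "(\<Sum>j=1..N. proximity (r j) (B ^ (2 * i))) \<le> proximity (r i) (B ^ (2 * i)) + proximity (r (Suc i)) (B ^ (2 * i)) + N * (1 / (B * B))"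
          proof (rule sum_split_pair)
            fix j assume j: "j \<in> {1..N}" "j \<noteq> i" "j \<noteq> Suc i"
            show "proximity (r j) (B ^ (2 * i)) \<le> 1 / (B * B)"
            proof (cases "j < i")
              case True then show ?thesis using low j by (intro ratio_small) auto
            next
              case False
              then have "Suc (Suc i) \<le> j" using j by auto
              then have "B ^ (2 * Suc i) \<le> r j" using gap mono[of "Suc (Suc i)" j] j by fastforce
              then show ?thesis by (rule ratio_small')
            qed
          qed (use iN False in auto)
          moreover have "2 * (1 - C / B) / B \<le> (\<Sum>j=1..N. proximity (r j) (B ^ (2 * i)))"
            using inner iN False by auto
          moreover have "proximity (r i) (B ^ (2 * i)) \<le> (1 + Z * 4 ^ i / B) / B"
          proof -
            have "r i / B ^ (2 * i) \<le> (B ^ (2 * i) / B * (1 + Z * 4 ^ i / B)) / B ^ (2 * i)"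
              using ri False Bpow[of "2 * i"] by (intro divide_right_mono) auto
            also have "\<dots> = (1 + Z * 4 ^ i / B) / B" using Bpow[of "2 * i"] by simp
            finally show ?thesis using proximity_le(2)[of "r i" "B ^ (2 * i)"] by linarith
          qed
          moreover have "proximity (r (Suc i)) (B ^ (2 * i)) \<le> B ^ (2 * i) / r (Suc i)" by (rule proximity_le)
          ultimately have "2 * (1 - C / B) / B - (1 + Z * 4 ^ i / B) / B - N * (1 / (B * B)) \<le> B ^ (2 * i) / r (Suc i)" by linarith
          moreover have "2 * (1 - C / B) / B - (1 + Z * 4 ^ i / B) / B - N * (1 / (B * B)) = (1 - (Z + Z * 4 ^ i) / B) / B"
            using Bp by (simp add: Z_def field_simps)
          moreover have "(1 - 2 * Z * 4 ^ i / B) / B \<le> (1 - (Z + Z * 4 ^ i) / B) / B"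
          proof -
            have "Z * 1 \<le> Z * 4 ^ i" using Z by (intro mult_left_mono) auto
            then show ?thesis using Bp by (intro divide_right_mono diff_left_mono) auto
          qed
          ultimately show ?thesis by linarith
        qed
        \<comment> \<open>Inverting 1 - x doubles the error, so that \<open>2 * Z * 4 ^ i\<close>
          turns into \<open>Z * 4 ^ Suc i\<close>.\<close>
        define x where "x = 2 * Z * 4 ^ i / B"
        have x: "0 \<le> x" "x \<le> 1 / 2" using Z_le[of i] iN Bp Z by (auto simp: x_def)
        have "(1 - x) / B * r (Suc i) \<le> B ^ (2 * i)" using ex rp by (simp add: x_def pos_le_divide_eq)
        then have "r (Suc i) \<le> B ^ (2 * i) * B * (1 / (1 - x))" using x Bp by (simp add: field_simps)
        also have "\<dots> \<le> B ^ (2 * i) * B * (1 + 2 * x)"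
          using inverse_one_minus_le[OF x] Bpow Bp by (intro mult_left_mono) (auto intro: less_imp_le)
        also have "\<dots> = B ^ (2 * Suc i) / B * (1 + Z * 4 ^ Suc i / B)" unfolding Bpow_Suc using Bp by (simp add: x_def)
        finally show ?thesis .
      qed
      have bound: "B ^ (2 * Suc i) / B * (1 + Z * 4 ^ Suc i / B) \<le> B ^ (2 * Suc i)"
      proof -
        have "Z * 4 ^ Suc i / B \<le> 1 / 4" using iN by (intro Z_le) auto
        then have "1 + Z * 4 ^ Suc i / B \<le> 4" by linarith
        then have "B ^ (2 * Suc i) / B * (1 + Z * 4 ^ Suc i / B) \<le> B ^ (2 * Suc i) / B * 4"
          using Bpow[of "2 * Suc i"] Bp by (intro mult_left_mono) auto
        also have "\<dots> \<le> B ^ (2 * Suc i) / B * B" using B4 Bpow[of "2 * Suc i"] by (intro mult_left_mono) auto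
        finally show ?thesis using Bp by simp
      qed
      show "(\<forall>j\<in>{1..Suc i}. r j \<le> B ^ (2 * j)) \<and>
        (r (Suc i) \<le> B ^ (2 * Suc i) / B * (1 + Z * 4 ^ Suc i / B) \<or> Suc (Suc i) \<le> N \<and> r (Suc (Suc i)) \<le> B ^ (2 * Suc i))"
      proof (cases "i = 0")
        case True
        show ?thesis
        proof (cases "Suc (Suc i) \<le> N \<and> r (Suc (Suc i)) \<le> B ^ (2 * Suc i)")
          case T: True
          then have "r (Suc i) \<le> B ^ (2 * Suc i)" using mono[of "Suc i" "Suc (Suc i)"] by auto
          then show ?thesis using T True by auto
        next
          case False
          then have "r (Suc i) \<le> B ^ (2 * Suc i) / B * (1 + Z * 4 ^ Suc i / B)" using True by (intro key) auto
          then show ?thesis using True bound by auto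
        qed
      next
        case F: False
        then have IH: "\<forall>j\<in>{1..i}. r j \<le> B ^ (2 * j)"
          "r i \<le> B ^ (2 * i) / B * (1 + Z * 4 ^ i / B) \<or> Suc i \<le> N \<and> r (Suc i) \<le> B ^ (2 * i)"
          using Suc iN by auto
        have *: "(\<forall>j\<in>{1..Suc i}. r j \<le> B ^ (2 * j))" if "r (Suc i) \<le> B ^ (2 * Suc i)"
          using IH(1) that by (auto simp: le_Suc_eq simp del: power_Suc mult_Suc_right)
        show ?thesis
        \<comment> \<open>A surplus root left of the i-th test frequency meets the sharp bound for
          index i + 1 with a whole factor B to spare, so the first alternative is restored.\<close>
        proof (cases "r (Suc i) \<le> B ^ (2 * i)")
          case True
          have c: "B ^ (2 * i) \<le> B ^ (2 * Suc i) / B * (1 + Z * 4 ^ Suc i / B)"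
          proof -
            have "B ^ (2 * i) * 1 \<le> B ^ (2 * i) * B" using B4 Bpow[of "2 * i"] by (intro mult_left_mono) auto
            also have "\<dots> = B ^ (2 * Suc i) / B" unfolding Bpow_Suc using Bp by simp
            also have "\<dots> \<le> B ^ (2 * Suc i) / B * (1 + Z * 4 ^ Suc i / B)"
              using Bpow[of "2 * Suc i"] Bp Z by (simp add: field_simps)
            finally show ?thesis by simp
          qed
          then show ?thesis using True bound * by (meson order_trans)
        next
          case False
          then have ri: "r i \<le> B ^ (2 * i) / B * (1 + Z * 4 ^ i / B)" using IH(2) by auto
          show ?thesis
          proof (cases "Suc (Suc i) \<le> N \<and> r (Suc (Suc i)) \<le> B ^ (2 * Suc i)")
            case T: True
            then have "r (Suc i) \<le> B ^ (2 * Suc i)" using mono[of "Suc i" "Suc (Suc i)"] by auto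
            then show ?thesis using T * by auto
          next
            case False
            then have "r (Suc i) \<le> B ^ (2 * Suc i) / B * (1 + Z * 4 ^ Suc i / B)"
              using ri IH(1) by (intro key) auto
            then show ?thesis using * bound by auto
          qed
        qed
      qed
    qed
  qed simp
  then show ?thesis using assms by simp
qed

text \<open>At the last index the second alternative of \<open>forward\<close> would require an
  (N+1)-th root, so the sharp upper bound holds. The last test condition gives the matching lower
  bound.\<close>

lemma last_root: "B ^ (2 * N) / B * (1 + s - N / B) \<le> r N" "r N \<le> B ^ (2 * N) / B * (1 + Z * 4 ^ N / B)"
proof -
  have Bp: "B > 0" using B4 by simp
  have f: "\<forall>j\<in>{1..N}. r j \<le> B ^ (2 * j)" "r N \<le> B ^ (2 * N) / B * (1 + Z * 4 ^ N / B)"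
    using forward[of N] N by auto
  then show "r N \<le> B ^ (2 * N) / B * (1 + Z * 4 ^ N / B)" by simp
  have "(\<Sum>j=1..N. proximity (r j) (B ^ (2 * N))) \<le> proximity (r N) (B ^ (2 * N)) + N * (1 / (B * B))"
    by (rule sum_split_one) (use f ratio_small N in auto)
  then have "(1 + s) / B - N * (1 / (B * B)) \<le> r N / B ^ (2 * N)"
    using last(1) proximity_le(2)[of "r N" "B ^ (2 * N)"] by linarith
  moreover have "(1 + s) / B - N * (1 / (B * B)) = (1 + s - N / B) / B" by (simp add: diff_divide_distrib)
  ultimately have "(1 + s - N / B) / B * B ^ (2 * N) \<le> r N" using Bpow[of "2 * N"] by (simp add: pos_le_divide_eq)
  then show "B ^ (2 * N) / B * (1 + s - N / B) \<le> r N" by (simp add: mult.commute)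
qed

text \<open>The two bounds for the last root are compatible only if s is at most of order 1/B: no
  choice of roots beats the equilibrium to leading order.\<close>

lemma slack: "s \<le> Z * 4 ^ (N + 1) / B"
proof -
  have Bp: "B > 0" using B4 by simp
  have "B ^ (2 * N) / B * (1 + s - N / B) \<le> B ^ (2 * N) / B * (1 + Z * 4 ^ N / B)" using last_root by linarith
  moreover have "0 < B ^ (2 * N) / B" using Bpow Bp by simp
  ultimately have "1 + s - N / B \<le> 1 + Z * 4 ^ N / B" by (simp only: mult_le_cancel_left_pos)
  then have "s \<le> (Z * 4 ^ N + N) / B" by (simp add: add_divide_distrib)
  also have "\<dots> \<le> Z * 4 ^ (N + 1) / B"
  proof -
    have "real N * 1 \<le> Z * 4 ^ N" using Z by (intro mult_mono) auto
    then show ?thesis using Bp by (intro divide_right_mono) auto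
  qed
  finally show ?thesis .
qed

text \<open>Downward induction from the last root. Once the (i+1)-th root is at least about
  \<open>B ^ (2 * i + 1)\<close>, its share at the i-th test frequency is at most about 1/B, and the
  i-th root must provide the other half. The same bound excludes the second alternative of
  \<open>forward\<close>, which then gives the upper estimate.\<close>

lemma backward:
  assumes "m < N"
  shows "B ^ (2 * (N - m)) / B * (1 - Z * 4 ^ (m + 1) / B) \<le> r (N - m) \<and>
    r (N - m) \<le> B ^ (2 * (N - m)) / B * (1 + Z * 4 ^ (N - m) / B)"
  using assms
proof (induction m rule: less_induct)
  case (less m)
  have Bp: "B > 0" using B4 by simp
  show ?case
  proof (cases m)
    case 0
    have "1 - Z * 4 ^ 1 / B \<le> 1 + s - N / B"
    proof -
      have "(C + N) / B \<le> Z * 4 / B" using Bp C by (intro divide_right_mono) (auto simp: Z_def)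
      then show ?thesis using last(2) by (simp add: add_divide_distrib)
    qed
    then have "B ^ (2 * N) / B * (1 - Z * 4 ^ 1 / B) \<le> B ^ (2 * N) / B * (1 + s - N / B)"
      using Bpow[of "2 * N"] Bp by (intro mult_left_mono) auto
    then show ?thesis using last_root 0 by auto
  next
    case (Suc m')
    define i where "i = N - m"
    have i: "1 \<le> i" "Suc i \<le> N" "N - m' = Suc i" "N - m = i" using less.prems Suc by (auto simp: i_def)
    have lb: "B ^ (2 * j) \<le> r (Suc j)" "B ^ (2 * Suc j) / B * (1 - Z * 4 ^ (N - Suc j + 1) / B) \<le> r (Suc j)" if "i \<le> j" "Suc j \<le> N" for j
    proof -
      have "N - Suc j < m" using that less.prems by (auto simp: i_def)
      from less.IH[OF this] show l: "B ^ (2 * Suc j) / B * (1 - Z * 4 ^ (N - Suc j + 1) / B) \<le> r (Suc j)" using that by auto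
      have "B ^ (2 * j) * 1 \<le> B ^ (2 * j) * (B * (1 - Z * 4 ^ (N - Suc j + 1) / B))"
      proof (intro mult_left_mono)
        have "1 - Z * 4 ^ (N - Suc j + 1) / B \<ge> 3 / 4" using Z_le[of "N - Suc j + 1"] by auto
        then have "4 * (3 / 4) \<le> B * (1 - Z * 4 ^ (N - Suc j + 1) / B)" using B4 by (intro mult_mono) auto
        then show "1 \<le> B * (1 - Z * 4 ^ (N - Suc j + 1) / B)" by simp
      qed (use Bpow[of "2 * j"] in simp)
      also have "\<dots> = B ^ (2 * Suc j) / B * (1 - Z * 4 ^ (N - Suc j + 1) / B)" unfolding Bpow_Suc using Bp by simp
      finally show "B ^ (2 * j) \<le> r (Suc j)" using l by simp
    qed
    have lb': "B ^ (2 * i) < r (Suc i)"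
    proof -
      have "1 - Z * 4 ^ (N - Suc i + 1) / B \<ge> 3 / 4" using Z_le[of "N - Suc i + 1"] by auto
      then have "4 * (3 / 4) \<le> B * (1 - Z * 4 ^ (N - Suc i + 1) / B)" using B4 by (intro mult_mono) auto
      then have "B ^ (2 * i) * 1 < B ^ (2 * i) * (B * (1 - Z * 4 ^ (N - Suc i + 1) / B))"
        using Bpow[of "2 * i"] by (intro mult_strict_left_mono) auto
      also have "\<dots> = B ^ (2 * Suc i) / B * (1 - Z * 4 ^ (N - Suc i + 1) / B)" unfolding Bpow_Suc using Bp by simp
      finally show ?thesis using lb(2)[of i] i by simp
    qed
    have f: "\<forall>j\<in>{1..i}. r j \<le> B ^ (2 * j)" "r i \<le> B ^ (2 * i) / B * (1 + Z * 4 ^ i / B)"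
      using forward[of i] i lb' by auto
    have "(\<Sum>j=1..N. proximity (r j) (B ^ (2 * i))) \<le> proximity (r i) (B ^ (2 * i)) + proximity (r (Suc i)) (B ^ (2 * i)) + N * (1 / (B * B))"
    proof (rule sum_split_pair)
      fix j assume j: "j \<in> {1..N}" "j \<noteq> i" "j \<noteq> Suc i"
      show "proximity (r j) (B ^ (2 * i)) \<le> 1 / (B * B)"
      proof (cases "j < i")
        case True then show ?thesis using f j by (intro ratio_small) auto
      next
        case False
        then have "i \<le> j - 1" "Suc (j - 1) \<le> N" "Suc i \<le> j - 1" using j by auto
        then have "B ^ (2 * Suc i) \<le> r j" using lb(1)[of "j - 1"] power_ge[of "Suc i" "j - 1"] by (auto intro: order_trans simp del: mult_Suc_right)
        then show ?thesis by (rule ratio_small')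
      qed
    qed (use i in auto)
    moreover have "2 * (1 - C / B) / B \<le> (\<Sum>j=1..N. proximity (r j) (B ^ (2 * i)))"
      using inner i by auto
    moreover have "proximity (r i) (B ^ (2 * i)) \<le> r i / B ^ (2 * i)" by (rule proximity_le)
    moreover have "proximity (r (Suc i)) (B ^ (2 * i)) \<le> (1 + 2 * (Z * 4 ^ m / B)) / B"
    proof -
      define x where "x = Z * 4 ^ m / B"
      have e: "N - Suc i + 1 = m" using i less.prems Suc by (auto simp: i_def)
      have x: "0 \<le> x" "x \<le> 1 / 2" using Z_le[of m] less.prems Bp Z by (auto simp: x_def)
      have "B ^ (2 * i) * B * (1 - x) \<le> r (Suc i)" using lb(2)[of i, unfolded e] i Bp unfolding Bpow_Suc x_def by simp
      then have "B ^ (2 * i) / r (Suc i) \<le> B ^ (2 * i) / (B ^ (2 * i) * B * (1 - x))"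
        using Bpow[of "2 * i"] Bp x by (intro divide_left_mono mult_pos_pos pos) (use i in auto)
      also have "\<dots> = 1 / (1 - x) / B" using Bpow[of "2 * i"] by simp
      also have "\<dots> \<le> (1 + 2 * x) / B" using inverse_one_minus_le[OF x] Bp by (intro divide_right_mono) auto
      finally show ?thesis using proximity_le(1)[of "r (Suc i)" "B ^ (2 * i)"] unfolding x_def by linarith
    qed
    ultimately have "2 * (1 - C / B) / B - (1 + 2 * (Z * 4 ^ m / B)) / B - N * (1 / (B * B)) \<le> r i / B ^ (2 * i)" by linarith
    moreover have "2 * (1 - C / B) / B - (1 + 2 * (Z * 4 ^ m / B)) / B - N * (1 / (B * B)) = (1 - (Z + 2 * (Z * 4 ^ m)) / B) / B"
      using Bp by (simp add: Z_def field_simps)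
    moreover have "(1 - Z * 4 ^ (m + 1) / B) / B \<le> (1 - (Z + 2 * (Z * 4 ^ m)) / B) / B"
    proof -
      have "Z * 1 \<le> Z * 4 ^ m" using Z by (intro mult_left_mono) auto
      moreover have "Z * 4 ^ (m + 1) = 4 * (Z * 4 ^ m)" by simp
      ultimately have "Z + 2 * (Z * 4 ^ m) \<le> Z * 4 ^ (m + 1)" using Z(1) by linarith
      then show ?thesis using Bp by (intro divide_right_mono diff_left_mono) auto
    qed
    ultimately have "(1 - Z * 4 ^ (m + 1) / B) / B \<le> r i / B ^ (2 * i)" by linarith
    then have "(1 - Z * 4 ^ (m + 1) / B) / B * B ^ (2 * i) \<le> r i" using Bpow[of "2 * i"] by (simp add: pos_le_divide_eq)
    then show ?thesis using f i by (simp add: mult.commute)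
  qed
qed

lemma roots:
  assumes "i \<in> {1..N}"
  shows "B ^ (2 * i) / B * (1 - Z * 4 ^ (N + 1) / B) \<le> r i" "r i \<le> B ^ (2 * i) / B * (1 + Z * 4 ^ (N + 1) / B)"
proof -
  have Bp: "B > 0" using B4 by simp
  have m: "N - i < N" "N - (N - i) = i" using assms by auto
  have "Z * 4 ^ (N - i + 1) / B \<le> Z * 4 ^ (N + 1) / B" "Z * 4 ^ i / B \<le> Z * 4 ^ (N + 1) / B"
    using Z Bp assms by (intro divide_right_mono mult_left_mono power_increasing; auto)+
  then have "B ^ (2 * i) / B * (1 - Z * 4 ^ (N + 1) / B) \<le> B ^ (2 * i) / B * (1 - Z * 4 ^ (N - i + 1) / B)"
    "B ^ (2 * i) / B * (1 + Z * 4 ^ i / B) \<le> B ^ (2 * i) / B * (1 + Z * 4 ^ (N + 1) / B)"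
    using Bpow[of "2 * i"] Bp by (intro mult_left_mono; simp)+
  then show "B ^ (2 * i) / B * (1 - Z * 4 ^ (N + 1) / B) \<le> r i" "r i \<le> B ^ (2 * i) / B * (1 + Z * 4 ^ (N + 1) / B)"
    using backward[OF m(1)] unfolding m(2) by linarith+
qed

end

section \<open>Arithmetic-geometric mean bounds\<close>

text \<open>The profile of the contrast: for real \<lambda> = k it equals
  \<open>4 * well (P / k)\<close>.\<close>

definition well :: "real \<Rightarrow> real" where "well t = t / (1 + t)\<^sup>2"

lemma well_nonneg: "0 \<le> t \<Longrightarrow> 0 \<le> well t" by (simp add: well_def)

lemma well_inverse: "0 < t \<Longrightarrow> well (1 / t) = well t"
  by (simp add: well_def field_simps power2_eq_square)

lemma well_ge: assumes "0 \<le> t" shows "t * (1 - 2 * t) \<le> well t"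
proof -
  have "(1 - 2 * t) * (1 + t)\<^sup>2 = 1 - t * t * (3 + 2 * t)" by (simp add: algebra_simps power2_eq_square)
  also have "\<dots> \<le> 1" using assms by simp
  finally have "1 - 2 * t \<le> 1 / (1 + t)\<^sup>2" using assms by (simp add: le_divide_eq)
  then have "t * (1 - 2 * t) \<le> t * (1 / (1 + t)\<^sup>2)" using assms by (intro mult_left_mono) auto
  then show ?thesis by (simp add: well_def)
qed

text \<open>The cut at 8/B ensures that in the intermediate range t / 4, or 1 / (4 t), is at least
  2/B. Outside that range \<open>well\<close> is almost t or 1/t.\<close>

lemma well_cases:
  assumes "0 < t" "8 \<le> B"
  obtains "2 / B \<le> well t" | "t < 8 / B" "t * (1 - 16 / B) \<le> well t" | "B / 8 < t" "1 / t * (1 - 16 / B) \<le> well t"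
proof -
  have small: "s * (1 - 16 / B) \<le> well s" if "0 < s" "s < 8 / B" for s
  proof -
    have "s * (1 - 16 / B) \<le> s * (1 - 2 * s)" using that by (intro mult_left_mono) auto
    then show ?thesis using well_ge[of s] that by linarith
  qed
  have mid: "2 / B \<le> well s" if "8 / B \<le> s" "s \<le> 1" for s
  proof -
    have s: "0 < s" using that assms by (meson divide_pos_pos less_le_trans order_less_le_trans zero_less_numeral)
    have "(1 + s)\<^sup>2 \<le> 2\<^sup>2" using that s by (intro power_mono) auto
    then have "s / 2\<^sup>2 \<le> well s" unfolding well_def using s by (intro divide_left_mono) auto
    moreover have "2 / B \<le> s / 4" using that by simp
    ultimately show ?thesis by simp
  qed
  have B: "0 < B" using assms by simp
  consider "t < 8 / B" | "8 / B \<le> t" "t \<le> 1" | "1 < t" "t \<le> B / 8" | "B / 8 < t" by linarith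
  then show thesis
  proof cases
    case 1 then show ?thesis using small assms that(2) by blast
  next
    case 2 then show ?thesis using mid that(1) by blast
  next
    case 3
    then have "8 / B \<le> 1 / t" "1 / t \<le> 1" using B by (auto simp: field_simps)
    then show ?thesis using mid[of "1 / t"] well_inverse[OF assms(1)] that(1) by simp
  next
    case 4
    then have "0 < 1 / t" "1 / t < 8 / B" using assms B by (auto simp: field_simps)
    then show ?thesis using small[of "1 / t"] well_inverse[OF assms(1)] that(3) 4 by simp
  qed
qed

text \<open>Used to drop the smaller summand of P / k. The constant 272 is the 256 of this
  comparison plus the 16 from \<open>well_cases\<close>.\<close>

lemma inverse_sum_ge:
  fixes a b B :: real
  assumes a: "0 < a" and b: "0 \<le> b" "b \<le> 256 / B * a" and B: "272 \<le> B"
  shows "1 / a * (1 - 272 / B) \<le> 1 / (a + b) * (1 - 16 / B)"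
proof -
  define x where "x = 1 / B"
  have x: "0 < x" "1 - 256 * x \<ge> 0" "1 - 16 * x \<ge> 0" using B by (auto simp: x_def)
  have "1 / (a * (1 + 256 * x)) \<le> 1 / (a + b)"
    using a b x by (intro divide_left_mono) (auto simp: x_def algebra_simps intro: add_pos_nonneg)
  moreover have "1 - 256 * x \<le> 1 / (1 + 256 * x)"
    using x by (simp add: le_divide_eq) (simp add: algebra_simps)
  then have "1 / a * (1 - 256 * x) \<le> 1 / a * (1 / (1 + 256 * x))" using a by (intro mult_left_mono) auto
  ultimately have "1 / a * (1 - 256 * x) \<le> 1 / (a + b)" by simp
  then have "1 / a * (1 - 256 * x) * (1 - 16 * x) \<le> 1 / (a + b) * (1 - 16 * x)" using x by (intro mult_right_mono) auto
  moreover have "1 / a * (1 - 272 * x) \<le> 1 / a * ((1 - 256 * x) * (1 - 16 * x))"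
    using a x by (intro mult_left_mono) (auto simp: algebra_simps)
  ultimately show ?thesis by (simp add: x_def mult.assoc)
qed

lemma amgm_pair:
  fixes x y m :: real
  assumes "0 \<le> x" "0 \<le> y" "x * y = m\<^sup>2" shows "2 * m \<le> x + y"
proof (rule power2_le_imp_le)
  have "0 \<le> (x - y)\<^sup>2" by simp
  then show "(2 * m)\<^sup>2 \<le> (x + y)\<^sup>2" using assms(3) by (simp add: power2_eq_square algebra_simps)
qed (use assms in simp)

lemma amgm_bound:
  fixes x y f B :: real
  assumes "0 \<le> x" "0 \<le> y" "x * y = (1 / B)\<^sup>2" "x * (1 - 272 / B) + y * (1 - 272 / B) \<le> f" "272 \<le> B"
  shows "2 / B * (1 - 272 / B) \<le> f"
proof -
  have "2 * (1 / B) * (1 - 272 / B) \<le> (x + y) * (1 - 272 / B)"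
    using amgm_pair[OF assms(1-3)] assms(5) by (intro mult_right_mono) auto
  then show ?thesis using assms(4) by (simp add: distrib_right)
qed

text \<open>Here k is in units of K/2, and k / B^5 is half of the overlap term. Two pairs dominate
  in turn: B / k with k / B^3, balanced at k = B^2, and B^3 / k with k / B^5, balanced at k = B^4.
  Either pair has the product 1 / B^2.\<close>

lemma one_condition_lower:
  fixes c k B :: real
  assumes c: "0 < c" and k: "c * B \<le> k" and B: "272 \<le> B" "16 / c \<le> B"
  shows "2 / B * (1 - 272 / B) \<le> k / B ^ 5 + well (B / k + k / B ^ 3)"
proof -
  have B0: "0 < B" "1 \<le> B" using B by auto
  have k0: "0 < k" using c B0 k by (meson less_le_trans mult_pos_pos)
  define t where "t = B / k + k / B ^ 3"
  have t: "0 < t" unfolding t_def using B0 k0 by (intro add_pos_pos divide_pos_pos) auto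
  have u: "1 - 272 / B \<le> 1 - 16 / B" "0 \<le> 1 - 272 / B" "1 - 272 / B \<le> 1" using B by (auto simp: divide_le_eq divide_right_mono)
  have kB: "0 \<le> k / B ^ 5" using k0 B0 by simp
  consider "2 / B \<le> well t" | "t < 8 / B" "t * (1 - 16 / B) \<le> well t" | "B / 8 < t" "1 / t * (1 - 16 / B) \<le> well t"
    by (rule well_cases[of t B]) (use t B in auto)
  then show ?thesis
  proof cases
    case 1
    have "2 / B * (1 - 272 / B) \<le> 2 / B * 1" using u B0 by (intro mult_left_mono) auto
    then show ?thesis using 1 kB by (simp add: t_def)
  next
    case 2
    have "2 / B * (1 - 272 / B) \<le> well t"
    proof (rule amgm_bound[OF _ _ _ _ B(1)])
      show "B / k * (k / B ^ 3) = (1 / B)\<^sup>2" using k0 B0 by (simp add: field_simps power2_eq_square power3_eq_cube)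
      have "t * (1 - 272 / B) \<le> t * (1 - 16 / B)" using t by (intro mult_left_mono[OF u(1)]) auto
      then show "B / k * (1 - 272 / B) + k / B ^ 3 * (1 - 272 / B) \<le> well t"
        using 2 by (simp add: t_def distrib_right)
    qed (use k0 B0 in auto)
    then show ?thesis using kB by (simp add: t_def)
  next
    case 3
    \<comment> \<open>Since k \<ge> c B, the summand B / k is at most 1 / c, so a large t can only
      come from k / B^3.\<close>
    have "B / k \<le> B / (c * B)" using k k0 B0 c by (intro divide_left_mono) auto
    also have "\<dots> = 1 / c" using B0 by simp
    also have "\<dots> \<le> B / 16" using B(2) c by (simp add: field_simps)
    finally have "B / k \<le> B / 16" .
    then have "B / 16 < k / B ^ 3" using 3(1) unfolding t_def by linarith
    then have kl: "B ^ 4 / 16 \<le> k" using B0 by (simp add: field_simps eval_nat_numeral)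
    have th: "B / k \<le> 256 / B * (k / B ^ 3)"
    proof -
      have "B ^ 4 / 16 * (B ^ 4 / 16) \<le> k * k" using kl k0 B0 by (intro mult_mono) auto
      moreover have "B ^ 4 * B \<le> B ^ 4 * B ^ 4" using B0 by (intro mult_left_mono self_le_power) auto
      ultimately have "B ^ 4 * B \<le> 256 * (k * k)" by linarith
      then show ?thesis using k0 B0 by (simp add: field_simps eval_nat_numeral)
    qed
    have "1 / (k / B ^ 3) * (1 - 272 / B) \<le> 1 / (k / B ^ 3 + B / k) * (1 - 16 / B)"
      using k0 B0 th B by (intro inverse_sum_ge) auto
    then have w: "B ^ 3 / k * (1 - 272 / B) \<le> well t" using 3 by (simp add: t_def add.commute)
    show ?thesis
    proof (rule amgm_bound[OF _ _ _ _ B(1)])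
      show "k / B ^ 5 * (B ^ 3 / k) = (1 / B)\<^sup>2" using k0 B0 by (simp add: field_simps eval_nat_numeral)
      have "k / B ^ 5 * (1 - 272 / B) \<le> k / B ^ 5 * 1" using u kB by (intro mult_left_mono) auto
      then show "k / B ^ 5 * (1 - 272 / B) + B ^ 3 / k * (1 - 272 / B) \<le> k / B ^ 5 + well (B / k + k / B ^ 3)"
        using w by (simp add: t_def)
    qed (use k0 B0 in auto)
  qed
qed

text \<open>The balance points are B^2, B^4, B^6 and B^8. The roots B^3 and B^5 of the second
  condition are nested between the roots B and B^7 of the first, so the dominant pairs are B / k
  with k / B^3, the two summands of P2 / k, B^5 / k with k / B^7, and B^7 / k with k / B^9.\<close>

lemma two_conditions_lower:
  fixes c k B :: real
  assumes c: "0 < c" and k: "c * B \<le> k" and B: "272 \<le> B" "16 / c \<le> B"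
  shows "2 / B * (1 - 272 / B) \<le> k / B ^ 9 + well (B / k + k / B ^ 7) + well (B ^ 3 / k + k / B ^ 5)"
proof -
  have B0: "0 < B" "1 \<le> B" using B by auto
  have k0: "0 < k" using c B0 k by (meson less_le_trans mult_pos_pos)
  define t1 t2 where t: "t1 = B / k + k / B ^ 7" "t2 = B ^ 3 / k + k / B ^ 5"
  have tp: "0 < t1" "0 < t2" unfolding t using B0 k0 by (auto intro!: add_pos_pos divide_pos_pos)
  have w0: "0 \<le> well t1" "0 \<le> well t2" using tp by (auto intro: well_nonneg)
  have u: "1 - 272 / B \<le> 1 - 16 / B" "0 \<le> 1 - 272 / B" "1 - 272 / B \<le> 1" using B by (auto simp: divide_le_eq divide_right_mono)
  have kB: "0 \<le> k / B ^ 9" using k0 B0 by simp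
  have mid: "2 / B * (1 - 272 / B) \<le> 2 / B" 
  proof -
    have "2 / B * (1 - 272 / B) \<le> 2 / B * 1" using u B0 by (intro mult_left_mono) auto
    then show ?thesis by simp
  qed
  have mu: "x * (1 - 272 / B) \<le> x * (1 - 16 / B)" if "0 \<le> x" for x using that by (intro mult_left_mono[OF u(1)]) auto
  have cases: "2 / B \<le> well t \<or> t < 8 / B \<and> t * (1 - 16 / B) \<le> well t \<or> B / 8 < t \<and> 1 / t * (1 - 16 / B) \<le> well t"
    if "0 < t" for t
    by (rule well_cases[of t B]) (use that B in auto)
  have k4: "B ^ 8 \<le> 256 / B * (k * k)" if "B ^ 6 / 16 \<le> k"
  proof -
    have "B ^ 6 / 16 * (B ^ 6 / 16) \<le> k * k" using that k0 B0 by (intro mult_mono) auto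
    moreover have "B ^ 8 * B \<le> B ^ 8 * B ^ 4" using B0 by (intro mult_left_mono self_le_power) auto
    moreover have "B ^ 6 * B ^ 6 = B ^ 8 * B ^ 4" by (simp flip: power_add)
    ultimately have "B ^ 8 * B \<le> 256 * (k * k)" by simp
    then show ?thesis using B0 by (simp add: field_simps)
  qed
  consider (mid) "2 / B \<le> well t1 \<or> 2 / B \<le> well t2" 
    | (high) "B / 8 < t1" "1 / t1 * (1 - 16 / B) \<le> well t1"
    | (low) "t1 * (1 - 16 / B) \<le> well t1" "t2 * (1 - 16 / B) \<le> well t2"
    | (middle) "t1 < 8 / B" "t1 * (1 - 16 / B) \<le> well t1" "B / 8 < t2" "1 / t2 * (1 - 16 / B) \<le> well t2"
    using cases[OF tp(1)] cases[OF tp(2)] by blast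
  then have "2 / B * (1 - 272 / B) \<le> k / B ^ 9 + well t1 + well t2"
  proof cases
    case mid
    then show ?thesis using w0 kB \<open>2 / B * (1 - 272 / B) \<le> 2 / B\<close> by linarith
  next
    case high
    have "B / k \<le> B / (c * B)" using k k0 B0 c by (intro divide_left_mono) auto
    also have "\<dots> = 1 / c" using B0 by simp
    also have "\<dots> \<le> B / 16" using B(2) c by (simp add: field_simps)
    finally have "B / k \<le> B / 16" .
    then have "B / 16 < k / B ^ 7" using high(1) unfolding t by linarith
    then have "B * B ^ 7 / 16 \<le> k" using B0 by (simp add: field_simps)
    moreover have "B ^ 6 \<le> B * B ^ 7" using power_increasing[of 6 "Suc 7" B] B0 unfolding power_Suc by simp
    ultimately have "B ^ 6 / 16 \<le> k" by linarith
    then have th: "B / k \<le> 256 / B * (k / B ^ 7)"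
      using k4 k0 B0 by (simp add: field_simps eval_nat_numeral)
    have "1 / (k / B ^ 7) * (1 - 272 / B) \<le> 1 / (k / B ^ 7 + B / k) * (1 - 16 / B)"
      using k0 B0 th B by (intro inverse_sum_ge) auto
    then have w: "B ^ 7 / k * (1 - 272 / B) \<le> well t1" using high by (simp add: t add.commute)
    have "2 / B * (1 - 272 / B) \<le> k / B ^ 9 + well t1"
    proof (rule amgm_bound[OF _ _ _ _ B(1)])
      show "k / B ^ 9 * (B ^ 7 / k) = (1 / B)\<^sup>2" using k0 B0 by (simp add: field_simps eval_nat_numeral)
      have "k / B ^ 9 * (1 - 272 / B) \<le> k / B ^ 9 * 1" using u kB by (intro mult_left_mono) auto
      then show "k / B ^ 9 * (1 - 272 / B) + B ^ 7 / k * (1 - 272 / B) \<le> k / B ^ 9 + well t1" using w by simp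
    qed (use k0 B0 in auto)
    then show ?thesis using w0 by linarith
  next
    case low
    have "2 / B * (1 - 272 / B) \<le> well t2"
    proof (rule amgm_bound[OF _ _ _ _ B(1)])
      show "B ^ 3 / k * (k / B ^ 5) = (1 / B)\<^sup>2" using k0 B0 by (simp add: field_simps eval_nat_numeral)
      show "B ^ 3 / k * (1 - 272 / B) + k / B ^ 5 * (1 - 272 / B) \<le> well t2"
        using low mu[of t2] tp by (simp add: t distrib_right)
    qed (use k0 B0 in auto)
    then show ?thesis using w0 kB by linarith
  next
    \<comment> \<open>A small \<open>t1\<close> with a large \<open>t2\<close> occurs on either side
      of the two roots of the second condition; the dominant pair then mixes one summand of
      \<open>t1\<close> with the inverse of one of \<open>t2\<close>.\<close>
    case middle
    consider "B / 16 < B ^ 3 / k" | "B / 16 < k / B ^ 5" using middle(3) unfolding t by linarith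
    then have "2 / B * (1 - 272 / B) \<le> well t1 + well t2"
    proof cases
      case 1
      then have ks: "k \<le> 16 * (B * B)" using k0 B0 by (simp add: field_simps power3_eq_cube)
      have th: "k / B ^ 5 \<le> 256 / B * (B ^ 3 / k)"
      proof -
        have "k * k \<le> 16 * (B * B) * (16 * (B * B))" using ks k0 B0 by (intro mult_mono) auto
        also have "\<dots> = 256 * B ^ 4" by (simp add: eval_nat_numeral)
        also have "B ^ 4 \<le> B ^ 7" using B0 by (intro power_increasing) auto
        finally have "k * k \<le> 256 * B ^ 7" by simp
        then show ?thesis using k0 B0 by (simp add: field_simps eval_nat_numeral)
      qed
      have "1 / (B ^ 3 / k) * (1 - 272 / B) \<le> 1 / (B ^ 3 / k + k / B ^ 5) * (1 - 16 / B)"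
        using k0 B0 th B by (intro inverse_sum_ge) auto
      then have w: "k / B ^ 3 * (1 - 272 / B) \<le> well t2" using middle by (simp add: t)
      have "B / k * (1 - 272 / B) \<le> t1 * (1 - 272 / B)" using k0 B0 u by (intro mult_right_mono) (auto simp: t)
      also have "\<dots> \<le> well t1" using mu[of t1] tp middle by linarith
      finally have w1: "B / k * (1 - 272 / B) \<le> well t1" .
      show ?thesis
      proof (rule amgm_bound[OF _ _ _ _ B(1)])
        show "B / k * (k / B ^ 3) = (1 / B)\<^sup>2" using k0 B0 by (simp add: field_simps eval_nat_numeral)
      qed (use k0 B0 w w1 in auto)
    next
      case 2
      then have "B * B ^ 5 / 16 \<le> k" using B0 by (simp add: field_simps)
      then have "B ^ 6 / 16 \<le> k" by (simp add: eval_nat_numeral)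
      then have th: "B ^ 3 / k \<le> 256 / B * (k / B ^ 5)"
        using k4 k0 B0 by (simp add: field_simps eval_nat_numeral)
      have "1 / (k / B ^ 5) * (1 - 272 / B) \<le> 1 / (k / B ^ 5 + B ^ 3 / k) * (1 - 16 / B)"
        using k0 B0 th B by (intro inverse_sum_ge) auto
      then have w: "B ^ 5 / k * (1 - 272 / B) \<le> well t2" using middle by (simp add: t add.commute)
      have "k / B ^ 7 * (1 - 272 / B) \<le> t1 * (1 - 272 / B)" using k0 B0 u by (intro mult_right_mono) (auto simp: t)
      also have "\<dots> \<le> well t1" using mu[of t1] tp middle by linarith
      finally have w1: "k / B ^ 7 * (1 - 272 / B) \<le> well t1" .
      show ?thesis
      proof (rule amgm_bound[OF _ _ _ _ B(1)])
        show "k / B ^ 7 * (B ^ 5 / k) = (1 / B)\<^sup>2" using k0 B0 by (simp add: field_simps eval_nat_numeral)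
      qed (use k0 B0 w w1 in auto)
    qed
    then show ?thesis using kB by linarith
  qed
  then show ?thesis unfolding t .
qed

section \<open>Necessary conditions and stability\<close>

text \<open>The test conditions are symmetric in the roots, and the roots come in no particular
  order from p and 1/q of the conditions; sorting brings them into the form of
  \<open>root_chain\<close>.\<close>

lemma chain_of_list:
  fixes xs :: "real list"
  assumes "length xs = N" "1 \<le> N" "0 \<le> C" "(2 * C + N) * 4 ^ (N + 2) \<le> B"
    and pos: "\<forall>x\<in>set xs. 0 < x"
    and first: "(1 - C / B) / B \<le> (\<Sum>x\<leftarrow>xs. 1 / x)"
    and inner: "\<And>i. i \<in> {1..<N} \<Longrightarrow> 2 * (1 - C / B) / B \<le> (\<Sum>x\<leftarrow>xs. proximity x (B ^ (2 * i)))"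
    and last: "(1 + s) / B \<le> (\<Sum>x\<leftarrow>xs. proximity x (B ^ (2 * N)))" "- C / B \<le> s"
  shows "s \<le> (2 * C + N) * 4 ^ (N + 1) / B"
    and "i \<in> {1..N} \<Longrightarrow> B ^ (2 * i) / B * (1 - (2 * C + N) * 4 ^ (N + 1) / B) \<le> sort xs ! (i - 1)"
    and "i \<in> {1..N} \<Longrightarrow> sort xs ! (i - 1) \<le> B ^ (2 * i) / B * (1 + (2 * C + N) * 4 ^ (N + 1) / B)"
proof -
  define r where "r i = sort xs ! (i - 1)" for i
  have sum: "(\<Sum>j=1..N. f (r j)) = (\<Sum>x\<leftarrow>xs. f x)" for f :: "real \<Rightarrow> real"
  proof -
    have "(\<Sum>x\<leftarrow>xs. f x) = (\<Sum>x\<leftarrow>sort xs. f x)"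
      by (metis mset_map mset_sort sum_mset_sum_list)
    also have "\<dots> = (\<Sum>j=0..<N. f (sort xs ! j))"
      by (simp add: sum_list_sum_nth assms(1))
    also have "\<dots> = (\<Sum>j=1..N. f (r j))"
      by (rule sum.reindex_bij_witness[of _ "\<lambda>j. j - 1" Suc]) (auto simp: r_def)
    finally show ?thesis by simp
  qed
  interpret root_chain N C B s r
  proof
    show "0 < r i" if "i \<in> {1..N}" for i
      using pos that assms(1) nth_mem[of "i - 1" "sort xs"] by (auto simp: r_def)
    show "r i \<le> r j" if "i \<in> {1..N}" "j \<in> {1..N}" "i \<le> j" for i j
      using that assms(1) sorted_nth_mono[OF sorted_sort[of xs], of "i - 1" "j - 1"] by (auto simp: r_def)
    show "(1 - C / B) / B \<le> (\<Sum>j=1..N. 1 / r j)"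
      unfolding sum[of "\<lambda>x. 1 / x"] by (rule first)
    show "2 * (1 - C / B) / B \<le> (\<Sum>j=1..N. proximity (r j) (B ^ (2 * i)))" if "i \<in> {1..<N}" for i
      unfolding sum[of "\<lambda>x. proximity x (B ^ (2 * i))"] by (rule inner[OF that])
    show "(1 + s) / B \<le> (\<Sum>j=1..N. proximity (r j) (B ^ (2 * N)))"
      unfolding sum[of "\<lambda>x. proximity x (B ^ (2 * N))"] by (rule last)
  qed (use assms in auto)
  show "s \<le> (2 * C + N) * 4 ^ (N + 1) / B"
    using slack by (simp only: Z_def)
  show "i \<in> {1..N} \<Longrightarrow> B ^ (2 * i) / B * (1 - (2 * C + N) * 4 ^ (N + 1) / B) \<le> sort xs ! (i - 1)"
    and "i \<in> {1..N} \<Longrightarrow> sort xs ! (i - 1) \<le> B ^ (2 * i) / B * (1 + (2 * C + N) * 4 ^ (N + 1) / B)"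
    using roots[of i] by (simp_all only: Z_def r_def)
qed

lemma proximity_scale: "0 < u \<Longrightarrow> proximity (u * a) (u * b) = proximity a b"
  by (simp add: proximity_def)

lemma proximity_nonneg: "0 < a \<Longrightarrow> 0 < b \<Longrightarrow> 0 \<le> proximity a b"
  by (simp add: proximity_def)

text \<open>P / k = p / k + q k, and the inverse of either summand bounds k / P. For k \<le> p and
  for k \<ge> 1/q a single outer flank suffices; in between, P / k is the sum of the two inner
  flanks. If 1/q < p, then 1 / (q k) is below p / k, so p alone suffices.\<close>

lemma min_symbol_le:
  fixes p q k :: real
  assumes "0 < p" "0 < q" "0 < k"
  shows "min (ventcell_symbol p q k / k) (k / ventcell_symbol p q k) \<le> proximity p k + proximity (1 / q) k"
    and "1 / q < p \<Longrightarrow> min (ventcell_symbol p q k / k) (k / ventcell_symbol p q k) \<le> proximity p k"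
proof -
  define P where "P = ventcell_symbol p q k"
  have P: "P = p + k\<^sup>2 * q" "0 < P" using assms by (auto simp: P_def ventcell_symbol_def intro: add_pos_pos)
  have Pk: "P / k = p / k + k * q" using assms by (simp add: P field_simps power2_eq_square)
  have a: "k / P \<le> k / p" using assms P by (intro divide_left_mono) auto
  have b: "k / P \<le> 1 / (k * q)"
  proof -
    have "k / P \<le> k / (k\<^sup>2 * q)" using assms P by (intro divide_left_mono) auto
    then show ?thesis using assms by (simp add: power2_eq_square)
  qed
  have nn: "0 \<le> proximity p k" "0 \<le> proximity (1 / q) k" using assms by (auto intro: proximity_nonneg)
  have "min (P / k) (k / P) \<le> proximity p k + proximity (1 / q) k"
  proof -
    consider "k \<le> p" | "1 / q \<le> k" | "p \<le> k" "k \<le> 1 / q" by linarith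
    then show ?thesis
    proof cases
      case 1
      then have "k / p \<le> 1" "1 \<le> p / k" using assms by (auto simp: field_simps)
      then have "proximity p k = k / p" unfolding proximity_def by linarith
      then show ?thesis using a nn by linarith
    next
      case 2
      then have "1 / (k * q) \<le> 1" "1 \<le> k * q" using assms by (auto simp: field_simps)
      moreover have "proximity (1 / q) k = min (k * q) (1 / (k * q))" by (simp add: proximity_def mult.commute)
      ultimately have "proximity (1 / q) k = 1 / (k * q)" by linarith
      then show ?thesis using b nn by linarith
    next
      case 3
      then have "1 \<le> k / p" "p / k \<le> 1" "k * q \<le> 1" "1 \<le> 1 / (k * q)" using assms by (auto simp: field_simps)
      then have "proximity p k = p / k" "proximity (1 / q) k = k * q"
        unfolding proximity_def by (simp_all add: mult.commute)
      then show ?thesis using Pk by linarith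
    qed
  qed
  then show "min (ventcell_symbol p q k / k) (k / ventcell_symbol p q k) \<le> proximity p k + proximity (1 / q) k"
    by (simp only: P_def)
  assume lt: "1 / q < p"
  have "min (P / k) (k / P) \<le> proximity p k"
  proof (cases "k \<le> p")
    case True
    then have "k / p \<le> 1" "1 \<le> p / k" using assms by (auto simp: field_simps)
    then have "proximity p k = k / p" unfolding proximity_def by linarith
    then show ?thesis using a by linarith
  next
    case False
    then have "1 \<le> k / p" "p / k \<le> 1" using assms by (auto simp: field_simps)
    then have e: "proximity p k = p / k" unfolding proximity_def by linarith
    have "1 / (k * q) = 1 / q / k" by (simp add: mult.commute)
    also have "\<dots> \<le> p / k" using lt assms by (intro divide_right_mono) auto
    finally show ?thesis using b e by linarith
  qed
  then show "min (ventcell_symbol p q k / k) (k / ventcell_symbol p q k) \<le> proximity p k"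
    by (simp only: P_def)
qed

section \<open>Test frequencies\<close>

context schwarz
begin

text \<open>The unit of frequency. At the lowest frequency 1 - \<rho> is about K (1/p1 + 1/p2); with
  K = 2 u a root p = u B contributes 2 / B, which is what two flanks contribute at the other test
  frequencies.\<close>

definition u :: real where "u = K / 2"

lemma u: "0 < u" using K_pos by (simp add: u_def)

definition w :: real where "w = \<eta> + \<epsilon> / 2"

lemma w: "0 < w" using eta eps by (simp add: w_def)

lemma re_le_w: "0 < k \<Longrightarrow> re k \<le> k * (1 + w / k\<^sup>2)"
  using re_le[of k] by (simp only: w_def)

lemma decay_le: assumes "0 < k" shows "decay k \<le> 1 / (2 * L\<^sup>2 * k\<^sup>2)"
proof -
  define y where "y = 2 * re k * L"
  have y: "2 * k * L \<le> y" "0 < y" using re_ge[of k] L re_pos[of k] by (auto simp: y_def)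
  have "(2 * k * L)\<^sup>2 \<le> y\<^sup>2" using y assms L by (intro power_mono) auto
  moreover have "1 + y + y\<^sup>2 / 2 \<le> exp y" using y by (intro exp_lower_Taylor_quadratic) auto
  moreover have "(2 * k * L)\<^sup>2 = 2 * (2 * L\<^sup>2 * k\<^sup>2)" by (simp add: power_mult_distrib)
  ultimately have "2 * L\<^sup>2 * k\<^sup>2 \<le> exp y" using y by linarith
  moreover have "decay k = 1 / exp y" by (simp add: decay_def y_def exp_minus inverse_eq_divide)
  ultimately show ?thesis using assms L by (simp add: frac_le)
qed

lemma contrast_le:
  assumes "0 < P" "0 < k"
  shows "contrast P k \<le> 4 * ((1 + w / k\<^sup>2) * min (P / k) (k / P))"
proof -
  have x: "0 < re k" "k \<le> re k" "re k \<le> k * (1 + w / k\<^sup>2)" using re_pos re_ge re_le_w assms by auto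
  have w1: "1 \<le> 1 + w / k\<^sup>2" using w by simp
  have dp: "0 < (P + re k)\<^sup>2 + (Im (lam k))\<^sup>2" using assms x by (simp add: add_pos_nonneg)
  have "P\<^sup>2 \<le> (P + re k)\<^sup>2" "(re k)\<^sup>2 \<le> (P + re k)\<^sup>2" using assms x by (auto intro!: power_mono)
  then have ge: "P\<^sup>2 \<le> (P + re k)\<^sup>2 + (Im (lam k))\<^sup>2" "(re k)\<^sup>2 \<le> (P + re k)\<^sup>2 + (Im (lam k))\<^sup>2"
    using zero_le_power2[of "Im (lam k)"] by linarith+
  have "contrast P k \<le> 4 * P * re k / P\<^sup>2"
    unfolding contrast_def using ge(1) assms x dp by (intro divide_left_mono mult_pos_pos) auto
  also have "\<dots> = 4 * (re k / P)" using assms by (simp add: power2_eq_square)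
  also have "\<dots> \<le> 4 * (k * (1 + w / k\<^sup>2) / P)" using x assms by (intro mult_left_mono divide_right_mono) auto
  finally have a: "contrast P k \<le> 4 * ((1 + w / k\<^sup>2) * (k / P))" by (simp add: mult.commute)
  have "contrast P k \<le> 4 * P * re k / (re k)\<^sup>2"
    unfolding contrast_def using ge(2) assms x dp by (intro divide_left_mono mult_pos_pos) auto
  also have "\<dots> = 4 * (P / re k)" using x by (simp add: power2_eq_square)
  also have "\<dots> \<le> 4 * (P / k)" using x assms by (intro mult_left_mono divide_left_mono) auto
  also have "\<dots> \<le> 4 * ((1 + w / k\<^sup>2) * (P / k))"
    using mult_right_mono[OF w1, of "P / k"] assms by simp
  finally have b: "contrast P k \<le> 4 * ((1 + w / k\<^sup>2) * (P / k))" .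
  show ?thesis using a b by (cases "P / k \<le> k / P") (auto simp: min_def)
qed

definition nearness :: "params \<Rightarrow> real \<Rightarrow> real" where
  "nearness = (\<lambda>(p1, q1, p2, q2) k.
     min (ventcell_symbol p1 q1 k / k) (k / ventcell_symbol p1 q1 k) +
     min (ventcell_symbol p2 q2 k / k) (k / ventcell_symbol p2 q2 k))"

definition positive :: "params set" where
  "positive = {(p1, q1, p2, q2). 0 < p1 \<and> 0 < q1 \<and> 0 < p2 \<and> 0 < q2}"

lemma symbol_pos: "0 < p \<Longrightarrow> 0 < q \<Longrightarrow> 0 < ventcell_symbol p q k"
  by (simp add: ventcell_symbol_def add_pos_nonneg)

text \<open>This compares \<open>rho_power4_lower\<close> with (1 - t)^4 \<le> 1 - 4 t + 6 t^2 and
  divides by 4.\<close>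

lemma test_high:
  assumes x: "x \<in> positive" and k: "0 < k" and "0 \<le> \<delta>" "rho \<delta> x k \<le> 1 - t" "0 \<le> t" "t \<le> 1"
  shows "t - 3 / 2 * t\<^sup>2 - 2 * decay k \<le> (1 + w / k\<^sup>2) * (k * \<delta> + nearness x k)"
proof -
  obtain p1 q1 p2 q2 where x_eq: "x = (p1, q1, p2, q2)" and pos: "0 < p1" "0 < q1" "0 < p2" "0 < q2"
    using x by (auto simp: positive_def)
  define P1 P2 where P: "P1 = ventcell_symbol p1 q1 k" "P2 = ventcell_symbol p2 q2 k"
  have Pp: "0 < P1" "0 < P2" using pos by (simp_all add: P symbol_pos)
  have "1 - 4 * re k * \<delta> - contrast P1 k - contrast P2 k - 8 * decay k \<le> rho \<delta> x k ^ 4"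
    unfolding P x_eq by (rule rho_power4_lower) (use Pp assms in \<open>auto simp: P\<close>)
  also have "\<dots> \<le> (1 - t) ^ 4" using assms rho_nonneg by (intro power_mono) auto
  also have "\<dots> = 1 - 4 * t + 6 * t\<^sup>2 - t ^ 3 * (4 - t)" by (simp add: algebra_simps eval_nat_numeral)
  also have "\<dots> \<le> 1 - 4 * t + 6 * t\<^sup>2" using assms by simp
  finally have "4 * t - 6 * t\<^sup>2 - 8 * decay k \<le> 4 * re k * \<delta> + contrast P1 k + contrast P2 k" by linarith
  moreover have "re k * \<delta> \<le> k * (1 + w / k\<^sup>2) * \<delta>" using re_le_w[OF k] assms by (intro mult_right_mono) auto
  moreover note contrast_le[OF Pp(1) k] contrast_le[OF Pp(2) k]
  moreover have "(1 + w / k\<^sup>2) * (k * \<delta> + nearness x k) = k * (1 + w / k\<^sup>2) * \<delta>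
      + ((1 + w / k\<^sup>2) * min (P1 / k) (k / P1) + (1 + w / k\<^sup>2) * min (P2 / k) (k / P2))"
    by (simp add: x_eq nearness_def P distrib_left mult.commute mult.left_commute)
  ultimately show ?thesis by linarith
qed

text \<open>Removes the factor \<open>1 + w / k\<^sup>2\<close>: if the right side exceeds t, the
  claim is immediate; otherwise the correction is at most \<open>w / k\<^sup>2 * t\<close>.\<close>

lemma test_high_absorbed:
  assumes x: "x \<in> positive" and k: "0 < k" and d: "0 \<le> \<delta>" and r: "rho \<delta> x k \<le> 1 - t" "0 \<le> t" "t \<le> 1"
  shows "t - 3 / 2 * t\<^sup>2 - 2 * decay k - w / k\<^sup>2 * t \<le> k * \<delta> + nearness x k"
proof -
  define X where "X = k * \<delta> + nearness x k"
  have "t - 3 / 2 * t\<^sup>2 - 2 * decay k \<le> X + w / k\<^sup>2 * X"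
    using test_high[OF assms] by (simp add: X_def distrib_right)
  moreover have wk: "0 \<le> w / k\<^sup>2" using w by simp
  ultimately show ?thesis
  proof (cases "X \<le> t")
    case True
    then have "w / k\<^sup>2 * X \<le> w / k\<^sup>2 * t" using wk by (intro mult_left_mono) auto
    then show ?thesis using \<open>t - 3 / 2 * t\<^sup>2 - 2 * decay k \<le> X + w / k\<^sup>2 * X\<close> by (simp only: X_def)
  next
    case False
    moreover have "0 \<le> w / k\<^sup>2 * t" by (rule mult_nonneg_nonneg[OF wk r(2)])
    moreover have "0 \<le> 3 / 2 * t\<^sup>2" by simp
    ultimately show ?thesis using decay_bounds(1)[of k] unfolding X_def by linarith
  qed
qed

text \<open>The overlap as a function of the scale \<open>B\<close>; \<open>m = 2, N = 2\<close> in the one-sided and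
  \<open>m = 1, N = 4\<close> in the two-sided case.\<close>

definition overlap :: "real \<Rightarrow> nat \<Rightarrow> real \<Rightarrow> real" where
  "overlap m N B = m / (u * B ^ (2 * N + 1))"

text \<open>All errors are of order 1 / B^2, because t \<le> 8 / B and k \<ge> u B. The constant 96
  is 3/2 times 8^2.\<close>

lemma test_frequency:
  assumes m: "1 \<le> m" "m \<le> 2" and B: "1 \<le> B" "8 \<le> B" and s: "- (1/2) \<le> s" "s \<le> 1" and i: "1 \<le> i" and x: "x \<in> positive"
    and d: "0 \<le> \<delta>" and r: "rho \<delta> x (u * B ^ (2 * i)) \<le> 1 - 2 * m / B * (1 + s)"
  shows "2 * m / B * (1 + s) - (96 + 1 / (L\<^sup>2 * u\<^sup>2) + w / u\<^sup>2) / B\<^sup>2 \<le> u * B ^ (2 * i) * \<delta> + nearness x (u * B ^ (2 * i))"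
proof -
  define k t where kt: "k = u * B ^ (2 * i)" "t = 2 * m / B * (1 + s)"
  have k: "0 < k" using u B by (simp add: kt)
  have kB: "u * B \<le> k" unfolding kt using u B i by (intro mult_left_mono self_le_power) auto
  have tB: "0 \<le> t" "t \<le> 8 / B"
  proof -
    have "2 * m * (1 + s) \<le> 4 * 2" using m s by (intro mult_mono) auto
    then have "2 * m * (1 + s) / B \<le> 8 / B" using B by (intro divide_right_mono) auto
    then show "t \<le> 8 / B" by (simp add: kt)
    show "0 \<le> t" unfolding kt using B m s by (intro mult_nonneg_nonneg divide_nonneg_nonneg) auto
  qed
  have t1: "t \<le> 1" using tB B by (smt (verit) divide_le_eq_1)
  have k2: "u\<^sup>2 * B\<^sup>2 \<le> k\<^sup>2" using kB u B by (simp add: power_mono flip: power_mult_distrib)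
  have "t\<^sup>2 \<le> (8 / B)\<^sup>2" using tB by (intro power_mono) auto
  then have a: "3 / 2 * t\<^sup>2 \<le> 96 / B\<^sup>2" by (simp add: power_divide)
  have "1 / (2 * L\<^sup>2 * k\<^sup>2) \<le> 1 / (2 * L\<^sup>2 * (u\<^sup>2 * B\<^sup>2))" using k2 k L u B by (intro divide_left_mono mult_left_mono mult_pos_pos) auto
  then have b: "2 * decay k \<le> 1 / (L\<^sup>2 * u\<^sup>2) / B\<^sup>2" using decay_le[OF k] by simp
  have "w / k\<^sup>2 * t \<le> w / k\<^sup>2 * 1" using t1 w by (intro mult_left_mono) auto
  also have "w / k\<^sup>2 \<le> w / (u\<^sup>2 * B\<^sup>2)" using k2 k w u B by (intro divide_left_mono mult_pos_pos) auto
  finally have c: "w / k\<^sup>2 * t \<le> w / u\<^sup>2 / B\<^sup>2" by simp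
  have "t - 3 / 2 * t\<^sup>2 - 2 * decay k - w / k\<^sup>2 * t \<le> k * \<delta> + nearness x k"
    by (rule test_high_absorbed) (use x k d r tB t1 in \<open>auto simp: kt\<close>)
  moreover have "(96 + 1 / (L\<^sup>2 * u\<^sup>2) + w / u\<^sup>2) / B\<^sup>2 = 96 / B\<^sup>2 + 1 / (L\<^sup>2 * u\<^sup>2) / B\<^sup>2 + w / u\<^sup>2 / B\<^sup>2"
    by (simp only: add_divide_distrib)
  ultimately show ?thesis unfolding kt(1)[symmetric] kt(2)[symmetric] using a b c by linarith
qed

text \<open>At \<open>kmin\<close> the first-order term is 2 K (1/P1 + 1/P2) with the exact
  constant, by \<open>K_eq\<close>. Passing from P to p \<le> P weakens the inequality in the
  admissible direction.\<close>

lemma test_lowest: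
  obtains C B0 where "0 \<le> C" "8 \<le> B0"
    "\<And>m B s x \<delta>. 1 \<le> m \<Longrightarrow> m \<le> 2 \<Longrightarrow> B0 \<le> B \<Longrightarrow> - (1/2) \<le> s \<Longrightarrow> s \<le> 1 \<Longrightarrow> x \<in> positive \<Longrightarrow> 0 \<le> \<delta> \<Longrightarrow> \<delta> \<le> 2 / (u * B\<^sup>2) \<Longrightarrow>
      rho \<delta> x kmin \<le> 1 - 2 * m / B * (1 + s) \<Longrightarrow>
      m / B * (1 + s) - C / B\<^sup>2 \<le> u / fst x + u / fst (snd (snd x))"
proof -
  define l g D where d: "l = cmod (lam kmin)" "g = (2 / gap * l)\<^sup>2" "D = 2 * re kmin + 8 / (L * gap)"
  have l: "0 < l" unfolding d(1) using norm_lam_ge[of kmin] re_pos[of kmin] by linarith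
  have D: "0 < D" using re_pos[of kmin] L gap by (simp add: d add_pos_pos)
  have g: "0 \<le> g" by (simp add: d)
  define C where "C = (64 + 64 * g / K\<^sup>2 + D * 2 / u) / 4"
  define B0 where "B0 = 8 + 4 * l / u + 32 / (L * gap * u)"
  have C0: "0 \<le> C" using g D u by (simp add: C_def)
  have B08: "8 \<le> B0" using l u L gap by (simp add: B0_def)
  show thesis
  proof (rule that[OF C0 B08])
    fix m B s \<delta> :: real and x
    assume m: "1 \<le> m" "m \<le> 2" and B: "B0 \<le> B" and s: "- (1/2) \<le> s" "s \<le> 1" and x: "x \<in> positive"
      and dl: "0 \<le> \<delta>" "\<delta> \<le> 2 / (u * B\<^sup>2)" and r: "rho \<delta> x kmin \<le> 1 - 2 * m / B * (1 + s)"
    obtain p1 q1 p2 q2 where x_eq: "x = (p1, q1, p2, q2)" and pos: "0 < p1" "0 < q1" "0 < p2" "0 < q2"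
      using x by (auto simp: positive_def)
    have B8: "8 \<le> B" using B B08 by simp
    define t where "t = 2 * m / B * (1 + s)"
    have tB: "0 \<le> t" "t \<le> 8 / B"
    proof -
      have "2 * m * (1 + s) \<le> 4 * 2" using m s by (intro mult_mono) auto
      then have "2 * m * (1 + s) / B \<le> 8 / B" using B8 by (intro divide_right_mono) auto
      then show "t \<le> 8 / B" by (simp add: t_def)
      show "0 \<le> t" unfolding t_def using B8 m s by (intro mult_nonneg_nonneg divide_nonneg_nonneg) auto
    qed
    have t1: "t \<le> 1" using tB B8 by (smt (verit) divide_le_eq_1)
    have t2: "t\<^sup>2 \<le> 64 / B\<^sup>2" using power_mono[OF tB(2,1), of 2] by (simp add: power_divide)
    define P1 P2 where P: "P1 = ventcell_symbol p1 q1 kmin" "P2 = ventcell_symbol p2 q2 kmin"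
    have Pp: "p1 \<le> P1" "p2 \<le> P2" "0 < P1" "0 < P2" using pos by (auto simp: P ventcell_symbol_def add_pos_nonneg)
    have inv: "1 / P1 \<le> 1 / p1" "1 / P2 \<le> 1 / p2" "0 < 1 / P1" "0 < 1 / P2" using Pp pos by (auto intro!: divide_left_mono)
    have K2: "K = 2 * u" by (simp add: u_def)
    have "t \<le> K * (1 / p1 + 1 / p2) + 2 * C / B\<^sup>2"
    proof (cases "l \<le> P1 \<and> l \<le> P2")
      case False
      then have "1 / l \<le> 1 / P1 + 1 / P2" using l Pp inv
        by (smt (verit) frac_le)
      then have "K * (1 / l) \<le> K * (1 / p1 + 1 / p2)" using inv K_pos by (intro mult_left_mono) auto
      moreover have "t \<le> K * (1 / l)"
      proof -
        have "4 * l / u \<le> B" using B l u L gap by (simp add: B0_def) (smt (verit) divide_nonneg_pos mult_pos_pos)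
        then have "8 / B \<le> K * (1 / l)" using l u B8 by (simp add: K2 field_simps)
        then show ?thesis using tB by linarith
      qed
      ultimately show ?thesis using C0 by (smt (verit) divide_nonneg_nonneg zero_le_power2)
    next
      case True
      define \<sigma> where "\<sigma> = 1 / P1 + 1 / P2"
      have sg: "0 < \<sigma>" "\<sigma> \<le> 1 / p1 + 1 / p2" unfolding \<sigma>_def using inv by linarith+
      have ov: "4 / (L * gap) * \<delta> \<le> 1 / 4"
      proof -
        have "32 / (L * gap * u) \<le> B" using B l u by (simp add: B0_def) (smt (verit) divide_nonneg_pos mult_pos_pos)
        also have "B \<le> B\<^sup>2" using B8 by (simp add: self_le_power)
        finally have "32 / (L * gap * u) \<le> B\<^sup>2" .
        then have "4 / (L * gap) * (2 / (u * B\<^sup>2)) \<le> 1 / 4" using L gap u B8 by (simp add: field_simps)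
        moreover have "4 / (L * gap) * \<delta> \<le> 4 / (L * gap) * (2 / (u * B\<^sup>2))" using dl L gap by (intro mult_left_mono) auto
        ultimately show ?thesis by linarith
      qed
      have "1 - ((2 * re kmin * \<delta> + 8 / (L * gap) * \<delta>) + ((S kmin / P2 + (2 / gap * cmod (lam kmin))\<^sup>2 / P2\<^sup>2) + (S kmin / P1 + (2 / gap * cmod (lam kmin))\<^sup>2 / P1\<^sup>2)))
          \<le> (rho \<delta> x kmin)\<^sup>2"
        unfolding P x_eq by (rule rho_square_lower_low) (use Pp dl ov True in \<open>auto simp: P d\<close>)
      moreover have "2 * re kmin * \<delta> + 8 / (L * gap) * \<delta> = D * \<delta>" by (simp add: d distrib_right)
      moreover have "(S kmin / P2 + g / P2\<^sup>2) + (S kmin / P1 + g / P1\<^sup>2) \<le> 2 * K * \<sigma> + g * \<sigma>\<^sup>2"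
      proof -
        have "0 \<le> 1 / P1 * (1 / P2)" using inv by (intro mult_nonneg_nonneg) auto
        then have "(1 / P1)\<^sup>2 + (1 / P2)\<^sup>2 \<le> \<sigma>\<^sup>2" unfolding \<sigma>_def power2_sum by linarith
        then have "g * ((1 / P1)\<^sup>2 + (1 / P2)\<^sup>2) \<le> g * \<sigma>\<^sup>2" using g by (intro mult_left_mono) auto
        moreover have "g / P1\<^sup>2 = g * (1 / P1)\<^sup>2" "g / P2\<^sup>2 = g * (1 / P2)\<^sup>2" by (simp_all add: power_divide)
        moreover have "S kmin / P1 + S kmin / P2 = 2 * K * \<sigma>" by (simp add: K_eq \<sigma>_def distrib_left)
        ultimately show ?thesis by (simp add: distrib_left)
      qed
      moreover have "(rho \<delta> x kmin)\<^sup>2 \<le> (1 - t)\<^sup>2" using r rho_nonneg by (intro power_mono) (auto simp: t_def)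
      moreover have "(1 - t)\<^sup>2 = 1 - 2 * t + t\<^sup>2" by (simp add: power2_eq_square algebra_simps)
      ultimately have main: "2 * t \<le> 2 * K * \<sigma> + g * \<sigma>\<^sup>2 + D * \<delta> + t\<^sup>2" unfolding d(1)[symmetric] d(2)[symmetric] by linarith
      show ?thesis
      \<comment> \<open>Either the first-order term alone suffices, or \<sigma> is of order 1/B and
        the quadratic term is an error of order 1 / B^2.\<close>
      proof (cases "K * \<sigma> \<le> t")
        case False
        moreover have "K * \<sigma> \<le> K * (1 / p1 + 1 / p2)" using sg K_pos by (intro mult_left_mono) auto
        ultimately show ?thesis using C0 by (smt (verit) divide_nonneg_nonneg zero_le_power2)
      next
        case True
        have "(K * \<sigma>)\<^sup>2 \<le> t\<^sup>2" using True sg K_pos by (intro power_mono) auto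
        then have "(K * \<sigma>)\<^sup>2 \<le> 64 / B\<^sup>2" using t2 by linarith
        then have "\<sigma>\<^sup>2 * K\<^sup>2 \<le> 64 / B\<^sup>2" by (simp only: power_mult_distrib mult.commute)
        moreover have "0 < K\<^sup>2" using K_pos by simp
        ultimately have "\<sigma>\<^sup>2 \<le> 64 / B\<^sup>2 / K\<^sup>2" by (simp only: pos_le_divide_eq)
        then have "g * \<sigma>\<^sup>2 \<le> g * (64 / B\<^sup>2 / K\<^sup>2)" using g by (intro mult_left_mono) auto
        moreover have "D * \<delta> \<le> D * (2 / (u * B\<^sup>2))" using dl D by (intro mult_left_mono) auto
        moreover have "4 * C / B\<^sup>2 = 64 / B\<^sup>2 + g * (64 / B\<^sup>2 / K\<^sup>2) + D * (2 / (u * B\<^sup>2))"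
          unfolding C_def by (simp add: add_divide_distrib mult_ac)
        moreover have "K * \<sigma> \<le> K * (1 / p1 + 1 / p2)" using sg K_pos by (intro mult_left_mono) auto
        ultimately show ?thesis using main t2 by linarith
      qed
    qed
    moreover have "t = 2 * (m / B * (1 + s))" by (simp add: t_def)
    moreover have "K * (1 / p1 + 1 / p2) = 2 * (u / p1 + u / p2)" by (simp add: K2 distrib_left)
    ultimately show "m / B * (1 + s) - C / B\<^sup>2 \<le> u / fst x + u / fst (snd (snd x))" by (simp add: x_eq)
  qed
qed

end

section \<open>Necessary conditions on the roots\<close>

context schwarz
begin

text \<open>The overlap is negligible at the inner test frequencies. At the last one it contributes
  m / B, taking the place of a next root at \<open>B ^ (2 * N + 1)\<close>.\<close>

lemma overlap_bounds:
  assumes "0 \<le> m" "m \<le> 2" "1 \<le> N" "1 \<le> B"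
  shows "0 \<le> overlap m N B" "overlap m N B \<le> 2 / (u * B\<^sup>2)"
    and "i < N \<Longrightarrow> u * B ^ (2 * i) * overlap m N B \<le> m / B\<^sup>2"
    and "u * B ^ (2 * N) * overlap m N B = m / B"
proof -
  show "0 \<le> overlap m N B" using assms u by (simp add: overlap_def)
  have "B\<^sup>2 \<le> B ^ (2 * N + 1)" using assms by (intro power_increasing) auto
  then show "overlap m N B \<le> 2 / (u * B\<^sup>2)"
    unfolding overlap_def using assms u by (intro frac_le mult_left_mono) auto
  show "u * B ^ (2 * N) * overlap m N B = m / B" using assms u by (simp add: overlap_def)
  assume "i < N"
  then have "B ^ (2 * i + 2) \<le> B ^ (2 * N + 1)" using assms by (intro power_increasing) auto
  then have "m * (B ^ (2 * i) / B ^ (2 * N + 1)) \<le> m * (B ^ (2 * i) / B ^ (2 * i + 2))"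
    using assms by (intro mult_left_mono divide_left_mono) auto
  also have "\<dots> = m / B\<^sup>2" using assms by (simp add: power_add power2_eq_square)
  finally show "u * B ^ (2 * i) * overlap m N B \<le> m / B\<^sup>2" using u by (simp add: overlap_def mult.commute)
qed

text \<open>The hypotheses of \<open>root_chain\<close> multiplied by m. The lower bound - Cs / B on
  the slack is absorbed into C, except at the last frequency: there the overlap takes one half of 2
  m / B, and the slack reappears doubled relative to what is left.\<close>

lemma necessary:
  fixes m Cs :: real and N :: nat
  assumes m: "1 \<le> m" "m \<le> 2" and N: "1 \<le> N" and Cs: "0 \<le> Cs"
  obtains C B0 where "0 \<le> C" "8 \<le> B0"
    "\<And>B s x. B0 \<le> B \<Longrightarrow> - Cs / B \<le> s \<Longrightarrow> s \<le> 1 \<Longrightarrow> x \<in> positive \<Longrightarrow>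
      rho (overlap m N B) x kmin \<le> 1 - 2 * m / B * (1 + s) \<Longrightarrow>
      (\<And>i. i \<in> {1..N} \<Longrightarrow> rho (overlap m N B) x (u * B ^ (2 * i)) \<le> 1 - 2 * m / B * (1 + s)) \<Longrightarrow>
      m * ((1 - C / B) / B) \<le> u / fst x + u / fst (snd (snd x)) \<and>
      (\<forall>i\<in>{1..<N}. m * (2 * (1 - C / B) / B) \<le> nearness x (u * B ^ (2 * i))) \<and>
      m * ((1 + (2 * s - C / B)) / B) \<le> nearness x (u * B ^ (2 * N))"
proof -
  obtain Cl B1 where Cl: "0 \<le> Cl" "8 \<le> B1" and low: "\<And>m B s x \<delta>. 1 \<le> m \<Longrightarrow> m \<le> 2 \<Longrightarrow> B1 \<le> B \<Longrightarrow> - (1/2) \<le> s \<Longrightarrow> s \<le> 1 \<Longrightarrow> x \<in> positive \<Longrightarrow> 0 \<le> \<delta> \<Longrightarrow> \<delta> \<le> 2 / (u * B\<^sup>2) \<Longrightarrow>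
      rho \<delta> x kmin \<le> 1 - 2 * m / B * (1 + s) \<Longrightarrow>
      m / B * (1 + s) - Cl / B\<^sup>2 \<le> u / fst x + u / fst (snd (snd x))"
    using test_lowest by blast
  define Q where "Q = 96 + 1 / (L\<^sup>2 * u\<^sup>2) + w / u\<^sup>2"
  have Q: "0 \<le> Q" using w by (simp add: Q_def)
  define C where "C = Q + Cl + Cs + 2"
  have C: "0 \<le> C" using Q Cl Cs by (simp add: C_def)
  show thesis
  proof (rule that[OF C])
    show "8 \<le> B1 + 2 * Cs" using Cl Cs by simp
    fix B s :: real and x
    assume B: "B1 + 2 * Cs \<le> B" and s: "- Cs / B \<le> s" "s \<le> 1" and x: "x \<in> positive"
      and r0: "rho (overlap m N B) x kmin \<le> 1 - 2 * m / B * (1 + s)"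
      and ri: "\<And>i. i \<in> {1..N} \<Longrightarrow> rho (overlap m N B) x (u * B ^ (2 * i)) \<le> 1 - 2 * m / B * (1 + s)"
    have B8: "8 \<le> B" "1 \<le> B" "B1 \<le> B" using B Cs Cl by auto
    have "Cs / B \<le> 1 / 2" using B B8 Cl by (simp add: divide_le_eq)
    then have s2: "- (1/2) \<le> s" using s by linarith
    have ms: "- (m * Cs / B\<^sup>2) \<le> m / B * s"
    proof -
      have "m / B * (- Cs / B) \<le> m / B * s" using s m B8 by (intro mult_left_mono) auto
      then show ?thesis by (simp add: power2_eq_square)
    qed
    note ov = overlap_bounds[of m N B]
    have tf: "2 * m / B * (1 + s) - Q / B\<^sup>2 \<le> u * B ^ (2 * i) * overlap m N B + nearness x (u * B ^ (2 * i))" if "i \<in> {1..N}" for i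
      unfolding Q_def by (rule test_frequency) (use m B8 s s2 x ri that ov N in auto)
    have e2: "2 * m / B * (1 + s) = 2 * (m / B) + 2 * (m / B * s)" "m / B * (1 + s) = m / B + m / B * s"
      by (simp_all add: distrib_left)
    have scale: "a \<le> b \<Longrightarrow> a / B\<^sup>2 \<le> b / B\<^sup>2" for a b :: real using B8 by (simp add: divide_right_mono)
    have mm: "a \<le> m * a" if "0 \<le> a" for a using that m mult_right_mono[of 1 m a] by simp
    have mC: "m * C = m * Q + m * Cl + m * Cs + m * 2" by (simp add: C_def distrib_left)
    have "m * ((1 - C / B) / B) = m / B - m * C / B\<^sup>2" by (simp add: power2_eq_square diff_divide_distrib right_diff_distrib)
    moreover have "m * Cs / B\<^sup>2 + Cl / B\<^sup>2 \<le> m * C / B\<^sup>2"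
      using scale[of "m * Cs + Cl" "m * C"] mm[OF Cl(1)] mm[OF Q] Q m unfolding mC by (simp add: add_divide_distrib)
    moreover have "m / B * (1 + s) - Cl / B\<^sup>2 \<le> u / fst x + u / fst (snd (snd x))"
      by (rule low) (use m B8 s s2 x r0 ov N in auto)
    ultimately have E0: "m * ((1 - C / B) / B) \<le> u / fst x + u / fst (snd (snd x))"
      using ms unfolding e2 by linarith
    have Ei: "m * (2 * (1 - C / B) / B) \<le> nearness x (u * B ^ (2 * i))" if i: "i \<in> {1..<N}" for i
    proof -
      have "m * (2 * (1 - C / B) / B) = 2 * (m / B) - 2 * (m * C) / B\<^sup>2"
        by (simp add: power2_eq_square diff_divide_distrib right_diff_distrib mult_ac)
      moreover have "2 * (m * Cs / B\<^sup>2) + Q / B\<^sup>2 + m / B\<^sup>2 \<le> 2 * (m * C) / B\<^sup>2"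
      proof -
        have "0 \<le> m * Cl" using m Cl by simp
        moreover have "2 * (m * C) = 2 * (m * Q) + 2 * (m * Cl) + 2 * (m * Cs) + 4 * m" unfolding mC by simp
        ultimately have "2 * (m * Cs) + Q + m \<le> 2 * (m * C)" using mm[OF Q] Q m by linarith
        from scale[OF this] show ?thesis by (simp add: add_divide_distrib)
      qed
      moreover have "u * B ^ (2 * i) * overlap m N B \<le> m / B\<^sup>2" using ov(3)[of i] i m N B8 by auto
      ultimately show ?thesis using tf[of i] i ms unfolding e2 by auto
    qed
    have EN: "m * ((1 + (2 * s - C / B)) / B) \<le> nearness x (u * B ^ (2 * N))"
    proof -
      have "m * ((1 + (2 * s - C / B)) / B) = m / B + 2 * (m / B * s) - m * C / B\<^sup>2"
        by (simp add: power2_eq_square add_divide_distrib diff_divide_distrib distrib_left right_diff_distrib mult_ac)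
      moreover have "Q / B\<^sup>2 \<le> m * C / B\<^sup>2"
      proof -
        have "0 \<le> m * Cl" "0 \<le> m * Cs" using m Cl Cs by auto
        then have "Q \<le> m * C" using mm[OF Q] m unfolding mC by linarith
        from scale[OF this] show ?thesis .
      qed
      moreover have "u * B ^ (2 * N) * overlap m N B = m / B" using ov(4) m N B8 by auto
      ultimately show ?thesis using tf[of N] N unfolding e2 by auto
    qed
    show "m * ((1 - C / B) / B) \<le> u / fst x + u / fst (snd (snd x)) \<and>
      (\<forall>i\<in>{1..<N}. m * (2 * (1 - C / B) / B) \<le> nearness x (u * B ^ (2 * i))) \<and>
      m * ((1 + (2 * s - C / B)) / B) \<le> nearness x (u * B ^ (2 * N))"
      using E0 Ei EN by blast
  qed
qed

text \<open>If \<open>p q > 1\<close>, the equation \<open>k = p + q k\<^sup>2\<close> has no root between \<open>p\<close> and \<open>1/q\<close>, and the condition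
  only contributes through \<open>p\<close>; its second root is then replaced by a value \<open>W\<close> out of range.\<close>

definition upper_root :: "real \<Rightarrow> real \<Rightarrow> real \<Rightarrow> real" where
  "upper_root W p q = (if 1 / q < p then W else 1 / (q * u))"

section \<open>Position of near-optimal parameters\<close>

lemma symbol_nearness_le:
  assumes "0 < p" "0 < q" "0 < \<kappa>" "0 < W"
  shows "min (ventcell_symbol p q (u * \<kappa>) / (u * \<kappa>)) (u * \<kappa> / ventcell_symbol p q (u * \<kappa>))
    \<le> proximity (p / u) \<kappa> + proximity (upper_root W p q) \<kappa>"
proof -
  have k: "0 < u * \<kappa>" using u assms by simp
  have p: "proximity p (u * \<kappa>) = proximity (p / u) \<kappa>"
    using proximity_scale[OF u, of "p / u" \<kappa>] u by simp
  have q: "proximity (1 / q) (u * \<kappa>) = proximity (1 / (q * u)) \<kappa>"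
    using proximity_scale[OF u, of "1 / (q * u)" \<kappa>] u by simp
  show ?thesis
  proof (cases "1 / q < p")
    case True
    then show ?thesis using min_symbol_le(2)[OF assms(1,2) k True] p proximity_nonneg[OF assms(4,3)]
      by (simp add: upper_root_def)
  next
    case False
    then show ?thesis using min_symbol_le(1)[OF assms(1,2) k] p q by (simp add: upper_root_def)
  qed
qed

text \<open>The chain keeps every sorted root below \<open>2 * B ^ (2 * N)\<close>. A placeholder
  above this bound therefore cannot occur in the list, so each condition has a genuine upper
  root.\<close>

lemma out_of_range:
  fixes xs :: "real list" and E B :: real
  assumes len: "length xs = N" and EB: "E \<le> B" "1 \<le> B" and E0: "0 \<le> E"
    and upper: "\<And>i. i \<in> {1..N} \<Longrightarrow> sort xs ! (i - 1) \<le> B ^ (2 * i) / B * (1 + E / B)"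
  shows "2 * B ^ (2 * N) + 1 \<notin> set xs"
proof
  assume "2 * B ^ (2 * N) + 1 \<in> set xs"
  then have "2 * B ^ (2 * N) + 1 \<in> set (sort xs)" by (simp only: set_sort)
  then obtain j where j: "j < N" "sort xs ! j = 2 * B ^ (2 * N) + 1"
    unfolding in_set_conv_nth using len by auto
  have "B ^ (2 * Suc j) / B \<le> B ^ (2 * Suc j) / 1" using EB by (intro divide_left_mono) auto
  also have "\<dots> \<le> B ^ (2 * N)" using j EB by (simp only: div_by_1, intro power_increasing) auto
  finally have "B ^ (2 * Suc j) / B \<le> B ^ (2 * N)" .
  moreover have "1 + E / B \<le> 2" using EB by simp
  ultimately have "B ^ (2 * Suc j) / B * (1 + E / B) \<le> B ^ (2 * N) * 2"
    using EB E0 by (intro mult_mono) auto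
  moreover have "sort xs ! j \<le> B ^ (2 * Suc j) / B * (1 + E / B)" using upper[of "Suc j"] j(1) by simp
  ultimately have "sort xs ! j \<le> 2 * B ^ (2 * N)" by linarith
  then show False using j by simp
qed

text \<open>Serves two purposes: with Cs = 0 and a positive s it bounds the min-max value from
  below; with a negative s of order 1/B it locates all parameters that are as good as the explicit
  choice. Since the two conditions coincide, the factor m = 2 cancels and two roots remain.\<close>

lemma one_sided_stability:
  fixes Cs :: real
  assumes Cs: "0 \<le> Cs"
  obtains E B0 where "0 \<le> E" "8 \<le> B0"
    "\<And>B s p q. B0 \<le> B \<Longrightarrow> - Cs / B \<le> s \<Longrightarrow> s \<le> 1 \<Longrightarrow> 0 < p \<Longrightarrow> 0 < q \<Longrightarrow>
      rho (overlap 2 2 B) (p, q, p, q) kmin \<le> 1 - 4 / B * (1 + s) \<Longrightarrow>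
      (\<And>i. i \<in> {1..2} \<Longrightarrow> rho (overlap 2 2 B) (p, q, p, q) (u * B ^ (2 * i)) \<le> 1 - 4 / B * (1 + s)) \<Longrightarrow>
      2 * s \<le> E / B \<and> \<bar>p / (u * B) - 1\<bar> \<le> E / B \<and> \<bar>1 / (q * u * B ^ 3) - 1\<bar> \<le> E / B"
proof -
  obtain C B1 where C: "0 \<le> C" "8 \<le> B1" and nec: "\<And>B s x. B1 \<le> B \<Longrightarrow> - Cs / B \<le> s \<Longrightarrow> s \<le> 1 \<Longrightarrow> x \<in> positive \<Longrightarrow>
      rho (overlap 2 2 B) x kmin \<le> 1 - 2 * 2 / B * (1 + s) \<Longrightarrow>
      (\<And>i. i \<in> {1..2} \<Longrightarrow> rho (overlap 2 2 B) x (u * B ^ (2 * i)) \<le> 1 - 2 * 2 / B * (1 + s)) \<Longrightarrow>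
      2 * ((1 - C / B) / B) \<le> u / fst x + u / fst (snd (snd x)) \<and>
      (\<forall>i\<in>{1..<2}. 2 * (2 * (1 - C / B) / B) \<le> nearness x (u * B ^ (2 * i))) \<and>
      2 * ((1 + (2 * s - C / B)) / B) \<le> nearness x (u * B ^ (2 * 2))"
    by (rule necessary[of 2 2 Cs]) (use Cs in auto)
  \<comment> \<open>The slack handed to the chain is 2 s - C / B, which is at least - (C + 2 Cs) /
    B.\<close>
  define C' where "C' = C + 2 * Cs"
  define E where "E = (2 * C' + 2) * 4 ^ 4"
  have C': "0 \<le> C'" "C \<le> C'" using C Cs by (auto simp: C'_def)
  have E: "0 \<le> E" "C \<le> E" using C' by (auto simp: E_def)
  show thesis
  proof (rule that[of "2 * E" "B1 + E"])
    show "0 \<le> 2 * E" "8 \<le> B1 + E" using E C by auto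
    fix B s p q :: real
    assume B: "B1 + E \<le> B" and s: "- Cs / B \<le> s" "s \<le> 1" and pos: "0 < p" "0 < q"
      and r0: "rho (overlap 2 2 B) (p, q, p, q) kmin \<le> 1 - 4 / B * (1 + s)"
      and ri: "\<And>i. i \<in> {1..2} \<Longrightarrow> rho (overlap 2 2 B) (p, q, p, q) (u * B ^ (2 * i)) \<le> 1 - 4 / B * (1 + s)"
    have B8: "8 \<le> B" "B1 \<le> B" "E \<le> B" using B C E by auto
    have x: "(p, q, p, q) \<in> positive" using pos by (simp add: positive_def)
    have N: "2 * ((1 - C / B) / B) \<le> u / fst (p, q, p, q) + u / fst (snd (snd (p, q, p, q))) \<and>
      (\<forall>i\<in>{1..<2}. 2 * (2 * (1 - C / B) / B) \<le> nearness (p, q, p, q) (u * B ^ (2 * i))) \<and>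
      2 * ((1 + (2 * s - C / B)) / B) \<le> nearness (p, q, p, q) (u * B ^ (2 * 2))"
      by (rule nec[OF B8(2) s x]) (use r0 ri in auto)
    have n: "2 * ((1 - C / B) / B) \<le> u / p + u / p"
      "2 * (2 * (1 - C / B) / B) \<le> nearness (p, q, p, q) (u * B ^ 2)"
      "2 * ((1 + (2 * s - C / B)) / B) \<le> nearness (p, q, p, q) (u * B ^ 4)"
      using N N[THEN conjunct2, THEN conjunct1, rule_format, of 1] by simp_all
    define W where "W = 2 * B ^ (2 * 2) + 1"
    have W: "0 < W" using B8 by (simp add: W_def add_pos_pos)
    define xs where "xs = [p / u, upper_root W p q]"
    have ur: "0 < upper_root W p q" using W pos u by (simp add: upper_root_def)
    have near: "nearness (p, q, p, q) (u * \<kappa>) \<le> 2 * (\<Sum>x\<leftarrow>xs. proximity x \<kappa>)" if "0 < \<kappa>" for \<kappa>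
      using symbol_nearness_le[OF pos that W] by (simp add: nearness_def xs_def)
    have CB: "(1 - C' / B) \<le> (1 - C / B)" using C' B8 by (simp add: divide_right_mono)
    have B0: "0 < B" using B8 by simp
    have len: "length xs = 2" by (simp add: xs_def)
    have large: "(2 * C' + real 2) * 4 ^ (2 + 2) \<le> B" using B8 by (simp add: E_def)
    have xpos: "\<forall>x\<in>set xs. 0 < x" using pos u ur by (simp add: xs_def)
    have c1: "(1 - C' / B) / B \<le> (\<Sum>x\<leftarrow>xs. 1 / x)"
    proof -
      have "(1 - C' / B) / B \<le> (1 - C / B) / B" using CB B0 by (intro divide_right_mono) auto
      moreover have "(1 - C / B) / B \<le> u / p" using n(1) by linarith
      moreover have "0 \<le> 1 / upper_root W p q" using ur by simp
      moreover have "(\<Sum>x\<leftarrow>xs. 1 / x) = u / p + 1 / upper_root W p q" by (simp add: xs_def)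
      ultimately show ?thesis by linarith
    qed
    have c2: "2 * (1 - C' / B) / B \<le> (\<Sum>x\<leftarrow>xs. proximity x (B ^ (2 * i)))" if "i \<in> {1..<2}" for i
    proof -
      have i: "i = 1" using that by auto
      have "2 * (1 - C' / B) / B \<le> 2 * (1 - C / B) / B" using CB B0 by (intro divide_right_mono) auto
      moreover have "nearness (p, q, p, q) (u * B\<^sup>2) \<le> 2 * (\<Sum>x\<leftarrow>xs. proximity x (B\<^sup>2))"
        using B0 by (intro near) simp
      ultimately show ?thesis using n(2) unfolding i by (simp only: mult_1_right; linarith)
    qed
    have c3: "(1 + (2 * s - C / B)) / B \<le> (\<Sum>x\<leftarrow>xs. proximity x (B ^ (2 * 2)))"
    proof -
      have "nearness (p, q, p, q) (u * B ^ 4) \<le> 2 * (\<Sum>x\<leftarrow>xs. proximity x (B ^ 4))"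
        using B0 by (intro near) simp
      then have "(1 + (2 * s - C / B)) / B \<le> (\<Sum>x\<leftarrow>xs. proximity x (B ^ 4))" using n(3) by linarith
      then show ?thesis by simp
    qed
    have c4: "- C' / B \<le> 2 * s - C / B"
    proof -
      have "C' / B = C / B + 2 * (Cs / B)" by (simp add: C'_def add_divide_distrib)
      then show ?thesis using s(1) unfolding minus_divide_left[symmetric] by linarith
    qed
    note ch = chain_of_list[OF len _ C'(1) large xpos c1 c2 c3 c4]
    define E' where "E' = (2 * C' + real 2) * 4 ^ (2 + 1)"
    have E': "E' \<le> E" "0 \<le> E'" using C' by (auto simp: E'_def E_def)
    have EB: "E' / B \<le> E / B" "0 \<le> E' / B" "E / B \<le> 2 * E / B" using E' B0 E by (auto simp: divide_right_mono)
    have "2 * s - C / B \<le> E' / B" using ch(1) by (simp only: E'_def)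
    moreover have "C / B \<le> E / B" using E B0 by (simp add: divide_right_mono)
    ultimately have S: "2 * s \<le> 2 * E / B" using EB by linarith
    have lo: "i \<in> {1..2} \<Longrightarrow> B ^ (2 * i) / B * (1 - E' / B) \<le> sort xs ! (i - 1)"
      and hi: "i \<in> {1..2} \<Longrightarrow> sort xs ! (i - 1) \<le> B ^ (2 * i) / B * (1 + E' / B)" for i
      using ch(2,3)[of i] by (simp_all only: E'_def)
    have "W \<notin> set xs" unfolding W_def by (rule out_of_range[OF len _ _ _ hi]) (use B8 E' in auto)
    then have nlt: "\<not> 1 / q < p" by (auto simp: xs_def upper_root_def)
    have srt: "sort xs = [p / u, 1 / (q * u)]"
    proof -
      have "p / u \<le> 1 / q / u" using nlt u by (intro divide_right_mono) auto
      then show ?thesis using nlt by (simp add: xs_def upper_root_def)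
    qed
    have p: "B * (1 - E' / B) \<le> p / u" "p / u \<le> B * (1 + E' / B)"
      using lo[of 1] hi[of 1] B0 by (simp_all add: srt power2_eq_square)
    have q: "B ^ 3 * (1 - E' / B) \<le> 1 / (q * u)" "1 / (q * u) \<le> B ^ 3 * (1 + E' / B)"
      using lo[of 2] hi[of 2] B0 by (simp_all add: srt eval_nat_numeral)
    have rel: "\<bar>y / b - 1\<bar> \<le> 2 * E / B" if "b * (1 - E' / B) \<le> y" "y \<le> b * (1 + E' / B)" "0 < b" for y b
    proof -
      have "1 - E' / B \<le> y / b" "y / b \<le> 1 + E' / B" using that by (auto simp: field_simps)
      then show ?thesis using EB by linarith
    qed
    have "\<bar>p / (u * B) - 1\<bar> \<le> 2 * E / B" using rel[OF p B0] by (simp add: mult.commute)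
    moreover have "\<bar>1 / (q * u * B ^ 3) - 1\<bar> \<le> 2 * E / B" using rel[OF q] B0 by (simp add: mult.assoc)
    ultimately show "2 * s \<le> 2 * E / B \<and> \<bar>p / (u * B) - 1\<bar> \<le> 2 * E / B \<and> \<bar>1 / (q * u * B ^ 3) - 1\<bar> \<le> 2 * E / B"
      using S by blast
  qed
qed

text \<open>The chain treats the four roots as an unlabelled collection, so the bound on s needs no
  ordering and applies to all of \<open>two_sided\<close>. The ordering decides which root belongs
  to which condition.\<close>

lemma two_sided_stability:
  fixes Cs :: real
  assumes Cs: "0 \<le> Cs"
  obtains E B0 where "0 \<le> E" "8 \<le> B0"
    "\<And>B s p1 q1 p2 q2. B0 \<le> B \<Longrightarrow> - Cs / B \<le> s \<Longrightarrow> s \<le> 1 \<Longrightarrow> (p1, q1, p2, q2) \<in> positive \<Longrightarrow>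
      rho (overlap 1 4 B) (p1, q1, p2, q2) kmin \<le> 1 - 2 / B * (1 + s) \<Longrightarrow>
      (\<And>i. i \<in> {1..4} \<Longrightarrow> rho (overlap 1 4 B) (p1, q1, p2, q2) (u * B ^ (2 * i)) \<le> 1 - 2 / B * (1 + s)) \<Longrightarrow>
      2 * s \<le> E / B \<and> (p1 < p2 \<longrightarrow> q1 < q2 \<longrightarrow>
        \<bar>p1 / (u * B) - 1\<bar> \<le> E / B \<and> \<bar>1 / (q1 * u * B ^ 7) - 1\<bar> \<le> E / B \<and>
        \<bar>p2 / (u * B ^ 3) - 1\<bar> \<le> E / B \<and> \<bar>1 / (q2 * u * B ^ 5) - 1\<bar> \<le> E / B)"
proof -
  obtain C B1 where C: "0 \<le> C" "8 \<le> B1" and nec: "\<And>B s x. B1 \<le> B \<Longrightarrow> - Cs / B \<le> s \<Longrightarrow> s \<le> 1 \<Longrightarrow> x \<in> positive \<Longrightarrow>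
      rho (overlap 1 4 B) x kmin \<le> 1 - 2 * 1 / B * (1 + s) \<Longrightarrow>
      (\<And>i. i \<in> {1..4} \<Longrightarrow> rho (overlap 1 4 B) x (u * B ^ (2 * i)) \<le> 1 - 2 * 1 / B * (1 + s)) \<Longrightarrow>
      1 * ((1 - C / B) / B) \<le> u / fst x + u / fst (snd (snd x)) \<and>
      (\<forall>i\<in>{1..<4}. 1 * (2 * (1 - C / B) / B) \<le> nearness x (u * B ^ (2 * i))) \<and>
      1 * ((1 + (2 * s - C / B)) / B) \<le> nearness x (u * B ^ (2 * 4))"
    by (rule necessary[of 1 4 Cs]) (use Cs in auto)
  define C' where "C' = C + 2 * Cs"
  define E where "E = (2 * C' + 4) * 4 ^ 6"
  have C': "0 \<le> C'" "C \<le> C'" using C Cs by (auto simp: C'_def)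
  have E: "0 \<le> E" "C \<le> E" using C' by (auto simp: E_def)
  show thesis
  proof (rule that[of "2 * E" "B1 + E"])
    show "0 \<le> 2 * E" "8 \<le> B1 + E" using E C by auto
    fix B s p1 q1 p2 q2 :: real
    assume B: "B1 + E \<le> B" and s: "- Cs / B \<le> s" "s \<le> 1" and x: "(p1, q1, p2, q2) \<in> positive"
      and r0: "rho (overlap 1 4 B) (p1, q1, p2, q2) kmin \<le> 1 - 2 / B * (1 + s)"
      and ri: "\<And>i. i \<in> {1..4} \<Longrightarrow> rho (overlap 1 4 B) (p1, q1, p2, q2) (u * B ^ (2 * i)) \<le> 1 - 2 / B * (1 + s)"
    have B8: "8 \<le> B" "B1 \<le> B" "E \<le> B" using B C E by auto
    have pos: "0 < p1" "0 < q1" "0 < p2" "0 < q2" using x by (auto simp: positive_def)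
    have n: "(1 - C / B) / B \<le> u / p1 + u / p2"
      "\<And>i. i \<in> {1..<4} \<Longrightarrow> 2 * (1 - C / B) / B \<le> nearness (p1, q1, p2, q2) (u * B ^ (2 * i))"
      "(1 + (2 * s - C / B)) / B \<le> nearness (p1, q1, p2, q2) (u * B ^ (2 * 4))"
    proof -
      have N: "1 * ((1 - C / B) / B) \<le> u / fst (p1, q1, p2, q2) + u / fst (snd (snd (p1, q1, p2, q2))) \<and>
        (\<forall>i\<in>{1..<4}. 1 * (2 * (1 - C / B) / B) \<le> nearness (p1, q1, p2, q2) (u * B ^ (2 * i))) \<and>
        1 * ((1 + (2 * s - C / B)) / B) \<le> nearness (p1, q1, p2, q2) (u * B ^ (2 * 4))"
        by (rule nec[OF B8(2) s x]) (use r0 ri in auto)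
      show "(1 - C / B) / B \<le> u / p1 + u / p2" using N by simp
      show "2 * (1 - C / B) / B \<le> nearness (p1, q1, p2, q2) (u * B ^ (2 * i))" if "i \<in> {1..<4}" for i
        using N[THEN conjunct2, THEN conjunct1, rule_format, OF that] by simp
      show "(1 + (2 * s - C / B)) / B \<le> nearness (p1, q1, p2, q2) (u * B ^ (2 * 4))" using N by simp
    qed
    define W where "W = 2 * B ^ (2 * 4) + 1"
    have W: "0 < W" using B8 by (simp add: W_def add_pos_pos)
    define xs where "xs = [p1 / u, upper_root W p1 q1, p2 / u, upper_root W p2 q2]"
    have ur: "0 < upper_root W p1 q1" "0 < upper_root W p2 q2" using W pos u by (simp_all add: upper_root_def)
    have near: "nearness (p1, q1, p2, q2) (u * \<kappa>) \<le> (\<Sum>x\<leftarrow>xs. proximity x \<kappa>)" if "0 < \<kappa>" for \<kappa>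
      using symbol_nearness_le[OF pos(1,2) that W] symbol_nearness_le[OF pos(3,4) that W] by (simp add: nearness_def xs_def)
    have CB: "(1 - C' / B) \<le> (1 - C / B)" using C' B8 by (simp add: divide_right_mono)
    have B0: "0 < B" using B8 by simp
    have len: "length xs = 4" by (simp add: xs_def)
    have large: "(2 * C' + real 4) * 4 ^ (4 + 2) \<le> B" using B8 by (simp add: E_def)
    have xpos: "\<forall>x\<in>set xs. 0 < x" using pos u ur by (simp add: xs_def)
    have c1: "(1 - C' / B) / B \<le> (\<Sum>x\<leftarrow>xs. 1 / x)"
    proof -
      have "(1 - C' / B) / B \<le> (1 - C / B) / B" using CB B0 by (intro divide_right_mono) auto
      moreover have "0 \<le> 1 / upper_root W p1 q1" "0 \<le> 1 / upper_root W p2 q2" using ur by simp_all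
      moreover have "(\<Sum>x\<leftarrow>xs. 1 / x) = u / p1 + (1 / upper_root W p1 q1 + (u / p2 + 1 / upper_root W p2 q2))" by (simp add: xs_def)
      ultimately show ?thesis using n(1) by linarith
    qed
    have c2: "2 * (1 - C' / B) / B \<le> (\<Sum>x\<leftarrow>xs. proximity x (B ^ (2 * i)))" if "i \<in> {1..<4}" for i
    proof -
      have "2 * (1 - C' / B) / B \<le> 2 * (1 - C / B) / B" using CB B0 by (intro divide_right_mono) auto
      then show ?thesis using n(2)[OF that] near[of "B ^ (2 * i)"] B0 by simp
    qed
    have c3: "(1 + (2 * s - C / B)) / B \<le> (\<Sum>x\<leftarrow>xs. proximity x (B ^ (2 * 4)))"
      using n(3) near[of "B ^ (2 * 4)"] B0 by simp
    have c4: "- C' / B \<le> 2 * s - C / B"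
    proof -
      have "C' / B = C / B + 2 * (Cs / B)" by (simp add: C'_def add_divide_distrib)
      then show ?thesis using s(1) unfolding minus_divide_left[symmetric] by linarith
    qed
    note ch = chain_of_list[OF len _ C'(1) large xpos c1 c2 c3 c4]
    define E' where "E' = (2 * C' + real 4) * 4 ^ (4 + 1)"
    have E': "E' \<le> E" "0 \<le> E'" using C' by (auto simp: E'_def E_def)
    have EB: "E' / B \<le> E / B" "0 \<le> E' / B" "E / B \<le> 2 * E / B" using E' B0 E by (auto simp: divide_right_mono)
    have "2 * s - C / B \<le> E' / B" using ch(1) by (simp only: E'_def)
    moreover have "C / B \<le> E / B" using E B0 by (simp add: divide_right_mono)
    ultimately have S: "2 * s \<le> 2 * E / B" using EB by linarith
    have lo: "i \<in> {1..4} \<Longrightarrow> B ^ (2 * i) / B * (1 - E' / B) \<le> sort xs ! (i - 1)"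
      and hi: "i \<in> {1..4} \<Longrightarrow> sort xs ! (i - 1) \<le> B ^ (2 * i) / B * (1 + E' / B)" for i
      using ch(2,3)[of i] by (simp_all only: E'_def)
    have "W \<notin> set xs" unfolding W_def by (rule out_of_range[OF len _ _ _ hi]) (use B8 E' in auto)
    then have nlt: "\<not> 1 / q1 < p1" "\<not> 1 / q2 < p2" by (auto simp: xs_def upper_root_def)
    have rel: "\<bar>y / b - 1\<bar> \<le> 2 * E / B" if "b * (1 - E' / B) \<le> y" "y \<le> b * (1 + E' / B)" "0 < b" for y b
    proof -
      have "1 - E' / B \<le> y / b" "y / b \<le> 1 + E' / B" using that by (auto simp: field_simps)
      then show ?thesis using EB by linarith
    qed
    have "\<bar>p1 / (u * B) - 1\<bar> \<le> 2 * E / B \<and> \<bar>1 / (q1 * u * B ^ 7) - 1\<bar> \<le> 2 * E / B \<and>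
        \<bar>p2 / (u * B ^ 3) - 1\<bar> \<le> 2 * E / B \<and> \<bar>1 / (q2 * u * B ^ 5) - 1\<bar> \<le> 2 * E / B"
      if lt: "p1 < p2" "q1 < q2"
    proof -
      \<comment> \<open>As p2 \<le> 1/q2 by \<open>nlt\<close>, the two inequalities between the
        conditions arrange the roots as p1, p2, 1/q2, 1/q1.\<close>
      have "1 / q2 \<le> 1 / q1" using lt pos by (intro divide_left_mono) auto
      then have ordered: "p1 / u \<le> p2 / u" "p2 / u \<le> 1 / q2 / u" "1 / q2 / u \<le> 1 / q1 / u"
        using nlt u lt by (intro divide_right_mono; simp)+
      have srt: "sort xs = [p1 / u, p2 / u, 1 / (q2 * u), 1 / (q1 * u)]"
      proof (rule properties_for_sort)
        show "mset [p1 / u, p2 / u, 1 / (q2 * u), 1 / (q1 * u)] = mset xs"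
          using nlt by (simp add: xs_def upper_root_def add_mset_commute)
        show "sorted [p1 / u, p2 / u, 1 / (q2 * u), 1 / (q1 * u)]"
          using ordered by simp
      qed
      have "B * (1 - E' / B) \<le> p1 / u" "p1 / u \<le> B * (1 + E' / B)"
        using lo[of 1] hi[of 1] B0 by (simp_all add: srt power2_eq_square)
      note 1 = rel[OF this B0]
      have "B ^ 3 * (1 - E' / B) \<le> p2 / u" "p2 / u \<le> B ^ 3 * (1 + E' / B)"
        using lo[of 2] hi[of 2] B0 by (simp_all add: srt eval_nat_numeral)
      note 2 = rel[OF this]
      have "B ^ 5 * (1 - E' / B) \<le> 1 / (q2 * u)" "1 / (q2 * u) \<le> B ^ 5 * (1 + E' / B)"
        using lo[of 3] hi[of 3] B0 by (simp_all add: srt eval_nat_numeral)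
      note 3 = rel[OF this]
      have "B ^ 7 * (1 - E' / B) \<le> 1 / (q1 * u)" "1 / (q1 * u) \<le> B ^ 7 * (1 + E' / B)"
        using lo[of 4] hi[of 4] B0 by (simp_all add: srt eval_nat_numeral)
      note 4 = rel[OF this]
      show ?thesis using 1 2 3 4 B0 by (simp add: mult.assoc)
    qed
    then show "2 * s \<le> 2 * E / B \<and> (p1 < p2 \<longrightarrow> q1 < q2 \<longrightarrow>
        \<bar>p1 / (u * B) - 1\<bar> \<le> 2 * E / B \<and> \<bar>1 / (q1 * u * B ^ 7) - 1\<bar> \<le> 2 * E / B \<and>
        \<bar>p2 / (u * B ^ 3) - 1\<bar> \<le> 2 * E / B \<and> \<bar>1 / (q2 * u * B ^ 5) - 1\<bar> \<le> 2 * E / B)"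
      using S by blast
  qed
qed

end

section \<open>Near-optimal parameters\<close>

text \<open>From (1 - y + y^2 / 2) (1 + y + y^2 / 2) = 1 + y^4 / 4 and the Taylor lower bound of exp
  y.\<close>

lemma exp_minus_le_quadratic: assumes "0 \<le> (y::real)" shows "exp (- y) \<le> 1 - y + y\<^sup>2 / 2"
proof -
  have "1 \<le> (1 - y + y\<^sup>2 / 2) * (1 + y + y\<^sup>2 / 2)"
  proof -
    have "(1 - y + y\<^sup>2 / 2) * (1 + y + y\<^sup>2 / 2) = 1 + (y\<^sup>2)\<^sup>2 / 4" by (simp add: field_simps power2_eq_square)
    then show ?thesis by simp
  qed
  moreover have "0 < 1 - y + y\<^sup>2 / 2"
  proof -
    have "1 - y + y\<^sup>2 / 2 = ((y - 1)\<^sup>2 + 1) / 2" by (simp add: field_simps power2_eq_square)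
    moreover have "0 < ((y - 1)\<^sup>2 + 1) / 2" by (simp add: add_nonneg_pos)
    ultimately show ?thesis by (simp only:)
  qed
  moreover have "1 + y + y\<^sup>2 / 2 \<le> exp y" by (rule exp_lower_Taylor_quadratic[OF assms])
  ultimately have "1 \<le> (1 - y + y\<^sup>2 / 2) * exp y"
    by (meson mult_left_mono less_imp_le order_trans)
  then have "1 * exp (- y) \<le> (1 - y + y\<^sup>2 / 2) * exp y * exp (- y)" by (intro mult_right_mono) auto
  then show ?thesis by (simp add: mult.assoc flip: exp_add)
qed

lemma le_of_square_le:
  fixes r a :: real
  assumes "r\<^sup>2 \<le> 1 - 2 * a" "a \<le> 1" shows "r \<le> 1 - a"
proof (rule power2_le_imp_le)
  have "(1 - a)\<^sup>2 = 1 - 2 * a + a\<^sup>2" by (simp add: power2_eq_square algebra_simps)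
  then show "r\<^sup>2 \<le> (1 - a)\<^sup>2" using assms(1) zero_le_power2[of a] by linarith
qed (use assms in simp)

section \<open>Sufficient conditions\<close>

context schwarz
begin

text \<open>Let z = w / k^2. Passing from \<lambda> to k changes the real part by at most k z and
  adds at most k^2 z for the imaginary part, so the denominator grows by a factor of at most 1 + 4
  z. For z > 1 the left side is not positive.\<close>

lemma contrast_ge:
  assumes "0 < P" "0 < k"
  shows "4 * ((1 - 4 * (w / k\<^sup>2)) * well (P / k)) \<le> contrast P k"
proof (cases "w / k\<^sup>2 \<le> 1")
  case False
  then have "1 - 4 * (w / k\<^sup>2) \<le> 0" by linarith
  then have "(1 - 4 * (w / k\<^sup>2)) * well (P / k) \<le> 0"
    using well_nonneg[of "P / k"] assms by (intro mult_nonpos_nonneg) auto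
  then show ?thesis using contrast_nonneg[OF assms(1), of k] by linarith
next
  case True
  define z where "z = w / k\<^sup>2"
  have z: "0 \<le> z" "z \<le> 1" using True w by (auto simp: z_def)
  have x: "0 < re k" "k \<le> re k" "re k \<le> k * (1 + z)" using re_pos re_ge re_le_w assms by (auto simp: z_def)
  have y: "(Im (lam k))\<^sup>2 \<le> (P + k)\<^sup>2 * z"
  proof -
    have "(Im (lam k))\<^sup>2 \<le> w" using Im_lam_square_le[of k] eta by (simp add: w_def)
    also have "w = k\<^sup>2 * z" using assms by (simp add: z_def)
    also have "\<dots> \<le> (P + k)\<^sup>2 * z" using assms z by (intro mult_right_mono power_mono) auto
    finally show ?thesis .
  qed
  have "0 \<le> P * z" using assms z by (intro mult_nonneg_nonneg) auto
  moreover have "(P + k) * (1 + z) = P + P * z + k * (1 + z)" by (simp add: algebra_simps)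
  ultimately have "P + re k \<le> (P + k) * (1 + z)" using x(3) by linarith
  then have "(P + re k)\<^sup>2 \<le> ((P + k) * (1 + z))\<^sup>2" using assms x by (intro power_mono) auto
  then have "(P + re k)\<^sup>2 + (Im (lam k))\<^sup>2 \<le> (P + k)\<^sup>2 * ((1 + z)\<^sup>2 + z)" using y
    by (simp only: power_mult_distrib distrib_left[of "(P + k)\<^sup>2"])
  also have "\<dots> \<le> (P + k)\<^sup>2 * (1 + 4 * z)"
  proof (intro mult_left_mono)
    have "z * z \<le> 1 * z" using z by (intro mult_right_mono) auto
    then show "(1 + z)\<^sup>2 + z \<le> 1 + 4 * z" by (simp add: power2_eq_square algebra_simps)
  qed simp
  finally have dn: "(P + re k)\<^sup>2 + (Im (lam k))\<^sup>2 \<le> (P + k)\<^sup>2 * (1 + 4 * z)" .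
  have dp: "0 < (P + re k)\<^sup>2 + (Im (lam k))\<^sup>2" using assms x by (simp add: add_pos_nonneg)
  have wl: "well (P / k) = P * k / (P + k)\<^sup>2"
  proof -
    have "1 + P / k = (P + k) / k" using assms by (simp add: field_simps)
    then show ?thesis using assms by (simp add: well_def power_divide) (simp add: power2_eq_square)
  qed
  have "(1 - 4 * z) \<le> 1 / (1 + 4 * z)"
  proof -
    have "(1 - 4 * z) * (1 + 4 * z) = 1 - 16 * (z * z)" by (simp add: algebra_simps)
    then show ?thesis using z by (simp add: le_divide_eq)
  qed
  then have "4 * ((1 - 4 * z) * well (P / k)) \<le> 4 * (1 / (1 + 4 * z) * well (P / k))"
    using assms by (intro mult_left_mono mult_right_mono well_nonneg) auto
  also have "\<dots> = 4 * P * k / ((P + k)\<^sup>2 * (1 + 4 * z))" by (simp add: wl mult_ac)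
  also have "\<dots> \<le> 4 * P * re k / ((P + re k)\<^sup>2 + (Im (lam k))\<^sup>2)"
    using dn dp assms x by (intro frac_le mult_left_mono) auto
  finally show ?thesis by (simp add: z_def contrast_def)
qed

text \<open>Beyond c u B the reflections are of order 1 / B^2, and 1 - \<rho> is governed by the
  overlap and the two wells. The constant c is arbitrary here; the low-frequency estimate will fix
  it.\<close>

lemma high_sufficient:
  assumes c: "0 < c"
  obtains C B0 where "0 \<le> C" "8 \<le> B0"
    "\<And>m B k \<delta> p1 q1 p2 q2. 0 \<le> m \<Longrightarrow> m \<le> 2 \<Longrightarrow> B0 \<le> B \<Longrightarrow> c * u * B \<le> k \<Longrightarrow> (p1, q1, p2, q2) \<in> positive \<Longrightarrow> 0 \<le> \<delta> \<Longrightarrow>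
      m * (2 / B * (1 - 272 / B)) \<le> k * \<delta> + well (ventcell_symbol p1 q1 k / k) + well (ventcell_symbol p2 q2 k / k) \<Longrightarrow>
      rho \<delta> (p1, q1, p2, q2) k \<le> 1 - (2 * m / B - C / B\<^sup>2)"
proof -
  define d where "d = c * u"
  have d: "0 < d" using c u by (simp add: d_def)
  define C where "C = 1108 + 4 / (L\<^sup>2 * d\<^sup>2)"
  define B0 where "B0 = 273 + 4 * w / d\<^sup>2 + 1 / (L\<^sup>2 * d\<^sup>2)"
  have B0: "273 \<le> B0" using w by (simp add: B0_def)
  show thesis
  proof (rule that[of C B0])
    show "0 \<le> C" by (simp add: C_def)
    show "8 \<le> B0" using B0 by simp
    fix m B k \<delta> p1 q1 p2 q2 :: real
    assume m: "0 \<le> m" "m \<le> 2" and B: "B0 \<le> B" and k: "c * u * B \<le> k" and x: "(p1, q1, p2, q2) \<in> positive" and \<delta>: "0 \<le> \<delta>"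
      and y: "m * (2 / B * (1 - 272 / B)) \<le> k * \<delta> + well (ventcell_symbol p1 q1 k / k) + well (ventcell_symbol p2 q2 k / k)"
    define P1 P2 where P: "P1 = ventcell_symbol p1 q1 k" "P2 = ventcell_symbol p2 q2 k"
    have Pp: "0 < P1" "0 < P2" using x by (auto simp: P positive_def symbol_pos)
    have Bp: "273 \<le> B" "0 < B" using B B0 by auto
    have kp: "0 < k" "d * B \<le> k" using k d Bp by (auto simp: d_def intro: less_le_trans[OF _ k])
    have k2: "d\<^sup>2 * B\<^sup>2 \<le> k\<^sup>2" using kp d Bp by (simp add: power_mono flip: power_mult_distrib)
    have kpos: "0 < k\<^sup>2" "0 < d\<^sup>2 * B\<^sup>2" using kp d Bp by auto
    have "w / k\<^sup>2 \<le> w / (d\<^sup>2 * B\<^sup>2)" using k2 kpos w by (intro divide_left_mono) auto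
    moreover have "4 * (w / (d\<^sup>2 * B\<^sup>2)) \<le> 1 / B"
    proof -
      have "4 * w / d\<^sup>2 \<le> B" using B unfolding B0_def by (smt (verit) divide_nonneg_nonneg zero_le_power2 mult_nonneg_nonneg)
      then show ?thesis using Bp d by (simp add: field_simps power2_eq_square)
    qed
    ultimately have z: "4 * (w / k\<^sup>2) \<le> 1 / B" by linarith
    define v where "v = 1 - 4 * (w / k\<^sup>2)"
    have "0 \<le> w / k\<^sup>2" "1 / B \<le> 1" using w Bp by simp_all
    then have v: "0 \<le> v" "v \<le> 1" "1 - 1 / B \<le> v" using z unfolding v_def by linarith+
    have e1: "decay k \<le> 1 / (2 * L\<^sup>2 * (d\<^sup>2 * B\<^sup>2))"
    proof -
      have "1 / (2 * L\<^sup>2 * k\<^sup>2) \<le> 1 / (2 * L\<^sup>2 * (d\<^sup>2 * B\<^sup>2))" using k2 kpos L by (intro divide_left_mono mult_left_mono mult_pos_pos) auto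
      then show ?thesis using decay_le[OF kp(1)] by linarith
    qed
    have "1 / (2 * L\<^sup>2 * (d\<^sup>2 * B\<^sup>2)) \<le> 1 / 2"
    proof -
      have "1 / (L\<^sup>2 * d\<^sup>2) \<le> B" using B w unfolding B0_def by (smt (verit) divide_nonneg_nonneg zero_le_power2)
      also have "B \<le> B\<^sup>2" using Bp by (simp add: self_le_power)
      finally show ?thesis using Bp d L by (simp add: field_simps)
    qed
    then have e2: "decay k \<le> 1 / 2" using e1 by linarith
    \<comment> \<open>273 is 272 plus the 1 lost by the factor v \<ge> 1 - 1 / B, which accounts for
      replacing \<lambda> by k.\<close>
    define Y where "Y = m * (2 / B * (1 - 273 / B))"
    have Y: "0 \<le> Y" "Y \<le> 4 / B"
    proof -
      have u1: "0 \<le> 1 - 273 / B" "1 - 273 / B \<le> 1" using Bp by auto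
      then have u2: "0 \<le> 2 / B * (1 - 273 / B)" "2 / B * (1 - 273 / B) \<le> 2 / B * 1"
        using Bp by (intro mult_nonneg_nonneg mult_left_mono; simp)+
      have "m * (2 / B * (1 - 273 / B)) \<le> 2 * (2 / B * 1)"
        by (rule mult_mono[OF m(2) u2(2) _ u2(1)]) simp
      then show "Y \<le> 4 / B" by (simp add: Y_def)
      show "0 \<le> Y" unfolding Y_def using m Bp by (intro mult_nonneg_nonneg) auto
    qed
    have w0: "0 \<le> well (P1 / k)" "0 \<le> well (P2 / k)" using Pp kp by (auto intro!: well_nonneg)
    have "Y \<le> (1 - 1 / B) * (m * (2 / B * (1 - 272 / B)))"
    proof -
      have "1 - 273 / B \<le> (1 - 1 / B) * (1 - 272 / B)" using Bp by (simp add: field_simps)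
      then have "m * (2 / B) * (1 - 273 / B) \<le> m * (2 / B) * ((1 - 1 / B) * (1 - 272 / B))" using m Bp by (intro mult_left_mono) auto
      then show ?thesis by (simp add: Y_def mult_ac)
    qed
    also have "\<dots> \<le> v * (m * (2 / B * (1 - 272 / B)))" using v m Bp by (intro mult_right_mono mult_nonneg_nonneg) auto
    also have "\<dots> \<le> v * (k * \<delta> + well (P1 / k) + well (P2 / k))" using y v unfolding P by (intro mult_left_mono) auto
    also have "\<dots> \<le> k * \<delta> + v * well (P1 / k) + v * well (P2 / k)"
    proof -
      have "v * (k * \<delta>) \<le> 1 * (k * \<delta>)" using v kp \<delta> by (intro mult_right_mono) auto
      then show ?thesis by (simp add: distrib_left)
    qed
    also have "\<dots> \<le> re k * \<delta> + (contrast P1 k + contrast P2 k) / 4"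
    proof -
      have "k * \<delta> \<le> re k * \<delta>" using re_ge[of k] \<delta> by (intro mult_right_mono) auto
      moreover have "a + x + y \<le> a' + (c1 + c2) / 4" if "a \<le> a'" "4 * x \<le> c1" "4 * y \<le> c2" for a a' x y c1 c2 :: real
      proof -
        have "x \<le> c1 / 4" "y \<le> c2 / 4" using that by simp_all
        then have "a + x + y \<le> a' + c1 / 4 + c2 / 4" using that(1) by (intro add_mono)
        then show ?thesis by (simp add: add_divide_distrib add.assoc)
      qed
      ultimately show ?thesis
        using contrast_ge[OF Pp(1) kp(1), folded v_def] contrast_ge[OF Pp(2) kp(1), folded v_def] by blast
    qed
    finally have Yle: "Y \<le> re k * \<delta> + (contrast P1 k + contrast P2 k) / 4" .
    have "(rho \<delta> (p1, q1, p2, q2) k)\<^sup>2 \<le> exp (- (2 * re k * \<delta> + (contrast P1 k + contrast P2 k) / 2)) + 16 * decay k"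
      unfolding P by (rule rho_square_upper_high) (use Pp \<delta> e2 in \<open>auto simp: P\<close>)
    also have "exp (- (2 * re k * \<delta> + (contrast P1 k + contrast P2 k) / 2)) \<le> exp (- (2 * Y))" using Yle by simp
    also have "exp (- (2 * Y)) \<le> 1 - 2 * Y + (2 * Y)\<^sup>2 / 2" using Y by (intro exp_minus_le_quadratic) auto
    also have "(2 * Y)\<^sup>2 / 2 \<le> 32 / B\<^sup>2"
      using power_mono[OF Y(2,1), of 2] by (simp add: power_divide)
    also have "16 * decay k \<le> 8 / (L\<^sup>2 * d\<^sup>2) / B\<^sup>2" using e1 by simp
    also have "1 - 2 * Y \<le> 1 - 2 * (2 * m / B) + 2184 / B\<^sup>2"
    proof -
      have "m * (4 * 273 / B\<^sup>2) \<le> 2 * (4 * 273 / B\<^sup>2)" using m by (intro mult_right_mono) auto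
      moreover have "2 * Y = 2 * (2 * m / B) - m * (4 * 273 / B\<^sup>2)" by (simp add: Y_def power2_eq_square right_diff_distrib diff_divide_distrib mult_ac)
      ultimately show ?thesis by simp
    qed
    finally have "(rho \<delta> (p1, q1, p2, q2) k)\<^sup>2 \<le> 1 - 2 * (2 * m / B - C / B\<^sup>2)"
      by (simp add: C_def add_divide_distrib)
    moreover have "2 * m / B - C / B\<^sup>2 \<le> 1"
    proof -
      have "2 * m / B \<le> 1" using m Bp by (simp add: divide_le_eq)
      moreover have "0 \<le> C / B\<^sup>2" by (simp add: C_def)
      ultimately show ?thesis by linarith
    qed
    ultimately show "rho \<delta> (p1, q1, p2, q2) k \<le> 1 - (2 * m / B - C / B\<^sup>2)" by (rule le_of_square_le)
  qed
qed

text \<open>Up to a fixed frequency \<open>ks\<close> the gain is S k \<ge> 2 K = 4 u against a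
  symbol close to u B, and the quadratic term is of order 1 / B^2. Beyond \<open>ks\<close>, S grows
  at least like k, which beats both the quadratic term and 4 / B. The weaker bound is for the second
  symbol of the two-sided choice, which is much larger than u B and gains nothing to leading
  order.\<close>

lemma low_terms:
  obtains c C B0 where "0 < c" "0 \<le> C" "8 \<le> B0"
    "\<And>B k P. B0 \<le> B \<Longrightarrow> kmin \<le> k \<Longrightarrow> k \<le> c * u * B \<Longrightarrow> u * B \<le> P \<Longrightarrow>
      cmod (lam k) \<le> P \<and> - S k / P + 2 * (2 / gap * cmod (lam k))\<^sup>2 / P\<^sup>2 \<le> C / B\<^sup>2 \<and>
      (P \<le> u * B + k\<^sup>2 / (u * B ^ 3) \<longrightarrow> - S k / P + 2 * (2 / gap * cmod (lam k))\<^sup>2 / P\<^sup>2 \<le> - (4 / B) + C / B\<^sup>2)"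
proof -
  \<comment> \<open>Beyond \<open>ks\<close> one has S k \<ge> k and, for P \<le> 2 u B, also k / P
    \<ge> 32 / B. The choice of \<open>c\<close> makes the quadratic term at most half of k / P and
    ensures |\<lambda>| \<le> P.\<close>
  define a b D ks c C B0 where d: "a = 2 * (1 + w / kmin\<^sup>2)" "b = 2 * (2 / gap * a)\<^sup>2" "D = 4 / (L * gap)" "ks = D + 64 * u"
    "c = 1 / (1 + 2 * b + a)" "C = b * ks\<^sup>2 / u\<^sup>2 + 4 * ks\<^sup>2 / u\<^sup>2" "B0 = (8::real)"
  have a0: "2 \<le> a" using w by (simp add: d(1))
  have b0: "0 \<le> b" by (simp add: d(2))
  have c0: "0 < c" "c \<le> 1" "b * c \<le> 1 / 2" "a * c \<le> 1" using a0 b0 by (auto simp: d(5) divide_simps)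
  have ks0: "0 < ks" using L gap u by (simp add: d add_pos_pos)
  show thesis
  proof (rule that[of c C B0])
    show "0 \<le> C" using b0 by (simp add: d(6))
    fix B k P :: real
    assume B: "B0 \<le> B" and k: "kmin \<le> k" "k \<le> c * u * B" and P: "u * B \<le> P"
    have B8: "8 \<le> B" "0 < B" using B by (auto simp: d)
    have uB: "0 < u * B" using u B8 by simp
    have Pp: "0 < P" using P uB by linarith
    have kp: "0 < k" using k kmin by simp
    have lamk: "cmod (lam k) \<le> a * k"
    proof -
      have "w / k\<^sup>2 \<le> w / kmin\<^sup>2" using k kmin w by (intro divide_left_mono power_mono mult_pos_pos) auto
      then have "k * (1 + w / k\<^sup>2) \<le> k * (1 + w / kmin\<^sup>2)" using kp by (intro mult_left_mono) auto
      then have "re k \<le> k * (1 + w / kmin\<^sup>2)" using re_le_w[OF kp] by linarith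
      moreover have "a * k = 2 * (k * (1 + w / kmin\<^sup>2))" by (simp add: d(1))
      ultimately show ?thesis using norm_lam_le[of k] by linarith
    qed
    have kP: "k / P \<le> c"
    proof -
      have "k \<le> c * (u * B)" using k by simp
      also have "\<dots> \<le> c * P" using P c0 by (intro mult_left_mono) auto
      finally show ?thesis using Pp by (simp add: divide_le_eq)
    qed
    have l: "cmod (lam k) \<le> P"
    proof -
      have "a * (k / P) \<le> a * c" using kP a0 by (intro mult_left_mono) auto
      then have "a * k / P \<le> 1" using c0 by simp
      then show ?thesis using lamk Pp by (simp add: divide_le_eq)
    qed
    have N: "2 * (2 / gap * cmod (lam k))\<^sup>2 / P\<^sup>2 \<le> b * (k / P)\<^sup>2"
    proof -
      have "2 * (2 / gap * cmod (lam k))\<^sup>2 \<le> 2 * (2 / gap * (a * k))\<^sup>2"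
        using lamk gap by (intro mult_left_mono power_mono) auto
      also have "\<dots> = b * k\<^sup>2" by (simp add: d(2) power_mult_distrib power_divide)
      finally have "2 * (2 / gap * cmod (lam k))\<^sup>2 / P\<^sup>2 \<le> b * k\<^sup>2 / P\<^sup>2" by (rule divide_right_mono) simp
      then show ?thesis by (simp only: power_divide times_divide_eq_right)
    qed
    have inv: "1 / P \<le> 1 / (u * B)"
      by (rule divide_left_mono[OF P _ mult_pos_pos[OF Pp uB]]) simp
    have key: "- S k / P + 2 * (2 / gap * cmod (lam k))\<^sup>2 / P\<^sup>2 \<le> C / B\<^sup>2 \<and>
      (P \<le> u * B + k\<^sup>2 / (u * B ^ 3) \<longrightarrow> - S k / P + 2 * (2 / gap * cmod (lam k))\<^sup>2 / P\<^sup>2 \<le> - (4 / B) + C / B\<^sup>2)"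
    proof (cases "k \<le> ks")
      case True
      have "k / P \<le> ks / (u * B)" using True P uB kp Pp by (intro frac_le) auto
      then have "b * (k / P)\<^sup>2 \<le> b * (ks / (u * B))\<^sup>2" using b0 kp Pp by (intro mult_left_mono power_mono) auto
      also have "\<dots> = b * ks\<^sup>2 / u\<^sup>2 / B\<^sup>2" by (simp add: power_divide power_mult_distrib)
      finally have n: "2 * (2 / gap * cmod (lam k))\<^sup>2 / P\<^sup>2 \<le> b * ks\<^sup>2 / u\<^sup>2 / B\<^sup>2" using N by linarith
      have S: "4 * u / P \<le> S k / P" using S_ge_K[OF k(1)] Pp by (intro divide_right_mono) (auto simp: u_def)
      have Ce: "C / B\<^sup>2 = b * ks\<^sup>2 / u\<^sup>2 / B\<^sup>2 + 4 * ks\<^sup>2 / u\<^sup>2 / B\<^sup>2" by (simp add: d(6) add_divide_distrib)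
      have nonneg: "0 \<le> 4 * ks\<^sup>2 / u\<^sup>2 / B\<^sup>2" "0 \<le> 4 * u / P" using u Pp by simp_all
      have close: "- (4 * u / P) \<le> - (4 / B) + 4 * ks\<^sup>2 / u\<^sup>2 / B\<^sup>2" if "P \<le> u * B + k\<^sup>2 / (u * B ^ 3)"
      proof -
        \<comment> \<open>A bound for the relative excess of P over u B when k \<le> ks; it is only
          of order 1 / B^4.\<close>
        define y where "y = ks\<^sup>2 / (u\<^sup>2 * B ^ 4)"
        have y: "0 \<le> y" by (simp add: y_def)
        have "k\<^sup>2 \<le> ks\<^sup>2" using True kp by (intro power_mono) auto
        then have "k\<^sup>2 / (u * B ^ 3) \<le> ks\<^sup>2 / (u * B ^ 3)" using u B8 by (intro divide_right_mono) auto
        also have "\<dots> = u * B * y" using u B8 by (simp add: y_def power2_eq_square eval_nat_numeral)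
        finally have "P \<le> u * B * (1 + y)" using that by (simp add: distrib_left)
        moreover have "0 < u * B * (1 + y)" by (rule mult_pos_pos[OF uB]) (use y in simp)
        ultimately have "1 / (u * B * (1 + y)) \<le> 1 / P"
          by (intro divide_left_mono[OF _ _ mult_pos_pos[OF _ Pp]]) auto
        moreover have "(1 - y) \<le> 1 / (1 + y)"
        proof -
          have "(1 - y) * (1 + y) = 1 - y * y" by (simp add: algebra_simps)
          then show ?thesis using y by (simp add: le_divide_eq)
        qed
        then have "1 / (u * B) * (1 - y) \<le> 1 / (u * B) * (1 / (1 + y))" using uB by (intro mult_left_mono) auto
        ultimately have "1 / (u * B) * (1 - y) \<le> 1 / P" by simp
        then have "4 * u * (1 / (u * B) * (1 - y)) \<le> 4 * u * (1 / P)" using u by (intro mult_left_mono) auto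
        moreover have "4 * u * (1 / (u * B) * (1 - y)) = 4 / B - 4 / B * y" using u by (simp add: right_diff_distrib)
        moreover have "4 / B * y \<le> 4 * ks\<^sup>2 / u\<^sup>2 / B\<^sup>2"
        proof -
          have "B\<^sup>2 \<le> B ^ 5" using B8 by (intro power_increasing) auto
          then have "4 * ks\<^sup>2 / u\<^sup>2 / B ^ 5 \<le> 4 * ks\<^sup>2 / u\<^sup>2 / B\<^sup>2" using B8 by (intro divide_left_mono) auto
          moreover have "4 / B * y = 4 * ks\<^sup>2 / u\<^sup>2 / B ^ 5" by (simp add: y_def eval_nat_numeral)
          ultimately show ?thesis by simp
        qed
        ultimately show ?thesis by simp
      qed
      have m: "- S k / P = - (S k / P)" by simp
      show ?thesis
      proof (intro conjI impI)
        show "- S k / P + 2 * (2 / gap * cmod (lam k))\<^sup>2 / P\<^sup>2 \<le> C / B\<^sup>2"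
          using n S Ce m nonneg by linarith
        assume "P \<le> u * B + k\<^sup>2 / (u * B ^ 3)"
        from close[OF this] show "- S k / P + 2 * (2 / gap * cmod (lam k))\<^sup>2 / P\<^sup>2 \<le> - (4 / B) + C / B\<^sup>2"
          using n S Ce m by linarith
      qed
    next
      case False
      have Sk: "k \<le> S k"
      proof -
        have "2 * k - D \<le> S k" using Re_dtn_growth[OF pa k(1)] Re_dtn_growth[OF pb k(1)] by (simp add: S_def d(3) gap_def)
        moreover have "D \<le> k" using False u by (simp add: d(4))
        ultimately show ?thesis by linarith
      qed
      have "b * (k / P)\<^sup>2 = b * (k / P) * (k / P)" by (simp add: power2_eq_square)
      also have "\<dots> \<le> 1 / 2 * (k / P)"
      proof (intro mult_right_mono)
        have "b * (k / P) \<le> b * c" using kP b0 by (intro mult_left_mono) auto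
        then show "b * (k / P) \<le> 1 / 2" using c0 by linarith
      qed (use kp Pp in simp)
      finally have "2 * (2 / gap * cmod (lam k))\<^sup>2 / P\<^sup>2 \<le> 1 / 2 * (k / P)" using N by linarith
      moreover have "k / P \<le> S k / P" using Sk Pp by (intro divide_right_mono) auto
      ultimately have T: "- S k / P + 2 * (2 / gap * cmod (lam k))\<^sup>2 / P\<^sup>2 \<le> - (1 / 2 * (k / P))" by simp
      have "0 \<le> k / P" using kp Pp by simp
      moreover have C0: "0 \<le> C / B\<^sup>2" using b0 by (simp add: d(6))
      moreover have "4 / B \<le> 1 / 2 * (k / P)" if "P \<le> u * B + k\<^sup>2 / (u * B ^ 3)"
      proof -
        have "k\<^sup>2 \<le> (u * B)\<^sup>2"
        proof -
          have "c * (u * B) \<le> 1 * (u * B)" using c0 uB by (intro mult_right_mono) auto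
          then show ?thesis using k kp by (intro power_mono) auto
        qed
        then have "k\<^sup>2 / (u * B ^ 3) \<le> (u * B)\<^sup>2 / (u * B ^ 3)" using u B8 by (intro divide_right_mono) auto
        also have "\<dots> = u / B" using u B8 by (simp add: power2_eq_square eval_nat_numeral)
        also have "\<dots> \<le> u" using u B8 by (simp add: divide_le_eq)
        also have "\<dots> \<le> u * B" using u B8 by simp
        finally have "P \<le> 2 * (u * B)" using that by simp
        moreover have "0 \<le> D" using L gap by (simp add: d(3))
        then have "64 * u \<le> k" using False unfolding d(4) by linarith
        ultimately have "64 * u / (2 * (u * B)) \<le> k / P" using u Pp kp by (intro frac_le) auto
        moreover have "64 * u / (2 * (u * B)) = 32 * (1 / B)" "4 / B = 4 * (1 / B)" "0 < 1 / B" using u B8 by simp_all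
        ultimately show ?thesis by linarith
      qed
      ultimately show ?thesis using T by auto
    qed
    show "cmod (lam k) \<le> P \<and> - S k / P + 2 * (2 / gap * cmod (lam k))\<^sup>2 / P\<^sup>2 \<le> C / B\<^sup>2 \<and>
      (P \<le> u * B + k\<^sup>2 / (u * B ^ 3) \<longrightarrow> - S k / P + 2 * (2 / gap * cmod (lam k))\<^sup>2 / P\<^sup>2 \<le> - (4 / B) + C / B\<^sup>2)"
      using l key by blast
  qed (use c0 in \<open>auto simp: d\<close>)
qed

text \<open>Here m counts the symbols that stay close to u B at low frequencies: both of them in the
  one-sided case, the first one in the two-sided case.\<close>

lemma low_sufficient:
  obtains c C B0 where "0 < c" "0 \<le> C" "8 \<le> B0"
    "\<And>m B k \<delta> p1 q1 p2 q2. m \<in> {1, 2} \<Longrightarrow> B0 \<le> B \<Longrightarrow> kmin \<le> k \<Longrightarrow> k \<le> c * u * B \<Longrightarrow> 0 \<le> \<delta> \<Longrightarrow> \<delta> \<le> 2 / (u * B\<^sup>2) \<Longrightarrow>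
      u * B \<le> ventcell_symbol p1 q1 k \<Longrightarrow> u * B \<le> ventcell_symbol p2 q2 k \<Longrightarrow>
      ventcell_symbol p1 q1 k \<le> u * B + k\<^sup>2 / (u * B ^ 3) \<Longrightarrow>
      (m = 2 \<longrightarrow> ventcell_symbol p2 q2 k \<le> u * B + k\<^sup>2 / (u * B ^ 3)) \<Longrightarrow>
      rho \<delta> (p1, q1, p2, q2) k \<le> 1 - (2 * m / B - C / B\<^sup>2)"
proof -
  obtain c C1 B1 where c: "0 < c" "0 \<le> C1" "8 \<le> B1" and
    T: "\<And>B k P. B1 \<le> B \<Longrightarrow> kmin \<le> k \<Longrightarrow> k \<le> c * u * B \<Longrightarrow> u * B \<le> P \<Longrightarrow>
      cmod (lam k) \<le> P \<and> - S k / P + 2 * (2 / gap * cmod (lam k))\<^sup>2 / P\<^sup>2 \<le> C1 / B\<^sup>2 \<and>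
      (P \<le> u * B + k\<^sup>2 / (u * B ^ 3) \<longrightarrow> - S k / P + 2 * (2 / gap * cmod (lam k))\<^sup>2 / P\<^sup>2 \<le> - (4 / B) + C1 / B\<^sup>2)"
    using low_terms by blast
  define C where "C = C1 + 16 + 16 / (L * gap * u)"
  define B0 where "B0 = B1 + C1 + 32 / (L * gap * u)"
  have C0: "0 \<le> C" using c L gap u by (simp add: C_def)
  have r: "0 \<le> 32 / (L * gap * u)" using L gap u by simp
  show thesis
  proof (rule that[of c C B0])
    show "8 \<le> B0" unfolding B0_def using c r by linarith
    fix m B k \<delta> p1 q1 p2 q2 :: real
    assume m: "m \<in> {1, 2}" and B: "B0 \<le> B" and k: "kmin \<le> k" "k \<le> c * u * B" and \<delta>: "0 \<le> \<delta>" "\<delta> \<le> 2 / (u * B\<^sup>2)"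
      and P: "u * B \<le> ventcell_symbol p1 q1 k" "u * B \<le> ventcell_symbol p2 q2 k"
        "ventcell_symbol p1 q1 k \<le> u * B + k\<^sup>2 / (u * B ^ 3)"
        "m = 2 \<longrightarrow> ventcell_symbol p2 q2 k \<le> u * B + k\<^sup>2 / (u * B ^ 3)"
    have B8: "8 \<le> B" "0 < B" "B1 \<le> B" "C1 \<le> B" "32 / (L * gap * u) \<le> B" using B c r unfolding B0_def by linarith+
    define P1 P2 where Pd: "P1 = ventcell_symbol p1 q1 k" "P2 = ventcell_symbol p2 q2 k"
    have "0 < u * B" using u B8 by simp
    then have Pp: "0 < P1" "0 < P2" using P unfolding Pd by linarith+
    define T1 T2 where Td: "T1 = - S k / P1 + 2 * (2 / gap * cmod (lam k))\<^sup>2 / P1\<^sup>2" "T2 = - S k / P2 + 2 * (2 / gap * cmod (lam k))\<^sup>2 / P2\<^sup>2"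
    have t: "cmod (lam k) \<le> P1" "cmod (lam k) \<le> P2" "T1 \<le> - (4 / B) + C1 / B\<^sup>2" "T2 \<le> C1 / B\<^sup>2" "m = 2 \<longrightarrow> T2 \<le> - (4 / B) + C1 / B\<^sup>2"
      using T[OF B8(3) k P(1)] T[OF B8(3) k P(2)] P(3,4) unfolding Td Pd by auto
    have TT: "T1 + T2 \<le> - (4 * m / B - 2 * (C1 / B\<^sup>2))" using m t by auto
    define y where "y = 4 * m / B - 2 * (C1 / B\<^sup>2)"
    have C1B: "C1 / B\<^sup>2 \<le> 1 / B" using B8 by (simp add: power2_eq_square divide_le_eq)
    have mB: "4 / B \<le> 4 * m / B" "4 * m / B \<le> 8 / B" using m B8 by (auto simp: divide_right_mono)
    have y: "0 \<le> y" "y \<le> 8 / B"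
    proof -
      have "4 / B = 4 * (1 / B)" "0 \<le> 1 / B" using B8 by simp_all
      then show "0 \<le> y" unfolding y_def using mB C1B by linarith
      have "0 \<le> C1 / B\<^sup>2" using c by simp
      then show "y \<le> 8 / B" unfolding y_def using mB by linarith
    qed
    have ov: "4 / (L * gap) * \<delta> \<le> 1 / 4"
    proof -
      have "32 / (L * gap * u) \<le> B" by (rule B8(5))
      also have "B \<le> B\<^sup>2" using B8 by (simp add: self_le_power)
      finally have "32 / (L * gap * u) \<le> B\<^sup>2" .
      then have "4 / (L * gap) * (2 / (u * B\<^sup>2)) \<le> 1 / 4" using L gap u B8 by (simp add: field_simps)
      moreover have "4 / (L * gap) * \<delta> \<le> 4 / (L * gap) * (2 / (u * B\<^sup>2))" using \<delta> L gap by (intro mult_left_mono) auto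
      ultimately show ?thesis by linarith
    qed
    have "(rho \<delta> (p1, q1, p2, q2) k)\<^sup>2 \<le> (1 + 16 / (L * gap) * \<delta>) * exp (T1 + T2)"
      unfolding Td Pd by (rule rho_square_upper_low) (use Pp \<delta> k t ov in \<open>auto simp: Pd\<close>)
    also have "\<dots> \<le> (1 + 16 / (L * gap) * \<delta>) * exp (- y)"
      using TT L gap \<delta> by (intro mult_left_mono) (auto simp: y_def)
    also have "\<dots> \<le> exp (- y) + 16 / (L * gap) * \<delta>"
    proof -
      have "16 / (L * gap) * \<delta> * exp (- y) \<le> 16 / (L * gap) * \<delta> * 1" using y L gap \<delta> by (intro mult_left_mono) auto
      then show ?thesis by (simp add: distrib_right)
    qed
    also have "exp (- y) \<le> 1 - y + y\<^sup>2 / 2" by (rule exp_minus_le_quadratic[OF y(1)])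
    also have "y\<^sup>2 / 2 \<le> 32 / B\<^sup>2" using power_mono[OF y(2,1), of 2] by (simp add: power_divide)
    also have "16 / (L * gap) * \<delta> \<le> 2 * (16 / (L * gap * u) / B\<^sup>2)"
    proof -
      have "16 / (L * gap) * \<delta> \<le> 16 / (L * gap) * (2 / (u * B\<^sup>2))" using \<delta> L gap by (intro mult_left_mono) auto
      then show ?thesis by simp
    qed
    finally have "(rho \<delta> (p1, q1, p2, q2) k)\<^sup>2 \<le> 1 - 2 * (2 * m / B - C / B\<^sup>2)"
      by (simp add: C_def y_def add_divide_distrib)
    moreover have "2 * m / B - C / B\<^sup>2 \<le> 1"
    proof -
      have "2 * m / B \<le> 1" using m B8 by (auto simp: divide_le_eq)
      moreover have "0 \<le> C / B\<^sup>2" using C0 by simp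
      ultimately show ?thesis by linarith
    qed
    ultimately show "rho \<delta> (p1, q1, p2, q2) k \<le> 1 - (2 * m / B - C / B\<^sup>2)" by (rule le_of_square_le)
  qed (use c C0 in auto)
qed

text \<open>p and 1/q, rather than the exact roots of k = p + q k^2, are set to u B and u B^3; the
  difference is of relative order 1 / B^2.\<close>

definition best_one_sided :: "real \<Rightarrow> params" where
  "best_one_sided B = (u * B, 1 / (u * B ^ 3), u * B, 1 / (u * B ^ 3))"

text \<open>The first condition takes the outer pair B, B^7 and the second the inner pair B^3, B^5,
  in accordance with \<open>two_sided_ordered\<close>.\<close>

definition best_two_sided :: "real \<Rightarrow> params" where
  "best_two_sided B = (u * B, 1 / (u * B ^ 7), u * B ^ 3, 1 / (u * B ^ 5))"

lemma best_one_sided_factor: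
  obtains C B0 where "0 \<le> C" "8 \<le> B0"
    "\<And>B k. B0 \<le> B \<Longrightarrow> kmin \<le> k \<Longrightarrow> rho (overlap 2 2 B) (best_one_sided B) k \<le> 1 - (4 / B - C / B\<^sup>2)"
proof -
  obtain c C1 B1 where c: "0 < c" "0 \<le> C1" "8 \<le> B1" and low:
    "\<And>m B k \<delta> p1 q1 p2 q2. m \<in> {1, 2} \<Longrightarrow> B1 \<le> B \<Longrightarrow> kmin \<le> k \<Longrightarrow> k \<le> c * u * B \<Longrightarrow> 0 \<le> \<delta> \<Longrightarrow> \<delta> \<le> 2 / (u * B\<^sup>2) \<Longrightarrow>
      u * B \<le> ventcell_symbol p1 q1 k \<Longrightarrow> u * B \<le> ventcell_symbol p2 q2 k \<Longrightarrow>
      ventcell_symbol p1 q1 k \<le> u * B + k\<^sup>2 / (u * B ^ 3) \<Longrightarrow>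
      (m = 2 \<longrightarrow> ventcell_symbol p2 q2 k \<le> u * B + k\<^sup>2 / (u * B ^ 3)) \<Longrightarrow>
      rho \<delta> (p1, q1, p2, q2) k \<le> 1 - (2 * m / B - C1 / B\<^sup>2)"
    using low_sufficient by blast
  obtain C2 B2 where C2: "0 \<le> C2" "8 \<le> B2" and high:
    "\<And>m B k \<delta> p1 q1 p2 q2. 0 \<le> m \<Longrightarrow> m \<le> 2 \<Longrightarrow> B2 \<le> B \<Longrightarrow> c * u * B \<le> k \<Longrightarrow> (p1, q1, p2, q2) \<in> positive \<Longrightarrow> 0 \<le> \<delta> \<Longrightarrow>
      m * (2 / B * (1 - 272 / B)) \<le> k * \<delta> + well (ventcell_symbol p1 q1 k / k) + well (ventcell_symbol p2 q2 k / k) \<Longrightarrow>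
      rho \<delta> (p1, q1, p2, q2) k \<le> 1 - (2 * m / B - C2 / B\<^sup>2)"
    using high_sufficient[OF c(1)] by blast
  show thesis
  proof (rule that[of "C1 + C2" "B1 + B2 + 272 + 16 / c"])
    fix B k
    assume B: "B1 + B2 + 272 + 16 / c \<le> B" and k: "kmin \<le> k"
    have "0 \<le> 16 / c" using c by simp
    then have Bs: "B1 \<le> B" "B2 \<le> B" "272 \<le> B" "16 / c \<le> B" "1 \<le> B" "0 < B" using B c C2 by linarith+
    define \<delta> where "\<delta> = overlap 2 2 B"
    have \<delta>: "0 \<le> \<delta>" "\<delta> \<le> 2 / (u * B\<^sup>2)" using overlap_bounds(1,2)[of 2 2 B] Bs by (auto simp: \<delta>_def)
    have kp: "0 < k" using k kmin by simp
    have sym: "ventcell_symbol (u * B) (1 / (u * B ^ 3)) k = u * B + k\<^sup>2 / (u * B ^ 3)" by (simp add: ventcell_symbol_def)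
    have nn: "0 \<le> k\<^sup>2 / (u * B ^ 3)" using u Bs by simp
    have "rho \<delta> (best_one_sided B) k \<le> 1 - (2 * 2 / B - (C1 + C2) / B\<^sup>2)"
    \<comment> \<open>The constant c of the low-frequency estimate is also the start of the
      high-frequency one, so the two regimes leave no gap.\<close>
    proof (cases "k \<le> c * u * B")
      case True
      have "rho \<delta> (best_one_sided B) k \<le> 1 - (2 * 2 / B - C1 / B\<^sup>2)"
        unfolding best_one_sided_def by (rule low) (use Bs k True \<delta> nn sym in auto)
      moreover have "C1 / B\<^sup>2 \<le> (C1 + C2) / B\<^sup>2" using C2 by (intro divide_right_mono) auto
      ultimately show ?thesis by linarith
    next
      case False
      define \<kappa> where "\<kappa> = k / u"
      have kk: "k = u * \<kappa>" using u by (simp add: \<kappa>_def)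
      have kap: "0 < \<kappa>" "c * B \<le> \<kappa>" using False kp u by (auto simp: \<kappa>_def le_divide_eq mult_ac)
      have Pk: "ventcell_symbol (u * B) (1 / (u * B ^ 3)) k / k = B / \<kappa> + \<kappa> / B ^ 3"
        unfolding sym unfolding kk using u kap Bs by (simp add: add_divide_distrib power2_eq_square)
      have kd: "k * \<delta> = 2 * (\<kappa> / B ^ 5)" unfolding \<delta>_def overlap_def kk using u by simp
      have "rho \<delta> (best_one_sided B) k \<le> 1 - (2 * 2 / B - C2 / B\<^sup>2)"
        unfolding best_one_sided_def
      proof (rule high)
        show "2 * (2 / B * (1 - 272 / B)) \<le> k * \<delta> + well (ventcell_symbol (u * B) (1 / (u * B ^ 3)) k / k)
          + well (ventcell_symbol (u * B) (1 / (u * B ^ 3)) k / k)"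
          using one_condition_lower[OF c(1) kap(2) Bs(3,4)] unfolding Pk kd by linarith
      qed (use Bs False \<delta> u in \<open>auto simp: positive_def\<close>)
      moreover have "C2 / B\<^sup>2 \<le> (C1 + C2) / B\<^sup>2" using c by (intro divide_right_mono) auto
      ultimately show ?thesis by linarith
    qed
    then show "rho (overlap 2 2 B) (best_one_sided B) k \<le> 1 - (4 / B - (C1 + C2) / B\<^sup>2)" by (simp add: \<delta>_def)
  next
    have "0 \<le> 16 / c" using c by simp
    then show "8 \<le> B1 + B2 + 272 + 16 / c" using c C2 by linarith
  qed (use c C2 in auto)
qed

lemma best_two_sided_factor:
  obtains C B0 where "0 \<le> C" "8 \<le> B0"
    "\<And>B k. B0 \<le> B \<Longrightarrow> kmin \<le> k \<Longrightarrow> rho (overlap 1 4 B) (best_two_sided B) k \<le> 1 - (2 / B - C / B\<^sup>2)"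
proof -
  obtain c C1 B1 where c: "0 < c" "0 \<le> C1" "8 \<le> B1" and low:
    "\<And>m B k \<delta> p1 q1 p2 q2. m \<in> {1, 2} \<Longrightarrow> B1 \<le> B \<Longrightarrow> kmin \<le> k \<Longrightarrow> k \<le> c * u * B \<Longrightarrow> 0 \<le> \<delta> \<Longrightarrow> \<delta> \<le> 2 / (u * B\<^sup>2) \<Longrightarrow>
      u * B \<le> ventcell_symbol p1 q1 k \<Longrightarrow> u * B \<le> ventcell_symbol p2 q2 k \<Longrightarrow>
      ventcell_symbol p1 q1 k \<le> u * B + k\<^sup>2 / (u * B ^ 3) \<Longrightarrow>
      (m = 2 \<longrightarrow> ventcell_symbol p2 q2 k \<le> u * B + k\<^sup>2 / (u * B ^ 3)) \<Longrightarrow>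
      rho \<delta> (p1, q1, p2, q2) k \<le> 1 - (2 * m / B - C1 / B\<^sup>2)"
    using low_sufficient by blast
  obtain C2 B2 where C2: "0 \<le> C2" "8 \<le> B2" and high:
    "\<And>m B k \<delta> p1 q1 p2 q2. 0 \<le> m \<Longrightarrow> m \<le> 2 \<Longrightarrow> B2 \<le> B \<Longrightarrow> c * u * B \<le> k \<Longrightarrow> (p1, q1, p2, q2) \<in> positive \<Longrightarrow> 0 \<le> \<delta> \<Longrightarrow>
      m * (2 / B * (1 - 272 / B)) \<le> k * \<delta> + well (ventcell_symbol p1 q1 k / k) + well (ventcell_symbol p2 q2 k / k) \<Longrightarrow>
      rho \<delta> (p1, q1, p2, q2) k \<le> 1 - (2 * m / B - C2 / B\<^sup>2)"
    using high_sufficient[OF c(1)] by blast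
  show thesis
  proof (rule that[of "C1 + C2" "B1 + B2 + 272 + 16 / c"])
    fix B k
    assume B: "B1 + B2 + 272 + 16 / c \<le> B" and k: "kmin \<le> k"
    have "0 \<le> 16 / c" using c by simp
    then have Bs: "B1 \<le> B" "B2 \<le> B" "272 \<le> B" "16 / c \<le> B" "1 \<le> B" "0 < B" using B c C2 by linarith+
    define \<delta> where "\<delta> = overlap 1 4 B"
    have \<delta>: "0 \<le> \<delta>" "\<delta> \<le> 2 / (u * B\<^sup>2)" using overlap_bounds(1,2)[of 1 4 B] Bs by (auto simp: \<delta>_def)
    have kp: "0 < k" using k kmin by simp
    have sym: "ventcell_symbol (u * B) (1 / (u * B ^ 7)) k = u * B + k\<^sup>2 / (u * B ^ 7)"
      "ventcell_symbol (u * B ^ 3) (1 / (u * B ^ 5)) k = u * B ^ 3 + k\<^sup>2 / (u * B ^ 5)" by (simp_all add: ventcell_symbol_def)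
    have nn: "0 \<le> k\<^sup>2 / (u * B ^ 7)" "0 \<le> k\<^sup>2 / (u * B ^ 5)" using u Bs by simp_all
    have le: "k\<^sup>2 / (u * B ^ 7) \<le> k\<^sup>2 / (u * B ^ 3)" 
    proof -
      have "B ^ 3 \<le> B ^ 7" using Bs by (intro power_increasing) auto
      then show ?thesis using u Bs by (intro divide_left_mono mult_left_mono mult_pos_pos) auto
    qed
    have B3: "u * B \<le> u * B ^ 3" using u Bs by (intro mult_left_mono self_le_power) auto
    have "rho \<delta> (best_two_sided B) k \<le> 1 - (2 * 1 / B - (C1 + C2) / B\<^sup>2)"
    proof (cases "k \<le> c * u * B")
      case True
      have "rho \<delta> (best_two_sided B) k \<le> 1 - (2 * 1 / B - C1 / B\<^sup>2)"
        unfolding best_two_sided_def by (rule low) (use Bs k True \<delta> nn sym le B3 in auto)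
      moreover have "C1 / B\<^sup>2 \<le> (C1 + C2) / B\<^sup>2" using C2 by (intro divide_right_mono) auto
      ultimately show ?thesis by linarith
    next
      case False
      define \<kappa> where "\<kappa> = k / u"
      have kk: "k = u * \<kappa>" using u by (simp add: \<kappa>_def)
      have kap: "0 < \<kappa>" "c * B \<le> \<kappa>" using False kp u by (auto simp: \<kappa>_def le_divide_eq mult_ac)
      have Pk: "ventcell_symbol (u * B) (1 / (u * B ^ 7)) k / k = B / \<kappa> + \<kappa> / B ^ 7"
        "ventcell_symbol (u * B ^ 3) (1 / (u * B ^ 5)) k / k = B ^ 3 / \<kappa> + \<kappa> / B ^ 5"
        unfolding sym unfolding kk using u kap Bs by (simp_all add: add_divide_distrib power2_eq_square)
      have kd: "k * \<delta> = \<kappa> / B ^ 9" unfolding \<delta>_def overlap_def kk using u by simp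
      have "rho \<delta> (best_two_sided B) k \<le> 1 - (2 * 1 / B - C2 / B\<^sup>2)"
        unfolding best_two_sided_def
      proof (rule high)
        show "1 * (2 / B * (1 - 272 / B)) \<le> k * \<delta> + well (ventcell_symbol (u * B) (1 / (u * B ^ 7)) k / k)
          + well (ventcell_symbol (u * B ^ 3) (1 / (u * B ^ 5)) k / k)"
          using two_conditions_lower[OF c(1) kap(2) Bs(3,4)] unfolding Pk kd by linarith
      qed (use Bs False \<delta> u in \<open>auto simp: positive_def\<close>)
      moreover have "C2 / B\<^sup>2 \<le> (C1 + C2) / B\<^sup>2" using c by (intro divide_right_mono) auto
      ultimately show ?thesis by linarith
    qed
    then show "rho (overlap 1 4 B) (best_two_sided B) k \<le> 1 - (2 / B - (C1 + C2) / B\<^sup>2)" by (simp add: \<delta>_def)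
  next
    have "0 \<le> 16 / c" using c by simp
    then show "8 \<le> B1 + B2 + 272 + 16 / c" using c C2 by linarith
  qed (use c C2 in auto)
qed

end

section \<open>Existence of minimizers\<close>

context schwarz
begin

text \<open>A crude bound whose purpose is to make the supremum over the frequencies well
  behaved.\<close>

lemma rho_le_bound:
  assumes x: "x \<in> positive" and "0 \<le> \<delta>" "kmin \<le> k"
  shows "rho \<delta> x k \<le> 2 / gap"
proof -
  obtain p1 q1 p2 q2 where x_eq: "x = (p1, q1, p2, q2)" and pos: "0 < p1" "0 < q1" "0 < p2" "0 < q2"
    using x by (auto simp: positive_def)
  have dk: "decay k \<le> 1 - gap" "0 < decay k" "decay k < 1"
    using decay_antimono[of kmin k] decay_bounds[of k] kmin assms(3) by (auto simp: gap_def)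
  have ratio: "cmod (num p P k) / cmod (den \<delta> p' P k) \<le> 2 / gap" if "0 < p" "0 < p'" "0 < P" for p p' P
  proof -
    define a b where ab: "a = cmod (of_real P - lam k)" "b = cmod (of_real P + lam k)"
    have le: "a \<le> b" "0 < b" "0 \<le> a" using norm_diff_less[OF that(3), of k] norm_add_pos[OF that(3), of k] by (auto simp: ab)
    have "cmod (refl p k * (of_real P + lam k)) \<le> 1 * b"
      unfolding norm_mult ab using norm_refl_le[OF that(1), of k] dk by (intro mult_right_mono) auto
    then have n: "cmod (num p P k) \<le> 2 * b"
      using norm_triangle_ineq[of "of_real P - lam k" "refl p k * (of_real P + lam k)"] le unfolding num_eq ab by linarith
    have "cmod (refl' \<delta> p' k * (of_real P - lam k)) \<le> (1 - gap) * b"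
      unfolding norm_mult ab(1)[symmetric] using norm_refl'_le[OF that(2) assms(2), of k] dk le by (intro mult_mono) auto
    then have "b - (1 - gap) * b \<le> cmod (den \<delta> p' P k)"
      using norm_diff_ineq[of "of_real P + lam k" "refl' \<delta> p' k * (of_real P - lam k)"] unfolding den_eq ab by linarith
    then have d: "gap * b \<le> cmod (den \<delta> p' P k)" by (simp add: algebra_simps)
    have "0 < gap * b" using gap le by simp
    then have "cmod (num p P k) / cmod (den \<delta> p' P k) \<le> 2 * b / (gap * b)" using n d le by (intro frac_le) auto
    then show ?thesis using le by simp
  qed
  have "(rho \<delta> x k)\<^sup>2 \<le> 1 * (2 / gap * (2 / gap))"
    unfolding x_eq rho_square using re_pos[of k] assms(2) gap pos symbol_pos pa pb
    by (intro mult_mono ratio) auto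
  then have "(rho \<delta> x k)\<^sup>2 \<le> (2 / gap)\<^sup>2" by (simp add: power2_eq_square)
  then show ?thesis by (rule power2_le_imp_le) (use gap in simp)
qed

lemma rho_tendsto:
  assumes X: "X \<longlonglongrightarrow> x" and x: "x \<in> positive" and \<delta>: "0 \<le> \<delta>"
  shows "(\<lambda>n. rho \<delta> (X n) k) \<longlonglongrightarrow> rho \<delta> x k"
proof -
  define F where "F x = exp (- 2 * re k * \<delta>) *
    ((cmod (num pa (ventcell_symbol (fst (snd (snd x))) (snd (snd (snd x))) k) k) /
      cmod (den \<delta> pb (ventcell_symbol (fst (snd (snd x))) (snd (snd (snd x))) k) k)) *
     (cmod (num pb (ventcell_symbol (fst x) (fst (snd x)) k) k) /
      cmod (den \<delta> pa (ventcell_symbol (fst x) (fst (snd x)) k) k)))" for x :: params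
  have rF: "rho \<delta> y k = sqrt (F y)" for y
  proof -
    have "(rho \<delta> y k)\<^sup>2 = F y" using rho_square[of \<delta> "fst y" "fst (snd y)" "fst (snd (snd y))" "snd (snd (snd y))" k] by (simp add: F_def)
    then show ?thesis using rho_nonneg[of \<delta> y k] by (metis real_sqrt_unique)
  qed
  have pos: "0 < ventcell_symbol (fst x) (fst (snd x)) k" "0 < ventcell_symbol (fst (snd (snd x))) (snd (snd (snd x))) k"
    using x by (auto simp: positive_def intro: symbol_pos)
  have num: "(\<lambda>n. num p (P n) k) \<longlonglongrightarrow> num p P0 k" and den: "(\<lambda>n. den \<delta> p (P n) k) \<longlonglongrightarrow> den \<delta> p P0 k"
    if "P \<longlonglongrightarrow> P0" for p P P0
    unfolding num_def den_def by (intro tendsto_intros that)+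
  have sym: "(\<lambda>n. ventcell_symbol (p n) (q n) k) \<longlonglongrightarrow> ventcell_symbol p0 q0 k" if "p \<longlonglongrightarrow> p0" "q \<longlonglongrightarrow> q0" for p q p0 q0
    unfolding ventcell_symbol_def by (intro tendsto_intros that)
  have "(\<lambda>n. F (X n)) \<longlonglongrightarrow> F x"
    unfolding F_def using den_nonzero[OF pa \<delta> pos(1), of k] den_nonzero[OF pb \<delta> pos(2), of k]
    by (intro tendsto_mult tendsto_divide tendsto_norm num den sym tendsto_fst tendsto_snd tendsto_const X) auto
  then show ?thesis unfolding rF by (rule tendsto_real_sqrt)
qed

definition worst :: "real \<Rightarrow> real \<Rightarrow> params \<Rightarrow> real" where
  "worst \<delta> kmax x = (SUP k \<in> {kmin..kmax}. rho \<delta> x k)"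

lemma rho_le_worst:
  assumes "x \<in> positive" "0 \<le> \<delta>" "k \<in> {kmin..kmax}"
  shows "rho \<delta> x k \<le> worst \<delta> kmax x"
  unfolding worst_def
  by (rule cSUP_upper[OF assms(3)]) (use rho_le_bound[OF assms(1,2)] in \<open>auto intro!: bdd_aboveI2\<close>)

lemma worst_le:
  assumes "kmin \<le> kmax" "\<And>k. k \<in> {kmin..kmax} \<Longrightarrow> rho \<delta> x k \<le> y"
  shows "worst \<delta> kmax x \<le> y"
  unfolding worst_def using assms by (intro cSUP_least) auto

lemma worst_nonneg:
  assumes "x \<in> positive" "0 \<le> \<delta>" "kmin \<le> kmax" shows "0 \<le> worst \<delta> kmax x"
  using rho_le_worst[OF assms(1,2), of kmin kmax] rho_nonneg[of \<delta> x kmin] assms(3) by auto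

text \<open>\<open>worst\<close> is a supremum of continuous functions, hence lower semicontinuous; a minimizer over the
  non-closed set \<open>A\<close> exists as soon as near-optimal points are confined to a compact part of \<open>A\<close>.\<close>

lemma minimizer_exists:
  assumes Bx: "compact Bx" "Bx \<subseteq> A" and A: "A \<subseteq> positive" and y: "y \<in> Bx" and \<delta>: "0 \<le> \<delta>" "kmin \<le> kmax"
    and conf: "\<And>x. x \<in> A \<Longrightarrow> worst \<delta> kmax x \<le> worst \<delta> kmax y \<Longrightarrow> x \<in> Bx"
  shows "\<exists>x. minmax_solution (worst \<delta> kmax) A x"
proof -
  define f where "f = worst \<delta> kmax"
  define I where "I = (INF x \<in> Bx. f x)"
  have bdd: "bdd_below (f ` Bx)" using worst_nonneg Bx A \<delta> by (intro bdd_belowI2[of _ 0]) (auto simp: f_def)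
  have "\<exists>x. x \<in> Bx \<and> f x < I + 1 / Suc n" for n
  proof -
    have "I < I + 1 / Suc n" by simp
    then show ?thesis using y bdd unfolding I_def by (subst (asm) cINF_less_iff) auto
  qed
  then obtain X where X: "\<And>n. X n \<in> Bx" "\<And>n. f (X n) < I + 1 / Suc n" by metis
  obtain x r where xr: "x \<in> Bx" "strict_mono (r :: nat \<Rightarrow> nat)" "(X \<circ> r) \<longlonglongrightarrow> x"
    using Bx(1) X(1) unfolding compact_def by blast
  have xp: "x \<in> positive" using xr Bx A by auto
  have fx: "f x \<le> I"
    unfolding f_def
  proof (rule worst_le[OF \<delta>(2)])
    fix k assume k: "k \<in> {kmin..kmax}"
    have lim: "(\<lambda>n. rho \<delta> ((X \<circ> r) n) k) \<longlonglongrightarrow> rho \<delta> x k" by (rule rho_tendsto[OF xr(3) xp \<delta>(1)])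
    have "(\<lambda>n. I + 1 / Suc n) \<longlonglongrightarrow> I + 0" by (intro tendsto_intros LIMSEQ_Suc lim_1_over_n)
    moreover have "\<exists>N. \<forall>n\<ge>N. rho \<delta> ((X \<circ> r) n) k \<le> I + 1 / Suc n"
    proof (intro exI allI impI)
      fix n :: nat
      have "rho \<delta> ((X \<circ> r) n) k \<le> f ((X \<circ> r) n)" unfolding f_def
        using X(1)[of "r n"] Bx A \<delta>(1) k by (intro rho_le_worst) auto
      also have "\<dots> \<le> I + 1 / Suc (r n)" using X(2)[of "r n"] by simp
      also have "\<dots> \<le> I + 1 / Suc n" using seq_suble[OF xr(2), of n] by (intro add_left_mono divide_left_mono) auto
      finally show "rho \<delta> ((X \<circ> r) n) k \<le> I + 1 / Suc n" .
    qed
    ultimately show "rho \<delta> x k \<le> I" using LIMSEQ_le[OF lim] by simp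
  qed
  have "is_arg_min f (\<lambda>x. x \<in> A) x"
    unfolding is_arg_min_def
  proof (intro conjI notI)
    show "x \<in> A" using xr Bx by auto
    assume "\<exists>z. z \<in> A \<and> f z < f x"
    then obtain z where z: "z \<in> A" "f z < f x" by blast
    have "I \<le> f y" unfolding I_def using y bdd by (rule cINF_lower[rotated])
    \<comment> \<open>A point better than x is also better than y and hence confined to
      \<open>Bx\<close>, where I is the infimum.\<close>
    then have "z \<in> Bx" using z fx conf[OF z(1)] by (auto simp: f_def)
    then have "I \<le> f z" unfolding I_def using bdd by (intro cINF_lower)
    then show False using z fx by linarith
  qed
  then show ?thesis unfolding minmax_solution_def f_def by blast
qed

section \<open>Optimal parameters at a fixed scale\<close>

definition admissible :: "nat \<Rightarrow> real \<Rightarrow> real \<Rightarrow> bool" where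
  "admissible N B kmax \<longleftrightarrow> kmin \<le> kmax \<and> (\<forall>i\<in>{1..N}. u * B ^ (2 * i) \<in> {kmin..kmax})"

lemma one_sided_positive: "one_sided \<subseteq> positive"
  by (auto simp: one_sided_def positive_def)

lemma two_sided_positive: "two_sided \<subseteq> positive" "two_sided_ordered \<subseteq> two_sided"
  by (auto simp: two_sided_def two_sided_ordered_def positive_def)

lemma box_center: "0 < b \<Longrightarrow> (b :: real) \<in> {b / 2..2 * b}"
  by simp

lemma ratio_box:
  fixes y b :: real
  assumes "\<bar>y / b - 1\<bar> \<le> 1 / 2" "0 < b" shows "y \<in> {b / 2..2 * b}"
proof -
  have "1 / 2 \<le> y / b" "y / b \<le> 2" using assms(1) by linarith+
  then show ?thesis using assms(2) by (auto simp: field_simps)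
qed

lemma inverse_ratio_box:
  fixes q b :: real
  assumes "\<bar>1 / (q * b) - 1\<bar> \<le> 1 / 2" "0 < b" "0 < q" shows "q \<in> {1 / b / 2..2 * (1 / b)}"
proof -
  have "1 / 2 \<le> 1 / (q * b)" "1 / (q * b) \<le> 2" using assms(1) by linarith+
  then show ?thesis using assms(2,3) by (auto simp: field_simps)
qed

text \<open>The constants do not depend on \<open>kmax\<close>: the explicit parameters are
  controlled at every k \<ge> kmin, and the lower bound looks at the test frequencies alone.\<close>

lemma one_sided_at_scale:
  obtains C B0 where "0 \<le> C" "8 \<le> B0"
    "\<And>B kmax. B0 \<le> B \<Longrightarrow> admissible 2 B kmax \<Longrightarrow>
      worst (overlap 2 2 B) kmax (best_one_sided B) \<le> 1 - 4 / B + C / B\<^sup>2 \<and>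
      (\<forall>x\<in>one_sided. 1 - 4 / B - C / B\<^sup>2 \<le> worst (overlap 2 2 B) kmax x) \<and>
      (\<forall>p q. 0 < p \<longrightarrow> 0 < q \<longrightarrow> worst (overlap 2 2 B) kmax (p, q, p, q) \<le> worst (overlap 2 2 B) kmax (best_one_sided B) \<longrightarrow>
        \<bar>p / (u * B) - 1\<bar> \<le> C / B \<and> \<bar>1 / (q * (u * B ^ 3)) - 1\<bar> \<le> C / B) \<and>
      (\<exists>x. minmax_solution (worst (overlap 2 2 B) kmax) one_sided x)"
proof -
  obtain C1 B1 where 1: "0 \<le> C1" "8 \<le> B1" "\<And>B k. B1 \<le> B \<Longrightarrow> kmin \<le> k \<Longrightarrow> rho (overlap 2 2 B) (best_one_sided B) k \<le> 1 - (4 / B - C1 / B\<^sup>2)"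
    using best_one_sided_factor by blast
  obtain E2 B2 where 2: "0 \<le> E2" "8 \<le> B2"
    "\<And>B s p q. B2 \<le> B \<Longrightarrow> - 0 / B \<le> s \<Longrightarrow> s \<le> 1 \<Longrightarrow> 0 < p \<Longrightarrow> 0 < q \<Longrightarrow>
      rho (overlap 2 2 B) (p, q, p, q) kmin \<le> 1 - 4 / B * (1 + s) \<Longrightarrow>
      (\<And>i. i \<in> {1..2} \<Longrightarrow> rho (overlap 2 2 B) (p, q, p, q) (u * B ^ (2 * i)) \<le> 1 - 4 / B * (1 + s)) \<Longrightarrow>
      2 * s \<le> E2 / B \<and> \<bar>p / (u * B) - 1\<bar> \<le> E2 / B \<and> \<bar>1 / (q * u * B ^ 3) - 1\<bar> \<le> E2 / B"
    using one_sided_stability[OF order_refl] by blast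
  have C14: "0 \<le> C1 / 4" using 1 by simp
  obtain E3 B3 where 3: "0 \<le> E3" "8 \<le> B3"
    "\<And>B s p q. B3 \<le> B \<Longrightarrow> - (C1 / 4) / B \<le> s \<Longrightarrow> s \<le> 1 \<Longrightarrow> 0 < p \<Longrightarrow> 0 < q \<Longrightarrow>
      rho (overlap 2 2 B) (p, q, p, q) kmin \<le> 1 - 4 / B * (1 + s) \<Longrightarrow>
      (\<And>i. i \<in> {1..2} \<Longrightarrow> rho (overlap 2 2 B) (p, q, p, q) (u * B ^ (2 * i)) \<le> 1 - 4 / B * (1 + s)) \<Longrightarrow>
      2 * s \<le> E3 / B \<and> \<bar>p / (u * B) - 1\<bar> \<le> E3 / B \<and> \<bar>1 / (q * u * B ^ 3) - 1\<bar> \<le> E3 / B"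
    using one_sided_stability[OF C14] by blast
  define C where "C = C1 + 4 * (E2 + 1) + E3"
  define B0 where "B0 = B1 + B2 + B3 + E2 + 1 + 2 * E3"
  show thesis
  proof (rule that[of C B0])
    show "0 \<le> C" "8 \<le> B0" using 1 2 3 by (auto simp: C_def B0_def)
    fix B kmax assume B: "B0 \<le> B" and adm: "admissible 2 B kmax"
    have Bs: "B1 \<le> B" "B2 \<le> B" "B3 \<le> B" "E2 + 1 \<le> B" "2 * E3 \<le> B" "8 \<le> B" "0 < B" using B 1 2 3 by (auto simp: B0_def)
    define \<delta> where "\<delta> = overlap 2 2 B"
    have \<delta>: "0 \<le> \<delta>" using overlap_bounds(1)[of 2 2 B] Bs by (simp add: \<delta>_def)
    have km: "kmin \<le> kmax" "\<And>i. i \<in> {1..2} \<Longrightarrow> u * B ^ (2 * i) \<in> {kmin..kmax}" using adm by (auto simp: admissible_def)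
    have frac: "a \<le> C \<Longrightarrow> a / B\<^sup>2 \<le> C / B\<^sup>2" "a \<le> C \<Longrightarrow> a / B \<le> C / B" for a
      using Bs by (auto intro: divide_right_mono)
    have CC: "C1 \<le> C" "4 * (E2 + 1) \<le> C" "E3 \<le> C" using 1 2 3 by (auto simp: C_def)
    have best: "worst \<delta> kmax (best_one_sided B) \<le> 1 - 4 / B + C1 / B\<^sup>2"
    proof (rule worst_le[OF km(1)])
      show "rho \<delta> (best_one_sided B) k \<le> 1 - 4 / B + C1 / B\<^sup>2" if "k \<in> {kmin..kmax}" for k
        using 1(3)[OF Bs(1), of k] that unfolding \<delta>_def by auto
    qed
    have lower: "1 - 4 / B - C / B\<^sup>2 \<le> worst \<delta> kmax x" if x: "x \<in> one_sided" for x
    proof (rule ccontr)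
      assume "\<not> ?thesis"
      then have lt: "worst \<delta> kmax x < 1 - 4 / B - C / B\<^sup>2" by simp
      obtain p q where pq: "x = (p, q, p, q)" "0 < p" "0 < q" using x by (auto simp: one_sided_def)
      \<comment> \<open>Chosen so that the conclusion 2 s \<le> E2 / B of the stability lemma
        fails.\<close>
      define s where "s = (E2 + 1) / B"
      have s: "- 0 / B \<le> s" "s \<le> 1" using Bs 2 by (auto simp: s_def)
      have "4 / B * (1 + s) = 4 / B + 4 * (E2 + 1) / B\<^sup>2" by (simp add: s_def distrib_left power2_eq_square add_divide_distrib)
      then have "worst \<delta> kmax x \<le> 1 - 4 / B * (1 + s)" using lt frac(1)[OF CC(2)] by linarith
      then have r: "rho \<delta> x k \<le> 1 - 4 / B * (1 + s)" if "k \<in> {kmin..kmax}" for k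
        using rho_le_worst[of x \<delta> k kmax] that x one_sided_positive \<delta> by fastforce
      have "2 * s \<le> E2 / B"
        using 2(3)[OF Bs(2) s pq(2,3)] r[of kmin] r[OF km(2)] km(1) unfolding pq(1) \<delta>_def by auto
      then have "2 * s * B \<le> E2 / B * B" using Bs by (intro mult_right_mono) auto
      then show False using Bs 2 by (simp add: s_def)
    qed
    have stable: "\<bar>p / (u * B) - 1\<bar> \<le> E3 / B \<and> \<bar>1 / (q * (u * B ^ 3)) - 1\<bar> \<le> E3 / B"
      if pq: "0 < p" "0 < q" and le: "worst \<delta> kmax (p, q, p, q) \<le> worst \<delta> kmax (best_one_sided B)" for p q
    proof -
      \<comment> \<open>Makes \<open>1 - 4 / B * (1 + s)\<close> equal to
        \<open>1 - 4 / B + C1 / B\<^sup>2\<close>, the bound known for the explicit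
        parameters.\<close>
      define s where "s = - (C1 / 4) / B"
      have s: "- (C1 / 4) / B \<le> s" "s \<le> 1" 
      proof -
        have "0 \<le> C1 / 4 / B" using C14 Bs by simp
        then show "s \<le> 1" by (simp add: s_def)
      qed (simp add: s_def)
      have "4 / B * (1 + s) = 4 / B - C1 / B\<^sup>2" by (simp add: s_def distrib_left power2_eq_square diff_divide_distrib)
      then have "worst \<delta> kmax (p, q, p, q) \<le> 1 - 4 / B * (1 + s)" using le best by linarith
      moreover have "(p, q, p, q) \<in> positive" using pq by (simp add: positive_def)
      ultimately have r: "rho \<delta> (p, q, p, q) k \<le> 1 - 4 / B * (1 + s)" if "k \<in> {kmin..kmax}" for k
        using rho_le_worst[of "(p, q, p, q)" \<delta> k kmax] that \<delta> by fastforce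
      show ?thesis
        using 3(3)[OF Bs(3) s pq] r[of kmin] r[OF km(2)] km(1) unfolding \<delta>_def by (auto simp: mult.assoc)
    qed
    have ex: "\<exists>x. minmax_solution (worst \<delta> kmax) one_sided x"
    proof (rule minimizer_exists)
      \<comment> \<open>Competitors satisfy the ratio bounds with E3 / B \<le> 1 / 2, which confines
        each parameter between half and twice its expected value.\<close>
      define Bx where "Bx = (\<lambda>(p, q). (p, q, p, q)) ` ({u * B / 2..2 * (u * B)} \<times> {1 / (u * B ^ 3) / 2..2 * (1 / (u * B ^ 3))})"
      show "compact Bx" unfolding Bx_def
        by (intro compact_continuous_image compact_Times) (auto simp: case_prod_unfold intro!: continuous_intros)
      have up: "0 < u * B / 2" "0 < 1 / (u * B ^ 3) / 2" using u Bs by simp_all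
      show "Bx \<subseteq> one_sided"
      proof
        fix x assume "x \<in> Bx"
        then obtain p q where pq: "x = (p, q, p, q)" "u * B / 2 \<le> p" "1 / (u * B ^ 3) / 2 \<le> q"
          unfolding Bx_def by force
        have "0 < p" "0 < q" using up pq(2,3) by linarith+
        then show "x \<in> one_sided" unfolding pq(1) one_sided_def by blast
      qed
      show "one_sided \<subseteq> positive" by (rule one_sided_positive)
      show "best_one_sided B \<in> Bx"
        unfolding Bx_def best_one_sided_def using u Bs
        by (intro image_eqI[of _ _ "(u * B, 1 / (u * B ^ 3))"] SigmaI box_center) simp_all
      show "0 \<le> \<delta>" "kmin \<le> kmax" using \<delta> km by auto
      show "x \<in> Bx" if x: "x \<in> one_sided" and le: "worst \<delta> kmax x \<le> worst \<delta> kmax (best_one_sided B)" for x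
      proof -
        obtain p q where pq: "x = (p, q, p, q)" "0 < p" "0 < q" using x by (auto simp: one_sided_def)
        have "E3 / B \<le> 1 / 2" using Bs by (simp add: divide_le_eq)
        then have "\<bar>p / (u * B) - 1\<bar> \<le> 1 / 2" "\<bar>1 / (q * (u * B ^ 3)) - 1\<bar> \<le> 1 / 2"
          using stable[OF pq(2,3) le[unfolded pq(1)]] by linarith+
        then have "p \<in> {u * B / 2..2 * (u * B)}" "q \<in> {1 / (u * B ^ 3) / 2..2 * (1 / (u * B ^ 3))}"
          using ratio_box[of p "u * B"] inverse_ratio_box[of q "u * B ^ 3"] pq u Bs by simp_all
        then show ?thesis unfolding Bx_def pq(1) by (intro image_eqI[of _ _ "(p, q)"]) auto
      qed
    qed
    show "worst (overlap 2 2 B) kmax (best_one_sided B) \<le> 1 - 4 / B + C / B\<^sup>2 \<and>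
      (\<forall>x\<in>one_sided. 1 - 4 / B - C / B\<^sup>2 \<le> worst (overlap 2 2 B) kmax x) \<and>
      (\<forall>p q. 0 < p \<longrightarrow> 0 < q \<longrightarrow> worst (overlap 2 2 B) kmax (p, q, p, q) \<le> worst (overlap 2 2 B) kmax (best_one_sided B) \<longrightarrow>
        \<bar>p / (u * B) - 1\<bar> \<le> C / B \<and> \<bar>1 / (q * (u * B ^ 3)) - 1\<bar> \<le> C / B) \<and>
      (\<exists>x. minmax_solution (worst (overlap 2 2 B) kmax) one_sided x)"
      unfolding \<delta>_def[symmetric]
    proof (intro conjI allI impI ballI)
      show "worst \<delta> kmax (best_one_sided B) \<le> 1 - 4 / B + C / B\<^sup>2" using best frac(1)[OF CC(1)] by linarith
    qed (use lower ex stable frac(2)[OF CC(3)] in \<open>blast intro: order_trans\<close>)+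
  qed
qed

text \<open>The lower bound covers all of \<open>two_sided\<close>. Existence and position are
  claimed on the ordered set, where near-optimal points lie in a single box.\<close>

lemma two_sided_at_scale:
  obtains C B0 where "0 \<le> C" "8 \<le> B0"
    "\<And>B kmax. B0 \<le> B \<Longrightarrow> admissible 4 B kmax \<Longrightarrow>
      best_two_sided B \<in> two_sided_ordered \<and>
      worst (overlap 1 4 B) kmax (best_two_sided B) \<le> 1 - 2 / B + C / B\<^sup>2 \<and>
      (\<forall>x\<in>two_sided. 1 - 2 / B - C / B\<^sup>2 \<le> worst (overlap 1 4 B) kmax x) \<and>
      (\<forall>p1 q1 p2 q2. (p1, q1, p2, q2) \<in> two_sided_ordered \<longrightarrow>
        worst (overlap 1 4 B) kmax (p1, q1, p2, q2) \<le> worst (overlap 1 4 B) kmax (best_two_sided B) \<longrightarrow>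
        \<bar>p1 / (u * B) - 1\<bar> \<le> C / B \<and> \<bar>1 / (q1 * (u * B ^ 7)) - 1\<bar> \<le> C / B \<and>
        \<bar>p2 / (u * B ^ 3) - 1\<bar> \<le> C / B \<and> \<bar>1 / (q2 * (u * B ^ 5)) - 1\<bar> \<le> C / B) \<and>
      (\<exists>x. minmax_solution (worst (overlap 1 4 B) kmax) two_sided_ordered x)"
proof -
  obtain C1 B1 where 1: "0 \<le> C1" "8 \<le> B1" "\<And>B k. B1 \<le> B \<Longrightarrow> kmin \<le> k \<Longrightarrow> rho (overlap 1 4 B) (best_two_sided B) k \<le> 1 - (2 / B - C1 / B\<^sup>2)"
    using best_two_sided_factor by blast
  obtain E2 B2 where 2: "0 \<le> E2" "8 \<le> B2"
    "\<And>B s p1 q1 p2 q2. B2 \<le> B \<Longrightarrow> - 0 / B \<le> s \<Longrightarrow> s \<le> 1 \<Longrightarrow> (p1, q1, p2, q2) \<in> positive \<Longrightarrow>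
      rho (overlap 1 4 B) (p1, q1, p2, q2) kmin \<le> 1 - 2 / B * (1 + s) \<Longrightarrow>
      (\<And>i. i \<in> {1..4} \<Longrightarrow> rho (overlap 1 4 B) (p1, q1, p2, q2) (u * B ^ (2 * i)) \<le> 1 - 2 / B * (1 + s)) \<Longrightarrow>
      2 * s \<le> E2 / B \<and> (p1 < p2 \<longrightarrow> q1 < q2 \<longrightarrow>
        \<bar>p1 / (u * B) - 1\<bar> \<le> E2 / B \<and> \<bar>1 / (q1 * u * B ^ 7) - 1\<bar> \<le> E2 / B \<and>
        \<bar>p2 / (u * B ^ 3) - 1\<bar> \<le> E2 / B \<and> \<bar>1 / (q2 * u * B ^ 5) - 1\<bar> \<le> E2 / B)"
    using two_sided_stability[OF order_refl] by blast
  have C12: "0 \<le> C1 / 2" using 1 by simp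
  obtain E3 B3 where 3: "0 \<le> E3" "8 \<le> B3"
    "\<And>B s p1 q1 p2 q2. B3 \<le> B \<Longrightarrow> - (C1 / 2) / B \<le> s \<Longrightarrow> s \<le> 1 \<Longrightarrow> (p1, q1, p2, q2) \<in> positive \<Longrightarrow>
      rho (overlap 1 4 B) (p1, q1, p2, q2) kmin \<le> 1 - 2 / B * (1 + s) \<Longrightarrow>
      (\<And>i. i \<in> {1..4} \<Longrightarrow> rho (overlap 1 4 B) (p1, q1, p2, q2) (u * B ^ (2 * i)) \<le> 1 - 2 / B * (1 + s)) \<Longrightarrow>
      2 * s \<le> E3 / B \<and> (p1 < p2 \<longrightarrow> q1 < q2 \<longrightarrow>
        \<bar>p1 / (u * B) - 1\<bar> \<le> E3 / B \<and> \<bar>1 / (q1 * u * B ^ 7) - 1\<bar> \<le> E3 / B \<and>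
        \<bar>p2 / (u * B ^ 3) - 1\<bar> \<le> E3 / B \<and> \<bar>1 / (q2 * u * B ^ 5) - 1\<bar> \<le> E3 / B)"
    using two_sided_stability[OF C12] by blast
  define C where "C = C1 + 2 * (E2 + 1) + E3"
  define B0 where "B0 = B1 + B2 + B3 + E2 + 1 + 2 * E3"
  show thesis
  proof (rule that[of C B0])
    show "0 \<le> C" "8 \<le> B0" using 1 2 3 by (auto simp: C_def B0_def)
    fix B kmax assume B: "B0 \<le> B" and adm: "admissible 4 B kmax"
    have Bs: "B1 \<le> B" "B2 \<le> B" "B3 \<le> B" "E2 + 1 \<le> B" "2 * E3 \<le> B" "8 \<le> B" "0 < B" using B 1 2 3 by (auto simp: B0_def)
    define \<delta> where "\<delta> = overlap 1 4 B"
    have \<delta>: "0 \<le> \<delta>" using overlap_bounds(1)[of 1 4 B] Bs by (simp add: \<delta>_def)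
    have km: "kmin \<le> kmax" "\<And>i. i \<in> {1..4} \<Longrightarrow> u * B ^ (2 * i) \<in> {kmin..kmax}" using adm by (auto simp: admissible_def)
    have frac: "a \<le> C \<Longrightarrow> a / B\<^sup>2 \<le> C / B\<^sup>2" "a \<le> C \<Longrightarrow> a / B \<le> C / B" for a
      using Bs by (auto intro: divide_right_mono)
    have CC: "C1 \<le> C" "2 * (E2 + 1) \<le> C" "E3 \<le> C" using 1 2 3 by (auto simp: C_def)
    have best: "worst \<delta> kmax (best_two_sided B) \<le> 1 - 2 / B + C1 / B\<^sup>2"
    proof (rule worst_le[OF km(1)])
      show "rho \<delta> (best_two_sided B) k \<le> 1 - 2 / B + C1 / B\<^sup>2" if "k \<in> {kmin..kmax}" for k
        using 1(3)[OF Bs(1), of k] that unfolding \<delta>_def by auto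
    qed
    have lower: "1 - 2 / B - C / B\<^sup>2 \<le> worst \<delta> kmax x" if x: "x \<in> two_sided" for x
    proof (rule ccontr)
      assume "\<not> ?thesis"
      then have lt: "worst \<delta> kmax x < 1 - 2 / B - C / B\<^sup>2" by simp
      obtain p1 q1 p2 q2 where pq: "x = (p1, q1, p2, q2)" by (cases x) auto
      have xp: "x \<in> positive" using x two_sided_positive by auto
      define s where "s = (E2 + 1) / B"
      have s: "- 0 / B \<le> s" "s \<le> 1" using Bs 2 by (auto simp: s_def)
      have "2 / B * (1 + s) = 2 / B + 2 * (E2 + 1) / B\<^sup>2" by (simp add: s_def distrib_left power2_eq_square add_divide_distrib)
      then have "worst \<delta> kmax x \<le> 1 - 2 / B * (1 + s)" using lt frac(1)[OF CC(2)] by linarith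
      then have r: "rho \<delta> x k \<le> 1 - 2 / B * (1 + s)" if "k \<in> {kmin..kmax}" for k
        using rho_le_worst[of x \<delta> k kmax] that xp \<delta> by fastforce
      have "2 * s \<le> E2 / B"
        using 2(3)[OF Bs(2) s xp[unfolded pq]] r[of kmin] r[OF km(2)] km(1) unfolding pq \<delta>_def by auto
      then have "2 * s * B \<le> E2 / B * B" using Bs by (intro mult_right_mono) auto
      then show False using Bs 2 by (simp add: s_def)
    qed
    have stable: "\<bar>p1 / (u * B) - 1\<bar> \<le> E3 / B \<and> \<bar>1 / (q1 * (u * B ^ 7)) - 1\<bar> \<le> E3 / B \<and>
        \<bar>p2 / (u * B ^ 3) - 1\<bar> \<le> E3 / B \<and> \<bar>1 / (q2 * (u * B ^ 5)) - 1\<bar> \<le> E3 / B"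
      if x: "(p1, q1, p2, q2) \<in> two_sided_ordered" and le: "worst \<delta> kmax (p1, q1, p2, q2) \<le> worst \<delta> kmax (best_two_sided B)" for p1 q1 p2 q2
    proof -
      define s where "s = - (C1 / 2) / B"
      have s: "- (C1 / 2) / B \<le> s" "s \<le> 1"
      proof -
        have "0 \<le> C1 / 2 / B" using C12 Bs by simp
        then show "s \<le> 1" by (simp add: s_def)
      qed (simp add: s_def)
      have "2 / B * (1 + s) = 2 / B - C1 / B\<^sup>2" by (simp add: s_def distrib_left power2_eq_square diff_divide_distrib)
      then have "worst \<delta> kmax (p1, q1, p2, q2) \<le> 1 - 2 / B * (1 + s)" using le best by linarith
      moreover have xp: "(p1, q1, p2, q2) \<in> positive" using x two_sided_positive by auto
      ultimately have r: "rho \<delta> (p1, q1, p2, q2) k \<le> 1 - 2 / B * (1 + s)" if "k \<in> {kmin..kmax}" for k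
        using rho_le_worst[of "(p1, q1, p2, q2)" \<delta> k kmax] that \<delta> by fastforce
      have "p1 < p2" "q1 < q2" using x by (auto simp: two_sided_ordered_def)
      then show ?thesis
        using 3(3)[OF Bs(3) s xp] r[of kmin] r[OF km(2)] km(1) unfolding \<delta>_def by (auto simp: mult.assoc)
    qed
    define Bx where "Bx = {u * B / 2..2 * (u * B)} \<times> {1 / (u * B ^ 7) / 2..2 * (1 / (u * B ^ 7))}
      \<times> {u * B ^ 3 / 2..2 * (u * B ^ 3)} \<times> {1 / (u * B ^ 5) / 2..2 * (1 / (u * B ^ 5))}"
    have sub: "Bx \<subseteq> two_sided_ordered"
    proof -
      have up: "0 < u * B / 2" "0 < 1 / (u * B ^ 7) / 2" "0 < u * B ^ 3 / 2" "0 < 1 / (u * B ^ 5) / 2" using u Bs by simp_all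
      \<comment> \<open>Separates the box of p1 from that of p2 and the box of q1 from that of q2,
        so the strict inequalities of the ordered set hold on the whole compact box.\<close>
      have B2: "4 < B\<^sup>2" using Bs power_strict_mono[of 2 B 2] by simp
      have "2 * (u * B) < u * B ^ 3 / 2"
      proof -
        have "u * B * 4 < u * B * B\<^sup>2" using B2 u Bs by (intro mult_strict_left_mono) auto
        then show ?thesis by (simp add: power2_eq_square power3_eq_cube)
      qed
      moreover have "2 * (1 / (u * B ^ 7)) < 1 / (u * B ^ 5) / 2"
      proof -
        have "1 / (u * B ^ 7) * 4 < 1 / (u * B ^ 7) * B\<^sup>2" using B2 u Bs by (intro mult_strict_left_mono) auto
        also have "1 / (u * B ^ 7) * B\<^sup>2 = 1 / (u * B ^ 5)" using Bs by (simp add: eval_nat_numeral)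
        finally show ?thesis by simp
      qed
      ultimately have ord: "2 * (u * B) < u * B ^ 3 / 2" "2 * (1 / (u * B ^ 7)) < 1 / (u * B ^ 5) / 2" by blast+
      show ?thesis
      proof
        fix x assume x: "x \<in> Bx"
        obtain p1 q1 p2 q2 where pq: "x = (p1, q1, p2, q2)" by (cases x) auto
        have "u * B / 2 \<le> p1" "p1 \<le> 2 * (u * B)" "1 / (u * B ^ 7) / 2 \<le> q1" "q1 \<le> 2 * (1 / (u * B ^ 7))"
          "u * B ^ 3 / 2 \<le> p2" "1 / (u * B ^ 5) / 2 \<le> q2"
          using x unfolding Bx_def pq by simp_all
        then have "0 < p1" "p1 < p2" "0 < q1" "q1 < q2" "0 < p2" "0 < q2" using up ord by linarith+
        then show "x \<in> two_sided_ordered" by (simp add: pq two_sided_ordered_def two_sided_def)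
      qed
    qed
    have inBx: "best_two_sided B \<in> Bx" 
      unfolding Bx_def best_two_sided_def using u Bs by (intro SigmaI box_center) simp_all
    have ex: "\<exists>x. minmax_solution (worst \<delta> kmax) two_sided_ordered x"
    proof (rule minimizer_exists[OF _ sub _ inBx \<delta> km(1)])
      show "compact Bx" unfolding Bx_def by (intro compact_Times) auto
      show "two_sided_ordered \<subseteq> positive" using two_sided_positive by auto
      show "x \<in> Bx" if x: "x \<in> two_sided_ordered" and le: "worst \<delta> kmax x \<le> worst \<delta> kmax (best_two_sided B)" for x
      proof -
        obtain p1 q1 p2 q2 where pq: "x = (p1, q1, p2, q2)" by (cases x) auto
        have pos: "0 < q1" "0 < q2" using x pq two_sided_positive by (auto simp: positive_def)
        have "E3 / B \<le> 1 / 2" using Bs by (simp add: divide_le_eq)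
        then have "\<bar>p1 / (u * B) - 1\<bar> \<le> 1 / 2" "\<bar>1 / (q1 * (u * B ^ 7)) - 1\<bar> \<le> 1 / 2"
          "\<bar>p2 / (u * B ^ 3) - 1\<bar> \<le> 1 / 2" "\<bar>1 / (q2 * (u * B ^ 5)) - 1\<bar> \<le> 1 / 2"
          using stable[OF x[unfolded pq] le[unfolded pq]] by linarith+
        then show ?thesis
          using ratio_box[of p1 "u * B"] inverse_ratio_box[of q1 "u * B ^ 7"] ratio_box[of p2 "u * B ^ 3"]
            inverse_ratio_box[of q2 "u * B ^ 5"] pos u Bs unfolding Bx_def pq by (intro SigmaI) simp_all
      qed
    qed
    show "best_two_sided B \<in> two_sided_ordered \<and> worst (overlap 1 4 B) kmax (best_two_sided B) \<le> 1 - 2 / B + C / B\<^sup>2 \<and>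
      (\<forall>x\<in>two_sided. 1 - 2 / B - C / B\<^sup>2 \<le> worst (overlap 1 4 B) kmax x) \<and>
      (\<forall>p1 q1 p2 q2. (p1, q1, p2, q2) \<in> two_sided_ordered \<longrightarrow>
        worst (overlap 1 4 B) kmax (p1, q1, p2, q2) \<le> worst (overlap 1 4 B) kmax (best_two_sided B) \<longrightarrow>
        \<bar>p1 / (u * B) - 1\<bar> \<le> C / B \<and> \<bar>1 / (q1 * (u * B ^ 7)) - 1\<bar> \<le> C / B \<and>
        \<bar>p2 / (u * B ^ 3) - 1\<bar> \<le> C / B \<and> \<bar>1 / (q2 * (u * B ^ 5)) - 1\<bar> \<le> C / B) \<and>
      (\<exists>x. minmax_solution (worst (overlap 1 4 B) kmax) two_sided_ordered x)"
      unfolding \<delta>_def[symmetric]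
    proof (intro conjI allI impI ballI)
      show "best_two_sided B \<in> two_sided_ordered" using sub inBx by auto
      show "worst \<delta> kmax (best_two_sided B) \<le> 1 - 2 / B + C / B\<^sup>2" using best frac(1)[OF CC(1)] by linarith
    qed (use lower ex stable frac(2)[OF CC(3)] in \<open>blast intro: order_trans\<close>)+
  qed
qed

end

section \<open>Asymptotics for small overlap\<close>

lemma minmax_solutionD:
  assumes "minmax_solution J A x"
  shows "x \<in> A" "y \<in> A \<Longrightarrow> J x \<le> J y"
  using assms unfolding minmax_solution_def is_arg_min_linorder by blast+

lemma minmax_value_bounds:
  assumes "x \<in> A" "J x \<le> hi" "\<And>y. y \<in> A \<Longrightarrow> lo \<le> J y"
  shows "lo \<le> minmax_value J A" "minmax_value J A \<le> hi"
proof -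
  show "lo \<le> minmax_value J A" unfolding minmax_value_def using assms by (intro cINF_greatest) auto
  have "bdd_below (J ` A)" using assms(3) by (intro bdd_belowI2)
  then have "minmax_value J A \<le> J x" unfolding minmax_value_def using assms(1) by (rule cINF_lower)
  then show "minmax_value J A \<le> hi" using assms(2) by linarith
qed

lemma asymp_equiv_of_ratio_bound:
  fixes f g B :: "real \<Rightarrow> real"
  assumes B: "filterlim B at_top F" and bd: "\<forall>\<^sub>F x in F. \<bar>f x / g x - 1\<bar> \<le> C / B x"
  shows "f \<sim>[F] g"
proof (rule asymp_equivI')
  have "((\<lambda>x. C / B x) \<longlongrightarrow> 0) F" by (rule real_tendsto_divide_at_top[OF tendsto_const B])
  then have "((\<lambda>x. f x / g x - 1) \<longlongrightarrow> 0) F"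
    by (rule Lim_null_comparison[rotated]) (use bd in simp)
  then show "((\<lambda>x. f x / g x) \<longlongrightarrow> 1) F" by (simp add: Lim_null[symmetric])
qed

text \<open>The chain controls 1/q rather than q; asymptotic equivalence passes to inverses.\<close>

lemma asymp_equiv_of_inverse_ratio_bound:
  fixes f g B :: "real \<Rightarrow> real"
  assumes B: "filterlim B at_top F" and bd: "\<forall>\<^sub>F x in F. \<bar>1 / (f x * g x) - 1\<bar> \<le> C / B x"
  shows "f \<sim>[F] (\<lambda>x. 1 / g x)"
proof -
  have "(\<lambda>x. 1 / f x) \<sim>[F] g"
    by (rule asymp_equiv_of_ratio_bound[OF B]) (use bd in \<open>simp add: divide_divide_eq_left\<close>)
  from asymp_equiv_inverse[OF this] show ?thesis by (simp add: inverse_eq_divide)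
qed

lemma bigo_of_expansion:
  fixes V \<tau> b :: "real \<Rightarrow> real"
  assumes "\<forall>\<^sub>F x in F. 1 - \<tau> x - C * b x \<le> V x \<and> V x \<le> 1 - \<tau> x + C * b x \<and> 0 \<le> b x"
  shows "(\<lambda>x. V x - (1 - \<tau> x)) \<in> O[F](b)"
proof (rule bigoI[of _ C])
  show "\<forall>\<^sub>F x in F. norm (V x - (1 - \<tau> x)) \<le> C * norm (b x)"
    using assms by eventually_elim (auto simp: abs_le_iff)
qed

text \<open>With h = \<delta> / c the largest frequency is at least of order 1 / \<delta>, which
  leaves room for all the test frequencies.\<close>

lemma frequency_range:
  fixes M :: "real \<Rightarrow> nat" and k c :: real
  assumes M: "(\<lambda>h. real (M h)) \<in> \<Theta>[at_right 0](\<lambda>h. 1 / h)" and "0 < c" "0 < k"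
  obtains a where "0 < a" "\<forall>\<^sub>F \<delta> in at_right 0. a / \<delta> \<le> real (M (\<delta> / c)) * k"
proof -
  have "(\<lambda>h. real (M h)) \<in> \<Omega>[at_right 0](\<lambda>h. 1 / h)" using M by (rule bigthetaD2)
  then obtain r where r: "0 < r" and "\<forall>\<^sub>F h in at_right 0. r * norm (1 / h) \<le> norm (real (M h))"
    by (elim landau_omega.bigE) auto
  then obtain b where b: "0 < b" "\<And>h. 0 < h \<Longrightarrow> h < b \<Longrightarrow> r * norm (1 / h) \<le> norm (real (M h))"
    unfolding eventually_at_right_field by auto
  show thesis
  proof (rule that)
    show "0 < r * c * k" using r assms by simp
    show "\<forall>\<^sub>F \<delta> in at_right 0. r * c * k / \<delta> \<le> real (M (\<delta> / c)) * k"
    proof (rule eventually_at_rightI)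
      show "0 < b * c" using b assms by simp
      fix \<delta> assume d: "\<delta> \<in> {0<..<b * c}"
      then have "r * norm (1 / (\<delta> / c)) \<le> norm (real (M (\<delta> / c)))"
        using assms by (intro b) (auto simp: divide_less_eq)
      then have "r * c / \<delta> \<le> real (M (\<delta> / c))" using d assms by simp
      then have "r * c / \<delta> * k \<le> real (M (\<delta> / c)) * k" using assms by (intro mult_right_mono) auto
      then show "r * c * k / \<delta> \<le> real (M (\<delta> / c)) * k" by simp
    qed
  qed
qed

section \<open>The scale as a function of the overlap\<close>

context schwarz
begin

text \<open>The positive solution B of \<open>overlap m N B = \<delta>\<close>.\<close>

definition scale :: "real \<Rightarrow> nat \<Rightarrow> real \<Rightarrow> real" where
  "scale m N \<delta> = (m / (u * \<delta>)) powr (1 / (2 * N + 1))"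

lemma scale_pos: "0 < m \<Longrightarrow> 0 < \<delta> \<Longrightarrow> 0 < scale m N \<delta>"
  using u by (simp add: scale_def)

lemma scale_power:
  assumes "0 < m" "0 < \<delta>" shows "scale m N \<delta> ^ (2 * N + 1) = m / (u * \<delta>)"
proof -
  have "scale m N \<delta> ^ (2 * N + 1) = scale m N \<delta> powr real (2 * N + 1)"
    by (rule powr_realpow[OF scale_pos[OF assms], symmetric])
  also have "\<dots> = (m / (u * \<delta>)) powr 1"
    unfolding scale_def powr_powr by (rule arg_cong[where f = "(powr) (m / (u * \<delta>))"]) (simp add: field_simps)
  finally show ?thesis using assms u by simp
qed

lemma overlap_scale:
  assumes "0 < m" "0 < \<delta>" shows "overlap m N (scale m N \<delta>) = \<delta>"
  unfolding overlap_def scale_power[OF assms] using assms u by simp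

lemma scale_at_top:
  assumes "0 < m" shows "filterlim (scale m N) at_top (at_right 0)"
  unfolding filterlim_at_top_gt[of _ _ 0]
proof (intro allI impI)
  fix Z :: real assume Z: "0 < Z"
  show "\<forall>\<^sub>F \<delta> in at_right 0. Z \<le> scale m N \<delta>"
  proof (rule eventually_at_rightI)
    have P: "0 < u * Z ^ (2 * N + 1)" using u Z by simp
    then show "0 < m / (u * Z ^ (2 * N + 1))" using assms by simp
    fix \<delta> assume d: "\<delta> \<in> {0<..<m / (u * Z ^ (2 * N + 1))}"
    then have "\<delta> * (u * Z ^ (2 * N + 1)) \<le> m" using P by (simp add: less_divide_eq del: power_Suc)
    then have "Z ^ (2 * N + 1) \<le> m / (u * \<delta>)" using d u by (simp add: le_divide_eq mult_ac del: power_Suc)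
    also have "\<dots> = scale m N \<delta> ^ (2 * N + 1)" using scale_power[of m \<delta> N] assms d by simp
    finally show "Z \<le> scale m N \<delta>"
      by (rule power_le_imp_le_base[of _ "2 * N", unfolded Suc_eq_plus1]) (use scale_pos[of m \<delta> N] assms d in simp)
  qed
qed

text \<open>The largest test frequency equals m / (\<delta> B), which falls below a / \<delta> as
  soon as B \<ge> m / a.\<close>

lemma admissible_scale:
  assumes "0 < m" "1 \<le> N" "0 < a" and kx: "\<forall>\<^sub>F \<delta> in at_right 0. a / \<delta> \<le> kx \<delta>"
  shows "\<forall>\<^sub>F \<delta> in at_right 0. admissible N (scale m N \<delta>) (kx \<delta>)"
proof -
  have "\<forall>\<^sub>F \<delta> in at_right 0. max 1 (max (kmin / u) (m / a)) \<le> scale m N \<delta>"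
    using scale_at_top[OF assms(1)] unfolding filterlim_at_top by blast
  then show ?thesis using kx eventually_at_right_less[of 0]
  proof eventually_elim
    fix \<delta> assume B: "max 1 (max (kmin / u) (m / a)) \<le> scale m N \<delta>" and k: "a / \<delta> \<le> kx \<delta>" and d: "0 < \<delta>"
    define B where "B = scale m N \<delta>"
    have B: "1 \<le> B" "kmin \<le> u * B" "m \<le> a * B"
      using B u assms by (auto simp: B_def divide_le_eq mult_ac)
    have top: "u * B ^ (2 * N) \<le> kx \<delta>"
    proof -
      have "u * B ^ (2 * N) * m \<le> u * B ^ (2 * N) * (a * B)" using B u by (intro mult_left_mono) auto
      also have "\<dots> = a * (u * (B ^ (2 * N + 1)))" by simp
      also have "\<dots> = a / \<delta> * m" using scale_power[OF assms(1) d, of N] u d by (simp add: B_def del: power_Suc)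
      finally have "u * B ^ (2 * N) \<le> a / \<delta>" using assms(1) by (rule mult_right_le_imp_le)
      then show ?thesis using k by linarith
    qed
    have i: "u * B ^ (2 * i) \<in> {kmin..kx \<delta>}" if i: "i \<in> {1..N}" for i
    proof -
      have "B ^ 1 \<le> B ^ (2 * i)" "B ^ (2 * i) \<le> B ^ (2 * N)" using B i by (intro power_increasing; simp)+
      then have "u * B ^ 1 \<le> u * B ^ (2 * i)" "u * B ^ (2 * i) \<le> u * B ^ (2 * N)" using u by (intro mult_left_mono; simp)+
      then show ?thesis using B top by auto
    qed
    then have "kmin \<le> kx \<delta>" using i[of 1] assms(2) by auto
    then show "admissible N (scale m N \<delta>) (kx \<delta>)" using i unfolding admissible_def B_def by blast
  qed
qed

text \<open>The scale is (4 / (K \<delta>)) powr (1/5). Taking logarithms reduces each identity to a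
  linear one in ln 2, ln K and ln \<delta>.\<close>

lemma one_sided_scale_values:
  assumes "0 < \<delta>"
  shows "u * scale 2 2 \<delta> = 2 powr (-3/5) * K powr (4/5) * \<delta> powr (-1/5)"
    and "1 / (u * scale 2 2 \<delta> ^ 3) = 2 powr (-1/5) * K powr (-2/5) * \<delta> powr (3/5)"
    and "4 / scale 2 2 \<delta> = 2 powr (8/5) * K powr (1/5) * \<delta> powr (1/5)"
    and "1 / (scale 2 2 \<delta>)\<^sup>2 = (K / 4) powr (2/5) * \<delta> powr (2/5)"
proof -
  have l4: "ln (4 :: real) = 2 * ln 2" using ln_realpow[of 2 2] by simp
  note l = ln_mult_pos ln_div ln_powr ln_realpow scale_def u_def l4 K_pos assms
    K_pos[THEN less_imp_neq, symmetric] assms[THEN less_imp_neq, symmetric] zero_less_mult_iff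
  show "u * scale 2 2 \<delta> = 2 powr (-3/5) * K powr (4/5) * \<delta> powr (-1/5)"
    by (subst ln_inj_iff[symmetric]) (simp_all add: l field_simps)
  show "1 / (u * scale 2 2 \<delta> ^ 3) = 2 powr (-1/5) * K powr (-2/5) * \<delta> powr (3/5)"
    by (subst ln_inj_iff[symmetric]) (simp_all add: l field_simps)
  show "4 / scale 2 2 \<delta> = 2 powr (8/5) * K powr (1/5) * \<delta> powr (1/5)"
    by (subst ln_inj_iff[symmetric]) (simp_all add: l field_simps)
  show "1 / (scale 2 2 \<delta>)\<^sup>2 = (K / 4) powr (2/5) * \<delta> powr (2/5)"
    by (subst ln_inj_iff[symmetric]) (simp_all add: l field_simps)
qed

text \<open>The scale is (2 / (K \<delta>)) powr (1/9); logarithms as in the one-sided case.\<close>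

lemma two_sided_scale_values:
  assumes "0 < \<delta>"
  shows "u * scale 1 4 \<delta> = 2 powr (-8/9) * K powr (8/9) * \<delta> powr (-1/9)"
    and "1 / (u * scale 1 4 \<delta> ^ 7) = 2 powr (2/9) * K powr (-2/9) * \<delta> powr (7/9)"
    and "u * scale 1 4 \<delta> ^ 3 = 2 powr (-2/3) * K powr (2/3) * \<delta> powr (-1/3)"
    and "1 / (u * scale 1 4 \<delta> ^ 5) = 2 powr (4/9) * K powr (-4/9) * \<delta> powr (5/9)"
    and "2 / scale 1 4 \<delta> = 2 powr (8/9) * K powr (1/9) * \<delta> powr (1/9)"
    and "1 / (scale 1 4 \<delta>)\<^sup>2 = (K / 2) powr (2/9) * \<delta> powr (2/9)"
proof -
  note l = ln_mult_pos ln_div ln_powr ln_realpow scale_def u_def K_pos assms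
    K_pos[THEN less_imp_neq, symmetric] assms[THEN less_imp_neq, symmetric] zero_less_mult_iff
  show "u * scale 1 4 \<delta> = 2 powr (-8/9) * K powr (8/9) * \<delta> powr (-1/9)"
    by (subst ln_inj_iff[symmetric]) (simp_all add: l field_simps)
  show "1 / (u * scale 1 4 \<delta> ^ 7) = 2 powr (2/9) * K powr (-2/9) * \<delta> powr (7/9)"
    by (subst ln_inj_iff[symmetric]) (simp_all add: l field_simps)
  show "u * scale 1 4 \<delta> ^ 3 = 2 powr (-2/3) * K powr (2/3) * \<delta> powr (-1/3)"
    by (subst ln_inj_iff[symmetric]) (simp_all add: l field_simps)
  show "1 / (u * scale 1 4 \<delta> ^ 5) = 2 powr (4/9) * K powr (-4/9) * \<delta> powr (5/9)"
    by (subst ln_inj_iff[symmetric]) (simp_all add: l field_simps)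
  show "2 / scale 1 4 \<delta> = 2 powr (8/9) * K powr (1/9) * \<delta> powr (1/9)"
    by (subst ln_inj_iff[symmetric]) (simp_all add: l field_simps)
  show "1 / (scale 1 4 \<delta>)\<^sup>2 = (K / 2) powr (2/9) * \<delta> powr (2/9)"
    by (subst ln_inj_iff[symmetric]) (simp_all add: l field_simps)
qed

text \<open>The statement at a fixed scale is transported along \<delta> \<mapsto>
  \<open>scale 2 2 \<delta>\<close>: relative errors C / B tend to 0, and C / B^2 becomes a multiple
  of \<delta> powr (2/5).\<close>

theorem one_sided_asymptotics:
  assumes "0 < a" and kx: "\<forall>\<^sub>F \<delta> in at_right 0. a / \<delta> \<le> kx \<delta>"
    and J: "\<And>\<delta>. J \<delta> = worst \<delta> (kx \<delta>)"
  shows "\<forall>\<^sub>F \<delta> in at_right 0. \<exists>x. minmax_solution (J \<delta>) one_sided x"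
    and "\<forall>\<^sub>F \<delta> in at_right 0. minmax_solution (J \<delta>) one_sided (p \<delta>, q \<delta>, p \<delta>, q \<delta>) \<Longrightarrow>
      p \<sim>[at_right 0] (\<lambda>\<delta>. 2 powr (-3/5) * K powr (4/5) * \<delta> powr (-1/5)) \<and>
      q \<sim>[at_right 0] (\<lambda>\<delta>. 2 powr (-1/5) * K powr (-2/5) * \<delta> powr (3/5))"
    and "(\<lambda>\<delta>. minmax_value (J \<delta>) one_sided - (1 - 2 powr (8/5) * K powr (1/5) * \<delta> powr (1/5)))
      \<in> O[at_right 0](\<lambda>\<delta>. \<delta> powr (2/5))"
proof -
  define B where "B = scale 2 2"
  obtain C B0 where at: "\<And>B kmax. B0 \<le> B \<Longrightarrow> admissible 2 B kmax \<Longrightarrow>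
      worst (overlap 2 2 B) kmax (best_one_sided B) \<le> 1 - 4 / B + C / B\<^sup>2 \<and>
      (\<forall>x\<in>one_sided. 1 - 4 / B - C / B\<^sup>2 \<le> worst (overlap 2 2 B) kmax x) \<and>
      (\<forall>p q. 0 < p \<longrightarrow> 0 < q \<longrightarrow> worst (overlap 2 2 B) kmax (p, q, p, q) \<le> worst (overlap 2 2 B) kmax (best_one_sided B) \<longrightarrow>
        \<bar>p / (u * B) - 1\<bar> \<le> C / B \<and> \<bar>1 / (q * (u * B ^ 3)) - 1\<bar> \<le> C / B) \<and>
      (\<exists>x. minmax_solution (worst (overlap 2 2 B) kmax) one_sided x)"
    using one_sided_at_scale by metis
  have Btop: "filterlim B at_top (at_right 0)" unfolding B_def by (rule scale_at_top) simp
  have "\<forall>\<^sub>F \<delta> in at_right 0. B0 \<le> B \<delta>" using Btop unfolding filterlim_at_top by blast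
  moreover have "\<forall>\<^sub>F \<delta> in at_right 0. admissible 2 (B \<delta>) (kx \<delta>)"
    unfolding B_def using assms(1) kx by (intro admissible_scale) auto
  ultimately have ev: "\<forall>\<^sub>F \<delta> in at_right 0. 0 < \<delta> \<and>
      J \<delta> (best_one_sided (B \<delta>)) \<le> 1 - 4 / B \<delta> + C / (B \<delta>)\<^sup>2 \<and>
      (\<forall>x\<in>one_sided. 1 - 4 / B \<delta> - C / (B \<delta>)\<^sup>2 \<le> J \<delta> x) \<and>
      (\<forall>p q. 0 < p \<longrightarrow> 0 < q \<longrightarrow> J \<delta> (p, q, p, q) \<le> J \<delta> (best_one_sided (B \<delta>)) \<longrightarrow>
        \<bar>p / (u * B \<delta>) - 1\<bar> \<le> C / B \<delta> \<and> \<bar>1 / (q * (u * B \<delta> ^ 3)) - 1\<bar> \<le> C / B \<delta>) \<and>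
      (\<exists>x. minmax_solution (J \<delta>) one_sided x)"
    using eventually_at_right_less[of 0]
  proof eventually_elim
    case (elim \<delta>)
    then have "overlap 2 2 (B \<delta>) = \<delta>" unfolding B_def by (intro overlap_scale) auto
    then show ?case using at[OF elim(1,2)] elim(3) unfolding J by simp
  qed
  have best: "best_one_sided (B \<delta>) \<in> one_sided" if "0 < \<delta>" for \<delta>
    using scale_pos[of 2 \<delta> 2] that u by (auto simp: B_def best_one_sided_def one_sided_def)
  show "\<forall>\<^sub>F \<delta> in at_right 0. \<exists>x. minmax_solution (J \<delta>) one_sided x"
    using ev by eventually_elim blast
  have pos: "\<forall>\<^sub>F \<delta> in at_right 0. (0 :: real) < \<delta>" by (rule eventually_at_right_less)
  show "p \<sim>[at_right 0] (\<lambda>\<delta>. 2 powr (-3/5) * K powr (4/5) * \<delta> powr (-1/5)) \<and>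
      q \<sim>[at_right 0] (\<lambda>\<delta>. 2 powr (-1/5) * K powr (-2/5) * \<delta> powr (3/5))"
    if sol: "\<forall>\<^sub>F \<delta> in at_right 0. minmax_solution (J \<delta>) one_sided (p \<delta>, q \<delta>, p \<delta>, q \<delta>)"
  proof -
    have near: "\<forall>\<^sub>F \<delta> in at_right 0. \<bar>p \<delta> / (u * B \<delta>) - 1\<bar> \<le> C / B \<delta> \<and> \<bar>1 / (q \<delta> * (u * B \<delta> ^ 3)) - 1\<bar> \<le> C / B \<delta>"
      using ev sol
    proof eventually_elim
      case (elim \<delta>)
      have "0 < p \<delta>" "0 < q \<delta>" using minmax_solutionD(1)[OF elim(2)] by (auto simp: one_sided_def)
      moreover have "J \<delta> (p \<delta>, q \<delta>, p \<delta>, q \<delta>) \<le> J \<delta> (best_one_sided (B \<delta>))"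
        using elim best by (intro minmax_solutionD(2)[OF elim(2)]) auto
      ultimately show ?case using elim(1) by blast
    qed
    have "p \<sim>[at_right 0] (\<lambda>\<delta>. u * B \<delta>)"
      by (rule asymp_equiv_of_ratio_bound[OF Btop]) (use near in \<open>eventually_elim, blast\<close>)
    also have "(\<lambda>\<delta>. u * B \<delta>) \<sim>[at_right 0] (\<lambda>\<delta>. 2 powr (-3/5) * K powr (4/5) * \<delta> powr (-1/5))"
      by (rule asymp_equiv_refl_ev, rule eventually_mono[OF pos], unfold B_def, rule one_sided_scale_values)
    finally have P: "p \<sim>[at_right 0] (\<lambda>\<delta>. 2 powr (-3/5) * K powr (4/5) * \<delta> powr (-1/5))" .
    have "q \<sim>[at_right 0] (\<lambda>\<delta>. 1 / (u * B \<delta> ^ 3))"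
      by (rule asymp_equiv_of_inverse_ratio_bound[OF Btop]) (use near in \<open>eventually_elim, blast\<close>)
    also have "(\<lambda>\<delta>. 1 / (u * B \<delta> ^ 3)) \<sim>[at_right 0] (\<lambda>\<delta>. 2 powr (-1/5) * K powr (-2/5) * \<delta> powr (3/5))"
      by (rule asymp_equiv_refl_ev, rule eventually_mono[OF pos], unfold B_def, rule one_sided_scale_values)
    finally show ?thesis using P by blast
  qed
  show "(\<lambda>\<delta>. minmax_value (J \<delta>) one_sided - (1 - 2 powr (8/5) * K powr (1/5) * \<delta> powr (1/5)))
      \<in> O[at_right 0](\<lambda>\<delta>. \<delta> powr (2/5))"
  proof (rule bigo_of_expansion[where C = "C * (K / 4) powr (2/5)"])
    show "\<forall>\<^sub>F \<delta> in at_right 0.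
        1 - 2 powr (8/5) * K powr (1/5) * \<delta> powr (1/5) - C * (K / 4) powr (2/5) * \<delta> powr (2/5) \<le> minmax_value (J \<delta>) one_sided \<and>
        minmax_value (J \<delta>) one_sided \<le> 1 - 2 powr (8/5) * K powr (1/5) * \<delta> powr (1/5) + C * (K / 4) powr (2/5) * \<delta> powr (2/5) \<and>
        0 \<le> \<delta> powr (2/5)"
      using ev
    proof eventually_elim
      case (elim \<delta>)
      note v = one_sided_scale_values(3,4)[of \<delta>, folded B_def]
      have "C / (B \<delta>)\<^sup>2 = C * (1 / (B \<delta>)\<^sup>2)" by simp
      also have "\<dots> = C * (K / 4) powr (2/5) * \<delta> powr (2/5)" using v(2) elim by simp
      finally have c: "C / (B \<delta>)\<^sup>2 = C * (K / 4) powr (2/5) * \<delta> powr (2/5)" .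
      have "1 - 4 / B \<delta> - C / (B \<delta>)\<^sup>2 \<le> minmax_value (J \<delta>) one_sided"
        "minmax_value (J \<delta>) one_sided \<le> 1 - 4 / B \<delta> + C / (B \<delta>)\<^sup>2"
        using elim minmax_value_bounds[OF best, of \<delta> "J \<delta>"] by blast+
      then show ?case using v(1) elim unfolding c by simp
    qed
  qed
qed

theorem two_sided_asymptotics:
  assumes "0 < a" and kx: "\<forall>\<^sub>F \<delta> in at_right 0. a / \<delta> \<le> kx \<delta>"
    and J: "\<And>\<delta>. J \<delta> = worst \<delta> (kx \<delta>)"
  shows "\<forall>\<^sub>F \<delta> in at_right 0. \<exists>x. minmax_solution (J \<delta>) two_sided_ordered x"
    and "\<forall>\<^sub>F \<delta> in at_right 0. minmax_solution (J \<delta>) two_sided_ordered (p1 \<delta>, q1 \<delta>, p2 \<delta>, q2 \<delta>) \<Longrightarrow>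
      p1 \<sim>[at_right 0] (\<lambda>\<delta>. 2 powr (-8/9) * K powr (8/9) * \<delta> powr (-1/9)) \<and>
      q1 \<sim>[at_right 0] (\<lambda>\<delta>. 2 powr (2/9) * K powr (-2/9) * \<delta> powr (7/9)) \<and>
      p2 \<sim>[at_right 0] (\<lambda>\<delta>. 2 powr (-2/3) * K powr (2/3) * \<delta> powr (-1/3)) \<and>
      q2 \<sim>[at_right 0] (\<lambda>\<delta>. 2 powr (4/9) * K powr (-4/9) * \<delta> powr (5/9))"
    and "A \<in> {two_sided, two_sided_ordered} \<Longrightarrow>
      (\<lambda>\<delta>. minmax_value (J \<delta>) A - (1 - 2 powr (8/9) * K powr (1/9) * \<delta> powr (1/9)))
      \<in> O[at_right 0](\<lambda>\<delta>. \<delta> powr (2/9))"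
proof -
  define B where "B = scale 1 4"
  obtain C B0 where at: "\<And>B kmax. B0 \<le> B \<Longrightarrow> admissible 4 B kmax \<Longrightarrow>
      best_two_sided B \<in> two_sided_ordered \<and>
      worst (overlap 1 4 B) kmax (best_two_sided B) \<le> 1 - 2 / B + C / B\<^sup>2 \<and>
      (\<forall>x\<in>two_sided. 1 - 2 / B - C / B\<^sup>2 \<le> worst (overlap 1 4 B) kmax x) \<and>
      (\<forall>p1 q1 p2 q2. (p1, q1, p2, q2) \<in> two_sided_ordered \<longrightarrow>
        worst (overlap 1 4 B) kmax (p1, q1, p2, q2) \<le> worst (overlap 1 4 B) kmax (best_two_sided B) \<longrightarrow>
        \<bar>p1 / (u * B) - 1\<bar> \<le> C / B \<and> \<bar>1 / (q1 * (u * B ^ 7)) - 1\<bar> \<le> C / B \<and>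
        \<bar>p2 / (u * B ^ 3) - 1\<bar> \<le> C / B \<and> \<bar>1 / (q2 * (u * B ^ 5)) - 1\<bar> \<le> C / B) \<and>
      (\<exists>x. minmax_solution (worst (overlap 1 4 B) kmax) two_sided_ordered x)"
    using two_sided_at_scale by metis
  have Btop: "filterlim B at_top (at_right 0)" unfolding B_def by (rule scale_at_top) simp
  have "\<forall>\<^sub>F \<delta> in at_right 0. B0 \<le> B \<delta>" using Btop unfolding filterlim_at_top by blast
  moreover have "\<forall>\<^sub>F \<delta> in at_right 0. admissible 4 (B \<delta>) (kx \<delta>)"
    unfolding B_def using assms(1) kx by (intro admissible_scale) auto
  ultimately have ev: "\<forall>\<^sub>F \<delta> in at_right 0. 0 < \<delta> \<and>
      best_two_sided (B \<delta>) \<in> two_sided_ordered \<and>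
      J \<delta> (best_two_sided (B \<delta>)) \<le> 1 - 2 / B \<delta> + C / (B \<delta>)\<^sup>2 \<and>
      (\<forall>x\<in>two_sided. 1 - 2 / B \<delta> - C / (B \<delta>)\<^sup>2 \<le> J \<delta> x) \<and>
      (\<forall>p1 q1 p2 q2. (p1, q1, p2, q2) \<in> two_sided_ordered \<longrightarrow>
        J \<delta> (p1, q1, p2, q2) \<le> J \<delta> (best_two_sided (B \<delta>)) \<longrightarrow>
        \<bar>p1 / (u * B \<delta>) - 1\<bar> \<le> C / B \<delta> \<and> \<bar>1 / (q1 * (u * B \<delta> ^ 7)) - 1\<bar> \<le> C / B \<delta> \<and>
        \<bar>p2 / (u * B \<delta> ^ 3) - 1\<bar> \<le> C / B \<delta> \<and> \<bar>1 / (q2 * (u * B \<delta> ^ 5)) - 1\<bar> \<le> C / B \<delta>) \<and>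
      (\<exists>x. minmax_solution (J \<delta>) two_sided_ordered x)"
    using eventually_at_right_less[of 0]
  proof eventually_elim
    case (elim \<delta>)
    then have "overlap 1 4 (B \<delta>) = \<delta>" unfolding B_def by (intro overlap_scale) auto
    then show ?case using at[OF elim(1,2)] elim(3) unfolding J by simp
  qed
  show "\<forall>\<^sub>F \<delta> in at_right 0. \<exists>x. minmax_solution (J \<delta>) two_sided_ordered x"
    using ev by eventually_elim blast
  have pos: "\<forall>\<^sub>F \<delta> in at_right 0. (0 :: real) < \<delta>" by (rule eventually_at_right_less)
  show "p1 \<sim>[at_right 0] (\<lambda>\<delta>. 2 powr (-8/9) * K powr (8/9) * \<delta> powr (-1/9)) \<and>
      q1 \<sim>[at_right 0] (\<lambda>\<delta>. 2 powr (2/9) * K powr (-2/9) * \<delta> powr (7/9)) \<and>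
      p2 \<sim>[at_right 0] (\<lambda>\<delta>. 2 powr (-2/3) * K powr (2/3) * \<delta> powr (-1/3)) \<and>
      q2 \<sim>[at_right 0] (\<lambda>\<delta>. 2 powr (4/9) * K powr (-4/9) * \<delta> powr (5/9))"
    if sol: "\<forall>\<^sub>F \<delta> in at_right 0. minmax_solution (J \<delta>) two_sided_ordered (p1 \<delta>, q1 \<delta>, p2 \<delta>, q2 \<delta>)"
  proof -
    have near: "\<forall>\<^sub>F \<delta> in at_right 0.
        \<bar>p1 \<delta> / (u * B \<delta>) - 1\<bar> \<le> C / B \<delta> \<and> \<bar>1 / (q1 \<delta> * (u * B \<delta> ^ 7)) - 1\<bar> \<le> C / B \<delta> \<and>
        \<bar>p2 \<delta> / (u * B \<delta> ^ 3) - 1\<bar> \<le> C / B \<delta> \<and> \<bar>1 / (q2 \<delta> * (u * B \<delta> ^ 5)) - 1\<bar> \<le> C / B \<delta>"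
      using ev sol
    proof eventually_elim
      case (elim \<delta>)
      have "J \<delta> (p1 \<delta>, q1 \<delta>, p2 \<delta>, q2 \<delta>) \<le> J \<delta> (best_two_sided (B \<delta>))"
        using elim(1) by (intro minmax_solutionD(2)[OF elim(2)]) blast
      then show ?case using elim(1) minmax_solutionD(1)[OF elim(2)] by blast
    qed
    have "p1 \<sim>[at_right 0] (\<lambda>\<delta>. u * B \<delta>)"
      by (rule asymp_equiv_of_ratio_bound[OF Btop]) (use near in \<open>eventually_elim, blast\<close>)
    also have "(\<lambda>\<delta>. u * B \<delta>) \<sim>[at_right 0] (\<lambda>\<delta>. 2 powr (-8/9) * K powr (8/9) * \<delta> powr (-1/9))"
      by (rule asymp_equiv_refl_ev, rule eventually_mono[OF pos], unfold B_def, rule two_sided_scale_values)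
    finally have P1: "p1 \<sim>[at_right 0] (\<lambda>\<delta>. 2 powr (-8/9) * K powr (8/9) * \<delta> powr (-1/9))" .
    have "p2 \<sim>[at_right 0] (\<lambda>\<delta>. u * B \<delta> ^ 3)"
      by (rule asymp_equiv_of_ratio_bound[OF Btop]) (use near in \<open>eventually_elim, blast\<close>)
    also have "(\<lambda>\<delta>. u * B \<delta> ^ 3) \<sim>[at_right 0] (\<lambda>\<delta>. 2 powr (-2/3) * K powr (2/3) * \<delta> powr (-1/3))"
      by (rule asymp_equiv_refl_ev, rule eventually_mono[OF pos], unfold B_def, rule two_sided_scale_values)
    finally have P2: "p2 \<sim>[at_right 0] (\<lambda>\<delta>. 2 powr (-2/3) * K powr (2/3) * \<delta> powr (-1/3))" .
    have "q1 \<sim>[at_right 0] (\<lambda>\<delta>. 1 / (u * B \<delta> ^ 7))"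
      by (rule asymp_equiv_of_inverse_ratio_bound[OF Btop]) (use near in \<open>eventually_elim, blast\<close>)
    also have "(\<lambda>\<delta>. 1 / (u * B \<delta> ^ 7)) \<sim>[at_right 0] (\<lambda>\<delta>. 2 powr (2/9) * K powr (-2/9) * \<delta> powr (7/9))"
      by (rule asymp_equiv_refl_ev, rule eventually_mono[OF pos], unfold B_def, rule two_sided_scale_values)
    finally have Q1: "q1 \<sim>[at_right 0] (\<lambda>\<delta>. 2 powr (2/9) * K powr (-2/9) * \<delta> powr (7/9))" .
    have "q2 \<sim>[at_right 0] (\<lambda>\<delta>. 1 / (u * B \<delta> ^ 5))"
      by (rule asymp_equiv_of_inverse_ratio_bound[OF Btop]) (use near in \<open>eventually_elim, blast\<close>)
    also have "(\<lambda>\<delta>. 1 / (u * B \<delta> ^ 5)) \<sim>[at_right 0] (\<lambda>\<delta>. 2 powr (4/9) * K powr (-4/9) * \<delta> powr (5/9))"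
      by (rule asymp_equiv_refl_ev, rule eventually_mono[OF pos], unfold B_def, rule two_sided_scale_values)
    finally show ?thesis using P1 P2 Q1 by blast
  qed
  show "(\<lambda>\<delta>. minmax_value (J \<delta>) A - (1 - 2 powr (8/9) * K powr (1/9) * \<delta> powr (1/9)))
      \<in> O[at_right 0](\<lambda>\<delta>. \<delta> powr (2/9))"
    if A: "A \<in> {two_sided, two_sided_ordered}"
  proof (rule bigo_of_expansion[where C = "C * (K / 2) powr (2/9)"])
    \<comment> \<open>The explicit choice lies in the smaller set and the lower bound holds on the
      larger one, so one argument serves both sets.\<close>
    have sub: "two_sided_ordered \<subseteq> A" "A \<subseteq> two_sided" using A two_sided_positive(2) by auto
    show "\<forall>\<^sub>F \<delta> in at_right 0.
        1 - 2 powr (8/9) * K powr (1/9) * \<delta> powr (1/9) - C * (K / 2) powr (2/9) * \<delta> powr (2/9) \<le> minmax_value (J \<delta>) A \<and>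
        minmax_value (J \<delta>) A \<le> 1 - 2 powr (8/9) * K powr (1/9) * \<delta> powr (1/9) + C * (K / 2) powr (2/9) * \<delta> powr (2/9) \<and>
        0 \<le> \<delta> powr (2/9)"
      using ev
    proof eventually_elim
      case (elim \<delta>)
      note v = two_sided_scale_values(5,6)[of \<delta>, folded B_def]
      have "C / (B \<delta>)\<^sup>2 = C * (1 / (B \<delta>)\<^sup>2)" by simp
      also have "\<dots> = C * (K / 2) powr (2/9) * \<delta> powr (2/9)" using v(2) elim by simp
      finally have c: "C / (B \<delta>)\<^sup>2 = C * (K / 2) powr (2/9) * \<delta> powr (2/9)" .
      have mem: "best_two_sided (B \<delta>) \<in> A" using elim sub by blast
      have hi: "J \<delta> (best_two_sided (B \<delta>)) \<le> 1 - 2 / B \<delta> + C / (B \<delta>)\<^sup>2" using elim by blast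
      have lo: "1 - 2 / B \<delta> - C / (B \<delta>)\<^sup>2 \<le> J \<delta> x" if "x \<in> A" for x using elim sub that by blast
      show ?case using minmax_value_bounds[of _ A "J \<delta>", OF mem hi lo] v(1) elim unfolding c by simp
    qed
  qed
qed

lemma worst_factor_eq: "worst_factor L Lhat \<eta> \<epsilon> pa pb m \<delta> = worst \<delta> (real m * kmin)"
  by (intro ext) (simp add: worst_factor_def worst_def rho_def kmin_def)

end

theorem theorem4p1:
  fixes L Lhat \<eta> \<epsilon> pa pb c :: real
    and M :: "real \<Rightarrow> nat"
    and K :: real
    and J :: "real \<Rightarrow> params \<Rightarrow> real"
  assumes "L > 0" "Lhat > 0" "\<eta> > 0" "\<epsilon> > 0" "pa > 0" "pb > 0" "c > 0"
    and M: "(\<lambda>h. real (M h)) \<in> \<Theta>[at_right 0](\<lambda>h. 1 / h)"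
  defines "K \<equiv> K_const L Lhat \<eta> \<epsilon> pa pb"
    and "J \<equiv> \<lambda>\<delta>. worst_factor L Lhat \<eta> \<epsilon> pa pb (M (\<delta> / c)) \<delta>"
  shows
    "((\<forall>\<^sub>F \<delta> in at_right 0. \<exists>x. minmax_solution (J \<delta>) one_sided x) \<and>
       (\<forall>p q. (\<forall>\<^sub>F \<delta> in at_right 0. minmax_solution (J \<delta>) one_sided (p \<delta>, q \<delta>, p \<delta>, q \<delta>)) \<longrightarrow>
          p \<sim>[at_right 0] (\<lambda>\<delta>. 2 powr (-3/5) * K powr (4/5) * \<delta> powr (-1/5)) \<and>
          q \<sim>[at_right 0] (\<lambda>\<delta>. 2 powr (-1/5) * K powr (-2/5) * \<delta> powr (3/5))) \<and>
       (\<lambda>\<delta>. minmax_value (J \<delta>) one_sided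
              - (1 - 2 powr (8/5) * K powr (1/5) * \<delta> powr (1/5)))
         \<in> O[at_right 0](\<lambda>\<delta>. \<delta> powr (2/5)))
     \<and>
      ((\<forall>\<^sub>F \<delta> in at_right 0. \<exists>x. minmax_solution (J \<delta>) two_sided_ordered x) \<and>
       (\<forall>p1 q1 p2 q2.
          (\<forall>\<^sub>F \<delta> in at_right 0.
             minmax_solution (J \<delta>) two_sided_ordered (p1 \<delta>, q1 \<delta>, p2 \<delta>, q2 \<delta>)) \<longrightarrow>
          p1 \<sim>[at_right 0] (\<lambda>\<delta>. 2 powr (-8/9) * K powr (8/9) * \<delta> powr (-1/9)) \<and>
          q1 \<sim>[at_right 0] (\<lambda>\<delta>. 2 powr (2/9) * K powr (-2/9) * \<delta> powr (7/9)) \<and>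
          p2 \<sim>[at_right 0] (\<lambda>\<delta>. 2 powr (-2/3) * K powr (2/3) * \<delta> powr (-1/3)) \<and>
          q2 \<sim>[at_right 0] (\<lambda>\<delta>. 2 powr (4/9) * K powr (-4/9) * \<delta> powr (5/9))) \<and>
       (\<lambda>\<delta>. minmax_value (J \<delta>) two_sided_ordered
              - (1 - 2 powr (8/9) * K powr (1/9) * \<delta> powr (1/9)))
         \<in> O[at_right 0](\<lambda>\<delta>. \<delta> powr (2/9)) \<and>
       (\<lambda>\<delta>. minmax_value (J \<delta>) two_sided
              - (1 - 2 powr (8/9) * K powr (1/9) * \<delta> powr (1/9)))
         \<in> O[at_right 0](\<lambda>\<delta>. \<delta> powr (2/9)))"
proof -
  have sch: "schwarz L Lhat \<eta> \<epsilon> pa pb" using assms by unfold_locales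
  obtain a where a: "0 < a" "\<forall>\<^sub>F \<delta> in at_right 0. a / \<delta> \<le> real (M (\<delta> / c)) * schwarz.kmin Lhat"
    using frequency_range[OF M \<open>c > 0\<close> schwarz.kmin[OF sch]] by blast
  have J: "J \<delta> = schwarz.worst L Lhat \<eta> \<epsilon> pa pb \<delta> (real (M (\<delta> / c)) * schwarz.kmin Lhat)" for \<delta>
    unfolding J_def schwarz.worst_factor_eq[OF sch] ..
  have K: "K = schwarz.K L Lhat \<eta> \<epsilon> pa pb"
    unfolding K_def schwarz.K_def[OF sch] ..
  note one = schwarz.one_sided_asymptotics[OF sch a J, folded K]
  note two = schwarz.two_sided_asymptotics[OF sch a J, folded K]
  show ?thesis
    by (intro conjI; (intro allI impI)?;
      (rule one(1) one(3) two(1) | (rule one(2) two(2), assumption) | (rule two(3), simp)))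
qed

end
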